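(* Let $C_1$ and $C_2$ be strict $L_\infty[1]$-algebras over a field, and let $f:C_1\to C_2$ be an $L_\infty[1]$-morphism which is a quasi-isomorphism. Then $f$ is a homotopy equivalence.
   Context: Fix a field $\mathbf{k}$ of characteristic $0$; all vector spaces are $\mathbb{Z}$-graded over $\mathbf{k}$. For a graded vector space $C$, $SC=TC/\langle v\otimes v'-(-1)^{|v||v'|}v'\otimes v\rangle$ is the graded symmetric algebra with product $\odot$, and $S^kC$ is its word-length-$k$ part. For homogeneous $a_1,\dots,a_k$ and a permutation $\tau$, $\mathrm{sgn}(\tau)$ is the Koszul sign defined by $a_{\tau(1)}\odot\cdots\odot a_{\tau(k)}=\mathrm{sgn}(\tau)\,a_1\odot\cdots\odot a_k$. $\mathrm{Sh}(i,k-i)$ is the set of $(i,k-i)$-unshuffles ($\tau(1)<\cdots<\tau(i)$, $\tau(i+1)<\cdots<\tau(k)$). Strict $L_\infty[1]$-algebra: a graded vector space $C$ with degree $1$ linear maps $l_k:S^kC\to C$, $k\ge1$, such that for all $k\ge1$ $$\sum_{i=1}^k\sum_{\tau\in \mathrm{Sh}(i,k-i)}\mathrm{sgn}(\tau)\,l_{k-i+1}(l_i(a_{\tau(1)},\dots,a_{\tau(i)}),a_{\tau(i+1)},\dots,a_{\tau(k)})=0.$$ In particular $(C,l_1)$ is a cochain complex. (Strict) $L_\infty[1]$-morphism $f:(C,\{l_k\})\to(C',\{l'_k\})$: degree $0$ linear maps $f_k:S^kC\to C'$, $k\ge1$, such that for all $k\ge1$ $$\sum_{i=1}^k\sum_{\tau\in\mathrm{Sh}(i,k-i)}\mathrm{sgn}(\tau)f_{k-i+1}(l_i(a_{\tau(1)},\dots,a_{\tau(i)}),a_{\tau(i+1)},\dots,a_{\tau(k)})=\sum_{\substack{t,j_1,\dots,j_t\ge1\\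 j_1+\cdots+j_t=k}}\sum_{\tau\in S_k}\frac{\mathrm{sgn}(\tau)}{t!\,j_1!\cdots j_t!}\,l'_t\big(f_{j_1}(a_{\tau(1)},\dots,a_{\tau(j_1)}),\dots,f_{j_t}(a_{\tau(k-j_t+1)},\dots,a_{\tau(k)})\big).$$ Composition: $(g\circ f)_k(a_1,\dots,a_k)$ is the right-hand side above with $l'_t$ replaced by $g_t$. The identity morphism has $(\mathrm{id}_C)_1=\mathrm{id}$ and $(\mathrm{id}_C)_k=0$ for $k\ge2$. A morphism $f$ is a quasi-isomorphism if the cochain map $f_1$ induces an isomorphism on cohomology. A model of $\Delta^1\times C$ is an $L_\infty[1]$-algebra $\mathfrak{C}$ with $L_\infty[1]$-morphisms $\mathrm{Eval}_j:\mathfrak{C}\to C$ ($j=0,1$) and $\mathrm{Incl}:C\to\mathfrak{C}$ such that: (i) $(\mathrm{Eval}_j)_k=0$ and $\mathrm{Incl}_k=0$ for $k\ge2$; (ii) $\mathrm{Eval}_0,\mathrm{Eval}_1,\mathrm{Incl}$ are quasi-isomorphisms; (iii) $(\mathrm{Eval}_j)_1\circ\mathrm{Incl}_1=\mathrm{id}_C$; (iv) $(\mathrm{Eval}_0)_1\oplus(\mathrm{Eval}_1)_1:\mathfrak{C}\to C\oplus C$ is surjective. Two $L_\infty[1]$-morphisms $f_0,f_1:C\to C'$ are homotopic if there exist a model $\mathfrak{C}'$ of $\Delta^1\times C'$ and an $L_\infty[1]$-morphism $h:C\to\mathfrak{C}'$ with $f_j=\mathrm{Eval}_j\circ h$ for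 $j=0,1$. An $L_\infty[1]$-morphism $f:C\to C'$ is a homotopy equivalence if there is an $L_\infty[1]$-morphism $g:C'\to C$ such that $g\circ f$ is homotopic to $\mathrm{id}_C$ and $f\circ g$ is homotopic to $\mathrm{id}_{C'}$. *)

theory Defs
  imports Complex_Main "HOL-Combinatorics.Permutations" "HOL-Library.Function_Algebras"
begin

text \<open>
  A \<open>\<int>\<close>-graded vector space is a family \<open>grade C p\<close> of linear subspaces of an ambient vector space
  of type \<open>'v\<close> with scalar multiplication \<open>smul C\<close>.  A homogeneous element is a pair \<open>(p, x)\<close> with
  \<open>x \<in> grade C p\<close>; since every homogeneous element carries its degree, the \<open>grade C p\<close> need not be
  independent in the ambient space, which plays no further role.

  A linear map \<open>S\<^sup>kC \<rightarrow> C'\<close> is given by its values \<open>f [a\<^sub>1, ..., a\<^sub>k]\<close> on homogeneous \<open>a\<^sub>i\<close>, that is, by a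
  function which is linear in each argument within a fixed degree and respects the relation
  \<open>v \<otimes> v' = (-1)\<^bsup>|v||v'|\<^esup> v' \<otimes> v\<close> defining the graded symmetric algebra.  A sequence \<open>(f\<^sub>k)\<^sub>k\<^sub>\<ge>\<^sub>1\<close> of such
  maps is one function on lists, \<open>f\<^sub>k\<close> being its restriction to lists of length \<open>k\<close>.  Values
  outside \<open>hwords C\<close> (in particular on the empty list) are irrelevant.
\<close>

record ('k, 'v) linf =
  smul :: "'k \<Rightarrow> 'v \<Rightarrow> 'v"
  grade :: "int \<Rightarrow> 'v set"
  brk :: "(int \<times> 'v) list \<Rightarrow> 'v"

definition graded_space :: "('k::field_char_0, 'v::ab_group_add) linf \<Rightarrow> bool" where
  "graded_space C \<longleftrightarrow> vector_space (smul C) \<and> (\<forall>p. module.subspace (smul C) (grade C p))"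

definition hwords :: "('k, 'v) linf \<Rightarrow> (int \<times> 'v) list set" where
  "hwords C = {as. as \<noteq> [] \<and> (\<forall>(p, x) \<in> set as. x \<in> grade C p)}"

definition total_deg :: "(int \<times> 'v) list \<Rightarrow> int" where
  "total_deg as = sum_list (map fst as)"

definition sym_maps ::
  "int \<Rightarrow> ('k::field_char_0, 'v::ab_group_add) linf \<Rightarrow> ('k, 'w::ab_group_add) linf
    \<Rightarrow> ((int \<times> 'v) list \<Rightarrow> 'w) set" where
  "sym_maps d C C' = {f.
     (\<forall>as \<in> hwords C. f as \<in> grade C' (total_deg as + d)) \<and>
     (\<forall>as bs p x y. as @ (p, x) # bs \<in> hwords C \<longrightarrow> as @ (p, y) # bs \<in> hwords C \<longrightarrow>
        f (as @ (p, x + y) # bs) = f (as @ (p, x) # bs) + f (as @ (p, y) # bs)) \<and>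
     (\<forall>as bs p x c. as @ (p, x) # bs \<in> hwords C \<longrightarrow>
        f (as @ (p, smul C c x) # bs) = smul C' c (f (as @ (p, x) # bs))) \<and>
     (\<forall>as bs p q x y. as @ (p, x) # (q, y) # bs \<in> hwords C \<longrightarrow>
        f (as @ (p, x) # (q, y) # bs) =
          smul C' ((-1) powi (p * q)) (f (as @ (q, y) # (p, x) # bs)))}"

text \<open>
  Positions in words are counted from 0, and \<open>permute_list \<tau> [a\<^sub>0, ..., a\<^sub>k\<^sub>-\<^sub>1]\<close> is
  \<open>[a\<^bsub>\<tau>(0)\<^esub>, ..., a\<^bsub>\<tau>(k-1)\<^esub>]\<close>.  The Koszul sign of \<open>\<tau>\<close> is the product of the signs of the
  transpositions of neighbours that sort this word, one for each inversion of \<open>\<tau>\<close>.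
\<close>

definition koszul :: "(int \<times> 'v) list \<Rightarrow> (nat \<Rightarrow> nat) \<Rightarrow> 'k::field_char_0" where
  "koszul as \<tau> = (\<Prod>(i, j) \<in> {(i, j). i < j \<and> j < length as \<and> \<tau> j < \<tau> i}.
     (-1) powi (fst (as ! \<tau> i) * fst (as ! \<tau> j)))"

definition unshuffles :: "nat \<Rightarrow> nat \<Rightarrow> (nat \<Rightarrow> nat) set" where
  "unshuffles i k = {\<tau>. \<tau> permutes {..<k} \<and> strict_mono_on {..<i} \<tau> \<and> strict_mono_on {i..<k} \<tau>}"

definition apply_deg :: "int \<Rightarrow> ((int \<times> 'v) list \<Rightarrow> 'w) \<Rightarrow> (int \<times> 'v) list \<Rightarrow> int \<times> 'w" where
  "apply_deg d f as = (total_deg as + d, f as)"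

text \<open>\<open>\<Sum>\<^sub>i \<Sum>\<^sub>\<tau> sgn(\<tau>) f\<^bsub>k-i+1\<^esub>(l\<^sub>i(a\<^bsub>\<tau>(1)\<^esub>, ..., a\<^bsub>\<tau>(i)\<^esub>), a\<^bsub>\<tau>(i+1)\<^esub>, ..., a\<^bsub>\<tau>(k)\<^esub>)\<close>, with values in \<open>C'\<close>\<close>

definition insert_brk ::
  "('k::field_char_0, 'v) linf \<Rightarrow> ('k, 'w::ab_group_add) linf
    \<Rightarrow> ((int \<times> 'v) list \<Rightarrow> 'w) \<Rightarrow> (int \<times> 'v) list \<Rightarrow> 'w" where
  "insert_brk C C' f as =
     (\<Sum>i = 1..length as. \<Sum>\<tau> \<in> unshuffles i (length as).
        smul C' (koszul as \<tau>)
          (f (apply_deg 1 (brk C) (take i (permute_list \<tau> as)) # drop i (permute_list \<tau> as))))"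

definition linf_algebra :: "('k::field_char_0, 'v::ab_group_add) linf \<Rightarrow> bool" where
  "linf_algebra C \<longleftrightarrow> graded_space C \<and> brk C \<in> sym_maps 1 C C \<and>
     (\<forall>as \<in> hwords C. insert_brk C C (brk C) as = 0)"

text \<open>The lists \<open>[j\<^sub>1, ..., j\<^sub>t]\<close> with all \<open>j\<^sub>s \<ge> 1\<close> and \<open>j\<^sub>1 + ... + j\<^sub>t = k\<close>.\<close>

definition compositions :: "nat \<Rightarrow> nat list set" where
  "compositions k = {js. 0 \<notin> set js \<and> sum_list js = k}"

lemma finite_compositions: "finite (compositions k)"
proof (rule finite_subset)
  have "length js \<le> sum_list js" if "0 \<notin> set js" for js :: "nat list"
    using that by (induction js) auto
  then show "compositions k \<subseteq> {js. set js \<subseteq> {..k} \<and> length js \<le> k}"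
    using member_le_sum_list by (fastforce simp: compositions_def)
  show "finite {js. set js \<subseteq> {..k} \<and> length js \<le> k}"
    by (rule finite_lists_length_le) simp
qed

primrec blocks :: "nat list \<Rightarrow> 'a list \<Rightarrow> 'a list list" where
  "blocks [] xs = []"
| "blocks (j # js) xs = take j xs # blocks js (drop j xs)"

text \<open>
  With \<open>g\<close> a morphism this is the composition \<open>g \<circ> f\<close>, and with \<open>g = brk C'\<close> the right-hand side of
  the morphism equation; \<open>C'\<close> is the target of \<open>g\<close>.
\<close>

definition linf_comp ::
  "('k::field_char_0, 'u::ab_group_add) linf \<Rightarrow> ((int \<times> 'w) list \<Rightarrow> 'u)
    \<Rightarrow> ((int \<times> 'v) list \<Rightarrow> 'w) \<Rightarrow> (int \<times> 'v) list \<Rightarrow> 'u" where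
  "linf_comp C' g f as =
     (\<Sum>js \<in> compositions (length as). \<Sum>\<tau> | \<tau> permutes {..<length as}.
        smul C' (koszul as \<tau> / (fact (length js) * prod_list (map fact js)))
          (g (map (apply_deg 0 f) (blocks js (permute_list \<tau> as)))))"

definition linf_morphism ::
  "('k::field_char_0, 'v::ab_group_add) linf \<Rightarrow> ('k, 'w::ab_group_add) linf
    \<Rightarrow> ((int \<times> 'v) list \<Rightarrow> 'w) \<Rightarrow> bool" where
  "linf_morphism C C' f \<longleftrightarrow> f \<in> sym_maps 0 C C' \<and>
     (\<forall>as \<in> hwords C. insert_brk C C' f as = linf_comp C' (brk C') f as)"

definition linf_id :: "(int \<times> 'v::zero) list \<Rightarrow> 'v" where
  "linf_id as = (case as of [(p, x)] \<Rightarrow> x | _ \<Rightarrow> 0)"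

definition morph_eq ::
  "('k, 'v) linf \<Rightarrow> ((int \<times> 'v) list \<Rightarrow> 'w) \<Rightarrow> ((int \<times> 'v) list \<Rightarrow> 'w) \<Rightarrow> bool" where
  "morph_eq C f g \<longleftrightarrow> (\<forall>as \<in> hwords C. f as = g as)"

definition cocycles :: "('k, 'v::zero) linf \<Rightarrow> int \<Rightarrow> 'v set" where
  "cocycles C p = {x \<in> grade C p. brk C [(p, x)] = 0}"

definition coboundaries :: "('k, 'v) linf \<Rightarrow> int \<Rightarrow> 'v set" where
  "coboundaries C p = (\<lambda>x. brk C [(p - 1, x)]) ` grade C (p - 1)"

definition cohomologous :: "('k, 'v::ab_group_add) linf \<Rightarrow> int \<Rightarrow> ('v \<times> 'v) set" where
  "cohomologous C p =
     {(x, y). x \<in> cocycles C p \<and> y \<in> cocycles C p \<and> x - y \<in> coboundaries C p}"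

definition cohomology :: "('k, 'v::ab_group_add) linf \<Rightarrow> int \<Rightarrow> 'v set set" where
  "cohomology C p = cocycles C p // cohomologous C p"

definition cohom_map ::
  "('k, 'w::ab_group_add) linf \<Rightarrow> ((int \<times> 'v) list \<Rightarrow> 'w) \<Rightarrow> int \<Rightarrow> 'v set \<Rightarrow> 'w set" where
  "cohom_map C' f p X = cohomologous C' p `` ((\<lambda>x. f [(p, x)]) ` X)"

text \<open>For a morphism \<open>f\<close> the induced map is linear, so bijectivity is isomorphy.\<close>

definition quasi_iso ::
  "('k, 'v::ab_group_add) linf \<Rightarrow> ('k, 'w::ab_group_add) linf
    \<Rightarrow> ((int \<times> 'v) list \<Rightarrow> 'w) \<Rightarrow> bool" where
  "quasi_iso C C' f \<longleftrightarrow> (\<forall>p. bij_betw (cohom_map C' f p) (cohomology C p) (cohomology C' p))"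

definition strict_morphism ::
  "('k::field_char_0, 'v::ab_group_add) linf \<Rightarrow> ('k, 'w::ab_group_add) linf
    \<Rightarrow> ((int \<times> 'v) list \<Rightarrow> 'w) \<Rightarrow> bool" where
  "strict_morphism C C' f \<longleftrightarrow> linf_morphism C C' f \<and> (\<forall>as \<in> hwords C. 2 \<le> length as \<longrightarrow> f as = 0)"

text \<open>\<open>linf_model C M ev0 ev1 incl\<close>: \<open>M\<close> with these evaluations and inclusion is a model of \<open>\<Delta>\<^sup>1 \<times> C\<close>.\<close>

definition linf_model ::
  "('k::field_char_0, 'v::ab_group_add) linf \<Rightarrow> ('k, 'm::ab_group_add) linf
    \<Rightarrow> ((int \<times> 'm) list \<Rightarrow> 'v) \<Rightarrow> ((int \<times> 'm) list \<Rightarrow> 'v) \<Rightarrow> ((int \<times> 'v) list \<Rightarrow> 'm) \<Rightarrow> bool" where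
  "linf_model C M ev0 ev1 incl \<longleftrightarrow>
     linf_algebra M \<and>
     strict_morphism M C ev0 \<and> strict_morphism M C ev1 \<and> strict_morphism C M incl \<and>
     quasi_iso M C ev0 \<and> quasi_iso M C ev1 \<and> quasi_iso C M incl \<and>
     (\<forall>p. \<forall>x \<in> grade C p. ev0 [(p, incl [(p, x)])] = x \<and> ev1 [(p, incl [(p, x)])] = x) \<and>
     (\<forall>p. (\<lambda>z. (ev0 [(p, z)], ev1 [(p, z)])) ` grade M p = grade C p \<times> grade C p)"

text \<open>
  HOL cannot quantify existentially over types, so the graded pieces of the model \<open>M\<close> are taken inside
  the type \<open>nat \<Rightarrow> 'w\<close>, where \<open>'w\<close> is the ambient type of the target \<open>C'\<close>; its vector space structure
  over the ground field and its grading are arbitrary.  This has room for the polynomial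
  model \<open>C'[t, dt]\<close> (a polynomial form is a finitely supported sequence of coefficients).  As
  homotopy does not depend on the choice of the model, admitting models of other
  types would not enlarge the relation; in any case what is required here implies it.
\<close>

definition homotopic ::
  "('k::field_char_0, 'v::ab_group_add) linf \<Rightarrow> ('k, 'w::ab_group_add) linf
    \<Rightarrow> ((int \<times> 'v) list \<Rightarrow> 'w) \<Rightarrow> ((int \<times> 'v) list \<Rightarrow> 'w) \<Rightarrow> bool" where
  "homotopic C C' f0 f1 \<longleftrightarrow>
     linf_morphism C C' f0 \<and> linf_morphism C C' f1 \<and>
     (\<exists>(M :: ('k, nat \<Rightarrow> 'w) linf) ev0 ev1 incl h.
        linf_model C' M ev0 ev1 incl \<and> linf_morphism C M h \<and>
        morph_eq C f0 (linf_comp C' ev0 h) \<and> morph_eq C f1 (linf_comp C' ev1 h))"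

definition homotopy_equivalence ::
  "('k::field_char_0, 'v::ab_group_add) linf \<Rightarrow> ('k, 'w::ab_group_add) linf
    \<Rightarrow> ((int \<times> 'v) list \<Rightarrow> 'w) \<Rightarrow> bool" where
  "homotopy_equivalence C C' f \<longleftrightarrow> linf_morphism C C' f \<and>
     (\<exists>g. linf_morphism C' C g \<and>
        homotopic C C (linf_comp C g f) linf_id \<and>
        homotopic C' C' (linf_comp C' f g) linf_id)"

end

theory Submission
  imports Defs "HOL-Combinatorics.Multiset_Permutations" "HOL-Library.Product_Plus"
begin

text \<open>
  A morphism is viewed as a map of symmetric coalgebras, and \<open>C[t, dt]\<close> serves as a model of
  \<open>\<Delta>\<^sup>1 \<times> C\<close>.  Given a quasi-isomorphism \<open>f : C\<^sub>1 \<rightarrow> C\<^sub>2\<close>, a morphism \<open>g : C\<^sub>2 \<rightarrow> C\<^sub>1\<close> and a homotopy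
  \<open>H : C\<^sub>2 \<rightarrow> C\<^sub>2[t, dt]\<close> from \<open>f g\<close> to the identity are constructed together, by induction on the word
  length.  The obstruction to extending the pair \<open>(g, H)\<close> by one word length is a cocycle with values
  in the homotopy fibre of \<open>f\<^sub>1\<close>; this fibre is acyclic, hence contractible over a field, and the
  contraction corrects \<open>g\<close> and \<open>H\<close>.  As \<open>g\<close> is again a quasi-isomorphism, it has a right inverse \<open>f'\<close> up
  to homotopy in the same way, and \<open>g f \<simeq> g f g f' \<simeq> g f' \<simeq> id\<close>, where homotopies are composed by
  gluing models along an end.
\<close>

section \<open>Coalgebra morphisms and coderivations on words\<close>

text \<open>An arbitrary partial inverse \<open>g\<close> need not extend to the next word length.
  What forces its obstruction to vanish is the homotopy carried along with it, and the corrections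
  of the two have to match at the end t = 0. Hence both unknowns are solved for at once, with values
  in pairs (x, z) where z is a path from the image of x to 0; in this construction the hypothesis on
  \<open>f\<close> enters only through the acyclicity of that complex. A linear contraction of the
  values also contracts the multilinear maps on every symmetric power, so no Kuenneth argument
  occurs. Characteristic 0 is used for the factorials that relate sums over permutations to sums
  over partitions, for recovering a polynomial from its values at the natural numbers, and for
  antiderivatives. Two composable homotopies may use unrelated models, so transitivity is not a
  matter of reparametrising paths; it needs the pullback of the two models.\<close>

definition sg :: "int \<Rightarrow> 'a::ab_group_add \<Rightarrow> 'a" where
  "sg n x = (if even n then x else - x)"

lemma sg_sg: "sg m (sg n x) = sg (m + n) x"
  by (auto simp: sg_def)

lemma sg_0 [simp]: "sg 0 x = x" "sg n 0 = 0"
  by (auto simp: sg_def)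

lemma sg_add: "sg n (x + y) = sg n x + sg n y"
  by (auto simp: sg_def)

lemma sg_minus: "sg n (- x) = - sg n x"
  by (auto simp: sg_def)

lemma sg_sum: "sg n (sum f A) = (\<Sum>x\<in>A. sg n (f x))"
  by (auto simp: sg_def sum_negf)

lemma sg_parity: "even (m - n) \<Longrightarrow> sg m x = sg n x"
  by (auto simp: sg_def)

lemma total_deg_simps [simp]:
  "total_deg [] = 0"
  "total_deg (a # as) = fst a + total_deg as"
  "total_deg (as @ bs) = total_deg as + total_deg bs"
  by (auto simp: total_deg_def)

lemma fst_apply_deg [simp]: "fst (apply_deg d f as) = total_deg as + d"
  by (simp add: apply_deg_def)

text \<open>
  The coproduct of the symmetric coalgebra, paired with a function \<open>\<phi>\<close> of two words: the sum of \<open>\<phi> u v\<close>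
  with its Koszul sign over all ways to split a word into complementary subwords \<open>u\<close> and \<open>v\<close>.
\<close>

fun spl :: "(int \<times> 'v) list \<Rightarrow> ((int \<times> 'v) list \<Rightarrow> (int \<times> 'v) list \<Rightarrow> 'u::ab_group_add) \<Rightarrow> 'u" where
  "spl [] \<phi> = \<phi> [] []"
| "spl (a # as) \<phi> = spl as (\<lambda>u v. \<phi> (a # u) v) + spl as (\<lambda>u v. sg (fst a * total_deg u) (\<phi> u (a # v)))"

lemma spl_cong_mset:
  assumes "\<And>u v. mset u + mset v = mset as \<Longrightarrow> \<phi> u v = \<psi> u v"
  shows "spl as \<phi> = spl as \<psi>"
  using assms
proof (induction as arbitrary: \<phi> \<psi>)
  case Nil
  then show ?case by simp
next
  case (Cons a as)
  have "spl as (\<lambda>u v. \<phi> (a # u) v) = spl as (\<lambda>u v. \<psi> (a # u) v)"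
    by (rule Cons.IH) (simp add: Cons.prems)
  moreover have "spl as (\<lambda>u v. sg (fst a * total_deg u) (\<phi> u (a # v)))
      = spl as (\<lambda>u v. sg (fst a * total_deg u) (\<psi> u (a # v)))"
    by (rule Cons.IH) (simp add: Cons.prems)
  ultimately show ?case by simp
qed

lemma mset_split_length: "mset u + mset v = mset as \<Longrightarrow> length u + length v = length as"
  by (metis size_mset size_union)

lemma mset_split_set: "mset u + mset v = mset as \<Longrightarrow> set u \<union> set v = set as"
  by (metis set_mset_mset set_mset_union)

lemma mset_split_deg: "mset u + mset v = mset as \<Longrightarrow> total_deg u + total_deg v = total_deg as"
  by (metis mset_append mset_map sum_mset_sum_list total_deg_def total_deg_simps(3))

text \<open>As a congruence rule for function definitions it hands the lengths of the two subwords
  to the termination proof of \<open>hat\<close>, whose recursive call is on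
  \<open>v\<close>.\<close>

lemma spl_cong [fundef_cong]:
  assumes "as = bs"
    and "\<And>u v. length u + length v = length bs \<Longrightarrow> \<phi> u v = \<psi> u v"
  shows "spl as \<phi> = spl bs \<psi>"
  using assms by (auto intro!: spl_cong_mset dest: mset_split_length)

lemma spl_cong_lists:
  assumes "as \<in> lists L"
    and "\<And>u v. u \<in> lists L \<Longrightarrow> v \<in> lists L \<Longrightarrow> length u + length v = length as \<Longrightarrow>
      total_deg u + total_deg v = total_deg as \<Longrightarrow> \<phi> u v = \<psi> u v"
  shows "spl as \<phi> = spl as \<psi>"
proof (rule spl_cong_mset)
  fix u v assume *: "mset u + mset v = mset as"
  show "\<phi> u v = \<psi> u v"
    using assms mset_split_set[OF *] mset_split_length[OF *] mset_split_deg[OF *]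
    by (intro assms(2)) (auto simp: in_lists_conv_set)
qed

lemma spl_add: "spl as (\<lambda>u v. \<phi> u v + \<psi> u v) = spl as \<phi> + spl as \<psi>"
  by (induction as arbitrary: \<phi> \<psi>) (simp_all add: sg_add)

lemma spl_minus: "spl as (\<lambda>u v. - \<phi> u v) = - spl as \<phi>"
  by (induction as arbitrary: \<phi>) (simp_all add: sg_minus)

lemma spl_diff: "spl as (\<lambda>u v. \<phi> u v - \<psi> u v) = spl as \<phi> - spl as \<psi>"
  using spl_add[of as \<phi> "\<lambda>u v. - \<psi> u v"] by (simp add: spl_minus)

lemma spl_zero [simp]: "spl as (\<lambda>u v. 0) = 0"
  by (induction as) simp_all

lemma spl_sg: "spl as (\<lambda>u v. sg n (\<phi> u v)) = sg n (spl as \<phi>)"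
  by (cases "even n") (simp_all add: sg_def spl_minus)

lemma spl_sum: "spl as (\<lambda>u v. \<Sum>x\<in>A. \<phi> x u v) = (\<Sum>x\<in>A. spl as (\<phi> x))"
  by (induction A rule: infinite_finite_induct) (simp_all add: spl_add)

text \<open>Coassociativity of the coproduct. In the induction the first letter joins one of three
  subwords; when it joins the last, the sign for passing the other two is the same on both sides
  because degrees add up under splitting.\<close>

lemma spl_coassoc:
  "spl as (\<lambda>u v. spl u (\<lambda>x y. \<phi> x y v)) = spl as (\<lambda>u v. spl v (\<lambda>x y. \<phi> u x y))"
proof (induction as arbitrary: \<phi>)
  case (Cons a as)
  have "spl as (\<lambda>u v. spl u (\<lambda>x y. sg (fst a * total_deg u) (\<phi> x y (a # v))))
      = spl as (\<lambda>u v. spl u (\<lambda>x y. sg (fst a * (total_deg x + total_deg y)) (\<phi> x y (a # v))))"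
    by (intro spl_cong_mset) (auto dest: mset_split_deg)
  also have "\<dots> = spl as (\<lambda>u v. spl v (\<lambda>x y. sg (fst a * (total_deg u + total_deg x)) (\<phi> u x (a # y))))"
    by (rule Cons.IH)
  finally show ?case
    using Cons.IH[of "\<lambda>x y. \<phi> (a # x) y"] Cons.IH[of "\<lambda>x y. sg (fst a * total_deg x) \<circ> (\<phi> x (a # y))"]
    by (simp add: spl_add spl_sg[symmetric] sg_sg sg_add algebra_simps)
qed simp

text \<open>Graded cocommutativity. Swapping the two subwords exchanges the two summands of the
  recursion; in one of them the sign for the first letter then occurs twice and drops out modulo
  2.\<close>

lemma spl_cocomm: "spl as \<phi> = spl as (\<lambda>u v. sg (total_deg u * total_deg v) (\<phi> v u))"
proof (induction as arbitrary: \<phi>)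
  case (Cons a as)
  have 1: "spl as (\<lambda>u v. \<phi> (a # u) v) = spl as (\<lambda>u v. sg (total_deg u * total_deg v) (\<phi> (a # v) u))"
    by (rule Cons.IH)
  have 2: "spl as (\<lambda>u v. sg (fst a * total_deg u) (\<phi> u (a # v)))
     = spl as (\<lambda>u v. sg (total_deg u * total_deg v + fst a * total_deg v) (\<phi> v (a # u)))"
    by (subst Cons.IH) (simp add: sg_sg)
  have 3: "spl as (\<lambda>u v. sg (fst a * total_deg u + total_deg u * (fst a + total_deg v)) (\<phi> (a # v) u))
     = spl as (\<lambda>u v. sg (total_deg u * total_deg v) (\<phi> (a # v) u))"
    by (intro spl_cong_mset sg_parity) (auto simp: algebra_simps)
  show ?case
    by (simp add: sg_sg 1 2 3) (simp add: algebra_simps)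
qed simp

text \<open>Cocommutativity of the left pair between two uses of coassociativity. It brings an inner
  subword to the place where a recursion expects it.\<close>

lemma spl_exchange:
  "spl as (\<lambda>u v. spl v (\<lambda>x y. \<phi> u x y)) =
    spl as (\<lambda>u v. spl v (\<lambda>x y. sg (total_deg u * total_deg x) (\<phi> x u y)))"
proof -
  have "spl as (\<lambda>u v. spl v (\<lambda>x y. \<phi> u x y)) = spl as (\<lambda>u v. spl u (\<lambda>x y. \<phi> x y v))"
    by (rule spl_coassoc[symmetric])
  also have "\<dots> = spl as (\<lambda>u v. spl u (\<lambda>x y. sg (total_deg x * total_deg y) (\<phi> y x v)))"
    by (subst spl_cocomm) simp
  also have "\<dots> = spl as (\<lambda>u v. spl v (\<lambda>x y. sg (total_deg u * total_deg x) (\<phi> x u y)))"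
    by (rule spl_coassoc)
  finally show ?thesis .
qed

lemma spl_isolate_right: "spl as \<phi> = \<phi> as [] + spl as (\<lambda>u v. if v = [] then 0 else \<phi> u v)"
proof (induction as arbitrary: \<phi>)
  case (Cons a as)
  show ?case
    using Cons.IH[of "\<lambda>u. \<phi> (a # u)"] by (simp add: add.assoc)
qed simp

text \<open>The right-hand version follows the recursion; cocommutativity carries it over, and its
  sign disappears because the empty word has degree 0.\<close>

lemma spl_isolate_left: "spl as \<phi> = \<phi> [] as + spl as (\<lambda>u v. if u = [] then 0 else \<phi> u v)"
proof -
  have "spl as \<phi> = \<phi> [] as + spl as (\<lambda>u v. sg (total_deg u * total_deg v) (if v = [] then 0 else \<phi> v u))"
    by (subst spl_cocomm, subst spl_isolate_right) (auto intro!: spl_cong_mset)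
  also have "spl as (\<lambda>u v. sg (total_deg u * total_deg v) (if v = [] then 0 else \<phi> v u))
      = spl as (\<lambda>u v. if u = [] then 0 else \<phi> u v)"
    by (rule spl_cocomm[symmetric])
  finally show ?thesis .
qed

text \<open>Components are controlled only on the graded pieces, not on the ambient type, so
  additivity is relative to a subgroup. It suffices for passing signs and the sums
  \<open>spl\<close> and \<open>hat\<close>; scalars are added later by
  \<open>lin_on\<close>.\<close>

definition hom_on :: "'a::ab_group_add set \<Rightarrow> ('a \<Rightarrow> 'b::ab_group_add) \<Rightarrow> bool" where
  "hom_on G h \<longleftrightarrow> 0 \<in> G \<and> (\<forall>x\<in>G. \<forall>y\<in>G. x + y \<in> G \<and> h (x + y) = h x + h y) \<and> (\<forall>x\<in>G. - x \<in> G)"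

lemma hom_onD:
  assumes "hom_on G h"
  shows "0 \<in> G" "h 0 = 0" "x \<in> G \<Longrightarrow> y \<in> G \<Longrightarrow> x + y \<in> G"
    "x \<in> G \<Longrightarrow> y \<in> G \<Longrightarrow> h (x + y) = h x + h y" "x \<in> G \<Longrightarrow> - x \<in> G" "x \<in> G \<Longrightarrow> h (- x) = - h x"
    "x \<in> G \<Longrightarrow> sg n x \<in> G" "x \<in> G \<Longrightarrow> h (sg n x) = sg n (h x)"
    "x \<in> G \<Longrightarrow> y \<in> G \<Longrightarrow> x - y \<in> G" "x \<in> G \<Longrightarrow> y \<in> G \<Longrightarrow> h (x - y) = h x - h y"
proof -
  show 0: "0 \<in> G" and add: "x \<in> G \<Longrightarrow> y \<in> G \<Longrightarrow> x + y \<in> G"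
    and hadd: "x \<in> G \<Longrightarrow> y \<in> G \<Longrightarrow> h (x + y) = h x + h y" and m: "x \<in> G \<Longrightarrow> - x \<in> G" for x y
    using assms by (auto simp: hom_on_def)
  show h0: "h 0 = 0" using hadd[OF 0 0] by simp
  show hm: "x \<in> G \<Longrightarrow> h (- x) = - h x" for x
    using hadd[of x "- x"] m[of x] h0 by (simp add: eq_neg_iff_add_eq_0 add.commute)
  show "x \<in> G \<Longrightarrow> sg n x \<in> G" "x \<in> G \<Longrightarrow> h (sg n x) = sg n (h x)"
    using m hm by (auto simp: sg_def)
  show "x \<in> G \<Longrightarrow> y \<in> G \<Longrightarrow> x - y \<in> G" "x \<in> G \<Longrightarrow> y \<in> G \<Longrightarrow> h (x - y) = h x - h y"
    using add[of x "- y"] hadd[of x "- y"] m hm by auto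
qed

lemma spl_hom_mset:
  assumes h: "hom_on G h" and "\<And>u v. mset u + mset v = mset as \<Longrightarrow> \<phi> u v \<in> G"
  shows "spl as \<phi> \<in> G \<and> h (spl as \<phi>) = spl as (\<lambda>u v. h (\<phi> u v))"
  using assms(2)
proof (induction as arbitrary: \<phi>)
  case (Cons a as)
  have "spl as (\<lambda>u v. h (sg (fst a * total_deg u) (\<phi> u (a # v)))) = spl as (\<lambda>u v. sg (fst a * total_deg u) (h (\<phi> u (a # v))))"
    by (intro spl_cong_mset hom_onD(8)[OF h] Cons.prems) simp
  moreover have "spl as (\<lambda>u v. \<phi> (a # u) v) \<in> G \<and> h (spl as (\<lambda>u v. \<phi> (a # u) v)) = spl as (\<lambda>u v. h (\<phi> (a # u) v))"
    by (intro Cons.IH Cons.prems) simp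
  moreover have "spl as (\<lambda>u v. sg (fst a * total_deg u) (\<phi> u (a # v))) \<in> G
     \<and> h (spl as (\<lambda>u v. sg (fst a * total_deg u) (\<phi> u (a # v)))) = spl as (\<lambda>u v. h (sg (fst a * total_deg u) (\<phi> u (a # v))))"
    by (intro Cons.IH hom_onD[OF h] Cons.prems) simp
  ultimately show ?case using hom_onD[OF h] by simp
qed simp

lemma spl_hom:
  assumes "hom_on G h" "as \<in> lists L"
    and "\<And>u v. u \<in> lists L \<Longrightarrow> v \<in> lists L \<Longrightarrow> length u + length v = length as \<Longrightarrow>
      total_deg u + total_deg v = total_deg as \<Longrightarrow> \<phi> u v \<in> G"
  shows "spl as \<phi> \<in> G" "h (spl as \<phi>) = spl as (\<lambda>u v. h (\<phi> u v))"
proof -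
  have "\<phi> u v \<in> G" if *: "mset u + mset v = mset as" for u v
    using assms(2) mset_split_set[OF *] mset_split_length[OF *] mset_split_deg[OF *]
    by (intro assms(3)) (auto simp: in_lists_conv_set)
  then show "spl as \<phi> \<in> G" "h (spl as \<phi>) = spl as (\<lambda>u v. h (\<phi> u v))"
    using spl_hom_mset[OF assms(1), of as \<phi>] by auto
qed

text \<open>
  The coalgebra morphism with components \<open>f\<close>, paired with \<open>g\<close>.  The blocks of a set partition of the word
  are listed in the order of their first letters, so each partition is counted once and the factorials
  of the definition of composition do not appear.
\<close>

function hat ::
  "((int \<times> 'v) list \<Rightarrow> 'w) \<Rightarrow> (int \<times> 'v) list \<Rightarrow> ((int \<times> 'w) list \<Rightarrow> 'u::ab_group_add) \<Rightarrow> 'u" where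
  "hat f [] g = g []"
| "hat f (a # as) g = spl as (\<lambda>u v. hat f v (\<lambda>W. g (apply_deg 0 f (a # u) # W)))"
  by pat_completeness auto
termination
  by (relation "measure (\<lambda>(f, as, g). length as)") auto

lemma hat_add: "hat f as (\<lambda>W. g W + h W) = hat f as g + hat f as h"
  by (induction "length as" arbitrary: as g h rule: less_induct)
     (case_tac as, auto simp: spl_add[symmetric] intro!: spl_cong)

lemma hat_minus: "hat f as (\<lambda>W. - g W) = - hat f as g"
  by (induction "length as" arbitrary: as g rule: less_induct)
     (case_tac as, auto simp: spl_minus[symmetric] intro!: spl_cong)

lemma hat_diff: "hat f as (\<lambda>W. g W - h W) = hat f as g - hat f as h"
  using hat_add[of f as g "\<lambda>W. - h W"] by (simp add: hat_minus)

lemma hat_zero [simp]: "hat f as (\<lambda>W. 0) = 0"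
  by (induction "length as" arbitrary: as rule: less_induct) (case_tac as, auto intro!: trans[OF spl_cong spl_zero])

lemma hat_sg: "hat f as (\<lambda>W. sg n (g W)) = sg n (hat f as g)"
  by (cases "even n") (simp_all add: sg_def hat_minus)

lemma hat_spl_swap: "hat f bs (\<lambda>W. spl as (\<lambda>u v. \<phi> u v W)) = spl as (\<lambda>u v. hat f bs (\<phi> u v))"
proof (induction as arbitrary: \<phi>)
  case (Cons a as)
  then show ?case by (simp add: hat_add hat_sg)
qed simp

definition letters :: "('k, 'v) linf \<Rightarrow> (int \<times> 'v) set" where
  "letters C = {(p, x). x \<in> grade C p}"

lemma letters_iff [simp]: "(p, x) \<in> letters C \<longleftrightarrow> x \<in> grade C p"
  by (simp add: letters_def)

lemma hwords_iff: "as \<in> hwords C \<longleftrightarrow> as \<noteq> [] \<and> as \<in> lists (letters C)"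
  by (auto simp: hwords_def letters_def in_lists_conv_set)

text \<open>A component has no meaning on the empty word, so nothing is asked there. This is why
  nonemptiness of words and blocks is tracked throughout.\<close>

definition degmap ::
  "int \<Rightarrow> ('k, 'v) linf \<Rightarrow> ('k, 'w) linf \<Rightarrow> ((int \<times> 'v) list \<Rightarrow> 'w) \<Rightarrow> bool" where
  "degmap d C C' f \<longleftrightarrow> (\<forall>as \<in> lists (letters C). as \<noteq> [] \<longrightarrow> f as \<in> grade C' (total_deg as + d))"

lemma degmapD: "degmap d C C' f \<Longrightarrow> as \<in> lists (letters C) \<Longrightarrow> as \<noteq> [] \<Longrightarrow> f as \<in> grade C' (total_deg as + d)"
  by (simp add: degmap_def)

lemma apply_deg_letters:
  "degmap d C C' f \<Longrightarrow> as \<in> lists (letters C) \<Longrightarrow> as \<noteq> [] \<Longrightarrow> apply_deg d f as \<in> letters C'"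
  by (simp add: apply_deg_def degmapD)

text \<open>Blocks are nonempty and \<open>f\<close> has degree 0, so the list of block values is
  never longer than the word, is empty only with it, and has the same degree. Only on such lists do
  the two functions have to agree.\<close>

lemma hat_cong:
  assumes "degmap 0 C C' f" "as \<in> lists (letters C)"
    and "\<And>W. W \<in> lists (letters C') \<Longrightarrow> total_deg W = total_deg as \<Longrightarrow> (W = [] \<longleftrightarrow> as = []) \<Longrightarrow>
      length W \<le> length as \<Longrightarrow> g W = h W"
  shows "hat f as g = hat f as h"
  using assms(2,3)
proof (induction "length as" arbitrary: as g h rule: less_induct)
  case less
  show ?case
  proof (cases as)
    case Nil
    then show ?thesis using less.prems by simp
  next
    case (Cons a bs)
    have "hat f v (\<lambda>W. g (apply_deg 0 f (a # u) # W)) = hat f v (\<lambda>W. h (apply_deg 0 f (a # u) # W))"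
      if "u \<in> lists (letters C)" "v \<in> lists (letters C)" "length u + length v = length bs"
         "total_deg u + total_deg v = total_deg bs" for u v
      using that less.prems(1) Cons apply_deg_letters[OF assms(1), of "a # u"]
      by (intro less.hyps less.prems) auto
    then show ?thesis
      unfolding Cons hat.simps
      by (intro spl_cong_lists[of _ "letters C"]) (use less.prems(1) Cons in auto)
  qed
qed

lemma hat_cong_map:
  assumes "degmap 0 C C' f" "as \<in> lists (letters C)"
    and "\<And>bs. bs \<in> lists (letters C) \<Longrightarrow> bs \<noteq> [] \<Longrightarrow> length bs \<le> length as \<Longrightarrow> f bs = f' bs"
  shows "hat f as g = hat f' as g"
  using assms(2,3)
proof (induction "length as" arbitrary: as g rule: less_induct)
  case less
  show ?case
  proof (cases as)
    case Nil
    then show ?thesis by simp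
  next
    case (Cons a bs)
    have "hat f v (\<lambda>W. g (apply_deg 0 f (a # u) # W)) = hat f' v (\<lambda>W. g (apply_deg 0 f' (a # u) # W))"
      if "u \<in> lists (letters C)" "v \<in> lists (letters C)" "length u + length v = length bs"
         "total_deg u + total_deg v = total_deg bs" for u v
    proof -
      have "apply_deg 0 f (a # u) = apply_deg 0 f' (a # u)"
        using that less.prems Cons by (auto simp: apply_deg_def)
      moreover have "hat f v (\<lambda>W. g (apply_deg 0 f (a # u) # W)) = hat f' v (\<lambda>W. g (apply_deg 0 f (a # u) # W))"
        using that less.prems Cons by (intro less.hyps) auto
      ultimately show ?thesis by simp
    qed
    then show ?thesis
      unfolding Cons hat.simps
      by (intro spl_cong_lists[of _ "letters C"]) (use less.prems(1) Cons in auto)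
  qed
qed

lemma hat_hom:
  assumes "degmap 0 C C' f" "as \<in> lists (letters C)" and h: "hom_on G h"
    and "\<And>W. W \<in> lists (letters C') \<Longrightarrow> total_deg W = total_deg as \<Longrightarrow> (W = [] \<longleftrightarrow> as = []) \<Longrightarrow>
      length W \<le> length as \<Longrightarrow> g W \<in> G"
  shows "hat f as g \<in> G" "h (hat f as g) = hat f as (\<lambda>W. h (g W))"
proof -
  have "hat f as g \<in> G \<and> h (hat f as g) = hat f as (\<lambda>W. h (g W))"
    using assms(2,4)
  proof (induction "length as" arbitrary: as g rule: less_induct)
    case less
    show ?case
    proof (cases as)
      case Nil
      then show ?thesis using less.prems by simp
    next
      case (Cons a bs)
      have *: "hat f v (\<lambda>W. g (apply_deg 0 f (a # u) # W)) \<in> G \<and>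
         h (hat f v (\<lambda>W. g (apply_deg 0 f (a # u) # W))) = hat f v (\<lambda>W. h (g (apply_deg 0 f (a # u) # W)))"
        if "u \<in> lists (letters C)" "v \<in> lists (letters C)" "length u + length v = length bs"
           "total_deg u + total_deg v = total_deg bs" for u v
        using that less.prems(1) Cons apply_deg_letters[OF assms(1), of "a # u"]
        by (intro less.hyps less.prems) auto
      have bs: "bs \<in> lists (letters C)" using less.prems(1) Cons by auto
      have "hat f as g \<in> G" "h (hat f as g) = spl bs (\<lambda>u v. h (hat f v (\<lambda>W. g (apply_deg 0 f (a # u) # W))))"
        unfolding Cons hat.simps using * by (intro spl_hom[OF h bs]; simp)+
      moreover have "spl bs (\<lambda>u v. h (hat f v (\<lambda>W. g (apply_deg 0 f (a # u) # W)))) = hat f as (\<lambda>W. h (g W))"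
        unfolding Cons hat.simps using * by (intro spl_cong_lists[OF bs]) auto
      ultimately show ?thesis by simp
    qed
  qed
  then show "hat f as g \<in> G" "h (hat f as g) = hat f as (\<lambda>W. h (g W))" by auto
qed

text \<open>A block lies entirely on one side of a splitting, so \<open>hat f\<close> respects the
  coproduct: splitting the list of blocks amounts to splitting the word first. The induction follows
  the block of the first letter.\<close>

lemma hat_spl:
  assumes f: "degmap 0 C C' f" and "as \<in> lists (letters C)"
  shows "hat f as (\<lambda>W. spl W \<phi>) = spl as (\<lambda>u v. hat f u (\<lambda>X. hat f v (\<lambda>Y. \<phi> X Y)))"
  using assms(2)
proof (induction "length as" arbitrary: as \<phi> rule: less_induct)
  case less
  show ?case
  proof (cases as)
    case Nil
    then show ?thesis by simp
  next
    case (Cons a bs)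
    have bs: "bs \<in> lists (letters C)" and a: "a \<in> letters C" using less.prems Cons by auto
    let ?L = "\<lambda>u. apply_deg 0 f (a # u)"
    define P where "P u x y = hat f x (\<lambda>X. hat f y (\<lambda>Y. \<phi> (?L u # X) Y))" for u x y
    define Q where "Q u x y = hat f x (\<lambda>X. hat f y (\<lambda>Y. \<phi> X (?L u # Y)))" for u x y
    have "hat f as (\<lambda>W. spl W \<phi>) = spl bs (\<lambda>u v. spl v (\<lambda>x y. P u x y)
        + spl v (\<lambda>x y. sg ((fst a + total_deg u) * total_deg x) (Q u x y)))"
      unfolding Cons hat.simps
    proof (intro spl_cong_lists[OF bs])
      fix u v assume uv: "u \<in> lists (letters C)" "v \<in> lists (letters C)" "length u + length v = length bs"
      have "hat f v (\<lambda>W. spl (?L u # W) \<phi>)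
          = spl v (\<lambda>x y. P u x y) + spl v (\<lambda>x y. hat f x (\<lambda>X. hat f y (\<lambda>Y. sg ((fst a + total_deg u) * total_deg X) (\<phi> X (?L u # Y)))))"
        using uv Cons unfolding spl.simps hat_add P_def by (subst (1 2) less.hyps) auto
      also have "spl v (\<lambda>x y. hat f x (\<lambda>X. hat f y (\<lambda>Y. sg ((fst a + total_deg u) * total_deg X) (\<phi> X (?L u # Y)))))
          = spl v (\<lambda>x y. sg ((fst a + total_deg u) * total_deg x) (Q u x y))"
        unfolding Q_def hat_sg[symmetric]
        by (intro spl_cong_lists[OF uv(2)] hat_cong[OF f]) auto
      finally show "hat f v (\<lambda>W. spl (?L u # W) \<phi>) = spl v (\<lambda>x y. P u x y) + spl v (\<lambda>x y. sg ((fst a + total_deg u) * total_deg x) (Q u x y))" .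
    qed
    also have "\<dots> = spl bs (\<lambda>u v. spl u (\<lambda>x y. P x y v))
        + spl bs (\<lambda>u v. spl v (\<lambda>x y. sg (fst a * total_deg u) (Q x u y)))"
    proof -
      \<comment> \<open>If the block \<open>a # u\<close> lies on the right, it passes
        \<open>x\<close> with a sign from both \<open>a\<close> and \<open>u\<close>. Exchanging
        \<open>u\<close> and \<open>x\<close> cancels the part of \<open>u\<close> and leaves the
        sign with which the letter \<open>a\<close> alone passes.\<close>
      have "spl bs (\<lambda>u v. spl v (\<lambda>x y. sg ((fst a + total_deg u) * total_deg x) (Q u x y)))
         = spl bs (\<lambda>u v. spl v (\<lambda>x y. sg (fst a * total_deg u) (Q x u y)))"
        by (subst spl_exchange) (auto simp: sg_sg intro!: spl_cong sg_parity simp: algebra_simps)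
      then show ?thesis by (simp add: spl_add spl_coassoc)
    qed
    also have "\<dots> = spl as (\<lambda>u v. hat f u (\<lambda>X. hat f v (\<lambda>Y. \<phi> X Y)))"
      unfolding Cons spl.simps hat.simps P_def Q_def hat_sg[symmetric] hat_spl_swap by (simp add: spl_sg hat_sg)
    finally show ?thesis .
  qed
qed

section \<open>Additivity and graded symmetry in the letters; functoriality of
  \<open>hat\<close>\<close>

definition multihom :: "('k, 'v::ab_group_add) linf \<Rightarrow> ((int \<times> 'v) list \<Rightarrow> 'u::ab_group_add) \<Rightarrow> bool" where
  "multihom C g \<longleftrightarrow> (\<forall>us \<in> lists (letters C). \<forall>vs \<in> lists (letters C). \<forall>p.
     hom_on (grade C p) (\<lambda>x. g (us @ (p, x) # vs)))"

definition symm :: "('k, 'v) linf \<Rightarrow> ((int \<times> 'v) list \<Rightarrow> 'u::ab_group_add) \<Rightarrow> bool" where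
  "symm C g \<longleftrightarrow> (\<forall>us \<in> lists (letters C). \<forall>vs \<in> lists (letters C). \<forall>a \<in> letters C. \<forall>b \<in> letters C.
     g (us @ a # b # vs) = sg (fst a * fst b) (g (us @ b # a # vs)))"

lemma multihomD:
  "multihom C g \<Longrightarrow> us \<in> lists (letters C) \<Longrightarrow> vs \<in> lists (letters C) \<Longrightarrow> hom_on (grade C p) (\<lambda>x. g (us @ (p, x) # vs))"
  by (auto simp: multihom_def)

lemma multihom_head:
  "multihom C g \<Longrightarrow> vs \<in> lists (letters C) \<Longrightarrow> hom_on (grade C p) (\<lambda>x. g ((p, x) # vs))"
  using multihomD[of C g "[]"] by auto

lemma multihom_Cons:
  assumes g: "multihom C g" and a: "a \<in> letters C"
  shows "multihom C (\<lambda>W. g (a # W))"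
proof -
  have *: "hom_on (grade C p) (\<lambda>x. g (a # us @ (p, x) # vs))"
    if "us \<in> lists (letters C)" "vs \<in> lists (letters C)" for us vs p
    using multihomD[OF g, of "a # us" vs p] that a by simp
  show ?thesis unfolding multihom_def by (intro ballI allI *)
qed

lemma symmD:
  "symm C g \<Longrightarrow> us \<in> lists (letters C) \<Longrightarrow> vs \<in> lists (letters C) \<Longrightarrow> a \<in> letters C \<Longrightarrow> b \<in> letters C \<Longrightarrow>
     g (us @ a # b # vs) = sg (fst a * fst b) (g (us @ b # a # vs))"
  unfolding symm_def by blast

lemma symm_head:
  "symm C g \<Longrightarrow> vs \<in> lists (letters C) \<Longrightarrow> a \<in> letters C \<Longrightarrow> b \<in> letters C \<Longrightarrow>
     g (a # b # vs) = sg (fst a * fst b) (g (b # a # vs))"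
  using symmD[of C g "[]" vs a b] by simp

lemma symm_Cons:
  assumes g: "symm C g" and a: "a \<in> letters C"
  shows "symm C (\<lambda>W. g (a # W))"
proof -
  have *: "g (a # us @ b # c # vs) = sg (fst b * fst c) (g (a # us @ c # b # vs))"
    if "us \<in> lists (letters C)" "vs \<in> lists (letters C)" "b \<in> letters C" "c \<in> letters C" for us vs b c
    using symmD[OF g, of "a # us" vs b c] that a by simp
  show ?thesis unfolding symm_def by (intro ballI *)
qed

lemma hom_on_hat:
  assumes f: "degmap 0 C C' f" and as: "as \<in> lists (letters C)"
    and h: "\<And>W. W \<in> lists (letters C') \<Longrightarrow> hom_on G (\<lambda>s. \<phi> s W)"
  shows "hom_on G (\<lambda>s. hat f as (\<phi> s))"
proof -
  have "hat f as (\<phi> (x + y)) = hat f as (\<phi> x) + hat f as (\<phi> y)" if "x \<in> G" "y \<in> G" for x y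
    unfolding hat_add[symmetric] by (intro hat_cong[OF f as] hom_onD(4)[OF h] that)
  then show ?thesis using h[of "[]"] by (auto simp: hom_on_def)
qed

lemma hat_degmap:
  assumes e: "degmap 0 C C' e" and f: "degmap d C' C'' f" and G: "\<And>p. hom_on (grade C'' p) (\<lambda>x. x)"
  shows "degmap d C C'' (\<lambda>u. hat e u f)"
  unfolding degmap_def
proof (intro ballI impI)
  fix as assume as: "as \<in> lists (letters C)" "as \<noteq> []"
  show "hat e as f \<in> grade C'' (total_deg as + d)"
  proof (rule hat_hom(1)[OF e as(1) G])
    fix W assume "W \<in> lists (letters C')" "total_deg W = total_deg as" "W = [] \<longleftrightarrow> as = []"
    then show "f W \<in> grade C'' (total_deg as + d)"
      using degmapD[OF f, of W] as(2) by simp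
  qed
qed

lemma multihom_hat_head:
  assumes f: "degmap 0 C C' f" and as: "as \<in> lists (letters C)" and g: "multihom C' g"
  shows "hom_on (grade C' p) (\<lambda>s. hat f as (\<lambda>Z. g ((p, s) # Z)))"
  by (intro hom_on_hat[OF f as] multihom_head[OF g])

text \<open>Functoriality of the passage from components to coalgebra morphisms. A partition of the
  list of blocks merges blocks; coassociativity collects everything merged with the block of the
  first letter into one subword \<open>w\<close>.\<close>

lemma hat_hat:
  assumes e: "degmap 0 C C' e" and f: "degmap 0 C' C'' f" and as: "as \<in> lists (letters C)"
    and g: "multihom C'' g"
  shows "hat e as (\<lambda>W. hat f W g) = hat (\<lambda>u. hat e u f) as g"
  using as g
proof (induction "length as" arbitrary: as g rule: less_induct)
  case less
  note as = less.prems(1) and g = less.prems(2)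
  show ?case
  proof (cases as)
    case Nil
    then show ?thesis by simp
  next
    case (Cons a bs)
    have bs: "bs \<in> lists (letters C)" and a: "a \<in> letters C" using as Cons by auto
    let ?e = "\<lambda>u. apply_deg 0 e (a # u)"
    define P where "P u x y = hat e x (\<lambda>X. hat e y (\<lambda>Y. hat f Y (\<lambda>Z. g (apply_deg 0 f (?e u # X) # Z))))" for u x y
    have "hat e as (\<lambda>W. hat f W g) = spl bs (\<lambda>u v. spl v (\<lambda>x y. P u x y))"
      unfolding Cons hat.simps P_def
      by (intro spl_cong_lists[OF bs] hat_spl[OF e])
    also have "\<dots> = spl bs (\<lambda>w y. spl w (\<lambda>u x. P u x y))"
      by (rule spl_coassoc[symmetric])
    also have "\<dots> = spl bs (\<lambda>w y. hat (\<lambda>u. hat e u f) y (\<lambda>Z. g (apply_deg 0 (\<lambda>u. hat e u f) (a # w) # Z)))"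
    proof (intro spl_cong_lists[OF bs])
      fix w y assume w: "w \<in> lists (letters C)" and y: "y \<in> lists (letters C)" and len: "length w + length y = length bs"
      let ?p = "fst a + total_deg w"
      \<comment> \<open>\<open>h\<close> is the outer expression as a function of the value of the
        merged block. That value is the sum \<open>hat e (a # w) f\<close>, and additivity of
        \<open>h\<close> spreads it into the unmerged terms.\<close>
      define h where "h s = hat e y (\<lambda>Y. hat f Y (\<lambda>Z. g ((?p, s) # Z)))" for s
      have h: "hom_on (grade C'' ?p) h"
        unfolding h_def by (intro hom_on_hat[OF e y] multihom_hat_head[OF f] g)
      have mem: "f (?e u # X) \<in> grade C'' ?p" if "u \<in> lists (letters C)" "X \<in> lists (letters C')" "total_deg u + total_deg X = total_deg w" for u X
        using degmapD[OF f, of "?e u # X"] apply_deg_letters[OF e, of "a # u"] that a by (simp add: add.assoc)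
      have id: "hom_on (grade C'' ?p) (\<lambda>x. x)"
        using h by (auto simp: hom_on_def)
      have *: "hat e x (\<lambda>X. f (?e u # X)) \<in> grade C'' ?p" if "u \<in> lists (letters C)" "x \<in> lists (letters C)" "total_deg u + total_deg x = total_deg w" for u x
        by (rule hat_hom(1)[OF e _ id]) (use that in \<open>auto intro!: mem\<close>)
      have "hat e (a # w) f \<in> grade C'' ?p"
        unfolding hat.simps by (rule spl_hom(1)[OF id w]) (use * in auto)
      then have "hat (\<lambda>u. hat e u f) y (\<lambda>Z. g (apply_deg 0 (\<lambda>u. hat e u f) (a # w) # Z)) = h (hat e (a # w) f)"
        unfolding h_def apply_deg_def
        by (subst less.hyps[symmetric]) (use Cons len y g in \<open>auto intro!: multihom_Cons\<close>)
      also have "\<dots> = spl w (\<lambda>u x. h (hat e x (\<lambda>X. f (?e u # X))))"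
        unfolding hat.simps by (rule spl_hom(2)[OF h w]) (use * in auto)
      also have "\<dots> = spl w (\<lambda>u x. hat e x (\<lambda>X. h (f (?e u # X))))"
        by (intro spl_cong_lists[OF w] hat_hom(2)[OF e _ h] mem) auto
      also have "\<dots> = spl w (\<lambda>u x. P u x y)"
        unfolding P_def h_def
        by (intro spl_cong_lists[OF w] hat_cong[OF e]) (use y in \<open>auto simp: apply_deg_def add.assoc\<close>)
      finally show "spl w (\<lambda>u x. P u x y) = hat (\<lambda>u. hat e u f) y (\<lambda>Z. g (apply_deg 0 (\<lambda>u. hat e u f) (a # w) # Z))" by simp
    qed
    finally show ?thesis unfolding Cons by simp
  qed
qed

text \<open>
  The coderivation with components \<open>l\<close>, and the coderivation along \<open>hat f\<close> with components \<open>E\<close>, both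
  paired with \<open>g\<close>.
\<close>

definition coder :: "((int \<times> 'v) list \<Rightarrow> 'v) \<Rightarrow> (int \<times> 'v) list \<Rightarrow> ((int \<times> 'v) list \<Rightarrow> 'u::ab_group_add) \<Rightarrow> 'u" where
  "coder l as g = spl as (\<lambda>u v. if u = [] then 0 else g (apply_deg 1 l u # v))"

definition der :: "((int \<times> 'v) list \<Rightarrow> 'w) \<Rightarrow> ((int \<times> 'v) list \<Rightarrow> 'w) \<Rightarrow> (int \<times> 'v) list \<Rightarrow> ((int \<times> 'w) list \<Rightarrow> 'u::ab_group_add) \<Rightarrow> 'u" where
  "der f E as g = spl as (\<lambda>u v. if u = [] then 0 else hat f v (\<lambda>W. g (apply_deg 1 E u # W)))"

lemma coder_cong:
  assumes "degmap 1 C C l" "as \<in> lists (letters C)"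
    and "\<And>W. W \<in> lists (letters C) \<Longrightarrow> W \<noteq> [] \<Longrightarrow> length W \<le> length as \<Longrightarrow> total_deg W = total_deg as + 1 \<Longrightarrow> g W = h W"
  shows "coder l as g = coder l as h"
  unfolding coder_def
proof (intro spl_cong_lists[OF assms(2)] if_cong refl assms(3))
  fix u v
  assume *: "u \<in> lists (letters C)" "v \<in> lists (letters C)" "length u + length v = length as"
    "total_deg u + total_deg v = total_deg as" "u \<noteq> []"
  show "apply_deg 1 l u # v \<in> lists (letters C)"
    using * apply_deg_letters[OF assms(1), of u] by simp
  have "length u > 0" using * by simp
  then show "length (apply_deg 1 l u # v) \<le> length as"
    using *(3) unfolding length_Cons by linarith
  show "total_deg (apply_deg 1 l u # v) = total_deg as + 1"
    using * by simp
qed simp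

lemma coder_hom:
  assumes l: "degmap 1 C C l" and as: "as \<in> lists (letters C)" and h: "hom_on G h"
    and *: "\<And>W. W \<in> lists (letters C) \<Longrightarrow> W \<noteq> [] \<Longrightarrow> total_deg W = total_deg as + 1 \<Longrightarrow> g W \<in> G"
  shows "coder l as g \<in> G" "h (coder l as g) = coder l as (\<lambda>W. h (g W))"
proof -
  have mem: "(if u = [] then 0 else g (apply_deg 1 l u # v)) \<in> G"
    if "u \<in> lists (letters C)" "v \<in> lists (letters C)" "total_deg u + total_deg v = total_deg as" for u v
    using that apply_deg_letters[OF l, of u] hom_onD(1)[OF h] by (auto intro!: *)
  show "coder l as g \<in> G"
    unfolding coder_def by (rule spl_hom(1)[OF h as mem])
  have "h (coder l as g) = spl as (\<lambda>u v. h (if u = [] then 0 else g (apply_deg 1 l u # v)))"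
    unfolding coder_def by (rule spl_hom(2)[OF h as mem])
  also have "\<dots> = coder l as (\<lambda>W. h (g W))"
    unfolding coder_def by (intro spl_cong) (auto simp: hom_onD(2)[OF h])
  finally show "h (coder l as g) = coder l as (\<lambda>W. h (g W))" .
qed

lemma coder_add: "coder l as (\<lambda>W. g W + h W) = coder l as g + coder l as h"
  unfolding coder_def spl_add[symmetric] by (intro spl_cong) auto

lemma coder_diff: "coder l as (\<lambda>W. g W - h W) = coder l as g - coder l as h"
  unfolding coder_def spl_diff[symmetric] by (intro spl_cong) auto

lemma coder_degmap:
  assumes l: "degmap 1 C C l" and f: "degmap d C C' f" and G: "\<And>p. hom_on (grade C' p) (\<lambda>x. x)"
  shows "degmap (d + 1) C C' (\<lambda>u. coder l u f)"
  unfolding degmap_def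
proof (intro ballI impI)
  fix as assume as: "as \<in> lists (letters C)" "as \<noteq> []"
  show "coder l as f \<in> grade C' (total_deg as + (d + 1))"
  proof (rule coder_hom(1)[OF l as(1) G])
    fix W assume "W \<in> lists (letters C)" "W \<noteq> []" "total_deg W = total_deg as + 1"
    then show "f W \<in> grade C' (total_deg as + (d + 1))"
      using degmapD[OF f, of W] by (simp add: algebra_simps)
  qed
qed

text \<open>\<open>coder\<close> puts its new letter in front, so that letter lies in the first
  block formed by \<open>hat\<close>. Coassociativity joins the bracketed subword with the rest of
  this block, and the sum over the ways to cut the joint subword is again a
  \<open>coder\<close>.\<close>

lemma coder_hat:
  assumes l: "degmap 1 C C l" and f: "degmap 0 C C' f" and as: "as \<in> lists (letters C)" and g: "multihom C' g"
  shows "coder l as (\<lambda>W. hat f W g) = der f (\<lambda>u. coder l u f) as g"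
proof -
  define P where "P u x y = (if u = [] then 0 else hat f y (\<lambda>Z. g (apply_deg 0 f (apply_deg 1 l u # x) # Z)))" for u x y
  have "coder l as (\<lambda>W. hat f W g) = spl as (\<lambda>u v. spl v (\<lambda>x y. P u x y))"
    unfolding coder_def P_def by (intro spl_cong) auto
  also have "\<dots> = spl as (\<lambda>w y. spl w (\<lambda>u x. P u x y))"
    by (rule spl_coassoc[symmetric])
  also have "\<dots> = der f (\<lambda>u. coder l u f) as g"
    unfolding der_def
  proof (intro spl_cong_lists[OF as])
    fix w y assume w: "w \<in> lists (letters C)" and y: "y \<in> lists (letters C)"
    let ?p = "total_deg w + 1"
    define h where "h s = hat f y (\<lambda>Z. g ((?p, s) # Z))" for s
    have h: "hom_on (grade C' ?p) h"
      unfolding h_def by (intro multihom_hat_head[OF f y g])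
    have mem: "f W \<in> grade C' ?p" if "W \<in> lists (letters C)" "W \<noteq> []" "total_deg W = ?p" for W
      using degmapD[OF f, of W] that by simp
    have "hat f y (\<lambda>W. g (apply_deg 1 (\<lambda>u. coder l u f) w # W)) = h (coder l w f)"
      by (simp add: h_def apply_deg_def)
    also have "\<dots> = coder l w (\<lambda>W. h (f W))"
      by (rule coder_hom(2)[OF l w h mem])
    also have "\<dots> = spl w (\<lambda>u x. P u x y)"
      unfolding P_def h_def coder_def
      by (intro spl_cong_lists[OF w]) (auto simp: apply_deg_def add_ac)
    finally show "spl w (\<lambda>u x. P u x y) = (if w = [] then 0 else hat f y (\<lambda>W. g (apply_deg 1 (\<lambda>u. coder l u f) w # W)))"
      by (auto simp: P_def)
  qed
  finally show ?thesis .
qed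

text \<open>By \<open>hat_spl\<close> the blocks entering the bracket and the remaining blocks come
  from complementary subwords, and additivity moves the first sum inside.\<close>

lemma hat_coder:
  assumes l: "degmap 1 C' C' l" and f: "degmap 0 C C' f" and as: "as \<in> lists (letters C)" and g: "multihom C' g"
  shows "hat f as (\<lambda>W. coder l W g) = der f (\<lambda>u. hat f u l) as g"
proof -
  have "hat f as (\<lambda>W. coder l W g)
      = spl as (\<lambda>u v. hat f u (\<lambda>X. hat f v (\<lambda>Y. if X = [] then 0 else g (apply_deg 1 l X # Y))))"
    unfolding coder_def by (rule hat_spl[OF f as])
  also have "\<dots> = der f (\<lambda>u. hat f u l) as g"
    unfolding der_def
  proof (intro spl_cong_lists[OF as])
    fix u v assume u: "u \<in> lists (letters C)" and v: "v \<in> lists (letters C)"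
    let ?p = "total_deg u + 1"
    define h where "h s = hat f v (\<lambda>Z. g ((?p, s) # Z))" for s
    have h: "hom_on (grade C' ?p) h"
      unfolding h_def by (intro multihom_hat_head[OF f v g])
    show "hat f u (\<lambda>X. hat f v (\<lambda>Y. if X = [] then 0 else g (apply_deg 1 l X # Y)))
      = (if u = [] then 0 else hat f v (\<lambda>W. g (apply_deg 1 (\<lambda>u. hat f u l) u # W)))"
    proof (cases "u = []")
      case False
      have "hat f u (\<lambda>X. hat f v (\<lambda>Y. if X = [] then 0 else g (apply_deg 1 l X # Y))) = hat f u (\<lambda>X. h (l X))"
        unfolding h_def by (intro hat_cong[OF f u]) (use False in \<open>auto simp: apply_deg_def\<close>)
      also have "\<dots> = h (hat f u l)"
      proof (rule hat_hom(2)[OF f u h, symmetric])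
        fix W assume "W \<in> lists (letters C')" "total_deg W = total_deg u" "W = [] \<longleftrightarrow> u = []"
        then show "l W \<in> grade C' ?p"
          using degmapD[OF l, of W] False by simp
      qed
      finally show ?thesis
        using False by (simp add: h_def apply_deg_def)
    qed simp
  qed
  finally show ?thesis .
qed

text \<open>The square of an odd coderivation is a coderivation whose components are
  \<open>coder l as l\<close>; these vanish by assumption.\<close>

lemma coder_coder:
  fixes f :: "(int \<times> 'v::ab_group_add) list \<Rightarrow> 'u::ab_group_add"
  assumes l: "degmap 1 C C l" and as: "as \<in> lists (letters C)"
    and ll: "\<And>as. as \<in> lists (letters C) \<Longrightarrow> coder l as l = 0"
    and f: "multihom C f" "symm C f" and two: "\<And>z::'u. z = - z \<Longrightarrow> z = 0"
  shows "coder l as (\<lambda>W. coder l W f) = 0"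
proof -
  \<comment> \<open>Two successive brackets are either nested (\<open>P\<close>) or applied to
    disjoint subwords (\<open>Q\<close>).\<close>
  define P where "P u x y = (if u = [] then 0 else f (apply_deg 1 l (apply_deg 1 l u # x) # y))" for u x y
  define Q where "Q u x y = (if u = [] \<or> x = [] then 0 else
      sg ((total_deg u + 1) * total_deg x) (f (apply_deg 1 l x # apply_deg 1 l u # y)))" for u x y
  have "coder l as (\<lambda>W. coder l W f) = spl as (\<lambda>u v. spl v (\<lambda>x y. P u x y + Q u x y))"
    unfolding coder_def P_def Q_def
  proof (intro spl_cong refl)
    fix u v
    show "(if u = [] then 0 else spl (apply_deg 1 l u # v) (\<lambda>u v. if u = [] then 0 else f (apply_deg 1 l u # v)))
        = spl v (\<lambda>x y. (if u = [] then 0 else f (apply_deg 1 l (apply_deg 1 l u # x) # y))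
          + (if u = [] \<or> x = [] then 0 else sg ((total_deg u + 1) * total_deg x) (f (apply_deg 1 l x # apply_deg 1 l u # y))))"
      by (cases "u = []") (simp_all add: spl_add if_distrib[of "sg _"] cong del: if_weak_cong)
  qed
  also have "\<dots> = spl as (\<lambda>u v. spl v (\<lambda>x y. P u x y)) + spl as (\<lambda>u v. spl v (\<lambda>x y. Q u x y))"
    by (simp add: spl_add)
  also have "spl as (\<lambda>u v. spl v (\<lambda>x y. P u x y)) = spl as (\<lambda>w y. spl w (\<lambda>u x. P u x y))"
    by (rule spl_coassoc[symmetric])
  also have "\<dots> = spl as (\<lambda>w y. 0)"
  proof (intro spl_cong_lists[OF as])
    fix w y assume w: "w \<in> lists (letters C)" and y: "y \<in> lists (letters C)"
    let ?p = "total_deg w + 1 + 1"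
    define h where "h s = f ((?p, s) # y)" for s
    have h: "hom_on (grade C ?p) h"
      unfolding h_def by (intro multihom_head f y)
    have "spl w (\<lambda>u x. P u x y) = coder l w (\<lambda>W. h (l W))"
      unfolding P_def h_def coder_def
      by (intro spl_cong_lists[OF w]) (auto simp: apply_deg_def add_ac)
    also have "\<dots> = h (coder l w l)"
      by (rule coder_hom(2)[OF l w h, symmetric]) (metis degmapD[OF l])
    finally show "spl w (\<lambda>u x. P u x y) = 0"
      using ll[OF w] hom_onD(2)[OF h] by simp
  qed
  \<comment> \<open>Both brackets are odd, so exchanging them changes the sign and the sum equals
    its own negative.\<close>
  also have "spl as (\<lambda>u v. spl v (\<lambda>x y. Q u x y)) = 0"
  proof (rule two)
    have "spl as (\<lambda>u v. spl v (\<lambda>x y. Q u x y)) = spl as (\<lambda>u v. spl v (\<lambda>x y. sg (total_deg u * total_deg x) (Q x u y)))"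
      by (rule spl_exchange)
    also have "\<dots> = spl as (\<lambda>u v. spl v (\<lambda>x y. - Q u x y))"
    proof (intro spl_cong_lists[OF as] spl_cong_lists[of _ "letters C"])
      fix u v x y assume "u \<in> lists (letters C)" "v \<in> lists (letters C)" "x \<in> lists (letters C)" "y \<in> lists (letters C)"
      then have *: "x \<noteq> [] \<Longrightarrow> u \<noteq> [] \<Longrightarrow> f (apply_deg 1 l x # apply_deg 1 l u # y)
          = sg ((total_deg x + 1) * (total_deg u + 1)) (f (apply_deg 1 l u # apply_deg 1 l x # y))"
        using symm_head[OF f(2), of y "apply_deg 1 l x" "apply_deg 1 l u"] apply_deg_letters[OF l] by simp
      show "sg (total_deg u * total_deg x) (Q x u y) = - Q u x y"
      proof (cases "x = [] \<or> u = []")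
        case True
        then show ?thesis by (auto simp: Q_def)
      next
        case False
        define F where "F = f (apply_deg 1 l u # apply_deg 1 l x # y)"
        have Q: "Q u x y = sg ((total_deg u + 1) * total_deg x) (sg ((total_deg x + 1) * (total_deg u + 1)) F)"
          "Q x u y = sg ((total_deg x + 1) * total_deg u) F"
          using False * by (simp_all add: Q_def F_def)
        show ?thesis
          unfolding Q by (simp add: sg_def)
      qed
    qed
    finally show "spl as (\<lambda>u v. spl v (\<lambda>x y. Q u x y)) = - spl as (\<lambda>u v. spl v (\<lambda>x y. Q u x y))"
      unfolding spl_minus .
  qed
  finally show ?thesis by simp
qed

definition defect :: "((int \<times> 'v) list \<Rightarrow> 'v) \<Rightarrow> ((int \<times> 'w) list \<Rightarrow> 'w) \<Rightarrow> ((int \<times> 'v) list \<Rightarrow> 'w::ab_group_add) \<Rightarrow> (int \<times> 'v) list \<Rightarrow> 'w" where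
  "defect l l' f as = coder l as f - hat f as l'"

lemma der_diff:
  assumes f: "degmap 0 C C' f" and as: "as \<in> lists (letters C)" and g: "multihom C' g"
    and E: "degmap 1 C C' E" "degmap 1 C C' E'"
  shows "der f (\<lambda>u. E u - E' u) as g = der f E as g - der f E' as g"
  unfolding der_def spl_diff[symmetric]
proof (intro spl_cong_lists[OF as])
  fix u v assume u: "u \<in> lists (letters C)" and v: "v \<in> lists (letters C)"
  show "(if u = [] then 0 else hat f v (\<lambda>W. g (apply_deg 1 (\<lambda>u. E u - E' u) u # W))) =
    (if u = [] then 0 else hat f v (\<lambda>W. g (apply_deg 1 E u # W))) -
    (if u = [] then 0 else hat f v (\<lambda>W. g (apply_deg 1 E' u # W)))"
    using hom_onD(10)[OF multihom_hat_head[OF f v g, of "total_deg u + 1"], of "E u" "E' u"] u degmapD[OF E(1), of u] degmapD[OF E(2), of u]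
    by (auto simp: apply_deg_def)
qed

text \<open>The failure of \<open>hat f\<close> to commute with the two coderivations is itself a
  coderivation along \<open>hat f\<close>, so it is determined by its components, the
  defect.\<close>

lemma defect_comp:
  assumes l: "degmap 1 C C l" and l': "degmap 1 C' C' l'" and f: "degmap 0 C C' f" and as: "as \<in> lists (letters C)"
    and g: "multihom C' g" and G: "\<And>p. hom_on (grade C' p) (\<lambda>x. x)"
  shows "coder l as (\<lambda>W. hat f W g) - hat f as (\<lambda>W. coder l' W g) = der f (defect l l' f) as g"
  unfolding defect_def coder_hat[OF l f as g] hat_coder[OF l' f as g]
  using coder_degmap[OF l f G] hat_degmap[OF f l' G] by (intro der_diff[symmetric, OF f as g]) auto

text \<open>Applying the source coderivation to the defect kills the first of its two terms, since
  that coderivation squares to zero; the second is rewritten by \<open>defect_comp\<close>, using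
  that the target coderivation squares to zero. This identity later makes obstructions
  cocycles.\<close>

lemma bianchi:
  fixes C' :: "('k, 'w::ab_group_add) linf"
  assumes l: "degmap 1 C C l" and l': "degmap 1 C' C' l'" and f: "degmap 0 C C' f" and as: "as \<in> lists (letters C)"
    and ll: "\<And>as. as \<in> lists (letters C) \<Longrightarrow> coder l as l = 0"
    and ll': "\<And>as. as \<in> lists (letters C') \<Longrightarrow> coder l' as l' = 0"
    and g: "multihom C' l'" and G: "\<And>p. hom_on (grade C' p) (\<lambda>x. x)"
    and ff: "multihom C f" "symm C f" and two: "\<And>z::'w. z = - z \<Longrightarrow> z = 0"
  shows "coder l as (defect l l' f) = - der f (defect l l' f) as l'"
proof -
  have "coder l as (defect l l' f) = - coder l as (\<lambda>W. hat f W l')"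
    unfolding defect_def coder_diff using coder_coder[OF l as ll ff two] by simp
  moreover have "hat f as (\<lambda>W. coder l' W l') = hat f as (\<lambda>W. 0)"
    by (intro hat_cong[OF f as] ll')
  ultimately show ?thesis
    using defect_comp[OF l l' f as g G] by simp
qed

section \<open>Sums over permutations as sums over partitions\<close>

text \<open>The exponent of the Koszul sign of a list of positions, collected inversion by
  inversion. With integer exponents, signs are compared by parity.\<close>

fun ksg :: "(nat \<Rightarrow> int \<times> 'v) \<Rightarrow> nat list \<Rightarrow> int" where
  "ksg a [] = 0"
| "ksg a (i # is) = (\<Sum>j\<leftarrow>is. if j < i then fst (a i) * fst (a j) else 0) + ksg a is"

text \<open>The exponent of the sign for moving the letters indexed by \<open>U\<close> in front of those indexed by \<open>V\<close>.\<close>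

definition crs :: "(nat \<Rightarrow> int \<times> 'v) \<Rightarrow> nat set \<Rightarrow> nat set \<Rightarrow> int" where
  "crs a U V = (\<Sum>x\<in>U. \<Sum>y\<in>V. if y < x then fst (a x) * fst (a y) else 0)"

lemma prod_power_int_minus_one: "(\<Prod>x\<in>A. (- 1 :: 'k::field) powi f x) = (- 1) powi sum f A"
  by (induction A rule: infinite_finite_induct) (simp_all add: power_int_add)

lemma ksg_eq_sum:
  "ksg a xs = (\<Sum>i<length xs. \<Sum>j<length xs. if i < j \<and> xs ! j < xs ! i then fst (a (xs ! i)) * fst (a (xs ! j)) else 0)"
proof (induction xs)
  case (Cons x xs)
  have "(\<Sum>j\<leftarrow>xs. if j < x then fst (a x) * fst (a j) else 0) = (\<Sum>j<length xs. if xs ! j < x then fst (a x) * fst (a (xs ! j)) else 0)"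
    by (simp add: sum_list_sum_nth atLeast0LessThan)
  with Cons show ?case
    by (simp add: sum.lessThan_Suc_shift del: sum.lessThan_Suc cong: if_cong)
qed simp

lemma koszul_ksg: "koszul as \<tau> = (- 1 :: 'k::field_char_0) powi ksg (nth as) (map \<tau> [0..<length as])"
proof -
  let ?n = "length as"
  let ?P = "\<lambda>(i, j). i < j \<and> \<tau> j < \<tau> i"
  have "{(i, j). i < j \<and> j < ?n \<and> \<tau> j < \<tau> i} = {x \<in> {..<?n} \<times> {..<?n}. ?P x}"
    by auto
  moreover have "ksg (nth as) (map \<tau> [0..<?n]) = (\<Sum>x\<in>{..<?n} \<times> {..<?n}. if ?P x then fst (as ! \<tau> (fst x)) * fst (as ! \<tau> (snd x)) else 0)"
    unfolding ksg_eq_sum by (simp add: sum.cartesian_product case_prod_unfold cong: if_cong)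
  then have "ksg (nth as) (map \<tau> [0..<?n]) = (\<Sum>x\<in>{x \<in> {..<?n} \<times> {..<?n}. ?P x}. fst (as ! \<tau> (fst x)) * fst (as ! \<tau> (snd x)))"
    by (subst sum.inter_filter) auto
  ultimately show ?thesis
    unfolding koszul_def by (simp add: prod_power_int_minus_one case_prod_unfold)
qed

lemma ksg_append: "distinct (us @ vs) \<Longrightarrow> ksg a (us @ vs) = ksg a us + ksg a vs + crs a (set us) (set vs)"
proof (induction us)
  case (Cons u us)
  have "(\<Sum>j\<leftarrow>vs. if j < u then fst (a u) * fst (a j) else 0) = (\<Sum>j\<in>set vs. if j < u then fst (a u) * fst (a j) else 0)"
    using Cons.prems by (simp add: sum_list_distinct_conv_sum_set)
  with Cons show ?case by (simp add: crs_def)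
qed (simp add: crs_def)

text \<open>Links the recursive splitting to subsets of positions. The first position is the
  smallest: inside \<open>U\<close> it crosses nothing, outside \<open>U\<close> every element of
  \<open>U\<close> crosses it, which are the two signs in the recursion of
  \<open>spl\<close>.\<close>

lemma spl_subsets:
  assumes "sorted_wrt (<) is"
  shows "spl (map a is) \<phi> = (\<Sum>U\<in>Pow (set is). sg (crs a U (set is - U))
     (\<phi> (map a (filter (\<lambda>i. i \<in> U) is)) (map a (filter (\<lambda>i. i \<notin> U) is))))"
  using assms
proof (induction "is" arbitrary: \<phi>)
  case Nil
  then show ?case by (simp add: crs_def)
next
  case (Cons i "is")
  let ?S = "set is"
  have i: "\<forall>x\<in>?S. i < x" "i \<notin> ?S" "sorted_wrt (<) is"
    using Cons.prems by auto
  have fil: "filter (\<lambda>j. j \<in> insert i U) is = filter (\<lambda>j. j \<in> U) is"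
    "filter (\<lambda>j. j \<notin> insert i U) is = filter (\<lambda>j. j \<notin> U) is" for U
    using i by (auto intro!: filter_cong)
  let ?F = "\<lambda>U. sg (crs a U (insert i ?S - U)) (\<phi> (map a (filter (\<lambda>j. j \<in> U) (i # is))) (map a (filter (\<lambda>j. j \<notin> U) (i # is))))"
  have 1: "spl (map a is) (\<lambda>u v. \<phi> (a i # u) v) = (\<Sum>U\<in>Pow ?S. ?F (insert i U))"
  proof (subst Cons.IH[OF i(3)], intro sum.cong refl)
    fix U assume U: "U \<in> Pow ?S"
    have "crs a (insert i U) (insert i ?S - insert i U) = crs a U (?S - U)"
    proof -
      have *: "insert i ?S - insert i U = ?S - U" using i by auto
      have "(\<Sum>y\<in>?S - U. if y < i then fst (a i) * fst (a y) else 0) = 0"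
        using i by (intro sum.neutral) force
      moreover have "i \<notin> U" "finite U" using i U finite_subset[of U ?S] by auto
      ultimately show ?thesis
        unfolding * crs_def by simp
    qed
    then show "sg (crs a U (?S - U)) (\<phi> (a i # map a (filter (\<lambda>i. i \<in> U) is)) (map a (filter (\<lambda>i. i \<notin> U) is))) = ?F (insert i U)"
      using fil[of U] by simp
  qed
  have 2: "spl (map a is) (\<lambda>u v. sg (fst (a i) * total_deg u) (\<phi> u (a i # v))) = (\<Sum>U\<in>Pow ?S. ?F U)"
  proof (subst Cons.IH[OF i(3)], intro sum.cong refl)
    fix U assume U: "U \<in> Pow ?S"
    have iU: "i \<notin> U" and fU: "finite U" using i U finite_subset[of U ?S] by auto
    have *: "insert i ?S - U = insert i (?S - U)" using iU by auto
    have "crs a U (insert i ?S - U) = crs a U (?S - U) + (\<Sum>x\<in>U. fst (a x) * fst (a i))"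
      unfolding * crs_def using i U by (simp add: sum.distrib) (auto intro!: sum.cong)
    moreover have "total_deg (map a (filter (\<lambda>i. i \<in> U) is)) = (\<Sum>x\<in>U. fst (a x))"
    proof -
      have "distinct is" using i(3) strict_sorted_iff by blast
      then have "total_deg (map a (filter (\<lambda>i. i \<in> U) is)) = (\<Sum>x\<in>set (filter (\<lambda>i. i \<in> U) is). fst (a x))"
        by (simp add: total_deg_def sum_list_distinct_conv_sum_set o_def)
      moreover have "set (filter (\<lambda>i. i \<in> U) is) = U" using U by auto
      ultimately show ?thesis by simp
    qed
    ultimately show "sg (crs a U (?S - U)) (sg (fst (a i) * total_deg (map a (filter (\<lambda>i. i \<in> U) is))) (\<phi> (map a (filter (\<lambda>i. i \<in> U) is)) (a i # map a (filter (\<lambda>i. i \<notin> U) is)))) = ?F U"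
      using iU by (simp add: sg_sg sum_distrib_left mult.commute)
  qed
  have "inj_on (insert i) (Pow ?S)" using i by (auto simp: inj_on_def)
  moreover have "Pow ?S \<inter> insert i ` Pow ?S = {}" using i by auto
  ultimately have "(\<Sum>U\<in>Pow (insert i ?S). ?F U) = (\<Sum>U\<in>Pow ?S. ?F U) + (\<Sum>U\<in>Pow ?S. ?F (insert i U))"
    by (simp add: Pow_insert sum.union_disjoint sum.reindex)
  then show ?case using 1 2 by simp
qed

lemma filter_sorted_list_of_set:
  "finite T \<Longrightarrow> U \<subseteq> T \<Longrightarrow> filter (\<lambda>i. i \<in> U) (sorted_list_of_set T) = sorted_list_of_set (U :: nat set)"
  by (rule sorted_distinct_set_unique[symmetric]) (auto simp: finite_subset[of U T] sorted_wrt_filter)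

abbreviation wrd :: "(nat \<Rightarrow> int \<times> 'v) \<Rightarrow> nat set \<Rightarrow> (int \<times> 'v) list" where
  "wrd a U \<equiv> map a (sorted_list_of_set U)"

lemma spl_wrd:
  assumes "finite T"
  shows "spl (wrd a T) \<phi> = (\<Sum>U\<in>Pow T. sg (crs a U (T - U)) (\<phi> (wrd a U) (wrd a (T - U))))"
proof -
  have "spl (wrd a T) \<phi> = (\<Sum>U\<in>Pow T. sg (crs a U (T - U))
     (\<phi> (map a (filter (\<lambda>i. i \<in> U) (sorted_list_of_set T))) (map a (filter (\<lambda>i. i \<notin> U) (sorted_list_of_set T)))))"
    using spl_subsets[of "sorted_list_of_set T" a \<phi>] assms by simp
  also have "\<dots> = (\<Sum>U\<in>Pow T. sg (crs a U (T - U)) (\<phi> (wrd a U) (wrd a (T - U))))"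
  proof (intro sum.cong refl)
    fix U assume U: "U \<in> Pow T"
    have "filter (\<lambda>i. i \<notin> U) (sorted_list_of_set T) = filter (\<lambda>i. i \<in> T - U) (sorted_list_of_set T)"
      using assms by (intro filter_cong) auto
    then show "sg (crs a U (T - U)) (\<phi> (map a (filter (\<lambda>i. i \<in> U) (sorted_list_of_set T))) (map a (filter (\<lambda>i. i \<notin> U) (sorted_list_of_set T))))
       = sg (crs a U (T - U)) (\<phi> (wrd a U) (wrd a (T - U)))"
      using U assms filter_sorted_list_of_set[of T U] filter_sorted_list_of_set[of T "T - U"] by simp
  qed
  finally show ?thesis .
qed

lemma sum_permutes_lists:
  "(\<Sum>\<tau> | \<tau> permutes {..<n}. F (map \<tau> [0..<n])) = (\<Sum>is\<in>permutations_of_set {..<n}. F is)"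
proof (rule sum.reindex_bij_witness[where i = "\<lambda>is k. if k < n then is ! k else k" and j = "\<lambda>\<tau>. map \<tau> [0..<n]"])
  fix \<tau> assume "\<tau> \<in> {\<tau>. \<tau> permutes {..<n}}"
  then have \<tau>: "\<tau> permutes {..<n}" by simp
  show "(\<lambda>k. if k < n then map \<tau> [0..<n] ! k else k) = \<tau>"
    using permutes_not_in[OF \<tau>] by auto
  show "map \<tau> [0..<n] \<in> permutations_of_set {..<n}"
    using permutes_image[OF \<tau>] permutes_inj_on[OF \<tau>]
    by (auto simp: permutations_of_set_def distinct_map atLeast0LessThan)
next
  fix xs assume "xs \<in> permutations_of_set {..<n}"
  then have xs: "set xs = {..<n}" "distinct xs" by (auto simp: permutations_of_set_def)
  then have len: "length xs = n" using distinct_card[of xs] by simp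
  show "map (\<lambda>k. if k < n then xs ! k else k) [0..<n] = xs"
    using len by (intro nth_equalityI) auto
  have "bij_betw (nth xs) {..<n} {..<n}"
    by (rule bij_betw_nth) (simp_all add: xs len)
  then have "bij_betw (\<lambda>k. if k < n then xs ! k else k) {..<n} {..<n}"
    by (subst bij_betw_cong[where g = "nth xs"]) auto
  then show "(\<lambda>k. if k < n then xs ! k else k) \<in> {\<tau>. \<tau> permutes {..<n}}"
    by (intro CollectI bij_imp_permutes) auto
qed simp

text \<open>An arrangement is cut after its first \<open>j\<close> entries and grouped by the set
  \<open>U\<close> of those entries. By \<open>ksg_append\<close> its inversions lie within the two
  pieces or between them, and the latter depend on \<open>U\<close> only.\<close>

lemma sum_permutations_split:
  assumes T: "finite T"
  shows "(\<Sum>is | is \<in> permutations_of_set T \<and> j \<le> card T. sg (ksg a is) (\<psi> (take j is) (drop j is))) =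
    (\<Sum>U | U \<subseteq> T \<and> card U = j. sg (crs a U (T - U))
       (\<Sum>us\<in>permutations_of_set U. \<Sum>vs\<in>permutations_of_set (T - U). sg (ksg a us + ksg a vs) (\<psi> us vs)))"
proof -
  let ?A = "Sigma {U. U \<subseteq> T \<and> card U = j} (\<lambda>U. permutations_of_set U \<times> permutations_of_set (T - U))"
  have fin: "finite {U. U \<subseteq> T \<and> card U = j}" using T by (simp add: finite_subset[of _ "Pow T"])
  have "(\<Sum>U | U \<subseteq> T \<and> card U = j. sg (crs a U (T - U))
       (\<Sum>us\<in>permutations_of_set U. \<Sum>vs\<in>permutations_of_set (T - U). sg (ksg a us + ksg a vs) (\<psi> us vs)))
     = (\<Sum>(U, us, vs)\<in>?A. sg (crs a U (T - U) + (ksg a us + ksg a vs)) (\<psi> us vs))"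
    using fin by (simp add: sg_sum sg_sg sum.cartesian_product sum.Sigma case_prod_unfold)
  also have "\<dots> = (\<Sum>is | is \<in> permutations_of_set T \<and> j \<le> card T. sg (ksg a is) (\<psi> (take j is) (drop j is)))"
  proof (rule sum.reindex_bij_witness[where j = "\<lambda>(U, us, vs). us @ vs" and i = "\<lambda>is. (set (take j is), take j is, drop j is)"])
    fix x assume "x \<in> ?A"
    then obtain U us vs where x: "x = (U, us, vs)" and U: "U \<subseteq> T" "card U = j"
      and us: "set us = U" "distinct us" and vs: "set vs = T - U" "distinct vs"
      by (auto simp: permutations_of_set_def)
    have len: "length us = j" using us U distinct_card[of us] by simp
    show "(set (take j (case x of (U, us, vs) \<Rightarrow> us @ vs)), take j (case x of (U, us, vs) \<Rightarrow> us @ vs), drop j (case x of (U, us, vs) \<Rightarrow> us @ vs)) = x"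
      using x len us by simp
    show "(case x of (U, us, vs) \<Rightarrow> us @ vs) \<in> {is. is \<in> permutations_of_set T \<and> j \<le> card T}"
      using x us vs U T by (auto simp: permutations_of_set_def intro: card_mono)
    have "distinct (us @ vs)" using us vs by auto
    from ksg_append[OF this, of a]
    show "sg (ksg a (case x of (U, us, vs) \<Rightarrow> us @ vs)) (\<psi> (take j (case x of (U, us, vs) \<Rightarrow> us @ vs)) (drop j (case x of (U, us, vs) \<Rightarrow> us @ vs))) = (case x of (U, us, vs) \<Rightarrow> sg (crs a U (T - U) + (ksg a us + ksg a vs)) (\<psi> us vs))"
      using x us vs len by (simp add: add_ac)
  next
    fix xs assume "xs \<in> {is. is \<in> permutations_of_set T \<and> j \<le> card T}"
    then have xs: "set xs = T" "distinct xs" "j \<le> length xs"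
      using distinct_card[of xs] by (auto simp: permutations_of_set_def)
    show "(case (set (take j xs), take j xs, drop j xs) of (U, us, vs) \<Rightarrow> us @ vs) = xs" by simp
    have "set (take j xs) \<inter> set (drop j xs) = {}" "set (take j xs) \<union> set (drop j xs) = T"
      using xs set_take_disj_set_drop_if_distinct[of xs j j] by (auto simp flip: set_append)
    moreover have "card (set (take j xs)) = j" using xs by (simp add: distinct_card)
    ultimately show "(set (take j xs), take j xs, drop j xs) \<in> ?A"
      using xs by (auto simp: permutations_of_set_def)
  qed
  finally show ?thesis by simp
qed

lemma permutations_of_set_one: "finite U \<Longrightarrow> {us \<in> permutations_of_set U. sorted_wrt (<) us} = {sorted_list_of_set (U :: nat set)}"
  by (auto simp: permutations_of_set_def strict_sorted_iff intro: sorted_distinct_set_unique)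

lemma vs_simps:
  assumes "vector_space s"
  shows "s c 0 = 0" "s 0 x = 0" "s c (- x) = - s c x" "s (- c) x = - s c x" "s c (x + y) = s c x + s c y"
    "s (c + d) x = s c x + s d x" "s c (x - y) = s c x - s c y" "s 1 x = x" "s c (s d x) = s (c * d) x"
    "s c (sum f A) = (\<Sum>i\<in>A. s c (f i))" "s c (sg n x) = sg n (s c x)"
proof -
  interpret vector_space s by fact
  show "s c 0 = 0" "s 0 x = 0" "s c (- x) = - s c x" "s (- c) x = - s c x" "s c (x + y) = s c x + s c y"
    "s (c + d) x = s c x + s d x" "s c (x - y) = s c x - s c y" "s 1 x = x" "s c (s d x) = s (c * d) x"
    "s c (sum f A) = (\<Sum>i\<in>A. s c (f i))" "s c (sg n x) = sg n (s c x)"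
    by (simp_all add: scale_right_distrib scale_left_distrib scale_right_diff_distrib scale_sum_right sg_def)
qed

lemma vs_sg: "vector_space s \<Longrightarrow> s ((- 1) powi n) x = sg n x"
  by (auto simp: sg_def vs_simps power_int_minus_left)

lemma ksg_sorted: "sorted_wrt (<) is \<Longrightarrow> ksg a is = 0"
proof (induction "is")
  case (Cons i "is")
  have "(\<Sum>j\<leftarrow>is. if j < i then fst (a i) * fst (a j) else 0) = (\<Sum>j\<leftarrow>is. 0)"
    using Cons.prems by (intro arg_cong[where f = sum_list] map_cong) auto
  with Cons show ?case by simp
qed simp

lemma koszul_sg: "vector_space s \<Longrightarrow> s (koszul as \<tau>) x = sg (ksg (nth as) (map \<tau> [0..<length as])) x"
  by (simp add: koszul_ksg vs_sg)

lemma permute_list_map: "permute_list \<tau> as = map (nth as) (map \<tau> [0..<length as])"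
  by (simp add: permute_list_def)

lemma wrd_all: "wrd (nth as) {..<length as} = as"
  by (simp add: lessThan_atLeast0 map_nth)

lemma unshuffles_iff:
  assumes "i \<le> n"
  shows "\<tau> \<in> unshuffles i n \<longleftrightarrow> \<tau> permutes {..<n} \<and>
    sorted_wrt (<) (take i (map \<tau> [0..<n])) \<and> sorted_wrt (<) (drop i (map \<tau> [0..<n]))"
proof -
  have "strict_mono_on {..<i} \<tau> \<longleftrightarrow> sorted_wrt (<) (take i (map \<tau> [0..<n]))"
    using assms by (auto simp: sorted_wrt_iff_nth_less strict_mono_on_def)
  moreover have "strict_mono_on {i..<n} \<tau> \<longleftrightarrow> sorted_wrt (<) (drop i (map \<tau> [0..<n]))"
  proof
    assume "strict_mono_on {i..<n} \<tau>"
    then show "sorted_wrt (<) (drop i (map \<tau> [0..<n]))"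
      using assms by (auto simp: sorted_wrt_iff_nth_less intro!: strict_mono_onD[of "{i..<n}" \<tau>])
  next
    assume *: "sorted_wrt (<) (drop i (map \<tau> [0..<n]))"
    show "strict_mono_on {i..<n} \<tau>"
    proof (rule strict_mono_onI)
      fix x y assume xy: "x \<in> {i..<n}" "y \<in> {i..<n}" "x < y"
      have "drop i (map \<tau> [0..<n]) ! (x - i) < drop i (map \<tau> [0..<n]) ! (y - i)"
        by (rule sorted_wrt_nth_less[OF *]) (use xy in auto)
      then show "\<tau> x < \<tau> y" using xy by simp
    qed
  qed
  ultimately show ?thesis by (simp add: unshuffles_def)
qed

text \<open>An unshuffle is a permutation increasing on both pieces. So for each set
  \<open>U\<close> of leading positions exactly one term is left, with both pieces sorted and hence
  without inner sign.\<close>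

lemma sum_unshuffles:
  assumes s: "vector_space s" and i: "i \<le> length as"
  shows "(\<Sum>\<tau>\<in>unshuffles i (length as). s (koszul as \<tau>) (\<phi> (take i (permute_list \<tau> as)) (drop i (permute_list \<tau> as)))) =
    spl as (\<lambda>u v. if length u = i then \<phi> u v else 0)"
proof -
  let ?n = "length as" and ?a = "nth as"
  define \<psi> where "\<psi> us vs = (if sorted_wrt (<) us \<and> sorted_wrt (<) vs then \<phi> (map ?a us) (map ?a vs) else 0)" for us vs
  have "(\<Sum>\<tau>\<in>unshuffles i ?n. s (koszul as \<tau>) (\<phi> (take i (permute_list \<tau> as)) (drop i (permute_list \<tau> as))))
     = (\<Sum>\<tau> | \<tau> permutes {..<?n}. (\<lambda>is. sg (ksg ?a is) (\<psi> (take i is) (drop i is))) (map \<tau> [0..<?n]))"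
  proof (rule sum.mono_neutral_cong_left)
    show "finite {\<tau>. \<tau> permutes {..<?n}}" by (rule finite_permutations) simp
    show "unshuffles i ?n \<subseteq> {\<tau>. \<tau> permutes {..<?n}}" by (auto simp: unshuffles_def)
    show "\<forall>\<tau>\<in>{\<tau>. \<tau> permutes {..<?n}} - unshuffles i ?n. sg (ksg ?a (map \<tau> [0..<?n])) (\<psi> (take i (map \<tau> [0..<?n])) (drop i (map \<tau> [0..<?n]))) = 0"
      using unshuffles_iff[OF i] by (auto simp: \<psi>_def)
    fix \<tau> assume "\<tau> \<in> unshuffles i ?n"
    then show "s (koszul as \<tau>) (\<phi> (take i (permute_list \<tau> as)) (drop i (permute_list \<tau> as)))
      = sg (ksg ?a (map \<tau> [0..<?n])) (\<psi> (take i (map \<tau> [0..<?n])) (drop i (map \<tau> [0..<?n])))"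
      using unshuffles_iff[OF i, of \<tau>]
      by (simp only: koszul_sg[OF s] permute_list_map \<psi>_def take_map drop_map if_True simp_thms)
  qed
  also have "\<dots> = (\<Sum>is | is \<in> permutations_of_set {..<?n} \<and> i \<le> card {..<?n}. sg (ksg ?a is) (\<psi> (take i is) (drop i is)))"
    using i by (subst sum_permutes_lists) simp
  also have "\<dots> = (\<Sum>U | U \<subseteq> {..<?n} \<and> card U = i. sg (crs ?a U ({..<?n} - U)) (\<phi> (wrd ?a U) (wrd ?a ({..<?n} - U))))"
  proof (subst sum_permutations_split, simp, intro sum.cong refl arg_cong[where f = "sg _"])
    fix U assume "U \<in> {U. U \<subseteq> {..<?n} \<and> card U = i}"
    then have fU: "finite U" using finite_subset[of U "{..<?n}"] by auto
    let ?V = "{..<?n} - U"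
    have "(\<Sum>vs\<in>permutations_of_set ?V. sg (ksg ?a us + ksg ?a vs) (\<psi> us vs))
       = (if sorted_wrt (<) us then \<phi> (map ?a us) (wrd ?a ?V) else 0)" for us
    proof -
      have "(\<Sum>vs\<in>permutations_of_set ?V. sg (ksg ?a us + ksg ?a vs) (\<psi> us vs))
         = (\<Sum>vs\<in>{vs \<in> permutations_of_set ?V. sorted_wrt (<) vs}. sg (ksg ?a us + ksg ?a vs) (\<psi> us vs))"
        by (rule sum.mono_neutral_right) (auto simp: \<psi>_def)
      then show ?thesis
        using ksg_sorted[of us ?a] ksg_sorted[of "sorted_list_of_set ?V" ?a] by (simp add: permutations_of_set_one \<psi>_def)
    qed
    moreover have "(\<Sum>us\<in>permutations_of_set U. (if sorted_wrt (<) us then \<phi> (map ?a us) (wrd ?a ?V) else 0))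
       = (\<Sum>us\<in>{us \<in> permutations_of_set U. sorted_wrt (<) us}. (if sorted_wrt (<) us then \<phi> (map ?a us) (wrd ?a ?V) else 0))"
      by (rule sum.mono_neutral_right) auto
    ultimately show "(\<Sum>us\<in>permutations_of_set U. \<Sum>vs\<in>permutations_of_set ?V. sg (ksg ?a us + ksg ?a vs) (\<psi> us vs)) = \<phi> (wrd ?a U) (wrd ?a ?V)"
      using fU by (simp add: permutations_of_set_one)
  qed
  also have "\<dots> = (\<Sum>U\<in>Pow {..<?n}. sg (crs ?a U ({..<?n} - U)) (if length (wrd ?a U) = i then \<phi> (wrd ?a U) (wrd ?a ({..<?n} - U)) else 0))"
    by (rule sum.mono_neutral_cong_left) (auto simp: finite_subset[of _ "{..<?n}"])
  also have "\<dots> = spl (wrd ?a {..<?n}) (\<lambda>u v. if length u = i then \<phi> u v else 0)"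
    by (simp add: spl_wrd)
  also have "\<dots> = spl as (\<lambda>u v. if length u = i then \<phi> u v else 0)"
    by (simp only: wrd_all)
  finally show ?thesis .
qed

text \<open>The lower bound 1 of the outer sum is the condition \<open>u \<noteq> []\<close> in
  \<open>coder\<close>, and the size of the unshuffle is recovered as the length of
  \<open>u\<close>.\<close>

lemma insert_brk_coder:
  assumes s: "vector_space (smul C')"
  shows "insert_brk C C' f as = coder (brk C) as f"
proof -
  have "insert_brk C C' f as = (\<Sum>i = 1..length as. spl as (\<lambda>u v. if length u = i then f (apply_deg 1 (brk C) u # v) else 0))"
    unfolding insert_brk_def by (intro sum.cong refl sum_unshuffles[OF s]) simp
  also have "\<dots> = spl as (\<lambda>u v. \<Sum>i = 1..length as. if length u = i then f (apply_deg 1 (brk C) u # v) else 0)"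
    by (rule spl_sum[symmetric])
  also have "\<dots> = coder (brk C) as f"
    unfolding coder_def by (intro spl_cong) (auto simp: sum.delta Suc_le_eq)
  finally show ?thesis .
qed

lemma symm_insort:
  assumes "symm C \<phi>" "a i \<in> letters C" "map a xs \<in> lists (letters C)" "sorted xs"
  shows "\<phi> (a i # map a xs) = sg (\<Sum>j\<leftarrow>xs. if j < i then fst (a i) * fst (a j) else 0) (\<phi> (map a (insort i xs)))"
  using assms
proof (induction xs arbitrary: \<phi>)
  case (Cons x xs)
  show ?case
  proof (cases "i \<le> x")
    case True
    then have "(\<Sum>j\<leftarrow>x # xs. if j < i then fst (a i) * fst (a j) else 0) = (\<Sum>j\<leftarrow>x # xs. 0)"
      using Cons.prems(4) by (intro arg_cong[where f = sum_list] map_cong) auto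
    then show ?thesis using True by (simp del: list.map add: list.map(2)[of a])
  next
    case False
    have ax: "a x \<in> letters C" and xs: "map a xs \<in> lists (letters C)" using Cons.prems by auto
    have "\<phi> (a i # a x # map a xs) = sg (fst (a i) * fst (a x)) (\<phi> (a x # a i # map a xs))"
      by (rule symm_head[OF Cons.prems(1) xs Cons.prems(2) ax])
    also have "\<phi> (a x # a i # map a xs) = sg (\<Sum>j\<leftarrow>xs. if j < i then fst (a i) * fst (a j) else 0) (\<phi> (a x # map a (insort i xs)))"
      by (rule Cons.IH[OF symm_Cons[OF Cons.prems(1) ax]]) (use Cons.prems xs in auto)
    finally have "\<phi> (a i # a x # map a xs) = sg (fst (a i) * fst (a x) + (\<Sum>j\<leftarrow>xs. if j < i then fst (a i) * fst (a j) else 0)) (\<phi> (a x # map a (insort i xs)))"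
      unfolding sg_sg .
    moreover have "x < i" using False by simp
    ultimately show ?thesis using False by simp
  qed
qed simp

text \<open>Insertion sort: each swap of neighbours removes one inversion and costs the
  corresponding factor of the Koszul sign.\<close>

lemma symm_sort:
  assumes "symm C \<phi>" "map a xs \<in> lists (letters C)"
  shows "\<phi> (map a xs) = sg (ksg a xs) (\<phi> (map a (sort xs)))"
  using assms
proof (induction xs arbitrary: \<phi>)
  case (Cons x xs)
  have ax: "a x \<in> letters C" and xs: "map a xs \<in> lists (letters C)" using Cons.prems by auto
  have "\<phi> (a x # map a xs) = sg (ksg a xs) (\<phi> (a x # map a (sort xs)))"
    by (rule Cons.IH[OF symm_Cons[OF Cons.prems(1) ax] xs])
  also have "\<phi> (a x # map a (sort xs)) = sg (\<Sum>j\<leftarrow>sort xs. if j < x then fst (a x) * fst (a j) else 0) (\<phi> (map a (insort x (sort xs))))"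
    by (rule symm_insort[where \<phi> = \<phi> and a = a and i = x, OF Cons.prems(1) ax]) (use xs in auto)
  also have "(\<Sum>j\<leftarrow>sort xs. if j < x then fst (a x) * fst (a j) else 0) = (\<Sum>j\<leftarrow>xs. if j < x then fst (a x) * fst (a j) else 0)"
    by (simp only: sum_mset_sum_list[symmetric] mset_map mset_sort)
  finally show ?case by (simp add: sg_sg add.commute)
qed simp

lemma vs_sum_const: "vector_space s \<Longrightarrow> (\<Sum>i\<in>A. x) = s (of_nat (card A)) x"
proof (induction A rule: infinite_finite_induct)
  case (insert i A)
  then show ?case by (simp add: vs_simps)
qed (simp_all add: vs_simps)

text \<open>Sorting an arrangement costs exactly the sign in front of it, so all terms coincide and
  only their number remains.\<close>

lemma sum_permutations_symm:
  assumes s: "vector_space s" and \<phi>: "symm C \<phi>" and U: "finite U" "a ` U \<subseteq> letters C"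
  shows "(\<Sum>us\<in>permutations_of_set U. sg (ksg a us) (\<phi> (map a us))) = s (fact (card U)) (\<phi> (wrd a U))"
proof -
  have "(\<Sum>us\<in>permutations_of_set U. sg (ksg a us) (\<phi> (map a us))) = (\<Sum>us\<in>permutations_of_set U. \<phi> (wrd a U))"
  proof (intro sum.cong refl)
    fix us assume "us \<in> permutations_of_set U"
    then have us: "set us = U" "distinct us" by (auto simp: permutations_of_set_def)
    have "sort us = sorted_list_of_set U"
      using us by (intro sorted_distinct_set_unique) auto
    moreover have "map a us \<in> lists (letters C)" using us U by auto
    ultimately have "\<phi> (map a us) = sg (ksg a us) (\<phi> (wrd a U))"
      using symm_sort[OF \<phi>, of a us] by simp
    then show "sg (ksg a us) (\<phi> (map a us)) = \<phi> (wrd a U)"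
      by (simp add: sg_sg) (simp add: sg_def)
  qed
  also have "\<dots> = s (of_nat (card (permutations_of_set U))) (\<phi> (wrd a U))"
    by (rule vs_sum_const[OF s])
  finally show ?thesis using U by simp
qed

text \<open>
  Unlike \<open>hat\<close>, the functions \<open>ordb\<close> and \<open>ordt\<close> sum over ordered partitions, with block sizes \<open>js\<close> and with
  \<open>t\<close> nonempty blocks; they link the sum over all permutations in the definitions to \<open>hat\<close>.
\<close>

fun ordb :: "((int \<times> 'v) list \<Rightarrow> 'w) \<Rightarrow> nat list \<Rightarrow> (int \<times> 'v) list \<Rightarrow> ((int \<times> 'w) list \<Rightarrow> 'u::ab_group_add) \<Rightarrow> 'u" where
  "ordb f [] as \<phi> = \<phi> []"
| "ordb f (j # js) as \<phi> = spl as (\<lambda>u v. if length u = j then ordb f js v (\<lambda>w. \<phi> (apply_deg 0 f u # w)) else 0)"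

lemma ordb_minus: "ordb f js as (\<lambda>w. - \<phi> w) = - ordb f js as \<phi>"
proof (induction js arbitrary: as \<phi>)
  case (Cons j js)
  show ?case by (auto simp: Cons.IH spl_minus[symmetric] intro!: spl_cong)
qed simp

lemma ordb_sg: "ordb f js as (\<lambda>w. sg n (\<phi> w)) = sg n (ordb f js as \<phi>)"
  by (cases "even n") (simp_all add: sg_def ordb_minus)

lemma ordb_cong:
  assumes "degmap 0 C C' f" "as \<in> lists (letters C)" "0 \<notin> set js"
    and "\<And>w. w \<in> lists (letters C') \<Longrightarrow> \<phi> w = \<psi> w"
  shows "ordb f js as \<phi> = ordb f js as \<psi>"
  using assms(2-)
proof (induction js arbitrary: as \<phi> \<psi>)
  case (Cons j js)
  show ?case
    unfolding ordb.simps
  proof (intro spl_cong_lists[OF Cons.prems(1)] if_cong refl Cons.IH Cons.prems(3))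
    fix u v w assume "u \<in> lists (letters C)" "length u = j" "w \<in> lists (letters C')"
    then show "apply_deg 0 f u # w \<in> lists (letters C')"
      using Cons.prems(2) by (auto intro!: apply_deg_letters[OF assms(1)])
  qed (use Cons.prems in auto)
qed simp

text \<open>The blocks are cut off one by one. Graded symmetry of \<open>f\<close> makes all orders
  inside a block contribute equally, so a block of size \<open>j\<close> accounts for the factor
  \<open>fact j\<close>.\<close>

lemma sum_perms_blocks:
  assumes s: "vector_space s" and f: "degmap 0 C C' f" "symm C f" and T: "finite T" "a ` T \<subseteq> letters C"
    and js: "0 \<notin> set js" "card T = sum_list js" and \<phi>: "multihom C' \<phi>"
  shows "(\<Sum>is\<in>permutations_of_set T. sg (ksg a is) (\<phi> (map (apply_deg 0 f) (blocks js (map a is)))))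
    = s (prod_list (map fact js)) (ordb f js (wrd a T) \<phi>)"
  using T js \<phi>
proof (induction js arbitrary: T \<phi>)
  case Nil
  then show ?case by (simp add: vs_simps[OF s])
next
  case (Cons j js)
  let ?P = "prod_list (map fact js)"
  have j: "j > 0" "0 \<notin> set js" "j \<le> card T" using Cons.prems by auto
  define \<psi> where "\<psi> us vs = \<phi> (apply_deg 0 f (map a us) # map (apply_deg 0 f) (blocks js (map a vs)))" for us vs
  have "(\<Sum>is\<in>permutations_of_set T. sg (ksg a is) (\<phi> (map (apply_deg 0 f) (blocks (j # js) (map a is)))))
     = (\<Sum>is | is \<in> permutations_of_set T \<and> j \<le> card T. sg (ksg a is) (\<psi> (take j is) (drop j is)))"
    using j by (simp add: \<psi>_def take_map drop_map)
  also have "\<dots> = (\<Sum>U | U \<subseteq> T \<and> card U = j. sg (crs a U (T - U)) (s (fact j * ?P) (ordb f js (wrd a (T - U)) (\<lambda>w. \<phi> (apply_deg 0 f (wrd a U) # w)))))"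
  proof (subst sum_permutations_split[OF Cons.prems(1)], intro sum.cong refl arg_cong[where f = "sg _"])
    fix U assume "U \<in> {U. U \<subseteq> T \<and> card U = j}"
    then have U: "U \<subseteq> T" "card U = j" "finite U" using finite_subset[of U T] Cons.prems(1) by auto
    have UC: "a ` U \<subseteq> letters C" "a ` (T - U) \<subseteq> letters C" using U Cons.prems by auto
    have cV: "card (T - U) = sum_list js" using U Cons.prems by (simp add: card_Diff_subset)
    \<comment> \<open>The contribution of one choice of positions as a function of the first block
      alone. It is graded symmetric, so \<open>sum_permutations_symm\<close> sums it over the orders
      of that block.\<close>
    define \<theta> where "\<theta> us = (if length us = j then ordb f js (wrd a (T - U)) (\<lambda>w. \<phi> (apply_deg 0 f us # w)) else 0)" for us
    have let1: "apply_deg 0 f us \<in> letters C'" if "us \<in> lists (letters C)" "length us = j" for us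
      using that j by (intro apply_deg_letters[OF f(1)]) auto
    have V: "wrd a (T - U) \<in> lists (letters C)" using UC Cons.prems(1) by auto
    have "symm C \<theta>"
      unfolding symm_def
    proof (intro ballI)
      fix us vs b c
      assume *: "us \<in> lists (letters C)" "vs \<in> lists (letters C)" "b \<in> letters C" "c \<in> letters C"
      show "\<theta> (us @ b # c # vs) = sg (fst b * fst c) (\<theta> (us @ c # b # vs))"
      proof (cases "length (us @ b # c # vs) = j")
        case True
        have "\<phi> (apply_deg 0 f (us @ b # c # vs) # w) = sg (fst b * fst c) (\<phi> (apply_deg 0 f (us @ c # b # vs) # w))"
          if "w \<in> lists (letters C')" for w
        proof -
          have e: "f (us @ b # c # vs) = sg (fst b * fst c) (f (us @ c # b # vs))"
            by (rule symmD[OF f(2)]) (use * in auto)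
          have d: "total_deg (us @ c # b # vs) = total_deg (us @ b # c # vs)" by simp
          have "f (us @ c # b # vs) \<in> grade C' (total_deg (us @ b # c # vs))"
            using degmapD[OF f(1), of "us @ c # b # vs"] * unfolding d by simp
          from hom_onD(8)[OF multihom_head[OF Cons.prems(5) that] this]
          show ?thesis unfolding apply_deg_def e d by simp
        qed
        then show ?thesis
          using True by (simp add: \<theta>_def ordb_sg[symmetric] cong: ordb_cong[OF f(1) V j(2)])
      qed (simp add: \<theta>_def)
    qed
    have "(\<Sum>us\<in>permutations_of_set U. \<Sum>vs\<in>permutations_of_set (T - U). sg (ksg a us + ksg a vs) (\<psi> us vs))
      = (\<Sum>us\<in>permutations_of_set U. sg (ksg a us) (s ?P (\<theta> (map a us))))"
    proof (intro sum.cong refl)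
      fix us assume "us \<in> permutations_of_set U"
      then have us: "set us = U" "distinct us" by (auto simp: permutations_of_set_def)
      have len: "length us = j" using us U distinct_card[of us] by simp
      have "map a us \<in> lists (letters C)" using us UC by auto
      then have L: "apply_deg 0 f (map a us) \<in> letters C'" using len by (intro let1) auto
      have "(\<Sum>vs\<in>permutations_of_set (T - U). sg (ksg a vs) (\<psi> us vs)) = s ?P (\<theta> (map a us))"
        unfolding \<psi>_def using Cons.IH[OF _ UC(2) j(2) cV multihom_Cons[OF Cons.prems(5) L]] Cons.prems(1) len
        by (simp add: \<theta>_def)
      then show "(\<Sum>vs\<in>permutations_of_set (T - U). sg (ksg a us + ksg a vs) (\<psi> us vs)) = sg (ksg a us) (s ?P (\<theta> (map a us)))"
        by (simp add: sg_sg[symmetric] sg_sum[symmetric])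
    qed
    also have "\<dots> = s ?P (\<Sum>us\<in>permutations_of_set U. sg (ksg a us) (\<theta> (map a us)))"
      by (simp add: vs_simps[OF s])
    also have "\<dots> = s (fact j * ?P) (\<theta> (wrd a U))"
      by (subst sum_permutations_symm[OF s \<open>symm C \<theta>\<close> U(3) UC(1)]) (simp add: U vs_simps[OF s] mult.commute)
    also have "\<theta> (wrd a U) = ordb f js (wrd a (T - U)) (\<lambda>w. \<phi> (apply_deg 0 f (wrd a U) # w))"
      using U by (simp add: \<theta>_def)
    finally show "(\<Sum>us\<in>permutations_of_set U. \<Sum>vs\<in>permutations_of_set (T - U). sg (ksg a us + ksg a vs) (\<psi> us vs))
      = s (fact j * ?P) (ordb f js (wrd a (T - U)) (\<lambda>w. \<phi> (apply_deg 0 f (wrd a U) # w)))" .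
  qed
  also have "\<dots> = (\<Sum>U\<in>Pow T. sg (crs a U (T - U)) (s (fact j * ?P) (if length (wrd a U) = j then ordb f js (wrd a (T - U)) (\<lambda>w. \<phi> (apply_deg 0 f (wrd a U) # w)) else 0)))"
    using Cons.prems(1)
    by (intro sum.mono_neutral_cong_left) (auto simp: finite_subset[of _ T] vs_simps[OF s])
  also have "\<dots> = s (fact j * ?P) (spl (wrd a T) (\<lambda>u v. if length u = j then ordb f js v (\<lambda>w. \<phi> (apply_deg 0 f u # w)) else 0))"
    by (simp add: spl_wrd[OF Cons.prems(1)] vs_simps[OF s])
  finally show ?case by simp
qed

fun ordt :: "((int \<times> 'v) list \<Rightarrow> 'w) \<Rightarrow> nat \<Rightarrow> (int \<times> 'v) list \<Rightarrow> ((int \<times> 'w) list \<Rightarrow> 'u::ab_group_add) \<Rightarrow> 'u" where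
  "ordt f 0 as \<phi> = (if as = [] then \<phi> [] else 0)"
| "ordt f (Suc t) as \<phi> = spl as (\<lambda>u v. if u = [] then 0 else ordt f t v (\<lambda>w. \<phi> (apply_deg 0 f u # w)))"

lemma ordt_add: "ordt f t as (\<lambda>w. \<phi> w + \<psi> w) = ordt f t as \<phi> + ordt f t as \<psi>"
proof (induction t arbitrary: as \<phi> \<psi>)
  case (Suc t)
  show ?case by (auto simp: Suc.IH spl_add[symmetric] intro!: spl_cong)
qed simp

lemma ordt_minus: "ordt f t as (\<lambda>w. - \<phi> w) = - ordt f t as \<phi>"
proof (induction t arbitrary: as \<phi>)
  case (Suc t)
  show ?case by (auto simp: Suc.IH spl_minus[symmetric] intro!: spl_cong)
qed simp

lemma ordt_sg: "ordt f t as (\<lambda>w. sg n (\<phi> w)) = sg n (ordt f t as \<phi>)"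
  by (cases "even n") (simp_all add: sg_def ordt_minus)

lemma ordt_cong:
  assumes "degmap 0 C C' f" "as \<in> lists (letters C)"
    and "\<And>w. w \<in> lists (letters C') \<Longrightarrow> \<phi> w = \<psi> w"
  shows "ordt f t as \<phi> = ordt f t as \<psi>"
  using assms(2-)
proof (induction t arbitrary: as \<phi> \<psi>)
  case (Suc t)
  show ?case
    unfolding ordt.simps
  proof (intro spl_cong_lists[OF Suc.prems(1)] if_cong refl Suc.IH Suc.prems(2))
    fix u v w assume "u \<in> lists (letters C)" "u \<noteq> []" "w \<in> lists (letters C')"
    then show "apply_deg 0 f u # w \<in> lists (letters C')"
      by (auto intro!: apply_deg_letters[OF assms(1)])
  qed auto
qed simp

lemma compositions_length_0: "{js \<in> compositions n. length js = 0} = (if n = 0 then {[]} else {})"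
  by (auto simp: compositions_def)

lemma compositions_length_Suc:
  "{js \<in> compositions n. length js = Suc t} = (\<Union>j\<in>{1..n}. (#) j ` {js \<in> compositions (n - j). length js = t})"
proof (intro equalityI subsetI)
  fix xs assume "xs \<in> {js \<in> compositions n. length js = Suc t}"
  then obtain j js where "xs = j # js" "length js = t" "0 \<notin> set js" "j \<noteq> 0" "j + sum_list js = n"
    by (auto simp: compositions_def length_Suc_conv)
  then show "xs \<in> (\<Union>j\<in>{1..n}. (#) j ` {js \<in> compositions (n - j). length js = t})"
    by (auto simp: compositions_def intro!: bexI[of _ j])
qed (auto simp: compositions_def)

lemma sum_compositions_Suc:
  "(\<Sum>js | js \<in> compositions n \<and> length js = Suc t. F js) =
   (\<Sum>j = 1..n. \<Sum>js | js \<in> compositions (n - j) \<and> length js = t. F (j # js))"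
proof -
  have "(\<Sum>js | js \<in> compositions n \<and> length js = Suc t. F js)
     = (\<Sum>j = 1..n. sum F ((#) j ` {js \<in> compositions (n - j). length js = t}))"
    unfolding compositions_length_Suc
    by (rule sum.UNION_disjoint) (auto simp: finite_compositions)
  then show ?thesis by (simp add: sum.reindex)
qed

lemma sum_ordb:
  fixes as :: "(int \<times> 'v) list"
  shows "(\<Sum>js | js \<in> compositions (length as) \<and> length js = t. ordb f js as \<phi>) = ordt f t as \<phi>"
proof (induction t arbitrary: as \<phi>)
  case 0
  then show ?case unfolding compositions_length_0 by simp
next
  case (Suc t)
  let ?n = "length as"
  let ?X = "\<lambda>u v. ordt f t v (\<lambda>w. \<phi> (apply_deg 0 f u # w))"
  have "(\<Sum>js | js \<in> compositions ?n \<and> length js = Suc t. ordb f js as \<phi>)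
     = (\<Sum>j = 1..?n. spl as (\<lambda>u v. if length u = j then ?X u v else 0))"
    unfolding sum_compositions_Suc ordb.simps spl_sum[symmetric]
  proof (intro sum.cong refl spl_cong)
    fix j :: nat and u v :: "(int \<times> 'v) list" assume len: "length u + length v = length as"
    have "(\<Sum>js | js \<in> compositions (?n - j) \<and> length js = t. ordb f js v (\<lambda>w. \<phi> (apply_deg 0 f u # w))) = ?X u v"
      if "length u = j"
    proof -
      have "?n - j = length v" using len that by simp
      then show ?thesis using Suc.IH[of v] by simp
    qed
    then show "(\<Sum>js | js \<in> compositions (?n - j) \<and> length js = t.
        if length u = j then ordb f js v (\<lambda>w. \<phi> (apply_deg 0 f u # w)) else 0) = (if length u = j then ?X u v else 0)"
      by auto
  qed
  also have "\<dots> = spl as (\<lambda>u v. \<Sum>j = 1..?n. if length u = j then ?X u v else 0)"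
    by (rule spl_sum[symmetric])
  also have "\<dots> = ordt f (Suc t) as \<phi>"
    unfolding ordt.simps by (intro spl_cong) (auto simp: sum.delta Suc_le_eq)
  finally show ?case .
qed

text \<open>The denominators \<open>fact j\<close> for the block sizes cancel the factors from
  \<open>sum_perms_blocks\<close>; the denominator for the number of blocks stays, to compensate
  their ordering.\<close>

lemma linf_comp_ordt:
  fixes g :: "(int \<times> 'w::ab_group_add) list \<Rightarrow> 'u::ab_group_add" and C'' :: "('k::field_char_0, 'u) linf"
  assumes s: "vector_space (smul C'')" and f: "degmap 0 C C' f" "symm C f" and as: "as \<in> lists (letters C)"
    and g: "multihom C' g"
  shows "linf_comp C'' g f as = (\<Sum>t\<le>length as. smul C'' (1 / fact t) (ordt f t as g))"
proof -
  let ?n = "length as" and ?s = "smul C''"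
  have a: "nth as ` {..<?n} \<subseteq> letters C"
    using as by (auto simp: in_lists_conv_set)
  have "linf_comp C'' g f as = (\<Sum>js \<in> compositions ?n. ?s (1 / (fact (length js) * prod_list (map fact js)))
      (\<Sum>\<tau> | \<tau> permutes {..<?n}. (\<lambda>is. sg (ksg (nth as) is) (g (map (apply_deg 0 f) (blocks js (map (nth as) is))))) (map \<tau> [0..<?n])))"
    unfolding linf_comp_def permute_list_map koszul_sg[OF s, symmetric] vs_simps[OF s]
    by (simp add: vs_simps[OF s])
  also have "\<dots> = (\<Sum>js \<in> compositions ?n. ?s (1 / fact (length js)) (ordb f js as g))"
  proof (intro sum.cong refl)
    fix js assume "js \<in> compositions ?n"
    then have js: "0 \<notin> set js" "card {..<?n} = sum_list js" by (auto simp: compositions_def)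
    have nz: "prod_list (map fact js) \<noteq> (0 :: 'k)" by (auto simp: prod_list_zero_iff)
    have "(\<Sum>\<tau> | \<tau> permutes {..<?n}. (\<lambda>is. sg (ksg (nth as) is) (g (map (apply_deg 0 f) (blocks js (map (nth as) is))))) (map \<tau> [0..<?n]))
      = ?s (prod_list (map fact js)) (ordb f js as g)"
      using sum_perms_blocks[OF s f finite_lessThan a js g]
        sum_permutes_lists[of "\<lambda>is. sg (ksg (nth as) is) (g (map (apply_deg 0 f) (blocks js (map (nth as) is))))" ?n]
      by (simp only: wrd_all)
    then show "?s (1 / (fact (length js) * prod_list (map fact js)))
      (\<Sum>\<tau> | \<tau> permutes {..<?n}. (\<lambda>is. sg (ksg (nth as) is) (g (map (apply_deg 0 f) (blocks js (map (nth as) is))))) (map \<tau> [0..<?n]))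
      = ?s (1 / fact (length js)) (ordb f js as g)"
      using nz by (simp only: vs_simps(9)[OF s]) (simp add: field_simps)
  qed
  also have "\<dots> = (\<Sum>t\<le>?n. \<Sum>js | js \<in> compositions ?n \<and> length js = t. ?s (1 / fact t) (ordb f js as g))"
  proof -
    have *: "length js \<le> sum_list js" if "0 \<notin> set js" for js :: "nat list"
      using that by (induction js) auto
    have "length ` compositions ?n \<subseteq> {..?n}"
    proof safe
      fix js assume "js \<in> compositions ?n"
      then show "length js \<le> ?n" using *[of js] by (simp add: compositions_def)
    qed
    from sum.group[OF finite_compositions _ this, symmetric, of "\<lambda>js. ?s (1 / fact (length js)) (ordb f js as g)"]
    show ?thesis by simp
  qed
  also have "\<dots> = (\<Sum>t\<le>?n. ?s (1 / fact t) (ordt f t as g))"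
    by (simp add: vs_simps(10)[OF s, symmetric] sum_ordb)
  finally show ?thesis .
qed

text \<open>Among \<open>Suc t\<close> ordered blocks, the one containing the first letter may stand
  at any place. Symmetry of the outer function moves it to the front without changing the signed
  value, so it is counted \<open>Suc t\<close> times.\<close>

lemma ordt_Suc_Cons:
  assumes s: "vector_space s" and f: "degmap 0 C C' f" and as: "a # as \<in> lists (letters C)" and \<phi>: "symm C' \<phi>"
  shows "ordt f (Suc t) (a # as) \<phi> = s (of_nat (Suc t)) (spl as (\<lambda>u v. ordt f t v (\<lambda>w. \<phi> (apply_deg 0 f (a # u) # w))))"
  using as \<phi>
proof (induction t arbitrary: as \<phi>)
  case 0
  have "spl as (\<lambda>u v. sg (fst a * total_deg u) (if u = [] then 0 else if a # v = [] then \<phi> [apply_deg 0 f u] else 0)) = 0"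
    by (rule trans[OF spl_cong spl_zero]) auto
  then show ?case by (simp add: vs_simps[OF s] cong: if_cong)
next
  case (Suc t)
  have as: "as \<in> lists (letters C)" and a: "a \<in> letters C" using Suc.prems by auto
  let ?X = "\<lambda>u. apply_deg 0 f (a # u)"
  let ?S = "spl as (\<lambda>u v. ordt f (Suc t) v (\<lambda>w. \<phi> (?X u # w)))"
  define P where "P u x y = (if u = [] then 0 else ordt f t y (\<lambda>w. \<phi> (?X x # apply_deg 0 f u # w)))" for u x y
  have "spl as (\<lambda>u v. sg (fst a * total_deg u) (if u = [] then 0 else ordt f (Suc t) (a # v) (\<lambda>w. \<phi> (apply_deg 0 f u # w))))
    = s (of_nat (Suc t)) (spl as (\<lambda>u v. spl v (\<lambda>x y. sg (total_deg u * total_deg x) (P u x y))))"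
  proof -
    have hs: "hom_on UNIV (s c)" for c by (simp add: hom_on_def vs_simps[OF s])
    show ?thesis
      unfolding spl_hom(2)[OF hs as UNIV_I]
    proof (intro spl_cong_lists[OF as])
      fix u v assume u: "u \<in> lists (letters C)" and v: "v \<in> lists (letters C)"
      show "sg (fst a * total_deg u) (if u = [] then 0 else ordt f (Suc t) (a # v) (\<lambda>w. \<phi> (apply_deg 0 f u # w)))
        = s (of_nat (Suc t)) (spl v (\<lambda>x y. sg (total_deg u * total_deg x) (P u x y)))"
      proof (cases "u = []")
        case True
        then show ?thesis by (simp add: P_def vs_simps[OF s])
      next
        case False
        have L: "apply_deg 0 f u \<in> letters C'" using u False by (intro apply_deg_letters[OF f]) auto
        have "ordt f (Suc t) (a # v) (\<lambda>w. \<phi> (apply_deg 0 f u # w))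
          = s (of_nat (Suc t)) (spl v (\<lambda>x y. ordt f t y (\<lambda>w. \<phi> (apply_deg 0 f u # ?X x # w))))"
          by (rule Suc.IH[OF _ symm_Cons[OF Suc.prems(2) L]]) (use a v in simp)
        also have "spl v (\<lambda>x y. ordt f t y (\<lambda>w. \<phi> (apply_deg 0 f u # ?X x # w)))
          = spl v (\<lambda>x y. sg (fst a * total_deg u + total_deg u * total_deg x) (P u x y))"
        proof (intro spl_cong_lists[OF v])
          fix x y assume x: "x \<in> lists (letters C)" and y: "y \<in> lists (letters C)"
          have LX: "?X x \<in> letters C'" using x a by (intro apply_deg_letters[OF f]) auto
          have "ordt f t y (\<lambda>w. \<phi> (apply_deg 0 f u # ?X x # w)) = ordt f t y (\<lambda>w. sg (total_deg u * (fst a + total_deg x)) (\<phi> (?X x # apply_deg 0 f u # w)))"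
          proof (intro ordt_cong[OF f y])
            fix w assume w: "w \<in> lists (letters C')"
            show "\<phi> (apply_deg 0 f u # ?X x # w) = sg (total_deg u * (fst a + total_deg x)) (\<phi> (?X x # apply_deg 0 f u # w))"
              using symm_head[OF Suc.prems(2) w L LX] by simp
          qed
          then show "ordt f t y (\<lambda>w. \<phi> (apply_deg 0 f u # ?X x # w)) = sg (fst a * total_deg u + total_deg u * total_deg x) (P u x y)"
            using False by (simp add: ordt_sg P_def algebra_simps)
        qed
        finally show ?thesis
          using False by (simp add: vs_simps[OF s, symmetric] spl_sg[symmetric] sg_sg)
             (simp add: vs_simps(11)[OF s] spl_sg[symmetric] sg_sg algebra_simps sg_def)
      qed
    qed
  qed
  also have "spl as (\<lambda>u v. spl v (\<lambda>x y. sg (total_deg u * total_deg x) (P u x y))) = spl as (\<lambda>x v. spl v (\<lambda>u y. P u x y))"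
    by (rule spl_exchange[symmetric])
  also have "\<dots> = ?S"
    by (simp add: P_def)
  finally have "spl as (\<lambda>u v. sg (fst a * total_deg u) (if u = [] then 0 else ordt f (Suc t) (a # v) (\<lambda>w. \<phi> (apply_deg 0 f u # w)))) = s (of_nat (Suc t)) ?S" .
  moreover have "ordt f (Suc (Suc t)) (a # as) \<phi> = ?S + spl as (\<lambda>u v. sg (fst a * total_deg u) (if u = [] then 0 else ordt f (Suc t) (a # v) (\<lambda>w. \<phi> (apply_deg 0 f u # w))))"
    by (subst ordt.simps(2)) (simp del: ordt.simps)
  moreover have "s (of_nat (Suc (Suc t))) ?S = ?S + s (of_nat (Suc t)) ?S"
    by (simp only: of_nat_Suc[of "Suc t"] vs_simps(6,8)[OF s])
  ultimately show ?case by (simp only:)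
qed

text \<open>A set partition into t blocks has t! orderings, of which \<open>hat\<close> uses the one
  by first letters. In the recursion the factor \<open>Suc t\<close> of \<open>ordt_Suc_Cons\<close>
  turns 1/(t+1)! into 1/t!.\<close>

lemma hat_ordt:
  fixes s :: "'k::field_char_0 \<Rightarrow> 'u \<Rightarrow> 'u::ab_group_add"
  assumes s: "vector_space s" and f: "degmap 0 C C' f" and as: "as \<in> lists (letters C)" and g: "symm C' g"
  shows "hat f as g = (\<Sum>t\<le>length as. s (1 / fact t) (ordt f t as g))"
proof -
  \<comment> \<open>Any bound above the length will do, as longer orderings contribute 0; one bound
    then serves all the shorter words \<open>v\<close> in the induction.\<close>
  have "hat f as g = (\<Sum>t\<le>n. s (1 / fact t) (ordt f t as g))" if "length as \<le> n" for n
    using as g that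
  proof (induction n arbitrary: as g)
    case 0
    then show ?case by (simp add: vs_simps[OF s])
  next
    case (Suc n)
    show ?case
    proof (cases as)
      case Nil
      have "ordt f (Suc t) [] g = 0" for t by simp
      then show ?thesis unfolding Nil by (simp only: sum.atMost_Suc_shift) (simp add: vs_simps[OF s])
    next
      case (Cons a bs)
      have bs: "bs \<in> lists (letters C)" and a: "a \<in> letters C" using Suc.prems Cons by auto
      let ?X = "\<lambda>u. apply_deg 0 f (a # u)"
      have hs: "hom_on UNIV (s c)" for c by (simp add: hom_on_def vs_simps[OF s])
      have "hat f as g = spl bs (\<lambda>u v. \<Sum>t\<le>n. s (1 / fact t) (ordt f t v (\<lambda>w. g (?X u # w))))"
        unfolding Cons hat.simps
      proof (intro spl_cong_lists[OF bs] Suc.IH)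
        fix u v assume "u \<in> lists (letters C)" "v \<in> lists (letters C)" "length u + length v = length bs"
        then show "symm C' (\<lambda>w. g (?X u # w))" "length v \<le> n"
          using a Suc.prems Cons by (auto intro!: symm_Cons apply_deg_letters[OF f])
      qed
      also have "\<dots> = (\<Sum>t\<le>n. s (1 / fact (Suc t)) (ordt f (Suc t) as g))"
        unfolding spl_sum
      proof (intro sum.cong refl)
        fix t
        have "1 / fact (Suc t) * of_nat (Suc t) = (1 / fact t :: 'k)"
          by (simp add: fact_Suc del: of_nat_Suc)
        then show "spl bs (\<lambda>u v. s (1 / fact t) (ordt f t v (\<lambda>w. g (?X u # w)))) = s (1 / fact (Suc t)) (ordt f (Suc t) as g)"
          unfolding Cons using Suc.prems(1,2) Cons
          by (subst ordt_Suc_Cons[OF s f]) (simp_all only: spl_hom(2)[OF hs bs UNIV_I] vs_simps(9)[OF s])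
      qed
      also have "\<dots> = (\<Sum>t\<le>Suc n. s (1 / fact t) (ordt f t as g))"
        unfolding sum.atMost_Suc_shift using Cons by (simp add: vs_simps[OF s])
      finally show ?thesis .
    qed
  qed
  then show ?thesis by simp
qed

lemma linf_comp_hat:
  assumes "vector_space (smul C'')" "degmap 0 C C' f" "symm C f" "as \<in> lists (letters C)" "multihom C' g" "symm C' g"
  shows "linf_comp C'' g f as = hat f as g"
  using linf_comp_ordt[OF assms(1-5)] hat_ordt[OF assms(1,2,4,6)] by simp

section \<open>Linearity and graded symmetry of \<open>spl\<close>, \<open>hat\<close> and
  \<open>coder\<close>\<close>

definition lin_on :: "('k \<Rightarrow> 'v \<Rightarrow> 'v) \<Rightarrow> ('k \<Rightarrow> 'u \<Rightarrow> 'u) \<Rightarrow> 'v::ab_group_add set \<Rightarrow> ('v \<Rightarrow> 'u::ab_group_add) \<Rightarrow> bool" where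
  "lin_on sc s G h \<longleftrightarrow> hom_on G h \<and> (\<forall>c. \<forall>x\<in>G. sc c x \<in> G \<and> h (sc c x) = s c (h x))"

definition multilin :: "('k, 'v::ab_group_add) linf \<Rightarrow> ('k \<Rightarrow> 'u \<Rightarrow> 'u) \<Rightarrow> ((int \<times> 'v) list \<Rightarrow> 'u::ab_group_add) \<Rightarrow> bool" where
  "multilin C s g \<longleftrightarrow> (\<forall>us \<in> lists (letters C). \<forall>vs \<in> lists (letters C). \<forall>p.
     lin_on (smul C) s (grade C p) (\<lambda>x. g (us @ (p, x) # vs)))"

lemma multilinD:
  "multilin C s g \<Longrightarrow> us \<in> lists (letters C) \<Longrightarrow> vs \<in> lists (letters C) \<Longrightarrow>
    lin_on (smul C) s (grade C p) (\<lambda>x. g (us @ (p, x) # vs))"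
  unfolding multilin_def by blast

lemma multilin_head:
  "multilin C s g \<Longrightarrow> vs \<in> lists (letters C) \<Longrightarrow> lin_on (smul C) s (grade C p) (\<lambda>x. g ((p, x) # vs))"
  using multilinD[of C s g "[]" vs p] by simp

lemma multilin_Cons:
  assumes g: "multilin C s g" and a: "a \<in> letters C"
  shows "multilin C s (\<lambda>W. g (a # W))"
proof -
  have *: "lin_on (smul C) s (grade C p) (\<lambda>x. g (a # us @ (p, x) # vs))"
    if "us \<in> lists (letters C)" "vs \<in> lists (letters C)" for us vs p
    using multilinD[OF g, of "a # us" vs p] that a by simp
  show ?thesis unfolding multilin_def by (intro ballI allI *)
qed

lemma multilin_multihom: "multilin C s g \<Longrightarrow> multihom C g"
  unfolding multilin_def multihom_def lin_on_def by blast

lemma lin_onD: "lin_on sc s G h \<Longrightarrow> hom_on G h" "lin_on sc s G h \<Longrightarrow> x \<in> G \<Longrightarrow> sc c x \<in> G"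
  "lin_on sc s G h \<Longrightarrow> x \<in> G \<Longrightarrow> h (sc c x) = s c (h x)"
  by (auto simp: lin_on_def)

lemma lin_on_comp:
  assumes "lin_on sc s G h" "lin_on s s' G' h'" "\<And>x. x \<in> G \<Longrightarrow> h x \<in> G'"
  shows "lin_on sc s' G (\<lambda>x. h' (h x))"
  using assms by (auto simp: lin_on_def hom_on_def)

lemma lin_on_spl:
  assumes s: "vector_space s" and as: "as \<in> lists L"
    and h: "\<And>u v. u \<in> lists L \<Longrightarrow> v \<in> lists L \<Longrightarrow> length u + length v = length as \<Longrightarrow>
      total_deg u + total_deg v = total_deg as \<Longrightarrow> lin_on sc s G (\<lambda>x. \<phi> x u v)"
  shows "lin_on sc s G (\<lambda>x. spl as (\<phi> x))"
proof -
  have hs: "hom_on UNIV (s c)" for c by (simp add: hom_on_def vs_simps[OF s])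
  have 1: "spl as (\<phi> (x + y)) = spl as (\<phi> x) + spl as (\<phi> y)" if "x \<in> G" "y \<in> G" for x y
    unfolding spl_add[symmetric] by (intro spl_cong_lists[OF as] hom_onD(4)[OF lin_onD(1)[OF h]] that)
  have 2: "spl as (\<phi> (sc c x)) = s c (spl as (\<phi> x))" if "x \<in> G" for c x
    unfolding spl_hom(2)[OF hs as UNIV_I] by (intro spl_cong_lists[OF as] lin_onD(3)[OF h] that)
  obtain u v where "lin_on sc s G (\<lambda>x. \<phi> x u v)"
    using h[of as "[]"] as by auto
  then have "0 \<in> G" "\<And>x y. x \<in> G \<Longrightarrow> y \<in> G \<Longrightarrow> x + y \<in> G" "\<And>x. x \<in> G \<Longrightarrow> - x \<in> G" "\<And>c x. x \<in> G \<Longrightarrow> sc c x \<in> G"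
    unfolding lin_on_def hom_on_def by auto
  then show ?thesis
    using 1 2 by (simp add: lin_on_def hom_on_def)
qed

lemma lin_on_hat:
  assumes s: "vector_space s" and f: "degmap 0 C C' f" and as: "as \<in> lists (letters C)"
    and h: "\<And>W. W \<in> lists (letters C') \<Longrightarrow> lin_on sc s G (\<lambda>x. \<phi> x W)"
  shows "lin_on sc s G (\<lambda>x. hat f as (\<phi> x))"
proof -
  have hs: "hom_on UNIV (s c)" for c by (simp add: hom_on_def vs_simps[OF s])
  have 2: "hat f as (\<phi> (sc c x)) = s c (hat f as (\<phi> x))" if "x \<in> G" for c x
    unfolding hat_hom(2)[OF f as hs UNIV_I] by (intro hat_cong[OF f as] lin_onD(3)[OF h] that)
  have "hom_on G (\<lambda>x. hat f as (\<phi> x))"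
    by (intro hom_on_hat[OF f as] lin_onD(1)[OF h])
  moreover have "sc c x \<in> G" if "x \<in> G" for c x
    using h[of "[]"] that by (auto simp: lin_on_def)
  ultimately show ?thesis
    using 2 by (simp add: lin_on_def)
qed

lemma lin_on_const_simps:
  assumes s: "vector_space s" and h: "lin_on sc s G h"
  shows "lin_on sc s G (\<lambda>x. sg n (h x))" "lin_on sc s G (\<lambda>x. 0)"
  using h unfolding lin_on_def hom_on_def by (auto simp: vs_simps[OF s] sg_add)

lemma lin_on_add:
  assumes s: "vector_space s" and "lin_on sc s G h" "lin_on sc s G h'"
  shows "lin_on sc s G (\<lambda>x. h x + h' x)" "lin_on sc s G (\<lambda>x. h x - h' x)"
  using assms(2,3) unfolding lin_on_def hom_on_def by (auto simp: vs_simps[OF s])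

text \<open>The distinguished letter falls into the left or the right subword, whence the two
  hypotheses. The signs depend on its degree only, so they do not disturb linearity.\<close>

lemma lin_on_spl_letter:
  assumes s: "vector_space s" and us: "us \<in> lists L" and vs: "vs \<in> lists L"
    and h1: "\<And>u1 u2 v. u1 \<in> lists L \<Longrightarrow> u2 \<in> lists L \<Longrightarrow> v \<in> lists L \<Longrightarrow>
      length u1 + length u2 + length v = length us + length vs \<Longrightarrow> lin_on sc s G (\<lambda>x. \<phi> (u1 @ (p, x) # u2) v)"
    and h2: "\<And>u v1 v2. u \<in> lists L \<Longrightarrow> v1 \<in> lists L \<Longrightarrow> v2 \<in> lists L \<Longrightarrow>
      length u + length v1 + length v2 = length us + length vs \<Longrightarrow> lin_on sc s G (\<lambda>x. \<phi> u (v1 @ (p, x) # v2))"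
  shows "lin_on sc s G (\<lambda>x. spl (us @ (p, x) # vs) \<phi>)"
  using us h1 h2
proof (induction us arbitrary: \<phi> rule: list.induct)
  case Nil
  have h: "lin_on sc s G (\<lambda>x. \<phi> ((p, x) # u) v)" "lin_on sc s G (\<lambda>x. \<phi> u ((p, x) # v))"
    if "u \<in> lists L" "v \<in> lists L" "length u + length v = length vs" for u v
    using Nil(2)[of "[]" u v] Nil(3)[of u "[]" v] that by simp_all
  have "lin_on sc s G (\<lambda>x. spl vs (\<lambda>u v. \<phi> ((p, x) # u) v))"
    by (intro lin_on_spl[OF s vs]) (use h in simp)
  moreover have "lin_on sc s G (\<lambda>x. spl vs (\<lambda>u v. sg (p * total_deg u) (\<phi> u ((p, x) # v))))"
    by (intro lin_on_spl[OF s vs] lin_on_const_simps[OF s]) (use h in simp)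
  ultimately show ?case by (simp add: lin_on_add[OF s])
next
  case (Cons a us)
  have a: "a \<in> L" and us: "us \<in> lists L" using Cons.prems by auto
  have "lin_on sc s G (\<lambda>x. spl (us @ (p, x) # vs) (\<lambda>u v. \<phi> (a # u) v))"
  proof (rule Cons.IH[OF us])
    fix u v w assume *: "u \<in> lists L" "v \<in> lists L" "w \<in> lists L" "length u + length v + length w = length us + length vs"
    show "lin_on sc s G (\<lambda>x. \<phi> (a # u @ (p, x) # v) w)"
      using Cons.prems(2)[of "a # u" v w] * a by simp
    show "lin_on sc s G (\<lambda>x. \<phi> (a # u) (v @ (p, x) # w))"
      using Cons.prems(3)[of "a # u" v w] * a by simp
  qed
  moreover have "lin_on sc s G (\<lambda>x. spl (us @ (p, x) # vs) (\<lambda>u v. sg (fst a * total_deg u) (\<phi> u (a # v))))"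
  proof (rule Cons.IH[OF us])
    fix u v w assume *: "u \<in> lists L" "v \<in> lists L" "w \<in> lists L" "length u + length v + length w = length us + length vs"
    show "lin_on sc s G (\<lambda>x. sg (fst a * total_deg (u @ (p, x) # v)) (\<phi> (u @ (p, x) # v) (a # w)))"
      unfolding total_deg_simps fst_conv
      using Cons.prems(2)[of u v "a # w"] * a by (intro lin_on_const_simps(1)[OF s]) simp
    show "lin_on sc s G (\<lambda>x. sg (fst a * total_deg u) (\<phi> u (a # v @ (p, x) # w)))"
      using Cons.prems(3)[of u "a # v" w] * a by (intro lin_on_const_simps(1)[OF s]) simp
  qed
  ultimately show ?case by (simp add: lin_on_add[OF s])
qed

lemma lin_on_apply_deg:
  assumes f: "degmap d C C' f" "multilin C (smul C') f" and g: "multilin C' s g"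
    and "us \<in> lists (letters C)" "vs \<in> lists (letters C)" "W \<in> lists (letters C')"
  shows "lin_on (smul C) s (grade C p) (\<lambda>x. g (apply_deg d f (us @ (p, x) # vs) # W))"
proof -
  have "lin_on (smul C) s (grade C p) (\<lambda>x. g ((total_deg us + (p + total_deg vs) + d, f (us @ (p, x) # vs)) # W))"
    by (rule lin_on_comp[OF multilinD[OF f(2)] multilin_head[OF g]])
       (use assms degmapD[OF f(1), of "us @ (p, x) # vs" for x] in auto)
  then show ?thesis by (simp add: apply_deg_def)
qed

lemma multilin_hat:
  assumes s: "vector_space s" and f: "degmap 0 C C' f" "multilin C (smul C') f" and g: "multilin C' s g"
    and us: "us \<in> lists (letters C)" and vs: "vs \<in> lists (letters C)"
  shows "lin_on (smul C) s (grade C p) (\<lambda>x. hat f (us @ (p, x) # vs) g)"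
  using us vs g
proof (induction "length us + length vs" arbitrary: us vs g rule: less_induct)
  case less
  note us = less.prems(1) and vs = less.prems(2) and g = less.prems(3)
  show ?case
  proof (cases us)
    case Nil
    have "lin_on (smul C) s (grade C p) (\<lambda>x. spl vs (\<lambda>u v. hat f v (\<lambda>W. g (apply_deg 0 f ((p, x) # u) # W))))"
      by (intro lin_on_spl[OF s vs] lin_on_hat[OF s f(1)])
         (use lin_on_apply_deg[OF f g, of "[]"] in auto)
    then show ?thesis by (simp add: Nil)
  next
    case (Cons a us')
    have a: "a \<in> letters C" and us': "us' \<in> lists (letters C)" using us Cons by auto
    have "lin_on (smul C) s (grade C p) (\<lambda>x. spl (us' @ (p, x) # vs) (\<lambda>u v. hat f v (\<lambda>W. g (apply_deg 0 f (a # u) # W))))"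
    proof (rule lin_on_spl_letter[OF s us' vs])
      fix u v w assume *: "u \<in> lists (letters C)" "v \<in> lists (letters C)" "w \<in> lists (letters C)" "length u + length v + length w = length us' + length vs"
      show "lin_on (smul C) s (grade C p) (\<lambda>x. hat f w (\<lambda>W. g (apply_deg 0 f (a # u @ (p, x) # v) # W)))"
        by (intro lin_on_hat[OF s f(1)]) (use * a lin_on_apply_deg[OF f g, of "a # u" v] in auto)
      show "lin_on (smul C) s (grade C p) (\<lambda>x. hat f (v @ (p, x) # w) (\<lambda>W. g (apply_deg 0 f (a # u) # W)))"
        by (intro less.hyps multilin_Cons[OF g] apply_deg_letters[OF f(1)]) (use * a Cons in auto)
    qed
    then show ?thesis by (simp add: Cons)
  qed
qed

lemma symm_sg_deg:
  assumes "symm C g"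
  shows "symm C (\<lambda>u. sg (c * total_deg u) (g u))"
  unfolding symm_def
proof (intro ballI)
  fix us vs a b assume *: "us \<in> lists (letters C)" "vs \<in> lists (letters C)" "a \<in> letters C" "b \<in> letters C"
  have "total_deg (us @ a # b # vs) = total_deg (us @ b # a # vs)" by simp
  then show "sg (c * total_deg (us @ a # b # vs)) (g (us @ a # b # vs)) =
    sg (fst a * fst b) (sg (c * total_deg (us @ b # a # vs)) (g (us @ b # a # vs)))"
    unfolding symmD[OF assms *] by (simp only: sg_sg add.commute)
qed

lemma symm_sg:
  assumes "symm C g"
  shows "symm C (\<lambda>u. sg c (g u))"
  unfolding symm_def
proof (intro ballI)
  fix us vs a b assume *: "us \<in> lists (letters C)" "vs \<in> lists (letters C)" "a \<in> letters C" "b \<in> letters C"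
  show "sg c (g (us @ a # b # vs)) = sg (fst a * fst b) (sg c (g (us @ b # a # vs)))"
    unfolding symmD[OF assms *] by (simp only: sg_sg add.commute)
qed

text \<open>If the two neighbours land on the same side, symmetry of \<open>\<phi>\<close> in that
  argument applies. If they are separated, the two terms correspond under the swap, and the sign is
  the one for passing each other.\<close>

lemma spl_symm:
  assumes us: "us \<in> lists (letters C)" and vs: "vs \<in> lists (letters C)" and a: "a \<in> letters C" and b: "b \<in> letters C"
    and h1: "\<And>v. v \<in> lists (letters C) \<Longrightarrow> symm C (\<lambda>u. \<phi> u v)" and h2: "\<And>u. u \<in> lists (letters C) \<Longrightarrow> symm C (\<lambda>v. \<phi> u v)"
  shows "spl (us @ a # b # vs) \<phi> = sg (fst a * fst b) (spl (us @ b # a # vs) \<phi>)"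
  using us h1 h2
proof (induction us arbitrary: \<phi> rule: list.induct)
  case Nil
  let ?ab = "fst a * fst b"
  have 1: "spl vs (\<lambda>u v. \<phi> (a # b # u) v) = sg ?ab (spl vs (\<lambda>u v. \<phi> (b # a # u) v))"
    unfolding spl_sg[symmetric] by (intro spl_cong_lists[OF vs] symm_head[OF Nil(2)] a b)
  have 2: "spl vs (\<lambda>u v. sg ((fst a + fst b) * total_deg u) (\<phi> u (a # b # v))) = sg ?ab (spl vs (\<lambda>u v. sg ((fst a + fst b) * total_deg u) (\<phi> u (b # a # v))))"
    unfolding spl_sg[symmetric]
  proof (intro spl_cong_lists[OF vs])
    fix u v assume "u \<in> lists (letters C)" "v \<in> lists (letters C)"
    from symm_head[OF Nil(3)[OF this(1)] this(2) a b]
    show "sg ((fst a + fst b) * total_deg u) (\<phi> u (a # b # v)) = sg ?ab (sg ((fst a + fst b) * total_deg u) (\<phi> u (b # a # v)))"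
      by (simp only: sg_sg add.commute)
  qed
  show ?case
    using 1 2 by (simp add: spl_add spl_sg[symmetric] sg_sg sg_add algebra_simps) (simp add: sg_def)
next
  case (Cons c us)
  have c: "c \<in> letters C" and us: "us \<in> lists (letters C)" using Cons.prems by auto
  have "spl (us @ a # b # vs) (\<lambda>u v. \<phi> (c # u) v) = sg (fst a * fst b) (spl (us @ b # a # vs) (\<lambda>u v. \<phi> (c # u) v))"
  proof (rule Cons.IH[OF us])
    fix v assume "v \<in> lists (letters C)"
    then show "symm C (\<lambda>u. \<phi> (c # u) v)"
      by (intro symm_Cons[where g = "\<lambda>u. \<phi> u v"] Cons.prems c)
  next
    fix u assume "u \<in> lists (letters C)"
    then show "symm C (\<phi> (c # u))"
      by (intro Cons.prems) (use c in auto)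
  qed
  moreover have "spl (us @ a # b # vs) (\<lambda>u v. sg (fst c * total_deg u) (\<phi> u (c # v))) = sg (fst a * fst b) (spl (us @ b # a # vs) (\<lambda>u v. sg (fst c * total_deg u) (\<phi> u (c # v))))"
  proof (rule Cons.IH[OF us])
    fix v assume "v \<in> lists (letters C)"
    then show "symm C (\<lambda>u. sg (fst c * total_deg u) (\<phi> u (c # v)))"
      by (intro symm_sg_deg Cons.prems) (use c in auto)
  next
    fix u assume "u \<in> lists (letters C)"
    then show "symm C (\<lambda>v. sg (fst c * total_deg u) (\<phi> u (c # v)))"
      by (intro symm_sg symm_Cons[OF Cons.prems(3)] c)
  qed
  ultimately show ?case by (simp add: sg_add)
qed

lemma symm_apply_deg:
  assumes f: "degmap d C C' f" "symm C f" and g: "hom_on (grade C' (total_deg us + (fst a + (fst b + total_deg vs)) + d)) (\<lambda>x. g (total_deg us + (fst a + (fst b + total_deg vs)) + d, x))"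
    and *: "us \<in> lists (letters C)" "vs \<in> lists (letters C)" "a \<in> letters C" "b \<in> letters C"
  shows "g (apply_deg d f (us @ a # b # vs)) = sg (fst a * fst b) (g (apply_deg d f (us @ b # a # vs)))"
proof -
  have d: "total_deg (us @ a # b # vs) = total_deg us + (fst a + (fst b + total_deg vs))"
    "total_deg (us @ b # a # vs) = total_deg us + (fst a + (fst b + total_deg vs))" by auto
  have "f (us @ b # a # vs) \<in> grade C' (total_deg us + (fst a + (fst b + total_deg vs)) + d)"
    using degmapD[OF f(1), of "us @ b # a # vs"] * unfolding d by simp
  from hom_onD(8)[OF g this] show ?thesis
    unfolding apply_deg_def d symmD[OF f(2) *] .
qed

lemma hom_on_ordt:
  assumes f: "degmap 0 C C' f" and as: "as \<in> lists (letters C)"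
    and h: "\<And>W. W \<in> lists (letters C') \<Longrightarrow> hom_on G (\<lambda>s. \<phi> s W)"
  shows "hom_on G (\<lambda>s. ordt f t as (\<phi> s))"
proof -
  have "ordt f t as (\<phi> (x + y)) = ordt f t as (\<phi> x) + ordt f t as (\<phi> y)" if "x \<in> G" "y \<in> G" for x y
    unfolding ordt_add[symmetric] by (intro ordt_cong[OF f as] hom_onD(4)[OF h] that)
  then show ?thesis using h[of "[]"] by (auto simp: hom_on_def)
qed

lemma ordt_symm:
  assumes f: "degmap 0 C C' f" "symm C f" and g: "multihom C' g"
  shows "symm C (\<lambda>as. ordt f t as g)"
  using g
proof (induction t arbitrary: g)
  case 0
  then show ?case by (simp add: symm_def)
next
  case (Suc t)
  let ?\<phi> = "\<lambda>u v. if u = [] then 0 else ordt f t v (\<lambda>w. g (apply_deg 0 f u # w))"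
  show ?case
    unfolding symm_def ordt.simps
  proof (intro ballI spl_symm)
    fix v assume v: "v \<in> lists (letters C)"
    show "symm C (\<lambda>u. ?\<phi> u v)"
      unfolding symm_def
    proof (intro ballI)
      fix us vs a b assume *: "us \<in> lists (letters C)" "vs \<in> lists (letters C)" "a \<in> letters C" "b \<in> letters C"
      have "ordt f t v (\<lambda>w. g (apply_deg 0 f (us @ a # b # vs) # w)) = sg (fst a * fst b) (ordt f t v (\<lambda>w. g (apply_deg 0 f (us @ b # a # vs) # w)))"
        by (rule symm_apply_deg[where g = "\<lambda>x. ordt f t v (\<lambda>w. g (x # w))", OF f _ *])
           (intro hom_on_ordt[OF f(1) v] multihom_head[OF Suc.prems])
      then show "?\<phi> (us @ a # b # vs) v = sg (fst a * fst b) (?\<phi> (us @ b # a # vs) v)" by simp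
    qed
  next
    fix u assume u: "u \<in> lists (letters C)"
    show "symm C (\<lambda>v. ?\<phi> u v)"
    proof (cases "u = []")
      case True
      then show ?thesis by (simp add: symm_def)
    next
      case False
      then show ?thesis
        using Suc.IH[OF multihom_Cons[OF Suc.prems apply_deg_letters[OF f(1) u False]]] by simp
    qed
  qed auto
qed

text \<open>The recursion of \<open>hat\<close> singles out the first letter and so hides the
  symmetry. The sum over ordered partitions shows it term by term, and \<open>hat_ordt\<close>
  transfers it.\<close>

lemma hat_symm:
  fixes s :: "'k::field_char_0 \<Rightarrow> 'u \<Rightarrow> 'u::ab_group_add" and g :: "(int \<times> 'w::ab_group_add) list \<Rightarrow> 'u"
  assumes s: "vector_space s" and f: "degmap 0 C C' f" "symm C f" and g: "multihom C' g" "symm C' g"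
  shows "symm C (\<lambda>as. hat f as g)"
  unfolding symm_def
proof (intro ballI)
  fix us vs a b assume *: "us \<in> lists (letters C)" "vs \<in> lists (letters C)" "a \<in> letters C" "b \<in> letters C"
  have e: "ordt f t (us @ a # b # vs) g = sg (fst a * fst b) (ordt f t (us @ b # a # vs) g)" for t
    by (rule symmD[OF ordt_symm[OF f g(1)] *])
  have L: "us @ a # b # vs \<in> lists (letters C)" "us @ b # a # vs \<in> lists (letters C)" using * by auto
  show "hat f (us @ a # b # vs) g = sg (fst a * fst b) (hat f (us @ b # a # vs) g)"
    unfolding hat_ordt[OF s f(1) L(1) g(2)] hat_ordt[OF s f(1) L(2) g(2)] e vs_simps(11)[OF s] sg_sum[symmetric]
    by simp
qed

lemma subspace_simps:
  assumes "graded_space C"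
  shows "vector_space (smul C)" "0 \<in> grade C p" "x \<in> grade C p \<Longrightarrow> y \<in> grade C p \<Longrightarrow> x + y \<in> grade C p"
    "x \<in> grade C p \<Longrightarrow> smul C c x \<in> grade C p" "x \<in> grade C p \<Longrightarrow> - x \<in> grade C p"
    "x \<in> grade C p \<Longrightarrow> y \<in> grade C p \<Longrightarrow> x - y \<in> grade C p"
    "x \<in> grade C p \<Longrightarrow> sg n x \<in> grade C p" "hom_on (grade C p) (\<lambda>x. x)" "lin_on (smul C) (smul C) (grade C p) (\<lambda>x. x)"
proof -
  show vs: "vector_space (smul C)" using assms by (simp add: graded_space_def)
  interpret vector_space "smul C" by fact
  have sub: "subspace (grade C p)" for p using assms by (simp add: graded_space_def)
  show "0 \<in> grade C p" "x \<in> grade C p \<Longrightarrow> y \<in> grade C p \<Longrightarrow> x + y \<in> grade C p"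
    "x \<in> grade C p \<Longrightarrow> smul C c x \<in> grade C p" "x \<in> grade C p \<Longrightarrow> - x \<in> grade C p"
    "x \<in> grade C p \<Longrightarrow> y \<in> grade C p \<Longrightarrow> x - y \<in> grade C p"
    "x \<in> grade C p \<Longrightarrow> sg n x \<in> grade C p" "hom_on (grade C p) (\<lambda>x. x)" "lin_on (smul C) (smul C) (grade C p) (\<lambda>x. x)"
    using sub[of p] by (auto simp: subspace_0 subspace_add subspace_scale subspace_neg subspace_diff sg_def hom_on_def lin_on_def)
qed

lemma sym_maps_iff:
  assumes C: "graded_space C" and C': "graded_space C'"
  shows "f \<in> sym_maps d C C' \<longleftrightarrow> degmap d C C' f \<and> multilin C (smul C') f \<and> symm C f"
proof -
  note vs = subspace_simps(1)[OF C']
  have hw: "us @ (p, x) # vs \<in> hwords C \<longleftrightarrow> us \<in> lists (letters C) \<and> vs \<in> lists (letters C) \<and> x \<in> grade C p" for us vs p x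
    by (auto simp: hwords_iff)
  have 1: "(\<forall>as \<in> hwords C. f as \<in> grade C' (total_deg as + d)) \<longleftrightarrow> degmap d C C' f"
    unfolding degmap_def Ball_def hwords_iff by blast
  have 2: "((\<forall>as bs p x y. as @ (p, x) # bs \<in> hwords C \<longrightarrow> as @ (p, y) # bs \<in> hwords C \<longrightarrow>
        f (as @ (p, x + y) # bs) = f (as @ (p, x) # bs) + f (as @ (p, y) # bs)) \<and>
     (\<forall>as bs p x c. as @ (p, x) # bs \<in> hwords C \<longrightarrow>
        f (as @ (p, smul C c x) # bs) = smul C' c (f (as @ (p, x) # bs)))) \<longleftrightarrow> multilin C (smul C') f"
    (is "?A \<and> ?B \<longleftrightarrow> _")
  proof
    assume AB: "?A \<and> ?B"
    then have A: ?A and B: ?B by blast+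
    show "multilin C (smul C') f"
      unfolding multilin_def
    proof (intro ballI allI)
      fix us vs p assume *: "us \<in> lists (letters C)" "vs \<in> lists (letters C)"
      show "lin_on (smul C) (smul C') (grade C p) (\<lambda>x. f (us @ (p, x) # vs))"
        unfolding lin_on_def hom_on_def
        by (intro conjI allI ballI subspace_simps[OF C] A[rule_format] B[rule_format]; simp only: hw * subspace_simps(3)[OF C])
    qed
  next
    assume "multilin C (smul C') f"
    from multilinD[OF this] show "?A \<and> ?B"
      unfolding hw lin_on_def hom_on_def by simp
  qed
  have 3: "(\<forall>as bs p q x y. as @ (p, x) # (q, y) # bs \<in> hwords C \<longrightarrow>
        f (as @ (p, x) # (q, y) # bs) =
          smul C' ((-1) powi (p * q)) (f (as @ (q, y) # (p, x) # bs))) \<longleftrightarrow> symm C f"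
    unfolding hw symm_def vs_sg[OF vs] Ball_def split_paired_All Cons_in_lists_iff letters_iff fst_conv by blast
  show ?thesis
    unfolding sym_maps_def mem_Collect_eq 1 using 2 3 by blast
qed

section \<open>Algebras and morphisms in terms of coderivations\<close>

text \<open>Supplies the hypothesis \<open>two\<close> of \<open>bianchi\<close>, by multiplying
  with 1/2.\<close>

lemma two_torsion_free: "vector_space (s :: 'k::field_char_0 \<Rightarrow> 'u::ab_group_add \<Rightarrow> 'u) \<Longrightarrow> (z :: 'u) = - z \<Longrightarrow> z = 0"
proof -
  assume s: "vector_space s" and z: "z = - z"
  have "s 2 z = z + z" using vs_simps(6)[OF s, of 1 1 z] by (simp add: vs_simps[OF s])
  also have "\<dots> = 0" using z by (metis add.right_inverse)
  finally have "s (1 / 2 * 2) z = 0" unfolding vs_simps(9)[OF s, symmetric] by (simp add: vs_simps[OF s])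
  then show "z = 0" by (simp add: vs_simps[OF s])
qed

definition smaps ::
  "int \<Rightarrow> ('k::field_char_0, 'v::ab_group_add) linf \<Rightarrow> ('k, 'w::ab_group_add) linf \<Rightarrow> ((int \<times> 'v) list \<Rightarrow> 'w) \<Rightarrow> bool" where
  "smaps d C C' f \<longleftrightarrow> degmap d C C' f \<and> multilin C (smul C') f \<and> symm C f"

lemma smapsD:
  assumes "smaps d C C' f"
  shows "degmap d C C' f" "multilin C (smul C') f" "symm C f" "multihom C f"
  using assms multilin_multihom by (auto simp: smaps_def)

lemma sym_maps_eq_smaps: "graded_space C \<Longrightarrow> graded_space C' \<Longrightarrow> f \<in> sym_maps d C C' \<longleftrightarrow> smaps d C C' f"
  by (simp add: sym_maps_iff smaps_def)

lemma smaps_mem: "smaps d C C' f \<Longrightarrow> as \<in> lists (letters C) \<Longrightarrow> as \<noteq> [] \<Longrightarrow> f as \<in> grade C' (total_deg as + d)"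
  unfolding smaps_def using degmapD by blast

lemma smaps_head:
  "smaps d C C' f \<Longrightarrow> vs \<in> lists (letters C) \<Longrightarrow> lin_on (smul C) (smul C') (grade C p) (\<lambda>x. f ((p, x) # vs))"
  by (simp add: smaps_def multilin_head)

definition is_linf :: "('k::field_char_0, 'v::ab_group_add) linf \<Rightarrow> bool" where
  "is_linf C \<longleftrightarrow> graded_space C \<and> smaps 1 C C (brk C) \<and> (\<forall>as \<in> lists (letters C). coder (brk C) as (brk C) = 0)"

lemma linf_algebra_iff: "linf_algebra C \<longleftrightarrow> is_linf C"
proof -
  have "coder (brk C) [] (brk C) = 0" by (simp add: coder_def)
  then have "(\<forall>as\<in>hwords C. coder (brk C) as (brk C) = 0) \<longleftrightarrow> (\<forall>as \<in> lists (letters C). coder (brk C) as (brk C) = 0)"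
    unfolding Ball_def hwords_iff by metis
  then show ?thesis
    unfolding linf_algebra_def is_linf_def
    using sym_maps_eq_smaps[of C C] insert_brk_coder[of C C] subspace_simps(1)[of C] by auto
qed

lemma is_linfD:
  assumes "is_linf C"
  shows "graded_space C" "smaps 1 C C (brk C)" "as \<in> lists (letters C) \<Longrightarrow> coder (brk C) as (brk C) = 0"
    "vector_space (smul C)" "degmap 1 C C (brk C)"
  using assms subspace_simps(1) by (auto simp: is_linf_def smaps_def)

text \<open>The empty word is excluded: there the left side is 0, while the right side is the
  meaningless value \<open>brk C' []\<close>.\<close>

definition is_morph ::
  "('k::field_char_0, 'v::ab_group_add) linf \<Rightarrow> ('k, 'w::ab_group_add) linf \<Rightarrow> ((int \<times> 'v) list \<Rightarrow> 'w) \<Rightarrow> bool" where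
  "is_morph C C' f \<longleftrightarrow> smaps 0 C C' f \<and> (\<forall>as \<in> lists (letters C). as \<noteq> [] \<longrightarrow> coder (brk C) as f = hat f as (brk C'))"

lemma linf_comp_smaps:
  assumes "graded_space C''" "smaps 0 C C' f" "smaps d C' C'' g" "as \<in> lists (letters C)"
  shows "linf_comp C'' g f as = hat f as g"
  by (rule linf_comp_hat) (use assms smapsD subspace_simps(1) in blast)+

lemma linf_morphism_iff:
  assumes C: "is_linf C" and C': "is_linf C'"
  shows "linf_morphism C C' f \<longleftrightarrow> is_morph C C' f"
proof -
  have e: "linf_comp C' (brk C') f as = hat f as (brk C')" if "smaps 0 C C' f" "as \<in> lists (letters C)" for as
    by (rule linf_comp_smaps[OF is_linfD(1)[OF C'] that(1) is_linfD(2)[OF C'] that(2)])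
  show ?thesis
    unfolding linf_morphism_def is_morph_def Ball_def hwords_iff
      sym_maps_eq_smaps[OF is_linfD(1)[OF C] is_linfD(1)[OF C']]
      insert_brk_coder[where C' = C', OF is_linfD(4)[OF C']]
    using e by metis
qed

lemma is_morphD:
  assumes "is_morph C C' f"
  shows "smaps 0 C C' f" "as \<in> lists (letters C) \<Longrightarrow> as \<noteq> [] \<Longrightarrow> coder (brk C) as f = hat f as (brk C')"
  using assms by (auto simp: is_morph_def)

lemma smaps_comp:
  assumes C'': "graded_space C''" and f: "smaps 0 C C' f" and g: "smaps d C' C'' g"
  shows "smaps d C C'' (\<lambda>as. hat f as g)"
  unfolding smaps_def multilin_def
proof (intro conjI ballI allI)
  note s = subspace_simps(1)[OF C'']
  show "degmap d C C'' (\<lambda>as. hat f as g)"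
    by (rule hat_degmap[OF smapsD(1)[OF f] smapsD(1)[OF g] subspace_simps(8)[OF C'']])
  show "symm C (\<lambda>as. hat f as g)"
    by (rule hat_symm[OF s smapsD(1,3)[OF f] smapsD(4,3)[OF g]])
  fix us vs p assume "us \<in> lists (letters C)" "vs \<in> lists (letters C)"
  then show "lin_on (smul C) (smul C'') (grade C p) (\<lambda>x. hat f (us @ (p, x) # vs) g)"
    by (rule multilin_hat[OF s smapsD(1,2)[OF f] smapsD(2)[OF g]])
qed

lemma smaps_coder:
  assumes C: "graded_space C" and C': "graded_space C'" and l: "smaps 1 C C l" and f: "smaps d C C' f"
  shows "smaps (d + 1) C C' (\<lambda>as. coder l as f)"
  unfolding smaps_def multilin_def
proof (intro conjI ballI allI)
  note s = subspace_simps(1)[OF C']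
  let ?\<phi> = "\<lambda>u v. if u = [] then 0 else f (apply_deg 1 l u # v)"
  show "degmap (d + 1) C C' (\<lambda>as. coder l as f)"
    by (rule coder_degmap[OF smapsD(1)[OF l] smapsD(1)[OF f] subspace_simps(8)[OF C']])
  show "symm C (\<lambda>as. coder l as f)"
    unfolding symm_def coder_def
  proof (intro ballI spl_symm)
    fix v assume v: "v \<in> lists (letters C)"
    show "symm C (\<lambda>u. ?\<phi> u v)"
      unfolding symm_def
    proof (intro ballI)
      fix us vs a b assume *: "us \<in> lists (letters C)" "vs \<in> lists (letters C)" "a \<in> letters C" "b \<in> letters C"
      have "f (apply_deg 1 l (us @ a # b # vs) # v) = sg (fst a * fst b) (f (apply_deg 1 l (us @ b # a # vs) # v))"
        by (rule symm_apply_deg[where g = "\<lambda>x. f (x # v)", OF smapsD(1,3)[OF l] _ *])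
           (intro multihom_head[OF smapsD(4)[OF f] v])
      then show "?\<phi> (us @ a # b # vs) v = sg (fst a * fst b) (?\<phi> (us @ b # a # vs) v)" by simp
    qed
  next
    fix u assume u: "u \<in> lists (letters C)"
    show "symm C (\<lambda>v. ?\<phi> u v)"
    proof (cases "u = []")
      case True
      then show ?thesis by (simp add: symm_def)
    next
      case False
      then show ?thesis
        using symm_Cons[OF smapsD(3)[OF f] apply_deg_letters[OF smapsD(1)[OF l] u False]] by simp
    qed
  qed auto
  fix us vs p assume us: "us \<in> lists (letters C)" and vs: "vs \<in> lists (letters C)"
  show "lin_on (smul C) (smul C') (grade C p) (\<lambda>x. coder l (us @ (p, x) # vs) f)"
    unfolding coder_def
  proof (rule lin_on_spl_letter[OF s us vs])
    fix u v w assume *: "u \<in> lists (letters C)" "v \<in> lists (letters C)" "w \<in> lists (letters C)"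
    show "lin_on (smul C) (smul C') (grade C p) (\<lambda>x. ?\<phi> (u @ (p, x) # v) w)"
      using lin_on_apply_deg[OF smapsD(1,2)[OF l] smapsD(2)[OF f] *] by simp
    show "lin_on (smul C) (smul C') (grade C p) (\<lambda>x. ?\<phi> u (v @ (p, x) # w))"
    proof (cases "u = []")
      case True
      then show ?thesis
        using lin_on_const_simps(2)[OF s lin_on_comp[OF subspace_simps(9)[OF C] smaps_head[OF f *(2)]]] by simp
    next
      case False
      then show ?thesis
        using multilinD[OF multilin_Cons[OF smapsD(2)[OF f] apply_deg_letters[OF smapsD(1)[OF l] *(1) False]] *(2,3)] by simp
    qed
  qed
qed

text \<open>A morphism has zero defect, so by \<open>defect_comp\<close> its \<open>hat\<close>
  commutes with the coderivations; the equation then follows from that of \<open>g\<close> and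
  functoriality.\<close>

lemma is_morph_comp:
  assumes C: "is_linf C" and C': "is_linf C'" and C'': "is_linf C''" and f: "is_morph C C' f" and g: "is_morph C' C'' g"
  shows "is_morph C C'' (\<lambda>as. hat f as g)"
  unfolding is_morph_def
proof (intro conjI ballI impI)
  note f' = is_morphD(1)[OF f] and g' = is_morphD(1)[OF g]
  show "smaps 0 C C'' (\<lambda>as. hat f as g)"
    by (rule smaps_comp[OF is_linfD(1)[OF C''] f' g'])
  fix as assume as: "as \<in> lists (letters C)" "as \<noteq> []"
  have "coder (brk C) as (\<lambda>as. hat f as g) - hat f as (\<lambda>W. coder (brk C') W g) = der f (defect (brk C) (brk C') f) as g"
    by (rule defect_comp[OF is_linfD(5)[OF C] is_linfD(5)[OF C'] smapsD(1)[OF f'] as(1) smapsD(4)[OF g'] subspace_simps(8)[OF is_linfD(1)[OF C']]])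
  also have "der f (defect (brk C) (brk C') f) as g = spl as (\<lambda>u v. 0)"
    unfolding der_def
  proof (intro spl_cong_lists[OF as(1)])
    fix u v assume u: "u \<in> lists (letters C)" and v: "v \<in> lists (letters C)"
    have "hat f v (\<lambda>W. g ((total_deg u + 1, 0) # W)) = hat f v (\<lambda>W. 0)"
      by (intro hat_cong[OF smapsD(1)[OF f'] v] hom_onD(2)[OF multihom_head[OF smapsD(4)[OF g']]])
    then show "(if u = [] then 0 else hat f v (\<lambda>W. g (apply_deg 1 (defect (brk C) (brk C') f) u # W))) = 0"
      using is_morphD(2)[OF f u] by (simp add: apply_deg_def defect_def)
  qed
  finally have "coder (brk C) as (\<lambda>as. hat f as g) = hat f as (\<lambda>W. coder (brk C') W g)" by simp
  also have "\<dots> = hat f as (\<lambda>W. hat g W (brk C''))"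
    by (intro hat_cong[OF smapsD(1)[OF f'] as(1)] is_morphD(2)[OF g]) (use as in auto)
  also have "\<dots> = hat (\<lambda>u. hat f u g) as (brk C'')"
    by (rule hat_hat[OF smapsD(1)[OF f'] smapsD(1)[OF g'] as(1) smapsD(4)[OF is_linfD(2)[OF C'']]])
  finally show "coder (brk C) as (\<lambda>as. hat f as g) = hat (\<lambda>u. hat f u g) as (brk C'')" .
qed

section \<open>Strict morphisms and the identity\<close>

definition linear_part :: "((int \<times> 'v) list \<Rightarrow> 'w) \<Rightarrow> int \<times> 'v \<Rightarrow> int \<times> 'w" where
  "linear_part f a = (fst a, f [a])"

lemma linear_part_letters: "degmap 0 C C' f \<Longrightarrow> a \<in> letters C \<Longrightarrow> linear_part f a \<in> letters C'"
  using degmapD[of 0 C C' f "[a]"] by (simp add: linear_part_def)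

text \<open>Only the partition into single letters survives, because any larger block has value
  0.\<close>

lemma hat_strict:
  assumes f: "degmap 0 C C' f" and strict: "\<And>as. as \<in> lists (letters C) \<Longrightarrow> 2 \<le> length as \<Longrightarrow> f as = 0"
    and g: "multihom C' g" and as: "as \<in> lists (letters C)"
  shows "hat f as g = g (map (linear_part f) as)"
  using as g
proof (induction as arbitrary: g rule: list.induct)
  case (Cons a as)
  have a: "a \<in> letters C" and as: "as \<in> lists (letters C)" using Cons.prems by auto
  have L: "linear_part f a \<in> letters C'" by (rule linear_part_letters[OF f a])
  have "hat f (a # as) g = hat f as (\<lambda>W. g (apply_deg 0 f [a] # W))
     + spl as (\<lambda>u v. if u = [] then 0 else hat f v (\<lambda>W. g (apply_deg 0 f (a # u) # W)))"
    unfolding hat.simps by (rule spl_isolate_left)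
  also have "spl as (\<lambda>u v. if u = [] then 0 else hat f v (\<lambda>W. g (apply_deg 0 f (a # u) # W))) = spl as (\<lambda>u v. 0)"
  proof (intro spl_cong_lists[OF as])
    fix u v assume u: "u \<in> lists (letters C)" and v: "v \<in> lists (letters C)"
    have "hat f v (\<lambda>W. g ((total_deg (a # u) + 0, 0) # W)) = hat f v (\<lambda>W. 0)"
      by (intro hat_cong[OF f v] hom_onD(2)[OF multihom_head[OF Cons.prems(2)]])
    moreover have "u \<noteq> [] \<Longrightarrow> f (a # u) = 0"
      using strict[of "a # u"] a u by (cases u) auto
    ultimately show "(if u = [] then 0 else hat f v (\<lambda>W. g (apply_deg 0 f (a # u) # W))) = 0"
      by (simp add: apply_deg_def)
  qed
  also have "hat f as (\<lambda>W. g (apply_deg 0 f [a] # W)) = hat f as (\<lambda>W. g (linear_part f a # W))"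
    by (simp add: apply_deg_def linear_part_def)
  also have "\<dots> = g (linear_part f a # map (linear_part f) as)"
    by (rule Cons.IH[OF as multihom_Cons[OF Cons.prems(2) L]])
  finally show ?case by simp
qed simp

text \<open>Here the outer map is the strict one, so only the partition with a single block
  survives. This reduces composition with an evaluation to applying its linear part.\<close>

lemma hat_into_strict:
  assumes h: "degmap 0 C C' h" and strict: "\<And>as. as \<in> lists (letters C') \<Longrightarrow> 2 \<le> length as \<Longrightarrow> e as = 0"
    and e: "multihom C' e" and as: "as \<in> lists (letters C)" "as \<noteq> []"
  shows "hat h as e = e [(total_deg as, h as)]"
proof -
  obtain a bs where eq: "as = a # bs" using as by (cases as) auto
  have a: "a \<in> letters C" and bs: "bs \<in> lists (letters C)" using as eq by auto
  have "hat h as e = e [apply_deg 0 h (a # bs)] + spl bs (\<lambda>u v. if v = [] then 0 else hat h v (\<lambda>W. e (apply_deg 0 h (a # u) # W)))"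
    unfolding eq hat.simps by (subst spl_isolate_right) simp
  also have "spl bs (\<lambda>u v. if v = [] then 0 else hat h v (\<lambda>W. e (apply_deg 0 h (a # u) # W))) = spl bs (\<lambda>u v. 0)"
  proof (intro spl_cong_lists[OF bs])
    fix u v assume u: "u \<in> lists (letters C)" and v: "v \<in> lists (letters C)"
    have "apply_deg 0 h (a # u) \<in> letters C'" using a u by (intro apply_deg_letters[OF h]) auto
    then have "hat h v (\<lambda>W. e (apply_deg 0 h (a # u) # W)) = hat h v (\<lambda>W. 0)" if "v \<noteq> []"
      using that by (intro hat_cong[OF h v] strict) (auto simp: neq_Nil_conv)
    then show "(if v = [] then 0 else hat h v (\<lambda>W. e (apply_deg 0 h (a # u) # W))) = 0" by simp
  qed
  finally show ?thesis by (simp add: eq apply_deg_def)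
qed

lemma smaps_linf_id:
  fixes C :: "('k::field_char_0, 'v::ab_group_add) linf"
  assumes C: "graded_space C"
  shows "smaps 0 C C linf_id"
proof -
  have 1: "linf_id (us @ a # b # vs) = 0" for us vs :: "(int \<times> 'v) list" and a b
    unfolding linf_id_def by (cases us; cases "tl us") auto
  have 2: "us \<noteq> [] \<or> vs \<noteq> [] \<Longrightarrow> linf_id (us @ (p, x) # vs) = 0" for us vs :: "(int \<times> 'v) list" and p x
    unfolding linf_id_def by (cases us; cases "tl us"; cases vs) auto
  have 3: "linf_id [(p, x)] = x" for p and x :: 'v
    by (simp add: linf_id_def)
  have "multilin C (smul C) linf_id"
    unfolding multilin_def
  proof (intro ballI allI)
    fix us vs p
    show "lin_on (smul C) (smul C) (grade C p) (\<lambda>x. linf_id (us @ (p, x) # vs))"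
    proof (cases "us = [] \<and> vs = []")
      case True
      then show ?thesis by (simp add: 3 subspace_simps(9)[OF C])
    next
      case False
      then show ?thesis
        using 2 lin_on_const_simps(2)[OF subspace_simps(1)[OF C] subspace_simps(9)[OF C]] by simp
    qed
  qed
  moreover have "degmap 0 C C linf_id"
    unfolding degmap_def linf_id_def using subspace_simps(2)[OF C] by (auto split: list.split)
  ultimately show ?thesis
    by (simp add: smaps_def symm_def 1)
qed

lemma linf_id_long: "2 \<le> length as \<Longrightarrow> linf_id as = 0"
  by (auto simp: linf_id_def split: list.split)

lemma linf_id_single [simp]: "linf_id [(p, x)] = x" "linf_id [a] = snd a"
  by (auto simp: linf_id_def split: prod.split)

lemma hat_linf_id:
  assumes C: "graded_space C" and g: "multihom C g" and as: "as \<in> lists (letters C)"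
  shows "hat linf_id as g = g as"
proof -
  have "map (linear_part linf_id) as = as"
    by (rule map_idI) (simp add: linear_part_def)
  then show ?thesis
    using hat_strict[OF smapsD(1)[OF smaps_linf_id[OF C]] linf_id_long g as] by simp
qed

lemma hat_into_linf_id:
  assumes h: "degmap 0 C C' h" and C': "graded_space C'" and as: "as \<in> lists (letters C)" "as \<noteq> []"
  shows "hat h as linf_id = h as"
  using hat_into_strict[OF h linf_id_long smapsD(4)[OF smaps_linf_id[OF C']] as] by simp

lemma coder_into_strict:
  assumes l: "degmap 1 C C l" and as: "as \<in> lists (letters C)" "as \<noteq> []"
    and strict: "\<And>as. as \<in> lists (letters C) \<Longrightarrow> 2 \<le> length as \<Longrightarrow> e as = 0"
  shows "coder l as e = e [(total_deg as + 1, l as)]"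
proof -
  have "coder l as e = e [apply_deg 1 l as] + spl as (\<lambda>u v. if v = [] then 0 else if u = [] then 0 else e (apply_deg 1 l u # v))"
    unfolding coder_def using as(2) by (subst spl_isolate_right) simp
  also have "spl as (\<lambda>u v. if v = [] then 0 else if u = [] then 0 else e (apply_deg 1 l u # v)) = spl as (\<lambda>u v. 0)"
  proof (intro spl_cong_lists[OF as(1)])
    fix u v assume u: "u \<in> lists (letters C)" and v: "v \<in> lists (letters C)"
    have "u \<noteq> [] \<Longrightarrow> v \<noteq> [] \<Longrightarrow> e (apply_deg 1 l u # v) = 0"
      using apply_deg_letters[OF l u] v by (intro strict) (auto simp: neq_Nil_conv)
    then show "(if v = [] then 0 else if u = [] then 0 else e (apply_deg 1 l u # v)) = 0" by simp
  qed
  finally show ?thesis by (simp add: apply_deg_def)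
qed

lemma is_morph_strictI:
  assumes C: "is_linf C" and C': "is_linf C'" and f: "smaps 0 C C' f"
    and strict: "\<And>as. as \<in> lists (letters C) \<Longrightarrow> 2 \<le> length as \<Longrightarrow> f as = 0"
    and brk: "\<And>as. as \<in> lists (letters C) \<Longrightarrow> as \<noteq> [] \<Longrightarrow> f [(total_deg as + 1, brk C as)] = brk C' (map (linear_part f) as)"
  shows "is_morph C C' f"
  unfolding is_morph_def
proof (intro conjI ballI impI f)
  fix as assume as: "as \<in> lists (letters C)" "as \<noteq> []"
  show "coder (brk C) as f = hat f as (brk C')"
    using coder_into_strict[OF is_linfD(5)[OF C] as strict] brk[OF as]
      hat_strict[OF smapsD(1)[OF f] strict smapsD(4)[OF is_linfD(2)[OF C']] as(1)] by simp
qed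

lemma is_morph_linf_id:
  assumes C: "is_linf C"
  shows "is_morph C C linf_id"
proof (rule is_morph_strictI[OF C C smaps_linf_id[OF is_linfD(1)[OF C]] linf_id_long])
  fix as assume "as \<in> lists (letters C)"
  have "map (linear_part linf_id) as = as"
    by (rule map_idI) (simp add: linear_part_def)
  then show "linf_id [(total_deg as + 1, brk C as)] = brk C (map (linear_part linf_id) as)" by simp
qed

section \<open>Adjoining \<open>dt\<close>\<close>

lemma spl_map:
  assumes "\<And>a. fst (r a) = fst a"
  shows "spl (map r as) \<phi> = spl as (\<lambda>u v. \<phi> (map r u) (map r v))"
proof (induction as arbitrary: \<phi>)
  case (Cons a as)
  have "total_deg (map r u) = total_deg u" for u
    using assms by (simp add: total_deg_def o_def)
  with Cons show ?case by (simp add: assms)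
qed simp

lemma total_deg_map: "(\<And>a. fst (r a) = fst a) \<Longrightarrow> total_deg (map r u) = total_deg u"
  by (simp add: total_deg_def o_def)

text \<open>Naturality under a change of letters that keeps degrees. It serves the letterwise
  projections \<open>m0\<close> and \<open>n1\<close> and the evaluations \<open>ev n\<close>; the
  projection \<open>m1\<close> shifts degrees and is handled through \<open>ins\<close>.\<close>

lemma hat_map:
  assumes r: "\<And>a. fst (r a) = fst a" and r': "\<And>a. fst (r' a) = fst a"
    and f: "\<And>p u. r' (p, f u) = (p, f' (map r u))"
  shows "hat f as (\<lambda>W. \<phi> (map r' W)) = hat f' (map r as) \<phi>"
proof (induction "length as" arbitrary: as \<phi> rule: less_induct)
  case less
  show ?case
  proof (cases as)
    case (Cons a bs)
    have "hat f v (\<lambda>W. \<phi> (map r' (apply_deg 0 f (a # u) # W))) = hat f' (map r v) (\<lambda>W. \<phi> (apply_deg 0 f' (r a # map r u) # W))"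
      if "length u + length v = length bs" for u v
    proof -
      have "r' (apply_deg 0 f (a # u)) = apply_deg 0 f' (r a # map r u)"
        by (simp add: apply_deg_def f r total_deg_map[OF r])
      then show ?thesis
        using less.hyps[of v "\<lambda>W. \<phi> (apply_deg 0 f' (r a # map r u) # W)"] that Cons by simp
    qed
    then show ?thesis
      unfolding Cons hat.simps list.map spl_map[OF r] by (intro spl_cong) auto
  qed simp
qed

lemma coder_map:
  assumes r: "\<And>a. fst (r a) = fst a" and l: "\<And>p u. r (p, l u) = (p, l' (map r u))"
  shows "coder l as (\<lambda>W. \<phi> (map r W)) = coder l' (map r as) \<phi>"
  unfolding coder_def spl_map[OF r]
  by (intro spl_cong) (auto simp: apply_deg_def l total_deg_map[OF r])

text \<open>The extension of \<open>D\<close> to words by the Leibniz rule. There is no sign because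
  \<open>D\<close> has degree 0.\<close>

fun dsum :: "(int \<Rightarrow> 'v \<Rightarrow> 'v) \<Rightarrow> (int \<times> 'v) list \<Rightarrow> ((int \<times> 'v) list \<Rightarrow> 'u::ab_group_add) \<Rightarrow> 'u" where
  "dsum D [] \<phi> = 0"
| "dsum D (a # as) \<phi> = \<phi> ((fst a, D (fst a) (snd a)) # as) + dsum D as (\<lambda>w. \<phi> (a # w))"

text \<open>By symmetry the differentiated letter can be moved to the front, which turns the Leibniz
  sum into a sum over splittings with a single letter on the left. In this form it meets the unary
  part of \<open>coder\<close>.\<close>

lemma dsum_spl:
  assumes D: "\<And>p x. x \<in> grade C p \<Longrightarrow> D p x \<in> grade C p" and \<phi>: "symm C \<phi>" and as: "as \<in> lists (letters C)"
  shows "dsum D as \<phi> = spl as (\<lambda>u v. case u of [a] \<Rightarrow> \<phi> ((fst a, D (fst a) (snd a)) # v) | _ \<Rightarrow> 0)"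
  using as \<phi>
proof (induction as arbitrary: \<phi> rule: list.induct)
  case (Cons a as)
  have a: "a \<in> letters C" and as: "as \<in> lists (letters C)" using Cons.prems by auto
  have "spl as (\<lambda>u v. case a # u of [a] \<Rightarrow> \<phi> ((fst a, D (fst a) (snd a)) # v) | _ \<Rightarrow> 0)
    = \<phi> ((fst a, D (fst a) (snd a)) # as) + spl as (\<lambda>u v. if u = [] then 0 else case a # u of [a] \<Rightarrow> \<phi> ((fst a, D (fst a) (snd a)) # v) | _ \<Rightarrow> 0)"
    by (subst spl_isolate_left) simp
  also have "spl as (\<lambda>u v. if u = [] then 0 else case a # u of [a] \<Rightarrow> \<phi> ((fst a, D (fst a) (snd a)) # v) | _ \<Rightarrow> 0) = spl as (\<lambda>u v. 0)"
    by (intro spl_cong) (auto split: list.split)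
  finally have 1: "spl as (\<lambda>u v. case a # u of [a] \<Rightarrow> \<phi> ((fst a, D (fst a) (snd a)) # v) | _ \<Rightarrow> 0) = \<phi> ((fst a, D (fst a) (snd a)) # as)"
    by simp
  have "dsum D as (\<lambda>w. \<phi> (a # w)) = spl as (\<lambda>u v. case u of [b] \<Rightarrow> \<phi> (a # (fst b, D (fst b) (snd b)) # v) | _ \<Rightarrow> 0)"
    by (rule Cons.IH[OF as symm_Cons[OF Cons.prems(2) a]])
  also have "\<dots> = spl as (\<lambda>u v. sg (fst a * total_deg u) (case u of [b] \<Rightarrow> \<phi> ((fst b, D (fst b) (snd b)) # a # v) | _ \<Rightarrow> 0))"
  proof (intro spl_cong_lists[OF as])
    fix u v assume u: "u \<in> lists (letters C)" and v: "v \<in> lists (letters C)"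
    show "(case u of [b] \<Rightarrow> \<phi> (a # (fst b, D (fst b) (snd b)) # v) | _ \<Rightarrow> 0)
      = sg (fst a * total_deg u) (case u of [b] \<Rightarrow> \<phi> ((fst b, D (fst b) (snd b)) # a # v) | _ \<Rightarrow> 0)"
    proof (cases "\<exists>b. u = [b]")
      case True
      then obtain b where ub: "u = [b]" by blast
      then have "(fst b, D (fst b) (snd b)) \<in> letters C" using u D by (cases b) auto
      from symm_head[OF Cons.prems(2) v a this] show ?thesis by (simp add: ub)
    qed (auto split: list.split)
  qed
  finally show ?case using 1 by simp
qed simp

text \<open>
  Models of \<open>\<Delta>\<^sup>1 \<times> C\<close> must live in a type of sequences, so pairs of sequences are interleaved.
\<close>

definition q0 :: "(nat \<Rightarrow> 'w) \<Rightarrow> nat \<Rightarrow> 'w" where "q0 z = (\<lambda>n. z (2 * n))"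

definition q1 :: "(nat \<Rightarrow> 'w) \<Rightarrow> nat \<Rightarrow> 'w" where "q1 z = (\<lambda>n. z (2 * n + 1))"

definition mk :: "(nat \<Rightarrow> 'w) \<Rightarrow> (nat \<Rightarrow> 'w) \<Rightarrow> nat \<Rightarrow> 'w" where
  "mk y w = (\<lambda>n. if even n then y (n div 2) else w (n div 2))"

lemma q_mk [simp]: "q0 (mk y w) = y" "q1 (mk y w) = w"
  by (auto simp: q0_def q1_def mk_def)

lemma mk_q: "mk (q0 z) (q1 z) = z"
  by (auto simp: q0_def q1_def mk_def fun_eq_iff)

lemma q_eqI: "q0 y = q0 z \<Longrightarrow> q1 y = q1 z \<Longrightarrow> y = z"
  by (metis mk_q)

lemma q_add [simp]:
  fixes y z :: "nat \<Rightarrow> 'w::ab_group_add"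
  shows "q0 (y + z) = q0 y + q0 z" "q1 (y + z) = q1 y + q1 z" "q0 0 = (0 :: nat \<Rightarrow> 'w)" "q1 0 = (0 :: nat \<Rightarrow> 'w)"
    "q0 (- y) = - q0 y" "q1 (- y) = - q1 y" "q0 (y - z) = q0 y - q0 z" "q1 (y - z) = q1 y - q1 z"
  by (auto simp: q0_def q1_def fun_eq_iff)

lemma hom_on_q: "hom_on UNIV (q0 :: (nat \<Rightarrow> 'w::ab_group_add) \<Rightarrow> _)" "hom_on UNIV (q1 :: (nat \<Rightarrow> 'w::ab_group_add) \<Rightarrow> _)"
  by (auto simp: hom_on_def)

definition m0 :: "int \<times> (nat \<Rightarrow> 'w) \<Rightarrow> int \<times> (nat \<Rightarrow> 'w)" where "m0 a = (fst a, q0 (snd a))"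

text \<open>The coefficient of dt sits one degree lower, as dt has degree 1.\<close>

definition m1 :: "int \<times> (nat \<Rightarrow> 'w) \<Rightarrow> int \<times> (nat \<Rightarrow> 'w)" where "m1 a = (fst a - 1, q1 (snd a))"

lemma m_simps [simp]: "fst (m0 a) = fst a" "fst (m1 a) = fst a - 1" "m0 (p, z) = (p, q0 z)" "m1 (p, z) = (p - 1, q1 z)"
  by (auto simp: m0_def m1_def)

lemma total_deg_m0 [simp]: "total_deg (map m0 u) = total_deg u"
  by (rule total_deg_map) simp

text \<open>
  For letters \<open>y\<^sub>i + dt w\<^sub>i\<close>, the operation \<open>ins\<close> computes the coefficient of \<open>dt\<close>, moved to the front, of
  the product: one letter is replaced by its \<open>dt\<close>-part.
\<close>

fun ins :: "(int \<times> (nat \<Rightarrow> 'w)) list \<Rightarrow> ((int \<times> (nat \<Rightarrow> 'w)) list \<Rightarrow> 'u::ab_group_add) \<Rightarrow> 'u" where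
  "ins [] \<phi> = 0"
| "ins (a # zs) \<phi> = \<phi> (m1 a # map m0 zs) + sg (fst a) (ins zs (\<lambda>w. \<phi> (m0 a # w)))"

lemma ins_add: "ins zs (\<lambda>w. \<phi> w + \<psi> w) = ins zs \<phi> + ins zs \<psi>"
  by (induction zs arbitrary: \<phi> \<psi>) (simp_all add: sg_add)

lemma ins_minus: "ins zs (\<lambda>w. - \<phi> w) = - ins zs \<phi>"
  by (induction zs arbitrary: \<phi>) (simp_all add: sg_minus)

lemma ins_sg: "ins zs (\<lambda>w. sg n (\<phi> w)) = sg n (ins zs \<phi>)"
  by (cases "even n") (simp_all add: sg_def ins_minus)

lemma ins_zero [simp]: "ins zs (\<lambda>w. 0) = 0"
  by (induction zs) simp_all

lemma ins_cong:
  assumes "\<And>w. total_deg w = total_deg zs - 1 \<Longrightarrow> length w = length zs \<Longrightarrow> \<phi> w = \<psi> w"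
  shows "ins zs \<phi> = ins zs \<psi>"
  using assms
proof (induction zs arbitrary: \<phi> \<psi>)
  case (Cons a zs)
  have "ins zs (\<lambda>w. \<phi> (m0 a # w)) = ins zs (\<lambda>w. \<psi> (m0 a # w))"
    by (rule Cons.IH) (use Cons.prems in auto)
  then show ?case using Cons.prems[of "m1 a # map m0 zs"] by simp
qed simp

text \<open>The letter that supplies dt lies in exactly one of the two subwords. If it lies in the
  right one, bringing dt to the front passes the whole left subword.\<close>

lemma ins_spl:
  fixes \<phi> :: "(int \<times> (nat \<Rightarrow> 'w)) list \<Rightarrow> (int \<times> (nat \<Rightarrow> 'w)) list \<Rightarrow> 'u::ab_group_add"
  shows "ins zs (\<lambda>w. spl w \<phi>) = spl zs (\<lambda>u v. ins u (\<lambda>x. \<phi> x (map m0 v)) + sg (total_deg u) (ins v (\<lambda>y. \<phi> (map m0 u) y)))"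
proof (induction zs arbitrary: \<phi>)
  case (Cons a zs)
  let ?p = "fst a"
  have 1: "ins u (\<lambda>x. sg (?p * total_deg x) (\<phi> x (m0 a # map m0 v))) = sg (?p * (total_deg u - 1)) (ins u (\<lambda>x. \<phi> x (m0 a # map m0 v)))" for u v
    unfolding ins_sg[symmetric] by (rule ins_cong) simp
  have "ins (a # zs) (\<lambda>w. spl w \<phi>)
    = spl zs (\<lambda>u v. \<phi> (m1 a # map m0 u) (map m0 v)) + spl zs (\<lambda>u v. sg ((?p - 1) * total_deg u) (\<phi> (map m0 u) (m1 a # map m0 v)))
     + sg ?p (ins zs (\<lambda>w. spl w (\<lambda>u v. \<phi> (m0 a # u) v)) + ins zs (\<lambda>w. spl w (\<lambda>u v. sg (?p * total_deg u) (\<phi> u (m0 a # v)))))"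
    by (simp add: spl_map[where r = m0] ins_add)
  also have "\<dots> = spl zs (\<lambda>u v. \<phi> (m1 a # map m0 u) (map m0 v)
       + sg ((?p - 1) * total_deg u) (\<phi> (map m0 u) (m1 a # map m0 v))
       + sg ?p (ins u (\<lambda>x. \<phi> (m0 a # x) (map m0 v)) + sg (total_deg u) (ins v (\<lambda>y. \<phi> (m0 a # map m0 u) y))
       + (sg (?p * (total_deg u - 1)) (ins u (\<lambda>x. \<phi> x (m0 a # map m0 v))) + sg (total_deg u) (sg (?p * total_deg u) (ins v (\<lambda>y. \<phi> (map m0 u) (m0 a # y)))))))"
    unfolding Cons.IH spl_add[symmetric] spl_sg[symmetric] 1 ins_sg total_deg_m0 by simp
  also have "\<dots> = spl (a # zs) (\<lambda>u v. ins u (\<lambda>x. \<phi> x (map m0 v)) + sg (total_deg u) (ins v (\<lambda>y. \<phi> (map m0 u) y)))"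
  proof -
    have 2: "sg ((?p - 1) * total_deg u) x = sg (?p * total_deg u + total_deg u) x" for u and x :: 'u
      by (rule sg_parity) (simp add: algebra_simps)
    have 3: "sg (?p + ?p * (total_deg u - 1)) x = sg (?p * total_deg u) x" for u and x :: 'u
      by (rule sg_parity) (simp add: algebra_simps)
    show ?thesis
      by (simp add: sg_add sg_sg 2 3 spl_add add_ac)
  qed
  finally show ?case .
qed simp

text \<open>
  \<open>N \<oplus> dt N\<close>, the pair \<open>(y, w)\<close> standing for \<open>y + dt w\<close>, with the derivation \<open>dt D\<close> added to the
  differential; the brackets anticommute with \<open>dt\<close>, both being odd.
\<close>

definition dt_ext :: "('k, nat \<Rightarrow> 'w::ab_group_add) linf \<Rightarrow> (int \<Rightarrow> (nat \<Rightarrow> 'w) \<Rightarrow> nat \<Rightarrow> 'w) \<Rightarrow> ('k, nat \<Rightarrow> 'w) linf" where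
  "dt_ext N D = \<lparr>smul = \<lambda>c z. mk (smul N c (q0 z)) (smul N c (q1 z)),
     grade = \<lambda>p. {z. q0 z \<in> grade N p \<and> q1 z \<in> grade N (p - 1)},
     brk = \<lambda>zs. mk (brk N (map m0 zs)) ((case zs of [a] \<Rightarrow> D (fst a) (q0 (snd a)) | _ \<Rightarrow> 0) - ins zs (brk N))\<rparr>"

text \<open>The extension of \<open>f\<close> that is linear over dt. As \<open>f\<close> has degree
  0, the dt-part carries no extra sign, in contrast to the brackets of
  \<open>dt_ext\<close>.\<close>

definition dt_map :: "((int \<times> (nat \<Rightarrow> 'w)) list \<Rightarrow> nat \<Rightarrow> 'x::ab_group_add) \<Rightarrow> (int \<times> (nat \<Rightarrow> 'w)) list \<Rightarrow> nat \<Rightarrow> 'x" where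
  "dt_map f zs = mk (f (map m0 zs)) (ins zs f)"

lemma dt_ext_simps [simp]:
  "q0 (smul (dt_ext N D) c z) = smul N c (q0 z)" "q1 (smul (dt_ext N D) c z) = smul N c (q1 z)"
  "z \<in> grade (dt_ext N D) p \<longleftrightarrow> q0 z \<in> grade N p \<and> q1 z \<in> grade N (p - 1)"
  "q0 (brk (dt_ext N D) zs) = brk N (map m0 zs)"
  "q1 (brk (dt_ext N D) zs) = (case zs of [a] \<Rightarrow> D (fst a) (q0 (snd a)) | _ \<Rightarrow> 0) - ins zs (brk N)"
  by (auto simp: dt_ext_def)

lemma dt_map_simps [simp]: "q0 (dt_map f zs) = f (map m0 zs)" "q1 (dt_map f zs) = ins zs f"
  by (auto simp: dt_map_def)

lemma m_letters:
  "a \<in> letters (dt_ext N D) \<Longrightarrow> m0 a \<in> letters N" "a \<in> letters (dt_ext N D) \<Longrightarrow> m1 a \<in> letters N"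
  by (cases a; simp)+

lemma map_m0_lists: "zs \<in> lists (letters (dt_ext N D)) \<Longrightarrow> map m0 zs \<in> lists (letters N)"
  using m_letters(1) by (induction zs) auto

lemma ins_cong_lists:
  assumes "zs \<in> lists (letters (dt_ext N D))"
    and "\<And>w. w \<in> lists (letters N) \<Longrightarrow> length w = length zs \<Longrightarrow> total_deg w = total_deg zs - 1 \<Longrightarrow> \<phi> w = \<psi> w"
  shows "ins zs \<phi> = ins zs \<psi>"
  using assms
proof (induction zs arbitrary: \<phi> \<psi> rule: list.induct)
  case (Cons a zs)
  have "ins zs (\<lambda>w. \<phi> (m0 a # w)) = ins zs (\<lambda>w. \<psi> (m0 a # w))"
    by (rule Cons.IH) (use Cons.prems m_letters(1)[of a N D] in auto)
  then show ?case using Cons.prems(2)[of "m1 a # map m0 zs"] Cons.prems(1) m_letters(2)[of a N D] map_m0_lists[of zs N D] by simp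
qed simp

lemma ins_hom:
  assumes h: "hom_on G h" and zs: "zs \<in> lists (letters (dt_ext N D))"
    and \<phi>: "\<And>w. w \<in> lists (letters N) \<Longrightarrow> length w = length zs \<Longrightarrow> total_deg w = total_deg zs - 1 \<Longrightarrow> \<phi> w \<in> G"
  shows "ins zs \<phi> \<in> G \<and> h (ins zs \<phi>) = ins zs (\<lambda>w. h (\<phi> w))"
  using zs \<phi>
proof (induction zs arbitrary: \<phi> rule: list.induct)
  case (Cons a zs)
  have 1: "ins zs (\<lambda>w. \<phi> (m0 a # w)) \<in> G \<and> h (ins zs (\<lambda>w. \<phi> (m0 a # w))) = ins zs (\<lambda>w. h (\<phi> (m0 a # w)))"
    by (rule Cons.IH) (use Cons.prems m_letters(1)[of a N D] in auto)
  have 2: "\<phi> (m1 a # map m0 zs) \<in> G"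
    by (rule Cons.prems(2)) (use Cons.prems(1) m_letters(2)[of a N D] map_m0_lists[of zs N D] in auto)
  show ?case
    using 1 2 hom_onD(3,4)[OF h 2, of "sg (fst a) (ins zs (\<lambda>w. \<phi> (m0 a # w)))"] hom_onD(7,8)[OF h, of "ins zs (\<lambda>w. \<phi> (m0 a # w))" "fst a"] by simp
qed (use hom_onD[OF h] in simp)

lemma hom_on_ins:
  assumes zs: "zs \<in> lists (letters (dt_ext N D))" and h: "\<And>w. w \<in> lists (letters N) \<Longrightarrow> hom_on G (\<lambda>x. \<phi> x w)"
  shows "hom_on G (\<lambda>x. ins zs (\<phi> x))"
proof -
  have "ins zs (\<phi> (x + y)) = ins zs (\<phi> x) + ins zs (\<phi> y)" if "x \<in> G" "y \<in> G" for x y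
    unfolding ins_add[symmetric] by (intro ins_cong_lists[OF zs] hom_onD(4)[OF h] that)
  then show ?thesis using h[of "[]"] by (auto simp: hom_on_def)
qed

lemma hat_dt_map_m0: "hat (dt_map f) zs (\<lambda>W. \<phi> (map m0 W)) = hat f (map m0 zs) \<phi>"
  by (rule hat_map) auto

lemma ins_degmap:
  assumes "degmap d N C f" "hom_on (grade C (total_deg zs - 1 + d)) (\<lambda>x. x)" "zs \<in> lists (letters (dt_ext N D))" "zs \<noteq> []"
  shows "ins zs f \<in> grade C (total_deg zs - 1 + d)"
proof -
  have "ins zs f \<in> grade C (total_deg zs - 1 + d) \<and> ins zs f = ins zs (\<lambda>w. f w)"
  proof (rule ins_hom[OF assms(2,3)])
    fix w assume "w \<in> lists (letters N)" "length w = length zs" "total_deg w = total_deg zs - 1"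
    then show "f w \<in> grade C (total_deg zs - 1 + d)"
      using degmapD[OF assms(1), of w] assms(4) by (cases "w = []") simp_all
  qed
  then show ?thesis ..
qed

text \<open>The dt-part of a product of blocks comes from exactly one block. Within that block it
  comes from exactly one letter, so selecting a block and then a letter is the same as selecting a
  letter of the whole word.\<close>

lemma hat_dt_map_ins:
  assumes f: "degmap 0 N N' f" and G: "\<And>p. hom_on (grade N' p) (\<lambda>x. x)" and zs: "zs \<in> lists (letters (dt_ext N D))" and \<phi>: "multihom N' \<phi>"
  shows "hat (dt_map f) zs (\<lambda>W. ins W \<phi>) = ins zs (\<lambda>w. hat f w \<phi>)"
  using zs \<phi>
proof (induction "length zs" arbitrary: zs \<phi> rule: less_induct)
  case less
  note zs = less.prems(1) and \<phi> = less.prems(2)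
  show ?case
  proof (cases zs)
    case (Cons a bs)
    have a: "a \<in> letters (dt_ext N D)" and bs: "bs \<in> lists (letters (dt_ext N D))" using zs Cons by auto
    let ?p = "fst a"
    let ?y = "\<lambda>u. (?p + total_deg u, f (map m0 (a # u)))"
    let ?w = "\<lambda>u. (?p + total_deg u - 1, ins (a # u) f)"
    have "hat (dt_map f) zs (\<lambda>W. ins W \<phi>) = spl bs (\<lambda>u v. hat f (map m0 v) (\<lambda>W. \<phi> (?w u # W))
        + sg (?p + total_deg u) (ins v (\<lambda>w. hat f w (\<lambda>W. \<phi> (?y u # W)))))"
      unfolding Cons hat.simps
    proof (intro spl_cong_lists[OF bs])
      fix u v assume u: "u \<in> lists (letters (dt_ext N D))" and v: "v \<in> lists (letters (dt_ext N D))" and len: "length u + length v = length bs"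
      have L: "?y u \<in> letters N'"
        using degmapD[OF f map_m0_lists, of "a # u" D] a u by simp
      have "hat (dt_map f) v (\<lambda>W. ins (apply_deg 0 (dt_map f) (a # u) # W) \<phi>)
        = hat (dt_map f) v (\<lambda>W. \<phi> (?w u # map m0 W)) + sg (?p + total_deg u) (hat (dt_map f) v (\<lambda>W. ins W (\<lambda>w. \<phi> (?y u # w))))"
        by (simp add: apply_deg_def hat_add hat_sg)
      also have "hat (dt_map f) v (\<lambda>W. \<phi> (?w u # map m0 W)) = hat f (map m0 v) (\<lambda>W. \<phi> (?w u # W))"
        by (rule hat_dt_map_m0)
      also have "hat (dt_map f) v (\<lambda>W. ins W (\<lambda>w. \<phi> (?y u # w))) = ins v (\<lambda>w. hat f w (\<lambda>W. \<phi> (?y u # W)))"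
        by (rule less.hyps[OF _ v multihom_Cons[OF \<phi> L]]) (use Cons len in auto)
      finally show "hat (dt_map f) v (\<lambda>W. ins (apply_deg 0 (dt_map f) (a # u) # W) \<phi>) = hat f (map m0 v) (\<lambda>W. \<phi> (?w u # W))
        + sg (?p + total_deg u) (ins v (\<lambda>w. hat f w (\<lambda>W. \<phi> (?y u # W))))" .
    qed
    also have "\<dots> = spl bs (\<lambda>u v. hat f (map m0 v) (\<lambda>W. \<phi> (apply_deg 0 f (m1 a # map m0 u) # W))
      + sg ?p (ins u (\<lambda>x. hat f (map m0 v) (\<lambda>W. \<phi> (apply_deg 0 f (m0 a # x) # W)))
         + sg (total_deg u) (ins v (\<lambda>y. hat f y (\<lambda>W. \<phi> (apply_deg 0 f (m0 a # map m0 u) # W))))))"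
    proof (intro spl_cong_lists[OF bs])
      fix u v assume u: "u \<in> lists (letters (dt_ext N D))" and v: "v \<in> lists (letters (dt_ext N D))" and len: "length u + length v = length bs"
      let ?q = "?p + total_deg u - 1"
      \<comment> \<open>The outer value as a function of the first block; its additivity separates
        the dt-part supplied by the first letter from the one supplied by another letter of the same
        block.\<close>
      define h where "h s = hat f (map m0 v) (\<lambda>W. \<phi> ((?q, s) # W))" for s
      have h: "hom_on (grade N' ?q) h"
        unfolding h_def by (rule multihom_hat_head[OF f map_m0_lists[OF v] \<phi>])
      have 1: "f (m1 a # map m0 u) \<in> grade N' ?q"
        using degmapD[OF f, of "m1 a # map m0 u"] map_m0_lists[OF u] m_letters[OF a] by (simp add: algebra_simps)
      have 2: "ins u (\<lambda>x. f (m0 a # x)) \<in> grade N' ?q \<and> h (ins u (\<lambda>x. f (m0 a # x))) = ins u (\<lambda>x. h (f (m0 a # x)))"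
      proof (rule ins_hom[OF h u])
        fix w assume "w \<in> lists (letters N)" "total_deg w = total_deg u - 1"
        then show "f (m0 a # w) \<in> grade N' ?q"
          using degmapD[OF f, of "m0 a # w"] m_letters[OF a] by (simp add: add_diff_eq)
      qed
      have "hat f (map m0 v) (\<lambda>W. \<phi> (?w u # W)) = h (f (m1 a # map m0 u) + sg ?p (ins u (\<lambda>x. f (m0 a # x))))"
        by (simp add: h_def)
      also have "\<dots> = h (f (m1 a # map m0 u)) + sg ?p (ins u (\<lambda>x. h (f (m0 a # x))))"
        using 1 2 hom_onD(4)[OF h 1, of "sg ?p (ins u (\<lambda>x. f (m0 a # x)))"] hom_onD(7,8)[OF h, of "ins u (\<lambda>x. f (m0 a # x))" ?p] by simp
      also have "ins u (\<lambda>x. h (f (m0 a # x))) = ins u (\<lambda>x. hat f (map m0 v) (\<lambda>W. \<phi> (apply_deg 0 f (m0 a # x) # W)))"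
        by (rule ins_cong) (simp add: h_def apply_deg_def add_diff_eq)
      also have "h (f (m1 a # map m0 u)) = hat f (map m0 v) (\<lambda>W. \<phi> (apply_deg 0 f (m1 a # map m0 u) # W))"
        by (simp add: h_def apply_deg_def algebra_simps)
      finally have X: "hat f (map m0 v) (\<lambda>W. \<phi> (?w u # W)) = hat f (map m0 v) (\<lambda>W. \<phi> (apply_deg 0 f (m1 a # map m0 u) # W))
          + sg ?p (ins u (\<lambda>x. hat f (map m0 v) (\<lambda>W. \<phi> (apply_deg 0 f (m0 a # x) # W))))" .
      show "hat f (map m0 v) (\<lambda>W. \<phi> (?w u # W)) + sg (?p + total_deg u) (ins v (\<lambda>w. hat f w (\<lambda>W. \<phi> (?y u # W))))
        = hat f (map m0 v) (\<lambda>W. \<phi> (apply_deg 0 f (m1 a # map m0 u) # W))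
      + sg ?p (ins u (\<lambda>x. hat f (map m0 v) (\<lambda>W. \<phi> (apply_deg 0 f (m0 a # x) # W)))
         + sg (total_deg u) (ins v (\<lambda>y. hat f y (\<lambda>W. \<phi> (apply_deg 0 f (m0 a # map m0 u) # W)))))"
        unfolding X by (simp add: sg_add sg_sg apply_deg_def)
    qed
    also have "\<dots> = ins zs (\<lambda>w. hat f w \<phi>)"
      unfolding Cons ins.simps list.map hat.simps ins_spl by (simp add: spl_map[where r = m0] spl_add spl_sg)
    finally show ?thesis .
  qed simp
qed

lemma lin_on_q:
  "hom_on (grade N p) (\<lambda>x. x) \<Longrightarrow> hom_on (grade N (p - 1)) (\<lambda>x. x) \<Longrightarrow> (\<And>c x q. x \<in> grade N q \<Longrightarrow> smul N c x \<in> grade N q) \<Longrightarrow>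
    lin_on (smul (dt_ext N D)) (smul N) (grade (dt_ext N D) p) q0 \<and> lin_on (smul (dt_ext N D)) (smul N) (grade (dt_ext N D) p) q1"
  by (auto simp: lin_on_def hom_on_def)

lemma graded_dt_ext:
  assumes N: "graded_space N"
  shows "graded_space (dt_ext N D)"
proof -
  note s = subspace_simps(1)[OF N]
  have vs: "vector_space (smul (dt_ext N D))"
    by (unfold_locales; rule q_eqI; simp add: vs_simps[OF s])
  interpret vector_space "smul (dt_ext N D)" by fact
  have "subspace (grade (dt_ext N D) p)" for p
    by (rule subspaceI) (simp_all add: subspace_simps[OF N])
  then show ?thesis
    using vs by (simp add: graded_space_def)
qed

lemma lin_on_q0q1:
  assumes N: "graded_space N"
  shows "lin_on (smul (dt_ext N D)) (smul N) (grade (dt_ext N D) p) q0" "lin_on (smul (dt_ext N D)) (smul N) (grade (dt_ext N D) p) q1"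
  using lin_on_q[of N p D] subspace_simps[OF N] by auto

lemma lin_on_mk:
  "lin_on sc (smul N) G h0 \<Longrightarrow> lin_on sc (smul N) G h1 \<Longrightarrow> lin_on sc (smul (dt_ext N D)) G (\<lambda>x. mk (h0 x) (h1 x))"
  unfolding lin_on_def hom_on_def by (auto intro: q_eqI)

lemma map_m0_append: "map m0 (us @ (p, z) # vs) = map m0 us @ (p, q0 z) # map m0 vs"
  by simp

lemma ins_multilin:
  assumes N: "graded_space N" and s: "vector_space s" and f: "multilin N s f"
    and us: "us \<in> lists (letters (dt_ext N D))" and vs: "vs \<in> lists (letters (dt_ext N D))"
  shows "lin_on (smul (dt_ext N D)) s (grade (dt_ext N D) p) (\<lambda>z. ins (us @ (p, z) # vs) f)"
  using us f
proof (induction us arbitrary: f rule: list.induct)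
  case Nil
  have 1: "lin_on (smul (dt_ext N D)) s (grade (dt_ext N D) p) (\<lambda>z. f ((p - 1, q1 z) # map m0 vs))"
    by (rule lin_on_comp[OF lin_on_q0q1(2)[OF N] multilin_head[OF Nil(2) map_m0_lists[OF vs]]]) simp
  have "lin_on (smul (dt_ext N D)) s (grade (dt_ext N D) p) (\<lambda>z. ins vs (\<lambda>w. f ((p, q0 z) # w)))"
  proof -
    have "lin_on (smul (dt_ext N D)) s (grade (dt_ext N D) p) (\<lambda>z. f ((p, q0 z) # w))" if "w \<in> lists (letters N)" for w
      by (rule lin_on_comp[OF lin_on_q0q1(1)[OF N] multilin_head[OF Nil(2) that]]) simp
    note h = this
    have "ins vs (\<lambda>w. f ((p, q0 (smul (dt_ext N D) c z)) # w)) = s c (ins vs (\<lambda>w. f ((p, q0 z) # w)))" if "z \<in> grade (dt_ext N D) p" for c z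
    proof -
      have hs: "hom_on UNIV (s c)" by (simp add: hom_on_def vs_simps[OF s])
      show ?thesis
        using ins_hom[OF hs vs UNIV_I] lin_onD(3)[OF h that] by (auto intro!: ins_cong_lists[OF vs])
    qed
    moreover have "hom_on (grade (dt_ext N D) p) (\<lambda>z. ins vs (\<lambda>w. f ((p, q0 z) # w)))"
      by (rule hom_on_ins[OF vs lin_onD(1)[OF h]])
    moreover have "smul (dt_ext N D) c z \<in> grade (dt_ext N D) p" if "z \<in> grade (dt_ext N D) p" for c z
      using that subspace_simps(4)[OF N] by simp
    ultimately show ?thesis by (simp add: lin_on_def del: dt_ext_simps(1-3))
  qed
  then show ?case
    using 1 by (simp add: lin_on_add[OF s] lin_on_const_simps[OF s])
next
  case (Cons a us)
  have a: "a \<in> letters (dt_ext N D)" and us: "us \<in> lists (letters (dt_ext N D))" using Cons.prems by auto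
  have 1: "lin_on (smul (dt_ext N D)) s (grade (dt_ext N D) p) (\<lambda>z. f ((m1 a # map m0 us) @ (p, q0 z) # map m0 vs))"
    by (rule lin_on_comp[OF lin_on_q0q1(1)[OF N] multilinD[OF Cons.prems(2)]])
       (use m_letters[OF a] map_m0_lists[OF us] map_m0_lists[OF vs] in simp_all)
  have "lin_on (smul (dt_ext N D)) s (grade (dt_ext N D) p) (\<lambda>z. ins (us @ (p, z) # vs) (\<lambda>w. f (m0 a # w)))"
    by (rule Cons.IH[OF us multilin_Cons[OF Cons.prems(2) m_letters(1)[OF a]]])
  then show ?case
    using 1 by (simp add: lin_on_add[OF s] lin_on_const_simps[OF s])
qed

lemma ins_symm:
  fixes f :: "(int \<times> (nat \<Rightarrow> 'w::ab_group_add)) list \<Rightarrow> 'u::ab_group_add"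
  assumes f: "symm N f"
  shows "symm (dt_ext N D) (\<lambda>zs. ins zs f)"
  unfolding symm_def
proof (intro ballI)
  fix us vs a b
  assume us: "us \<in> lists (letters (dt_ext N D))" and vs: "vs \<in> lists (letters (dt_ext N D))"
    and a: "a \<in> letters (dt_ext N D)" and b: "b \<in> letters (dt_ext N D)"
  show "ins (us @ a # b # vs) f = sg (fst a * fst b) (ins (us @ b # a # vs) f)"
    using us f
  proof (induction us arbitrary: f rule: list.induct)
    case Nil
    note f = Nil(2)
    have 1: "f (m1 a # m0 b # map m0 vs) = sg ((fst a - 1) * fst b) (f (m0 b # m1 a # map m0 vs))"
      using symm_head[OF f map_m0_lists[OF vs] m_letters(2)[OF a] m_letters(1)[OF b]] by simp
    have 2: "f (m0 a # m1 b # map m0 vs) = sg (fst a * (fst b - 1)) (f (m1 b # m0 a # map m0 vs))"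
      using symm_head[OF f map_m0_lists[OF vs] m_letters(1)[OF a] m_letters(2)[OF b]] by simp
    have 3: "ins vs (\<lambda>w. f (m0 a # m0 b # w)) = sg (fst a * fst b) (ins vs (\<lambda>w. f (m0 b # m0 a # w)))"
      unfolding ins_sg[symmetric]
      using symm_head[OF f _ m_letters(1)[OF a] m_letters(1)[OF b]] by (intro ins_cong_lists[OF vs]) simp
    have 4: "sg ((fst a - 1) * fst b) x = sg (fst a * fst b + fst b) x" "sg (fst a + fst a * (fst b - 1)) x = sg (fst a * fst b) x" for x :: 'u
      by (rule sg_parity; simp add: algebra_simps)+
    show ?case
      by (simp add: 1 2 3 sg_add sg_sg 4 add_ac)
  next
    case (Cons c us)
    have c: "c \<in> letters (dt_ext N D)" and us: "us \<in> lists (letters (dt_ext N D))" using Cons.prems by auto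
    have "f ((m1 c # map m0 us) @ m0 a # m0 b # map m0 vs) = sg (fst (m0 a) * fst (m0 b)) (f ((m1 c # map m0 us) @ m0 b # m0 a # map m0 vs))"
      by (rule symmD[OF Cons.prems(2)]) (use m_letters[OF c] m_letters[OF a] m_letters[OF b] map_m0_lists[OF us] map_m0_lists[OF vs] in simp_all)
    moreover have "ins (us @ a # b # vs) (\<lambda>w. f (m0 c # w)) = sg (fst a * fst b) (ins (us @ b # a # vs) (\<lambda>w. f (m0 c # w)))"
      by (rule Cons.IH[OF us symm_Cons[OF Cons.prems(2) m_letters(1)[OF c]]])
    ultimately show ?case by (simp add: sg_add sg_sg add_ac)
  qed
qed

lemma m0_multilin:
  assumes N: "graded_space N" and f: "multilin N s f"
  shows "multilin (dt_ext N D) s (\<lambda>zs. f (map m0 zs))"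
  unfolding multilin_def
proof (intro ballI allI)
  fix us vs p assume us: "us \<in> lists (letters (dt_ext N D))" and vs: "vs \<in> lists (letters (dt_ext N D))"
  show "lin_on (smul (dt_ext N D)) s (grade (dt_ext N D) p) (\<lambda>z. f (map m0 (us @ (p, z) # vs)))"
    unfolding map_m0_append
    by (rule lin_on_comp[OF lin_on_q0q1(1)[OF N] multilinD[OF f map_m0_lists[OF us] map_m0_lists[OF vs]]]) simp
qed

lemma multilin_ins:
  assumes "graded_space N" "vector_space s" "multilin N s f"
  shows "multilin (dt_ext N D) s (\<lambda>zs. ins zs f)"
  unfolding multilin_def by (intro ballI allI ins_multilin assms)

lemma m0_symm:
  assumes f: "symm N f"
  shows "symm (dt_ext N D) (\<lambda>zs. f (map m0 zs))"
  unfolding symm_def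
proof (intro ballI)
  fix us vs a b
  assume *: "us \<in> lists (letters (dt_ext N D))" "vs \<in> lists (letters (dt_ext N D))" "a \<in> letters (dt_ext N D)" "b \<in> letters (dt_ext N D)"
  show "f (map m0 (us @ a # b # vs)) = sg (fst a * fst b) (f (map m0 (us @ b # a # vs)))"
    using symmD[OF f map_m0_lists[OF *(1)] map_m0_lists[OF *(2)] m_letters(1)[OF *(3)] m_letters(1)[OF *(4)]] by simp
qed

lemma smaps_mk:
  assumes "multilin (dt_ext N D) (smul N') g" "multilin (dt_ext N D) (smul N') h" "symm (dt_ext N D) g" "symm (dt_ext N D) h"
    and "degmap d (dt_ext N D) N' g" "degmap (d - 1) (dt_ext N D) N' h"
  shows "smaps d (dt_ext N D) (dt_ext N' D') (\<lambda>zs. mk (g zs) (h zs))"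
  unfolding smaps_def
proof (intro conjI)
  show "multilin (dt_ext N D) (smul (dt_ext N' D')) (\<lambda>zs. mk (g zs) (h zs))"
    unfolding multilin_def
    by (intro ballI allI lin_on_mk multilinD[OF assms(1)] multilinD[OF assms(2)])
  show "symm (dt_ext N D) (\<lambda>zs. mk (g zs) (h zs))"
    unfolding symm_def
  proof (intro ballI)
    fix us vs a b
    assume *: "us \<in> lists (letters (dt_ext N D))" "vs \<in> lists (letters (dt_ext N D))" "a \<in> letters (dt_ext N D)" "b \<in> letters (dt_ext N D)"
    have "mk (sg n x) (sg n y) = sg n (mk x y)" for n x y
      by (auto simp: sg_def intro: q_eqI)
    then show "mk (g (us @ a # b # vs)) (h (us @ a # b # vs)) = sg (fst a * fst b) (mk (g (us @ b # a # vs)) (h (us @ b # a # vs)))"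
      unfolding symmD[OF assms(3) *] symmD[OF assms(4) *] .
  qed
  show "degmap d (dt_ext N D) (dt_ext N' D') (\<lambda>zs. mk (g zs) (h zs))"
    using assms(5,6) unfolding degmap_def by (simp add: algebra_simps)
qed

lemma dt_map_smaps:
  assumes N: "graded_space N" and N': "graded_space N'" and f: "smaps 0 N N' f"
  shows "smaps 0 (dt_ext N D) (dt_ext N' D') (dt_map f)"
proof -
  note s = subspace_simps(1)[OF N']
  have "smaps 0 (dt_ext N D) (dt_ext N' D') (\<lambda>zs. mk (f (map m0 zs)) (ins zs f))"
  proof (rule smaps_mk)
    show "degmap (0 - 1) (dt_ext N D) N' (\<lambda>zs. ins zs f)"
      unfolding degmap_def using ins_degmap[OF smapsD(1)[OF f] subspace_simps(8)[OF N']] by simp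
    show "degmap 0 (dt_ext N D) N' (\<lambda>zs. f (map m0 zs))"
      unfolding degmap_def using degmapD[OF smapsD(1)[OF f] map_m0_lists] by simp
  qed (intro m0_symm ins_symm smapsD(2,3)[OF f] m0_multilin[OF N] multilin_ins[OF N s])+
  then show ?thesis by (simp add: dt_map_def[abs_def])
qed

definition is_deriv :: "('k::field_char_0, 'n::ab_group_add) linf \<Rightarrow> (int \<Rightarrow> 'n \<Rightarrow> 'n) \<Rightarrow> bool" where
  "is_deriv N D \<longleftrightarrow> (\<forall>p. lin_on (smul N) (smul N) (grade N p) (D p)) \<and> (\<forall>p. \<forall>x\<in>grade N p. D p x \<in> grade N p)"

text \<open>The Leibniz rule. With \<open>f\<close> a bracket it says that \<open>D\<close> is a
  derivation of all brackets; with \<open>f\<close> a morphism, that \<open>f\<close> is compatible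
  with the two derivations.\<close>

definition commutes_deriv ::
  "int \<Rightarrow> ('k::field_char_0, 'n::ab_group_add) linf \<Rightarrow> (int \<Rightarrow> 'n \<Rightarrow> 'n) \<Rightarrow> (int \<Rightarrow> 'm \<Rightarrow> 'm) \<Rightarrow> ((int \<times> 'n) list \<Rightarrow> 'm::ab_group_add) \<Rightarrow> bool" where
  "commutes_deriv d N D D' f \<longleftrightarrow> (\<forall>as\<in>lists (letters N). as \<noteq> [] \<longrightarrow> D' (total_deg as + d) (f as) = dsum D as f)"

definition dpart :: "(int \<Rightarrow> (nat \<Rightarrow> 'w) \<Rightarrow> nat \<Rightarrow> 'w) \<Rightarrow> (int \<times> (nat \<Rightarrow> 'w)) list \<Rightarrow> nat \<Rightarrow> 'w::ab_group_add" where
  "dpart D zs = (case zs of [a] \<Rightarrow> D (fst a) (q0 (snd a)) | _ \<Rightarrow> 0)"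

lemma dpart_simps [simp]: "dpart D [(p, z)] = D p (q0 z)" "dpart D [] = 0" "dpart D (a # b # zs) = 0"
  by (auto simp: dpart_def)

lemma dpart_long: "2 \<le> length zs \<Longrightarrow> dpart D zs = 0"
  by (auto simp: dpart_def split: list.split)

lemma brk_dt_ext: "brk (dt_ext N D) zs = mk (brk N (map m0 zs)) (dpart D zs - ins zs (brk N))"
  by (simp add: dt_ext_def dpart_def)

lemma dpart_smaps:
  assumes N: "graded_space N" and D: "is_deriv N D"
  shows "smaps 0 (dt_ext N D) N (dpart D)"
proof -
  have 2: "us \<noteq> [] \<or> vs \<noteq> [] \<Longrightarrow> dpart D (us @ (p, x) # vs) = 0" for us vs p x
    by (rule dpart_long) (cases us; cases vs; auto)
  have "multilin (dt_ext N D) (smul N) (dpart D)"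
    unfolding multilin_def
  proof (intro ballI allI)
    fix us vs p
    show "lin_on (smul (dt_ext N D)) (smul N) (grade (dt_ext N D) p) (\<lambda>x. dpart D (us @ (p, x) # vs))"
    proof (cases "us = [] \<and> vs = []")
      case True
      have "lin_on (smul (dt_ext N D)) (smul N) (grade (dt_ext N D) p) (\<lambda>x. D p (q0 x))"
        by (rule lin_on_comp[OF lin_on_q0q1(1)[OF N]]) (use D in \<open>auto simp: is_deriv_def\<close>)
      then show ?thesis using True by simp
    next
      case False
      then show ?thesis
        using 2 lin_on_const_simps(2)[OF subspace_simps(1)[OF N] lin_on_q0q1(1)[OF N]] by simp
    qed
  qed
  moreover have "degmap 0 (dt_ext N D) N (dpart D)"
    unfolding degmap_def dpart_def using subspace_simps(2)[OF N] D by (auto split: list.split simp: is_deriv_def)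
  moreover have "symm (dt_ext N D) (dpart D)"
    unfolding symm_def using dpart_long[of "us @ a # b # vs" D for us a b vs] by simp
  ultimately show ?thesis by (simp add: smaps_def)
qed

lemma multilin_diff:
  assumes s: "vector_space s" and "multilin C s g" "multilin C s h"
  shows "multilin C s (\<lambda>as. g as - h as)"
  using assms(2,3) lin_on_add(2)[OF s] unfolding multilin_def by blast

lemma symm_diff:
  assumes "symm C g" "symm C h"
  shows "symm C (\<lambda>as. g as - h as)"
  unfolding symm_def
proof (intro ballI)
  fix us vs a b
  assume *: "us \<in> lists (letters C)" "vs \<in> lists (letters C)" "a \<in> letters C" "b \<in> letters C"
  show "g (us @ a # b # vs) - h (us @ a # b # vs) = sg (fst a * fst b) (g (us @ b # a # vs) - h (us @ b # a # vs))"
    unfolding symmD[OF assms(1) *] symmD[OF assms(2) *] by (simp add: sg_def)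
qed

lemma brk_dt_ext_smaps:
  assumes N: "is_linf N" and D: "is_deriv N D"
  shows "smaps 1 (dt_ext N D) (dt_ext N D) (brk (dt_ext N D))"
proof -
  note gN = is_linfD(1)[OF N] and l = is_linfD(2)[OF N] and s = is_linfD(4)[OF N]
  note d = dpart_smaps[OF gN D]
  have "smaps 1 (dt_ext N D) (dt_ext N D) (\<lambda>zs. mk (brk N (map m0 zs)) (dpart D zs - ins zs (brk N)))"
  proof (rule smaps_mk)
    show "degmap (1 - 1) (dt_ext N D) N (\<lambda>zs. dpart D zs - ins zs (brk N))"
      unfolding degmap_def
    proof (intro ballI impI)
      fix zs assume zs: "zs \<in> lists (letters (dt_ext N D))" "zs \<noteq> []"
      show "dpart D zs - ins zs (brk N) \<in> grade N (total_deg zs + (1 - 1))"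
        using ins_degmap[OF smapsD(1)[OF l] subspace_simps(8)[OF gN] zs] degmapD[OF smapsD(1)[OF d] zs] by (simp add: subspace_simps[OF gN])
    qed
    show "degmap 1 (dt_ext N D) N (\<lambda>zs. brk N (map m0 zs))"
      unfolding degmap_def using degmapD[OF smapsD(1)[OF l] map_m0_lists] by simp
    show "symm (dt_ext N D) (\<lambda>zs. dpart D zs - ins zs (brk N))"
      by (intro symm_diff smapsD(3)[OF d] ins_symm smapsD(3)[OF l])
    show "multilin (dt_ext N D) (smul N) (\<lambda>zs. dpart D zs - ins zs (brk N))"
      by (rule multilin_diff[OF s smapsD(2)[OF d] multilin_ins[OF gN s smapsD(2)[OF l]]])
  qed (intro m0_symm smapsD(2,3)[OF l] m0_multilin[OF gN])+
  then show ?thesis by (simp add: brk_dt_ext[abs_def])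
qed

lemma coder_dt_ext_m0: "coder (brk (dt_ext N D)) zs (\<lambda>W. g (map m0 W)) = coder (brk N) (map m0 zs) g"
  by (rule coder_map) auto

text \<open>The factor dt is either created by the summand \<open>D\<close> of the differential,
  which gives the Leibniz sum, or already present in a letter, in which case moving it past the odd
  coderivation gives the minus sign.\<close>

lemma coder_dt_ext_ins:
  assumes N: "is_linf N" and D: "is_deriv N D" and zs: "zs \<in> lists (letters (dt_ext N D))"
    and g: "multihom N g" "symm N g"
  shows "coder (brk (dt_ext N D)) zs (\<lambda>W. ins W g) = dsum D (map m0 zs) g - ins zs (\<lambda>w. coder (brk N) w g)"
proof -
  note gN = is_linfD(1)[OF N] and l = is_linfD(2)[OF N]
  note d = dpart_smaps[OF gN D]
  let ?I = "\<lambda>u v. if u = [] then 0 else g ((total_deg u, ins u (brk N)) # map m0 v)"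
  let ?J = "\<lambda>u v. if u = [] then 0 else sg (total_deg u) (ins v (\<lambda>w. g (apply_deg 1 (brk N) (map m0 u) # w)))"
  let ?K = "\<lambda>u v. case map m0 u of [b] \<Rightarrow> g ((fst b, D (fst b) (snd b)) # map m0 v) | _ \<Rightarrow> 0"
  have "coder (brk (dt_ext N D)) zs (\<lambda>W. ins W g) = spl zs (\<lambda>u v. ?K u v - (?I u v + ?J u v))"
    unfolding coder_def
  proof (intro spl_cong_lists[OF zs])
    fix u v assume u: "u \<in> lists (letters (dt_ext N D))" and v: "v \<in> lists (letters (dt_ext N D))"
    show "(if u = [] then 0 else ins (apply_deg 1 (brk (dt_ext N D)) u # v) g) = ?K u v - (?I u v + ?J u v)"
    proof (cases "u = []")
      case False
      have i: "ins u (brk N) \<in> grade N (total_deg u)"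
        using ins_degmap[OF smapsD(1)[OF l] subspace_simps(8)[OF gN] u False] by simp
      have dm: "dpart D u \<in> grade N (total_deg u)"
        using degmapD[OF smapsD(1)[OF d] u False] by simp
      note h = multihom_head[OF g(1) map_m0_lists[OF v], of "total_deg u"]
      have K: "g ((total_deg u, dpart D u) # map m0 v) = ?K u v"
        using hom_onD(2)[OF h] False by (auto simp: dpart_def m0_def split: list.split)
      have "ins (apply_deg 1 (brk (dt_ext N D)) u # v) g = g ((total_deg u, dpart D u - ins u (brk N)) # map m0 v)
          + sg (total_deg u + 1) (ins v (\<lambda>w. g (apply_deg 1 (brk N) (map m0 u) # w)))"
        by (simp add: apply_deg_def brk_dt_ext)
      also have "g ((total_deg u, dpart D u - ins u (brk N)) # map m0 v) = ?K u v - ?I u v"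
        using hom_onD(10)[OF h dm i] False by (simp only: K if_False)
      finally show ?thesis using False by (simp add: sg_def)
    qed simp
  qed
  also have "\<dots> = spl zs ?K - spl zs (\<lambda>u v. ?I u v + ?J u v)"
    by (rule spl_diff)
  also have "spl zs ?K = dsum D (map m0 zs) g"
    by (subst dsum_spl[OF _ g(2) map_m0_lists[OF zs]]) (use D in \<open>auto simp: is_deriv_def spl_map[where r = m0]\<close>)
  also have "spl zs (\<lambda>u v. ?I u v + ?J u v) = ins zs (\<lambda>w. coder (brk N) w g)"
    unfolding coder_def ins_spl
  proof (intro spl_cong_lists[OF zs] arg_cong2[where f = "(+)"])
    fix u v assume u: "u \<in> lists (letters (dt_ext N D))" and v: "v \<in> lists (letters (dt_ext N D))"
    show "?J u v = sg (total_deg u) (ins v (\<lambda>y. if map m0 u = [] then 0 else g (apply_deg 1 (brk N) (map m0 u) # y)))"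
      by simp
    show "?I u v = ins u (\<lambda>x. if x = [] then 0 else g (apply_deg 1 (brk N) x # map m0 v))"
    proof (cases "u = []")
      case False
      note h = multihom_head[OF g(1) map_m0_lists[OF v], of "total_deg u"]
      have "g ((total_deg u, ins u (brk N)) # map m0 v) = ins u (\<lambda>x. g ((total_deg u, brk N x) # map m0 v))"
      proof (rule conjunct2[OF ins_hom[OF h u]])
        fix w assume "w \<in> lists (letters N)" "length w = length u" "total_deg w = total_deg u - 1"
        then show "brk N w \<in> grade N (total_deg u)"
          using degmapD[OF smapsD(1)[OF l], of w] False by (cases "w = []") simp_all
      qed
      also have "\<dots> = ins u (\<lambda>x. if x = [] then 0 else g (apply_deg 1 (brk N) x # map m0 v))"
        using False by (intro ins_cong) (auto simp: apply_deg_def)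
      finally show ?thesis using False by simp
    qed simp
  qed
  finally show ?thesis .
qed

lemma hom_q_spl:
  "q0 (spl zs F) = spl zs (\<lambda>u v. q0 (F u v))" "q1 (spl zs F) = spl zs (\<lambda>u v. q1 (F u v))"
  using spl_hom_mset[OF hom_on_q(1) UNIV_I] spl_hom_mset[OF hom_on_q(2) UNIV_I] by blast+

lemma hom_q_coder:
  "q0 (coder l zs F) = coder l zs (\<lambda>W. q0 (F W))" "q1 (coder l zs F) = coder l zs (\<lambda>W. q1 (F W))"
  unfolding coder_def hom_q_spl by (auto intro!: spl_cong)

text \<open>The part without dt repeats the relation of \<open>N\<close>. In the dt-part,
  \<open>D\<close> applied to a bracket cancels against the Leibniz sum by the derivation property,
  and what remains is the dt-part of the relation of \<open>N\<close>.\<close>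

lemma is_linf_dt_ext:
  assumes N: "is_linf N" and D: "is_deriv N D" "commutes_deriv 1 N D D (brk N)"
  shows "is_linf (dt_ext N D)"
proof -
  note gN = is_linfD(1)[OF N] and l = is_linfD(2)[OF N]
  note L = brk_dt_ext_smaps[OF N D(1)]
  have "coder (brk (dt_ext N D)) zs (brk (dt_ext N D)) = 0" if zs: "zs \<in> lists (letters (dt_ext N D))" for zs
  proof (cases "zs = []")
    case False
    show ?thesis
    proof (rule q_eqI)
      show "q0 (coder (brk (dt_ext N D)) zs (brk (dt_ext N D))) = q0 0"
        by (simp add: hom_q_coder coder_dt_ext_m0 is_linfD(3)[OF N map_m0_lists[OF zs]])
      have "q1 (coder (brk (dt_ext N D)) zs (brk (dt_ext N D))) = coder (brk (dt_ext N D)) zs (dpart D) - coder (brk (dt_ext N D)) zs (\<lambda>W. ins W (brk N))"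
        unfolding hom_q_coder brk_dt_ext[of N D W for W] q_mk coder_diff ..
      also have "coder (brk (dt_ext N D)) zs (dpart D) = D (total_deg zs + 1) (brk N (map m0 zs))"
        using coder_into_strict[where e = "dpart D", OF smapsD(1)[OF L] zs False dpart_long] by simp
      also have "\<dots> = dsum D (map m0 zs) (brk N)"
        using D(2) map_m0_lists[OF zs] False unfolding commutes_deriv_def by (metis Nil_is_map_conv total_deg_m0)
      also have "coder (brk (dt_ext N D)) zs (\<lambda>W. ins W (brk N)) = dsum D (map m0 zs) (brk N) - ins zs (\<lambda>w. coder (brk N) w (brk N))"
        by (rule coder_dt_ext_ins[OF N D(1) zs smapsD(4,3)[OF l]])
      also have "ins zs (\<lambda>w. coder (brk N) w (brk N)) = ins zs (\<lambda>w. 0)"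
        by (intro ins_cong_lists[OF zs] is_linfD(3)[OF N])
      finally show "q1 (coder (brk (dt_ext N D)) zs (brk (dt_ext N D))) = q1 0"
        by (simp only: ins_zero diff_zero diff_self q_add)
    qed
  qed (simp add: coder_def)
  then show ?thesis
    using graded_dt_ext[OF gN] L by (simp add: is_linf_def)
qed

lemma hom_q_hat:
  "q0 (hat f zs F) = hat f zs (\<lambda>W. q0 (F W))" "q1 (hat f zs F) = hat f zs (\<lambda>W. q1 (F W))"
proof -
  have "q0 (hat f zs F) = hat f zs (\<lambda>W. q0 (F W)) \<and> q1 (hat f zs F) = hat f zs (\<lambda>W. q1 (F W))"
  proof (induction "length zs" arbitrary: zs F rule: less_induct)
    case less
    show ?case
    proof (cases zs)
      case (Cons a bs)
      show ?thesis
        unfolding Cons hat.simps hom_q_spl by (intro conjI spl_cong refl) (use less Cons in auto)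
    qed simp
  qed
  then show "q0 (hat f zs F) = hat f zs (\<lambda>W. q0 (F W))" "q1 (hat f zs F) = hat f zs (\<lambda>W. q1 (F W))" by auto
qed

text \<open>As for the brackets: the terms with \<open>D\<close> match because \<open>f\<close>
  commutes with the derivations, and the remaining dt-terms are the morphism equation of
  \<open>f\<close> at the inserted words.\<close>

lemma is_morph_dt_map:
  assumes N: "is_linf N" "is_deriv N D" and N': "is_linf N'" "is_deriv N' D'"
    and f: "is_morph N N' f" "commutes_deriv 0 N D D' f"
  shows "is_morph (dt_ext N D) (dt_ext N' D') (dt_map f)"
  unfolding is_morph_def
proof (intro conjI ballI impI)
  note gN = is_linfD(1)[OF N(1)] and gN' = is_linfD(1)[OF N'(1)] and f' = is_morphD(1)[OF f(1)]
  show T: "smaps 0 (dt_ext N D) (dt_ext N' D') (dt_map f)"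
    by (rule dt_map_smaps[OF gN gN' f'])
  fix zs assume zs: "zs \<in> lists (letters (dt_ext N D))" "zs \<noteq> []"
  note m = map_m0_lists[OF zs(1)]
  show "coder (brk (dt_ext N D)) zs (dt_map f) = hat (dt_map f) zs (brk (dt_ext N' D'))"
  proof (rule q_eqI)
    show "q0 (coder (brk (dt_ext N D)) zs (dt_map f)) = q0 (hat (dt_map f) zs (brk (dt_ext N' D')))"
      using is_morphD(2)[OF f(1) m] zs(2) by (simp add: hom_q_coder hom_q_hat coder_dt_ext_m0 hat_dt_map_m0)
    have "q1 (hat (dt_map f) zs (brk (dt_ext N' D'))) = hat (dt_map f) zs (dpart D') - hat (dt_map f) zs (\<lambda>W. ins W (brk N'))"
      unfolding hom_q_hat brk_dt_ext[of N' D' W for W] q_mk hat_diff ..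
    also have "hat (dt_map f) zs (dpart D') = D' (total_deg zs) (f (map m0 zs))"
      using hat_into_strict[OF smapsD(1)[OF T] dpart_long smapsD(4)[OF dpart_smaps[OF gN' N'(2)]] zs] by simp
    also have "\<dots> = dsum D (map m0 zs) f"
      using f(2) m zs(2) unfolding commutes_deriv_def by (metis Nil_is_map_conv add_0_right total_deg_m0)
    also have "hat (dt_map f) zs (\<lambda>W. ins W (brk N')) = ins zs (\<lambda>w. hat f w (brk N'))"
      by (rule hat_dt_map_ins[OF smapsD(1)[OF f'] subspace_simps(8)[OF gN'] zs(1) smapsD(4)[OF is_linfD(2)[OF N'(1)]]])
    also have "\<dots> = ins zs (\<lambda>w. coder (brk N) w f)"
    proof (rule ins_cong_lists[OF zs(1)])
      fix w assume "w \<in> lists (letters N)" "length w = length zs"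
      then show "hat f w (brk N') = coder (brk N) w f"
        using is_morphD(2)[OF f(1), of w] zs(2) by (cases "w = []") simp_all
    qed
    finally show "q1 (coder (brk (dt_ext N D)) zs (dt_map f)) = q1 (hat (dt_map f) zs (brk (dt_ext N' D')))"
      unfolding hom_q_coder dt_map_simps coder_dt_ext_ins[OF N zs(1) smapsD(4,3)[OF f']] by (rule sym)
  qed
qed

section \<open>Polynomial paths\<close>

text \<open>
  Polynomials with values in \<open>C\<close> are represented by their sequences of values at the natural numbers, so
  that brackets and morphisms act pointwise; \<open>pder C p y y'\<close> says that \<open>y\<close> is polynomial with formal
  derivative \<open>y'\<close>.
\<close>

inductive pder :: "('k::field_char_0, 'v::ab_group_add) linf \<Rightarrow> int \<Rightarrow> (nat \<Rightarrow> 'v) \<Rightarrow> (nat \<Rightarrow> 'v) \<Rightarrow> bool"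
  for C p where
  const: "c \<in> grade C p \<Longrightarrow> pder C p (\<lambda>n. c) (\<lambda>n. 0)"
| add: "pder C p y y' \<Longrightarrow> pder C p z z' \<Longrightarrow> pder C p (\<lambda>n. y n + z n) (\<lambda>n. y' n + z' n)"
| mul: "pder C p y y' \<Longrightarrow> pder C p (\<lambda>n. smul C (of_nat n) (y n)) (\<lambda>n. y n + smul C (of_nat n) (y' n))"

lemma pder_eq: "pder C p y y' \<Longrightarrow> y = z \<Longrightarrow> y' = z' \<Longrightarrow> pder C p z z'"
  by simp

lemma pder_grade:
  assumes "graded_space C" "pder C p y y'"
  shows "y n \<in> grade C p" "y' n \<in> grade C p"
  using assms(2,1) by (induction) (auto simp: subspace_simps)

lemma pder_scale:
  assumes C: "graded_space C" and "pder C p y y'"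
  shows "pder C p (\<lambda>n. smul C c (y n)) (\<lambda>n. smul C c (y' n))"
  using assms(2)
proof induction
  case (const x)
  then show ?case
    using pder.const[of "smul C c x" C p] subspace_simps[OF C] by (simp add: vs_simps[OF subspace_simps(1)[OF C]])
next
  case (add y y' z z')
  from pder.add[OF add.IH] show ?case by (simp add: vs_simps[OF subspace_simps(1)[OF C]])
next
  case (mul y y')
  from pder.mul[OF mul.IH] show ?case by (simp add: vs_simps[OF subspace_simps(1)[OF C]] mult.commute)
qed

lemma pder_deriv:
  assumes C: "graded_space C" and "pder C p y y'"
  shows "\<exists>y''. pder C p y' y''"
  using assms(2)
proof induction
  case (const x)
  then show ?case using pder.const[OF subspace_simps(2)[OF C]] by blast
next
  case (add y y' z z')
  then show ?case using pder.add by blast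
next
  case (mul y y')
  then obtain y'' where "pder C p y' y''" by blast
  from pder.add[OF mul.hyps pder.mul[OF this]] show ?case by blast
qed

text \<open>Coefficients are what uniqueness and integration need. They are required to vanish from
  \<open>d\<close> on, so that sums of different length can be padded; for i = 0 the factor
  \<open>of_nat i\<close> makes the truncated exponent harmless.\<close>

lemma pder_normal_form:
  assumes C: "graded_space C" and "pder C p y y'"
  shows "\<exists>d c. (\<forall>i. c i \<in> grade C p) \<and> (\<forall>i\<ge>d. c i = 0) \<and> y = (\<lambda>n. \<Sum>i<d. smul C (of_nat n ^ i) (c i)) \<and>
    y' = (\<lambda>n. \<Sum>i<d. smul C (of_nat i * of_nat n ^ (i - 1)) (c i))"
  using assms(2)
proof induction
  note s = subspace_simps(1)[OF C]
  case (const x)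
  show ?case
    by (rule exI[of _ 1], rule exI[of _ "\<lambda>i. if i = 0 then x else 0"])
       (use const in \<open>auto simp: vs_simps[OF s] subspace_simps[OF C]\<close>)
next
  note s = subspace_simps(1)[OF C]
  case (add y y' z z')
  then obtain d c e b where c: "\<forall>i. c i \<in> grade C p" "\<forall>i\<ge>d. c i = 0" "y = (\<lambda>n. \<Sum>i<d. smul C (of_nat n ^ i) (c i))"
      "y' = (\<lambda>n. \<Sum>i<d. smul C (of_nat i * of_nat n ^ (i - 1)) (c i))"
    and b: "\<forall>i. b i \<in> grade C p" "\<forall>i\<ge>e. b i = 0" "z = (\<lambda>n. \<Sum>i<e. smul C (of_nat n ^ i) (b i))"
      "z' = (\<lambda>n. \<Sum>i<e. smul C (of_nat i * of_nat n ^ (i - 1)) (b i))"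
    by blast
  let ?m = "max d e"
  have pad: "(\<Sum>i<k. smul C (h i) (a i)) = (\<Sum>i<?m. smul C (h i) (a i))" if "\<forall>i\<ge>k. a i = 0" "k \<le> ?m" for k h and a :: "nat \<Rightarrow> 'b"
    using that by (intro sum.mono_neutral_left) (auto simp: vs_simps[OF s])
  show ?case
    unfolding c(3,4) b(3,4) pad[OF c(2) max.cobounded1] pad[OF b(2) max.cobounded2]
    by (rule exI[of _ ?m], rule exI[of _ "\<lambda>i. c i + b i"])
       (use c(1,2) b(1,2) in \<open>auto simp: vs_simps[OF s] sum.distrib subspace_simps[OF C]\<close>)
next
  note s = subspace_simps(1)[OF C]
  case (mul y y')
  then obtain d c where c: "\<forall>i. c i \<in> grade C p" "\<forall>i\<ge>d. c i = 0" "y = (\<lambda>n. \<Sum>i<d. smul C (of_nat n ^ i) (c i))"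
      "y' = (\<lambda>n. \<Sum>i<d. smul C (of_nat i * of_nat n ^ (i - 1)) (c i))"
    by blast
  \<comment> \<open>Multiplication by t shifts the coefficients up by one.\<close>
  define b where "b i = (case i of 0 \<Rightarrow> 0 | Suc j \<Rightarrow> c j)" for i
  have 1: "smul C (of_nat n) (y n) = (\<Sum>i<Suc d. smul C (of_nat n ^ i) (b i))" for n
    unfolding c(3) sum.lessThan_Suc_shift by (simp add: b_def vs_simps[OF s])
  have e: "of_nat n * (of_nat i * of_nat n ^ (i - 1)) = (of_nat i * of_nat n ^ i :: 'a)" for i n
    by (cases i) (simp_all add: algebra_simps)
  have 2: "y n + smul C (of_nat n) (y' n) = (\<Sum>i<Suc d. smul C (of_nat i * of_nat n ^ (i - 1)) (b i))" for n
  proof -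
    have "y n + smul C (of_nat n) (y' n) = (\<Sum>i<d. smul C (of_nat n ^ i) (c i) + smul C (of_nat n * (of_nat i * of_nat n ^ (i - 1))) (c i))"
      by (simp only: c(3,4) vs_simps(9,10)[OF s] sum.distrib)
    also have "\<dots> = (\<Sum>i<d. smul C (of_nat (Suc i) * of_nat n ^ i) (c i))"
      by (intro sum.cong refl) (simp only: vs_simps(6)[OF s, symmetric] e, simp add: algebra_simps)
    also have "\<dots> = (\<Sum>i<Suc d. smul C (of_nat i * of_nat n ^ (i - 1)) (b i))"
      unfolding sum.lessThan_Suc_shift by (simp add: b_def vs_simps(1,2)[OF s])
    finally show ?thesis .
  qed
  show ?case
    by (rule exI[of _ "Suc d"], rule exI[of _ b])
       (use c(1,2) 1 2 in \<open>auto simp: b_def subspace_simps[OF C] simp del: sum.lessThan_Suc split: nat.split\<close>)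
qed

lemma vs_cancel:
  assumes s: "vector_space s" and "s c x = 0" "c \<noteq> 0"
  shows "x = 0"
proof -
  have "x = s (1 / c) (s c x)" using assms(3) by (simp add: vs_simps[OF s])
  then show ?thesis using assms(2) by (simp add: vs_simps[OF s])
qed

text \<open>Evaluating at \<open>2n\<close> and subtracting \<open>2\<^sup>d\<close> times the value at \<open>n\<close> removes the leading coefficient.\<close>

lemma polynomial_coeffs_zero:
  fixes s :: "'k::field_char_0 \<Rightarrow> 'v \<Rightarrow> 'v::ab_group_add"
  assumes s: "vector_space s" and "\<And>n. (\<Sum>i<d. s (of_nat n ^ i) (c i)) = 0" "i < d"
  shows "c i = 0"
  using assms(2,3)
proof (induction d arbitrary: c i)
  case (Suc d)
  have "(\<Sum>i<d. s (of_nat n ^ i) (s (2 ^ i - 2 ^ d) (c i))) = 0" for n :: nat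
  proof -
    have dl: "s a x - s b x = s (a - b) x" for a b x
      using vs_simps(6)[OF s, of a "- b" x] by (simp add: vs_simps(4)[OF s])
    have "0 = (\<Sum>i<Suc d. s (of_nat (2 * n) ^ i) (c i)) - s (2 ^ d) (\<Sum>i<Suc d. s (of_nat n ^ i) (c i))"
      by (simp only: Suc.prems(1) vs_simps(1)[OF s] diff_self)
    also have "\<dots> = (\<Sum>i<Suc d. s (of_nat n ^ i * (2 ^ i - 2 ^ d)) (c i))"
      unfolding vs_simps(9,10)[OF s] sum_subtractf[symmetric] dl
      by (intro sum.cong refl arg_cong2[where f = s]) (simp add: power_mult_distrib algebra_simps)
    also have "\<dots> = (\<Sum>i<d. s (of_nat n ^ i) (s (2 ^ i - 2 ^ d) (c i)))"
      by (simp add: vs_simps(2,9)[OF s])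
    finally show ?thesis by (rule sym)
  qed
  then have *: "s (2 ^ i - 2 ^ d) (c i) = 0" if "i < d" for i
    using Suc.IH[of "\<lambda>i. s (2 ^ i - 2 ^ d) (c i)"] that by blast
  have low: "c i = 0" if "i < d" for i
  proof (rule vs_cancel[OF s *[OF that]])
    have "(2::nat) ^ i \<noteq> 2 ^ d" using that by simp
    then have "of_nat (2 ^ i) \<noteq> (of_nat (2 ^ d) :: 'k)" by (simp only: of_nat_eq_iff not_False_eq_True)
    then show "(2::'k) ^ i - 2 ^ d \<noteq> 0" by simp
  qed
  \<comment> \<open>Once the lower coefficients vanish, the value at n = 1 is the leading
    one.\<close>
  moreover have "c d = 0"
    using Suc.prems(1)[of 1] low by (simp add: vs_simps[OF s])
  ultimately show ?case using Suc.prems(2) by (cases "i = d") auto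
qed simp

text \<open>A polynomial is only given by values, so the formal derivative has to be shown to depend
  on them alone: in characteristic 0 the values at the natural numbers determine the
  coefficients.\<close>

lemma pder_unique:
  assumes C: "graded_space C" and "pder C p y y'" "pder C p y y''"
  shows "y' = y''"
proof -
  note s = subspace_simps(1)[OF C]
  \<comment> \<open>The difference of the two representations of \<open>y\<close> is identically 0,
    with formal derivative \<open>y' - y''\<close>; its coefficients vanish, and the derivative with
    them.\<close>
  have "pder C p (\<lambda>n. y n + smul C (- 1) (y n)) (\<lambda>n. y' n + smul C (- 1) (y'' n))"
    by (intro pder.add pder_scale C assms)
  then obtain d c where c: "(\<lambda>n. y n + smul C (- 1) (y n)) = (\<lambda>n. \<Sum>i<d. smul C (of_nat n ^ i) (c i))"
    "(\<lambda>n. y' n + smul C (- 1) (y'' n)) = (\<lambda>n. \<Sum>i<d. smul C (of_nat i * of_nat n ^ (i - 1)) (c i))"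
    using pder_normal_form[OF C] by blast
  have "(\<Sum>i<d. smul C (of_nat n ^ i) (c i)) = 0" for n
    using fun_cong[OF c(1), of n] by (simp add: vs_simps[OF s])
  then have "c i = 0" if "i < d" for i
    using polynomial_coeffs_zero[OF s] that by blast
  then have "y' n + smul C (- 1) (y'' n) = 0" for n
    using fun_cong[OF c(2), of n] by (simp add: vs_simps[OF s])
  then show ?thesis by (auto simp: vs_simps[OF s] fun_eq_iff)
qed

text \<open>Integration of monomials divides by \<open>Suc d\<close>, which is possible in
  characteristic 0. The value at 0 is normalised to make the start of a path controllable.\<close>

lemma pder_antiderivative:
  assumes C: "graded_space C" and "pder C p y y'"
  shows "\<exists>Y. pder C p Y y \<and> Y 0 = 0"
proof -
  note s = subspace_simps(1)[OF C]
  obtain d c where c: "\<forall>i. c i \<in> grade C p" "y = (\<lambda>n. \<Sum>i<d. smul C (of_nat n ^ i) (c i))"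
    using pder_normal_form[OF assms] by blast
  have mono: "pder C p (\<lambda>n. smul C (of_nat n ^ Suc i) x) (\<lambda>n. smul C (of_nat (Suc i) * of_nat n ^ i) x)" if x: "x \<in> grade C p" for i x
  proof (induction i)
    case 0
    from pder.mul[OF pder.const[OF x]] show ?case by (simp add: vs_simps[OF s])
  next
    case (Suc i)
    have "smul C (of_nat n ^ Suc i) x + smul C (of_nat n) (smul C (of_nat (Suc i) * of_nat n ^ i) x)
        = smul C (of_nat (Suc (Suc i)) * of_nat n ^ Suc i) x" for n
      unfolding vs_simps(9)[OF s] vs_simps(6)[OF s, symmetric] by (intro arg_cong2[where f = "smul C"]) (simp_all add: algebra_simps)
    moreover have "smul C (of_nat n) (smul C (of_nat n ^ Suc i) x) = smul C (of_nat n ^ Suc (Suc i)) x" for n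
      unfolding vs_simps(9)[OF s] by simp
    ultimately show ?case
      using pder.mul[OF Suc] by (simp only:)
  qed
  have "\<exists>Y. pder C p Y (\<lambda>n. \<Sum>i<d. smul C (of_nat n ^ i) (c i)) \<and> Y 0 = 0"
  proof (induction d)
    case 0
    then show ?case using pder.const[OF subspace_simps(2)[OF C, of p]] by (intro exI[of _ "\<lambda>n. 0"]) simp
  next
    case (Suc d)
    then obtain Y where Y: "pder C p Y (\<lambda>n. \<Sum>i<d. smul C (of_nat n ^ i) (c i))" "Y 0 = 0" by blast
    have nz: "of_nat (Suc d) \<noteq> (0 :: 'a)" by (rule of_nat_neq_0)
    have "smul C (of_nat (Suc d) * of_nat n ^ d) (smul C (1 / of_nat (Suc d)) (c d)) = smul C (of_nat n ^ d) (c d)" for n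
      using nz by (simp add: vs_simps[OF s] del: of_nat_Suc)
    then have "pder C p (\<lambda>n. Y n + smul C (of_nat n ^ Suc d) (smul C (1 / of_nat (Suc d)) (c d)))
        (\<lambda>n. (\<Sum>i<d. smul C (of_nat n ^ i) (c i)) + smul C (of_nat n ^ d) (c d))"
      using pder.add[OF Y(1) mono[of "smul C (1 / of_nat (Suc d)) (c d)" d]] c(1) subspace_simps(4)[OF C] by simp
    then show ?case
      by (intro exI[of _ "\<lambda>n. Y n + smul C (of_nat n ^ Suc d) (smul C (1 / of_nat (Suc d)) (c d))"] conjI)
         (simp_all add: Y(2) vs_simps[OF s])
  qed
  then show ?thesis using c by simp
qed

section \<open>The polynomial path algebra\<close>

definition pD :: "('k::field_char_0, 'v::ab_group_add) linf \<Rightarrow> int \<Rightarrow> (nat \<Rightarrow> 'v) \<Rightarrow> nat \<Rightarrow> 'v" where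
  "pD C p y = (THE y'. pder C p y y')"

lemma pD_eq: "graded_space C \<Longrightarrow> pder C p y y' \<Longrightarrow> pD C p y = y'"
  unfolding pD_def using pder_unique by blast

definition ev :: "nat \<Rightarrow> int \<times> (nat \<Rightarrow> 'v) \<Rightarrow> int \<times> 'v" where
  "ev n a = (fst a, snd a n)"

lemma ev_simps [simp]: "fst (ev n a) = fst a" "ev n (p, y) = (p, y n)"
  by (auto simp: ev_def)

definition ptw :: "((int \<times> 'v) list \<Rightarrow> 'w) \<Rightarrow> (int \<times> (nat \<Rightarrow> 'v)) list \<Rightarrow> nat \<Rightarrow> 'w" where
  "ptw f as = (\<lambda>n. f (map (ev n) as))"

text \<open>\<open>C\<close> tensored with k[t]. Extending brackets multilinearly over k[t] means
  evaluating them value by value.\<close>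

definition poly_ext :: "('k::field_char_0, 'v::ab_group_add) linf \<Rightarrow> ('k, nat \<Rightarrow> 'v) linf" where
  "poly_ext C = \<lparr>smul = \<lambda>c y n. smul C c (y n), grade = \<lambda>p. {y. \<exists>y'. pder C p y y'}, brk = ptw (brk C)\<rparr>"

lemma poly_ext_simps [simp]:
  "smul (poly_ext C) c y = (\<lambda>n. smul C c (y n))" "y \<in> grade (poly_ext C) p \<longleftrightarrow> (\<exists>y'. pder C p y y')" "brk (poly_ext C) = ptw (brk C)"
  by (auto simp: poly_ext_def)

lemma graded_poly_ext:
  assumes C: "graded_space C"
  shows "graded_space (poly_ext C)"
proof -
  note s = subspace_simps(1)[OF C]
  have vs: "vector_space (smul (poly_ext C))"
    by unfold_locales (auto simp: vs_simps[OF s] fun_eq_iff)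
  interpret vector_space "smul (poly_ext C)" by fact
  have "subspace (grade (poly_ext C) p)" for p
  proof (rule subspaceI)
    show "0 \<in> grade (poly_ext C) p"
      using pder.const[OF subspace_simps(2)[OF C], of p] by (auto simp: zero_fun_def)
    show "x + y \<in> grade (poly_ext C) p" if "x \<in> grade (poly_ext C) p" "y \<in> grade (poly_ext C) p" for x y
      using that pder.add unfolding poly_ext_simps plus_fun_def by blast
    show "smul (poly_ext C) c x \<in> grade (poly_ext C) p" if "x \<in> grade (poly_ext C) p" for c x
      using that pder_scale[OF C] unfolding poly_ext_simps by blast
  qed
  then show ?thesis using vs by (simp add: graded_space_def)
qed

lemma ev_letters: "graded_space C \<Longrightarrow> a \<in> letters (poly_ext C) \<Longrightarrow> ev n a \<in> letters C"
  by (cases a) (auto dest: pder_grade)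

lemma map_ev_lists:
  assumes C: "graded_space C" and as: "as \<in> lists (letters (poly_ext C))"
  shows "map (ev n) as \<in> lists (letters C)"
  using as by (induction as rule: list.induct) (simp_all add: ev_letters[OF C])

lemma dsum_pointwise: "dsum D as F n = dsum D as (\<lambda>w. F w n)"
  by (induction as arbitrary: F) auto

lemma pD_deriv:
  assumes C: "graded_space C"
  shows "is_deriv (poly_ext C) (pD C)"
proof -
  have 1: "pder C p y (pD C p y)" if "y \<in> grade (poly_ext C) p" for y p
    using that pD_eq[OF C] by auto
  have "pD C p y \<in> grade (poly_ext C) p" if "y \<in> grade (poly_ext C) p" for y p
    using pder_deriv[OF C 1[OF that]] by simp
  moreover have "lin_on (smul (poly_ext C)) (smul (poly_ext C)) (grade (poly_ext C) p) (pD C p)" for p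
    unfolding lin_on_def hom_on_def
  proof (intro conjI ballI allI subspace_simps[OF graded_poly_ext[OF C]])
    fix x y assume "x \<in> grade (poly_ext C) p" "y \<in> grade (poly_ext C) p"
    then show "pD C p (x + y) = pD C p x + pD C p y"
      using pD_eq[OF C pder.add[OF 1 1]] by (simp add: plus_fun_def)
  next
    fix c x assume "x \<in> grade (poly_ext C) p"
    then show "pD C p (smul (poly_ext C) c x) = smul (poly_ext C) c (pD C p x)"
      using pD_eq[OF C pder_scale[OF C 1]] by simp
  qed
  ultimately show ?thesis by (simp add: is_deriv_def del: poly_ext_simps)
qed

lemma pder_pD: "graded_space C \<Longrightarrow> y \<in> grade (poly_ext C) p \<Longrightarrow> pder C p y (pD C p y)"
  using pD_eq by fastforce

lemma dsum_add:
  "dsum D as (\<lambda>w. \<phi> w + \<psi> w) = dsum D as \<phi> + dsum D as \<psi>"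
  by (induction as arbitrary: \<phi> \<psi>) simp_all

lemma dsum_cong:
  assumes "is_deriv N D" "as \<in> lists (letters N)" "\<And>w. w \<in> lists (letters N) \<Longrightarrow> \<phi> w = \<psi> w"
  shows "dsum D as \<phi> = dsum D as \<psi>"
  using assms(2,3)
proof (induction as arbitrary: \<phi> \<psi> rule: list.induct)
  case (Cons a as)
  have "(fst a, D (fst a) (snd a)) \<in> letters N"
    using assms(1) Cons.prems(1) by (cases a) (auto simp: is_deriv_def)
  moreover have "dsum D as (\<lambda>w. \<phi> (a # w)) = dsum D as (\<lambda>w. \<psi> (a # w))"
    using Cons.prems by (intro Cons.IH) auto
  ultimately show ?case using Cons.prems by simp
qed simp

lemma dsum_scale:
  assumes "vector_space s"
  shows "dsum D as (\<lambda>w. s c (\<phi> w)) = s c (dsum D as \<phi>)"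
  by (induction as arbitrary: \<phi>) (simp_all add: vs_simps[OF assms])

text \<open>The product rule. The word \<open>us\<close> holds letters already fixed to constants.
  Rule induction on the first remaining letter either moves a constant into \<open>us\<close> or
  uses linearity for sums and for the factor t.\<close>

lemma pder_multilinear:
  assumes C: "graded_space C" and C': "graded_space C'" and f: "smaps d C C' f"
    and us: "us \<in> lists (letters C)" and zs: "zs \<in> lists (letters (poly_ext C))" and ne: "us \<noteq> [] \<or> zs \<noteq> []"
  shows "pder C' (total_deg us + total_deg zs + d) (\<lambda>n. f (us @ map (ev n) zs))
    (\<lambda>n. dsum (pD C) zs (\<lambda>w. f (us @ map (ev n) w)))"
  using zs us ne
proof (induction zs arbitrary: us rule: list.induct)
  case Nil
  then show ?case
    using degmapD[OF smapsD(1)[OF f], of us] pder.const[of "f us" C' "total_deg us + d"] by simp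
next
  case (Cons a zs)
  note s' = subspace_simps(1)[OF C']
  obtain p y where a: "a = (p, y)" by (cases a)
  have zs: "zs \<in> lists (letters (poly_ext C))" and y: "y \<in> grade (poly_ext C) p"
    using Cons.prems a by auto
  note us = Cons.prems(2)
  let ?q = "total_deg us + (p + total_deg zs) + d"
  let ?S = "\<lambda>x n. dsum (pD C) zs (\<lambda>w. f (us @ (p, x) # map (ev n) w))"
  have L: "lin_on (smul C) (smul C') (grade C p) (\<lambda>x. f (us @ (p, x) # map (ev n) w))"
    if "w \<in> lists (letters (poly_ext C))" for w n
    by (rule multilinD[OF smapsD(2)[OF f] us map_ev_lists[OF C that]])
  have "pder C' ?q (\<lambda>n. f (us @ (p, y n) # map (ev n) zs)) (\<lambda>n. f (us @ (p, y' n) # map (ev n) zs) + ?S (y n) n)"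
    if "pder C p y y'" for y y'
    using that
  proof induction
    case (const c)
    have "pder C' (total_deg (us @ [(p, c)]) + total_deg zs + d) (\<lambda>n. f ((us @ [(p, c)]) @ map (ev n) zs))
       (\<lambda>n. dsum (pD C) zs (\<lambda>w. f ((us @ [(p, c)]) @ map (ev n) w)))"
      by (rule Cons.IH[OF zs]) (use us const in auto)
    then show ?case
      using hom_onD(2)[OF lin_onD(1)[OF L[OF zs]]] by (simp add: add_ac)
  next
    case (add y y' z z')
    have S: "?S (y n + z n) n = ?S (y n) n + ?S (z n) n" for n
      unfolding dsum_add[symmetric]
      by (intro dsum_cong[OF pD_deriv[OF C] zs] hom_onD(4)[OF lin_onD(1)[OF L]] pder_grade[OF C add.hyps(1)] pder_grade[OF C add.hyps(2)])
    show ?case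
      using pder.add[OF add.IH]
      by (rule pder_eq)
         (auto simp: S fun_eq_iff hom_onD(4)[OF lin_onD(1)[OF L[OF zs]] pder_grade(1)[OF C add.hyps(1)] pder_grade(1)[OF C add.hyps(2)]]
           hom_onD(4)[OF lin_onD(1)[OF L[OF zs]] pder_grade(2)[OF C add.hyps(1)] pder_grade(2)[OF C add.hyps(2)]])
  next
    case (mul y y')
    note g = pder_grade[OF C mul.hyps]
    have S: "?S (smul C (of_nat n) (y n)) n = smul C' (of_nat n) (?S (y n) n)" for n
      unfolding dsum_scale[OF s', symmetric]
      by (intro dsum_cong[OF pD_deriv[OF C] zs] lin_onD(3)[OF L] g)
    show ?case
      using pder.mul[OF mul.IH]
      by (rule pder_eq)
         (auto simp: S fun_eq_iff lin_onD(3)[OF L[OF zs] g(1)] lin_onD(3)[OF L[OF zs] g(2)] vs_simps[OF s'] add_ac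
           hom_onD(4)[OF lin_onD(1)[OF L[OF zs]] g(1) subspace_simps(4)[OF C g(2)]])
  qed
  from this[OF pder_pD[OF C y]] show ?case
    by (simp add: a)
qed

lemma smaps_ptw:
  assumes C: "graded_space C" and C': "graded_space C'" and f: "smaps d C C' f"
  shows "smaps d (poly_ext C) (poly_ext C') (ptw f)"
  unfolding smaps_def
proof (intro conjI)
  show "degmap d (poly_ext C) (poly_ext C') (ptw f)"
    unfolding degmap_def ptw_def using pder_multilinear[OF C C' f, of "[]"] by auto
  show "symm (poly_ext C) (ptw f)"
    unfolding symm_def
  proof (intro ballI)
    fix us vs a b
    assume *: "us \<in> lists (letters (poly_ext C))" "vs \<in> lists (letters (poly_ext C))" "a \<in> letters (poly_ext C)" "b \<in> letters (poly_ext C)"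
    show "ptw f (us @ a # b # vs) = sg (fst a * fst b) (ptw f (us @ b # a # vs))"
    proof
      fix n
      have "f (map (ev n) us @ ev n a # ev n b # map (ev n) vs) = sg (fst (ev n a) * fst (ev n b)) (f (map (ev n) us @ ev n b # ev n a # map (ev n) vs))"
        by (intro symmD[OF smapsD(3)[OF f]] map_ev_lists[OF C] ev_letters[OF C] *)
      then show "ptw f (us @ a # b # vs) n = sg (fst a * fst b) (ptw f (us @ b # a # vs)) n"
        by (simp add: ptw_def sg_def)
    qed
  qed
  show "multilin (poly_ext C) (smul (poly_ext C')) (ptw f)"
    unfolding multilin_def
  proof (intro ballI allI)
    fix us vs p
    assume *: "us \<in> lists (letters (poly_ext C))" "vs \<in> lists (letters (poly_ext C))"
    have L: "lin_on (smul C) (smul C') (grade C p) (\<lambda>x. f (map (ev n) us @ (p, x) # map (ev n) vs))" for n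
      by (intro multilinD[OF smapsD(2)[OF f]] map_ev_lists[OF C] *)
    have g: "y n \<in> grade C p" if "y \<in> grade (poly_ext C) p" for y n
      using that pder_grade[OF C] by auto
    show "lin_on (smul (poly_ext C)) (smul (poly_ext C')) (grade (poly_ext C) p) (\<lambda>x. ptw f (us @ (p, x) # vs))"
      unfolding lin_on_def hom_on_def
    proof (intro conjI ballI allI subspace_simps[OF graded_poly_ext[OF C]])
      fix x y assume x: "x \<in> grade (poly_ext C) p" and y: "y \<in> grade (poly_ext C) p"
      show "ptw f (us @ (p, x + y) # vs) = ptw f (us @ (p, x) # vs) + ptw f (us @ (p, y) # vs)"
        using hom_onD(4)[OF lin_onD(1)[OF L] g[OF x] g[OF y]] by (auto simp: ptw_def fun_eq_iff)
    next
      fix c x assume x: "x \<in> grade (poly_ext C) p"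
      show "ptw f (us @ (p, smul (poly_ext C) c x) # vs) = smul (poly_ext C') c (ptw f (us @ (p, x) # vs))"
        using lin_onD(3)[OF L g[OF x]] by (auto simp: ptw_def fun_eq_iff)
    qed
  qed
qed

lemma ptw_commutes:
  assumes C: "graded_space C" and C': "graded_space C'" and f: "smaps d C C' f"
  shows "commutes_deriv d (poly_ext C) (pD C) (pD C') (ptw f)"
  unfolding commutes_deriv_def
proof (intro ballI impI)
  fix as assume "as \<in> lists (letters (poly_ext C))" "as \<noteq> []"
  from pD_eq[OF C' pder_multilinear[OF C C' f _ this(1), of "[]"]] this(2)
  show "pD C' (total_deg as + d) (ptw f as) = dsum (pD C) as (ptw f)"
    by (auto simp: ptw_def fun_eq_iff dsum_pointwise)
qed

lemma spl_pointwise: "spl zs F n = spl zs (\<lambda>u v. F u v n)"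
proof -
  have "hom_on UNIV (\<lambda>y. y n)" by (simp add: hom_on_def)
  from spl_hom_mset[OF this UNIV_I] show ?thesis by blast
qed

text \<open>Evaluation at a point is a degree preserving change of letters that commutes with
  pointwise operations, so the identities of \<open>C\<close> hold in \<open>poly_ext C\<close>
  point by point.\<close>

lemma coder_ptw: "coder (ptw l) zs (ptw g) n = coder l (map (ev n) zs) g"
proof -
  have "coder (ptw l) zs (ptw g) n = coder (ptw l) zs (\<lambda>W. g (map (ev n) W))"
    unfolding coder_def spl_pointwise by (auto simp: ptw_def intro!: spl_cong)
  also have "\<dots> = coder l (map (ev n) zs) g"
    by (rule coder_map) (auto simp: ptw_def)
  finally show ?thesis .
qed

lemma hat_pointwise: "hat F zs G n = hat F zs (\<lambda>W. G W n)"
proof (induction "length zs" arbitrary: zs G rule: less_induct)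
  case less
  show ?case
  proof (cases zs)
    case (Cons a bs)
    then show ?thesis
      unfolding Cons hat.simps spl_pointwise by (intro spl_cong refl less) (simp add: Cons)
  qed simp
qed

lemma hat_ptw: "hat (ptw f) zs (ptw g) n = hat f (map (ev n) zs) g"
proof -
  have "hat (ptw f) zs (ptw g) n = hat (ptw f) zs (\<lambda>W. g (map (ev n) W))"
    unfolding hat_pointwise by (simp add: ptw_def)
  also have "\<dots> = hat f (map (ev n) zs) g"
    by (rule hat_map) (auto simp: ptw_def)
  finally show ?thesis .
qed

lemma is_linf_poly_ext:
  assumes C: "is_linf C"
  shows "is_linf (poly_ext C)"
proof -
  note g = is_linfD(1)[OF C]
  have "coder (ptw (brk C)) zs (ptw (brk C)) = 0" if "zs \<in> lists (letters (poly_ext C))" for zs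
    by (rule ext) (simp add: coder_ptw is_linfD(3)[OF C map_ev_lists[OF g that]])
  then show ?thesis
    using graded_poly_ext[OF g] smaps_ptw[OF g g is_linfD(2)[OF C]] by (simp add: is_linf_def)
qed

lemma is_morph_ptw:
  assumes C: "is_linf C" and C': "is_linf C'" and f: "is_morph C C' f"
  shows "is_morph (poly_ext C) (poly_ext C') (ptw f)"
proof -
  note g = is_linfD(1)[OF C] and g' = is_linfD(1)[OF C']
  have "coder (ptw (brk C)) zs (ptw f) = hat (ptw f) zs (ptw (brk C'))" if "zs \<in> lists (letters (poly_ext C))" "zs \<noteq> []" for zs
    by (rule ext) (use is_morphD(2)[OF f map_ev_lists[OF g that(1)]] that(2) in \<open>simp add: coder_ptw hat_ptw\<close>)
  then show ?thesis
    using smaps_ptw[OF g g' is_morphD(1)[OF f]] by (simp add: is_morph_def)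
qed

text \<open>The model C[t, dt]: the derivation added to the differential is d/dt, so that t has
  differential dt.\<close>

definition path :: "('k::field_char_0, 'v::ab_group_add) linf \<Rightarrow> ('k, nat \<Rightarrow> 'v) linf" where
  "path C = dt_ext (poly_ext C) (pD C)"

lemma is_linf_path: "is_linf C \<Longrightarrow> is_linf (path C)"
  unfolding path_def
  by (intro is_linf_dt_ext is_linf_poly_ext pD_deriv) (auto simp: ptw_commutes is_linfD)

text \<open>The extension of a morphism linearly over k[t, dt]; it is used to postcompose
  homotopies.\<close>

definition path_map :: "((int \<times> 'v) list \<Rightarrow> 'w::ab_group_add) \<Rightarrow> (int \<times> (nat \<Rightarrow> 'v)) list \<Rightarrow> nat \<Rightarrow> 'w" where
  "path_map f = dt_map (ptw f)"

lemma is_morph_path_map: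
  assumes C: "is_linf C" and C': "is_linf C'" and f: "is_morph C C' f"
  shows "is_morph (path C) (path C') (path_map f)"
  unfolding path_def path_map_def
  by (intro is_morph_dt_map is_linf_poly_ext is_morph_ptw pD_deriv ptw_commutes C C' f is_linfD(1)[OF C] is_linfD(1)[OF C'] is_morphD(1)[OF f])

section \<open>Cohomology of the path object\<close>

lemma d_facts:
  assumes C: "is_linf C"
  shows "x \<in> grade C p \<Longrightarrow> brk C [(p, x)] \<in> grade C (p + 1)"
    "lin_on (smul C) (smul C) (grade C p) (\<lambda>x. brk C [(p, x)])" "hom_on (grade C p) (\<lambda>x. brk C [(p, x)])"
    "x \<in> grade C p \<Longrightarrow> brk C [(p + 1, brk C [(p, x)])] = 0"
proof -
  note l = is_linfD(2)[OF C]
  show "x \<in> grade C p \<Longrightarrow> brk C [(p, x)] \<in> grade C (p + 1)"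
    using smaps_mem[OF l, of "[(p, x)]"] by simp
  show "lin_on (smul C) (smul C) (grade C p) (\<lambda>x. brk C [(p, x)])"
    using smaps_head[OF l, of "[]" p] by simp
  then show "hom_on (grade C p) (\<lambda>x. brk C [(p, x)])" by (rule lin_onD)
  show "x \<in> grade C p \<Longrightarrow> brk C [(p + 1, brk C [(p, x)])] = 0"
    using is_linfD(3)[OF C, of "[(p, x)]"] by (simp add: coder_def apply_deg_def)
qed

lemma morph_facts:
  assumes f: "is_morph C C' f"
  shows "x \<in> grade C p \<Longrightarrow> f [(p, x)] \<in> grade C' p"
    "lin_on (smul C) (smul C') (grade C p) (\<lambda>x. f [(p, x)])" "hom_on (grade C p) (\<lambda>x. f [(p, x)])"
    "x \<in> grade C p \<Longrightarrow> f [(p + 1, brk C [(p, x)])] = brk C' [(p, f [(p, x)])]"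
proof -
  note l = is_morphD(1)[OF f]
  show "x \<in> grade C p \<Longrightarrow> f [(p, x)] \<in> grade C' p"
    using smaps_mem[OF l, of "[(p, x)]"] by simp
  show "lin_on (smul C) (smul C') (grade C p) (\<lambda>x. f [(p, x)])"
    using smaps_head[OF l, of "[]" p] by simp
  then show "hom_on (grade C p) (\<lambda>x. f [(p, x)])" by (rule lin_onD)
  show "x \<in> grade C p \<Longrightarrow> f [(p + 1, brk C [(p, x)])] = brk C' [(p, f [(p, x)])]"
    using is_morphD(2)[OF f, of "[(p, x)]"] by (simp add: coder_def apply_deg_def)
qed

lemma hom_cocycles:
  assumes C: "is_linf C"
  shows "hom_on (cocycles C p) (\<lambda>x. x)"
  using hom_onD[OF d_facts(3)[OF C, of p]] by (auto simp: hom_on_def cocycles_def)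

lemma coboundaries_iff: "x \<in> coboundaries C p \<longleftrightarrow> (\<exists>y\<in>grade C (p - 1). x = brk C [(p - 1, y)])"
  by (auto simp: coboundaries_def)

lemma hom_coboundaries:
  assumes C: "is_linf C"
  shows "hom_on (coboundaries C p) (\<lambda>x. x)"
  unfolding hom_on_def
proof (intro conjI ballI)
  note h = hom_onD[OF d_facts(3)[OF C, of "p - 1"]]
  show "0 \<in> coboundaries C p" using h(1,2) unfolding coboundaries_iff by force
  fix x assume "x \<in> coboundaries C p"
  then obtain a where a: "a \<in> grade C (p - 1)" "x = brk C [(p - 1, a)]" unfolding coboundaries_iff by blast
  show "- x \<in> coboundaries C p" using a h(5,6)[of a] unfolding coboundaries_iff by force
  fix y assume "y \<in> coboundaries C p"
  then obtain b where b: "b \<in> grade C (p - 1)" "y = brk C [(p - 1, b)]" unfolding coboundaries_iff by blast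
  show "x + y \<in> coboundaries C p" using a b h(3,4)[of a b] unfolding coboundaries_iff by force
qed simp

lemma equiv_cohomologous:
  assumes C: "is_linf C"
  shows "equiv (cocycles C p) (cohomologous C p)"
proof (rule equivI)
  note h = hom_onD[OF hom_coboundaries[OF C, of p]]
  show "cohomologous C p \<subseteq> cocycles C p \<times> cocycles C p" by (auto simp: cohomologous_def)
  show "refl_on (cocycles C p) (cohomologous C p)"
    using h(1) by (auto simp: refl_on_def cohomologous_def)
  show "sym (cohomologous C p)"
  proof (rule symI)
    fix x y assume "(x, y) \<in> cohomologous C p"
    then show "(y, x) \<in> cohomologous C p"
      using h(5)[of "x - y"] by (simp add: cohomologous_def)
  qed
  show "trans (cohomologous C p)"
  proof (rule transI)
    fix x y z assume "(x, y) \<in> cohomologous C p" "(y, z) \<in> cohomologous C p"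
    then show "(x, z) \<in> cohomologous C p"
      using h(3)[of "x - y" "y - z"] by (auto simp: cohomologous_def)
  qed
qed

lemma morph_cocycles:
  assumes C: "is_linf C" and C': "is_linf C'" and f: "is_morph C C' f"
  shows "x \<in> cocycles C p \<Longrightarrow> f [(p, x)] \<in> cocycles C' p" "x \<in> coboundaries C p \<Longrightarrow> f [(p, x)] \<in> coboundaries C' p"
proof -
  show "x \<in> cocycles C p \<Longrightarrow> f [(p, x)] \<in> cocycles C' p"
    using morph_facts(1,4)[OF f, of x p] hom_onD(2)[OF morph_facts(3)[OF f, of "p + 1"]] by (simp add: cocycles_def)
  show "x \<in> coboundaries C p \<Longrightarrow> f [(p, x)] \<in> coboundaries C' p"
    using morph_facts(1,4)[OF f, of _ "p - 1"] by (auto simp: coboundaries_iff)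
qed

lemma cohom_map_class:
  assumes C: "is_linf C" and C': "is_linf C'" and f: "is_morph C C' f" and x: "x \<in> cocycles C p"
  shows "cohom_map C' f p (cohomologous C p `` {x}) = cohomologous C' p `` {f [(p, x)]}"
proof -
  note e = equiv_cohomologous[OF C'] and fc = morph_cocycles[OF C C' f]
  have "(f [(p, x)], f [(p, y)]) \<in> cohomologous C' p" if "(x, y) \<in> cohomologous C p" for y
  proof -
    have y: "y \<in> cocycles C p" and xy: "x - y \<in> coboundaries C p" using that by (auto simp: cohomologous_def)
    have "f [(p, x - y)] = f [(p, x)] - f [(p, y)]"
      using hom_onD(10)[OF morph_facts(3)[OF f]] x y by (auto simp: cocycles_def)
    with fc(2)[OF xy] fc(1)[OF x] fc(1)[OF y] show ?thesis by (simp add: cohomologous_def)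
  qed
  moreover have "(x, x) \<in> cohomologous C p"
    using equiv_cohomologous[OF C] x by (auto simp: equiv_def refl_on_def)
  ultimately show ?thesis
    unfolding cohom_map_def using equiv_class_eq[OF e] by blast
qed

text \<open>Replaces classes by elements. As the induced map is additive, injectivity is the
  statement that its kernel is trivial.\<close>

lemma quasi_iso_iff:
  assumes C: "is_linf C" and C': "is_linf C'" and f: "is_morph C C' f"
  shows "quasi_iso C C' f \<longleftrightarrow>
    (\<forall>p. \<forall>x\<in>cocycles C p. f [(p, x)] \<in> coboundaries C' p \<longrightarrow> x \<in> coboundaries C p) \<and>
    (\<forall>p. \<forall>y\<in>cocycles C' p. \<exists>x\<in>cocycles C p. f [(p, x)] - y \<in> coboundaries C' p)"
proof -
  note e = equiv_cohomologous[OF C] and e' = equiv_cohomologous[OF C']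
  note cl = cohom_map_class[OF C C' f] and fc = morph_cocycles[OF C C' f]
  have rel: "cohomologous C p `` {x} = cohomologous C p `` {y} \<longleftrightarrow> x - y \<in> coboundaries C p"
    if "x \<in> cocycles C p" "y \<in> cocycles C p" for p x y
    using eq_equiv_class_iff[OF e that] that by (simp add: cohomologous_def)
  have rel': "cohomologous C' p `` {x} = cohomologous C' p `` {y} \<longleftrightarrow> x - y \<in> coboundaries C' p"
    if "x \<in> cocycles C' p" "y \<in> cocycles C' p" for p x y
    using eq_equiv_class_iff[OF e' that] that by (simp add: cohomologous_def)
  have inj: "inj_on (cohom_map C' f p) (cohomology C p) \<longleftrightarrow> (\<forall>x\<in>cocycles C p. f [(p, x)] \<in> coboundaries C' p \<longrightarrow> x \<in> coboundaries C p)" for p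
  proof
    assume inj: "inj_on (cohom_map C' f p) (cohomology C p)"
    show "\<forall>x\<in>cocycles C p. f [(p, x)] \<in> coboundaries C' p \<longrightarrow> x \<in> coboundaries C p"
    proof (intro ballI impI)
      fix x assume x: "x \<in> cocycles C p" "f [(p, x)] \<in> coboundaries C' p"
      have 0: "0 \<in> cocycles C p" "f [(p, 0)] = 0"
        using hom_onD(1)[OF hom_cocycles[OF C]] hom_onD(2)[OF morph_facts(3)[OF f]] by auto
      have "cohomologous C' p `` {f [(p, x)]} = cohomologous C' p `` {f [(p, 0)]}"
        using rel'[OF fc(1)[OF x(1)] fc(1)[OF 0(1)]] x(2) 0(2) by simp
      then have "cohom_map C' f p (cohomologous C p `` {x}) = cohom_map C' f p (cohomologous C p `` {0})"
        using cl[OF x(1)] cl[OF 0(1)] by simp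
      then have "cohomologous C p `` {x} = cohomologous C p `` {0}"
        using inj x(1) 0(1) by (auto simp: inj_on_def cohomology_def quotientI)
      then show "x \<in> coboundaries C p" using rel[OF x(1) 0(1)] by simp
    qed
  next
    assume *: "\<forall>x\<in>cocycles C p. f [(p, x)] \<in> coboundaries C' p \<longrightarrow> x \<in> coboundaries C p"
    show "inj_on (cohom_map C' f p) (cohomology C p)"
    proof (rule inj_onI)
      fix X Y assume "X \<in> cohomology C p" "Y \<in> cohomology C p" and eq: "cohom_map C' f p X = cohom_map C' f p Y"
      then obtain x y where x: "x \<in> cocycles C p" "X = cohomologous C p `` {x}" and y: "y \<in> cocycles C p" "Y = cohomologous C p `` {y}"
        by (auto simp: cohomology_def quotient_def)
      have "f [(p, x)] - f [(p, y)] \<in> coboundaries C' p"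
        using eq x y cl fc(1) rel' by simp
      moreover have "f [(p, x - y)] = f [(p, x)] - f [(p, y)]"
        using hom_onD(10)[OF morph_facts(3)[OF f]] x y by (auto simp: cocycles_def)
      ultimately show "X = Y"
        using * hom_onD(9)[OF hom_cocycles[OF C] x(1) y(1)] rel x y by simp
    qed
  qed
  have surj: "cohom_map C' f p ` cohomology C p = cohomology C' p \<longleftrightarrow> (\<forall>y\<in>cocycles C' p. \<exists>x\<in>cocycles C p. f [(p, x)] - y \<in> coboundaries C' p)" for p
  proof -
    have 1: "cohomology C p = (\<lambda>x. cohomologous C p `` {x}) ` cocycles C p" "cohomology C' p = (\<lambda>x. cohomologous C' p `` {x}) ` cocycles C' p"
      by (auto simp: cohomology_def quotient_def)
    have "cohom_map C' f p ` cohomology C p = (\<lambda>x. cohomologous C' p `` {f [(p, x)]}) ` cocycles C p"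
      unfolding 1 image_image using cl by auto
    moreover have "(\<lambda>x. cohomologous C' p `` {f [(p, x)]}) ` cocycles C p \<subseteq> cohomology C' p"
      unfolding 1 using fc(1) by blast
    ultimately have "cohom_map C' f p ` cohomology C p = cohomology C' p \<longleftrightarrow>
      cohomology C' p \<subseteq> (\<lambda>x. cohomologous C' p `` {f [(p, x)]}) ` cocycles C p"
      by auto
    also have "\<dots> \<longleftrightarrow> (\<forall>y\<in>cocycles C' p. \<exists>x\<in>cocycles C p. cohomologous C' p `` {y} = cohomologous C' p `` {f [(p, x)]})"
      unfolding 1(2) by (simp only: image_subset_iff image_iff)
    also have "\<dots> \<longleftrightarrow> (\<forall>y\<in>cocycles C' p. \<exists>x\<in>cocycles C p. f [(p, x)] - y \<in> coboundaries C' p)"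
      by (intro ball_cong bex_cong refl) (metis fc(1) rel')
    finally show ?thesis .
  qed
  show ?thesis
    unfolding quasi_iso_def bij_betw_def inj surj by blast
qed

text \<open>Of the quasi-isomorphism conditions one is enough: since the evaluations are left
  inverse to \<open>i\<close>, the map of \<open>i\<close> on cohomology is injective. The
  hypothesis \<open>coh\<close> makes it surjective, and then both evaluations induce its
  inverse.\<close>

lemma linf_modelI:
  assumes C: "is_linf C" and M: "is_linf M"
    and e0: "is_morph M C e0" and s0: "\<And>as. as \<in> lists (letters M) \<Longrightarrow> 2 \<le> length as \<Longrightarrow> e0 as = 0"
    and e1: "is_morph M C e1" and s1: "\<And>as. as \<in> lists (letters M) \<Longrightarrow> 2 \<le> length as \<Longrightarrow> e1 as = 0"
    and i: "is_morph C M i" and si: "\<And>as. as \<in> lists (letters C) \<Longrightarrow> 2 \<le> length as \<Longrightarrow> i as = 0"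
    and ei: "\<And>p x. x \<in> grade C p \<Longrightarrow> e0 [(p, i [(p, x)])] = x" "\<And>p x. x \<in> grade C p \<Longrightarrow> e1 [(p, i [(p, x)])] = x"
    and onto: "\<And>p a b. a \<in> grade C p \<Longrightarrow> b \<in> grade C p \<Longrightarrow> \<exists>z\<in>grade M p. e0 [(p, z)] = a \<and> e1 [(p, z)] = b"
    and coh: "\<And>p z. z \<in> cocycles M p \<Longrightarrow> \<exists>c\<in>cocycles C p. z - i [(p, c)] \<in> coboundaries M p"
  shows "linf_model C M e0 e1 i"
proof -
  note ic = morph_cocycles[OF C M i]
  have "quasi_iso C M i"
    unfolding quasi_iso_iff[OF C M i]
  proof (intro conjI allI ballI impI)
    fix p x assume x: "x \<in> cocycles C p" "i [(p, x)] \<in> coboundaries M p"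
    from morph_cocycles(2)[OF M C e0 x(2)] show "x \<in> coboundaries C p"
      using ei x(1) by (simp add: cocycles_def)
  next
    fix p z assume "z \<in> cocycles M p"
    from coh[OF this] show "\<exists>c\<in>cocycles C p. i [(p, c)] - z \<in> coboundaries M p"
      using hom_onD(5)[OF hom_coboundaries[OF M]] by (metis minus_diff_eq)
  qed
  moreover have "quasi_iso M C e" if e: "is_morph M C e" and ei: "\<And>p x. x \<in> grade C p \<Longrightarrow> e [(p, i [(p, x)])] = x" for e
    unfolding quasi_iso_iff[OF M C e]
  proof (intro conjI allI ballI impI)
    fix p z assume z: "z \<in> cocycles M p" "e [(p, z)] \<in> coboundaries C p"
    obtain c where c: "c \<in> cocycles C p" "z - i [(p, c)] \<in> coboundaries M p" using coh[OF z(1)] by blast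
    have "e [(p, z - i [(p, c)])] = e [(p, z)] - c"
      using hom_onD(10)[OF morph_facts(3)[OF e], of z p "i [(p, c)]"] z(1) ic(1)[OF c(1)] c(1) ei by (simp add: cocycles_def)
    then have "e [(p, z)] - c \<in> coboundaries C p"
      using morph_cocycles(2)[OF M C e c(2)] by simp
    from hom_onD(9)[OF hom_coboundaries[OF C] z(2) this] have "c \<in> coboundaries C p" by simp
    from hom_onD(3)[OF hom_coboundaries[OF M] c(2) ic(2)[OF this]] show "z \<in> coboundaries M p" by simp
  next
    fix p y assume y: "y \<in> cocycles C p"
    then have "e [(p, i [(p, y)])] - y = 0" using ei by (simp add: cocycles_def)
    then show "\<exists>x\<in>cocycles M p. e [(p, x)] - y \<in> coboundaries C p"
      using ic(1)[OF y] hom_onD(1)[OF hom_coboundaries[OF C]] by (intro bexI[of _ "i [(p, y)]"]) simp_all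
  qed
  moreover have "(\<lambda>z. (e0 [(p, z)], e1 [(p, z)])) ` grade M p = grade C p \<times> grade C p" for p
  proof (intro equalityI subsetI)
    fix x assume "x \<in> grade C p \<times> grade C p"
    then obtain a b where x: "x = (a, b)" "a \<in> grade C p" "b \<in> grade C p" by auto
    from onto[OF x(2,3)] show "x \<in> (\<lambda>z. (e0 [(p, z)], e1 [(p, z)])) ` grade M p"
      using x(1) by force
  qed (use morph_facts(1)[OF e0] morph_facts(1)[OF e1] in auto)
  ultimately show ?thesis
    unfolding linf_model_def strict_morphism_def linf_algebra_iff linf_morphism_iff[OF M C] linf_morphism_iff[OF C M]
    using assms by (auto simp: hwords_iff)
qed

section \<open>Evaluations, inclusion and cocycles of the path object\<close>

definition lin1 :: "(int \<Rightarrow> 'v \<Rightarrow> 'w) \<Rightarrow> (int \<times> 'v) list \<Rightarrow> 'w::zero" where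
  "lin1 \<theta> as = (case as of [a] \<Rightarrow> \<theta> (fst a) (snd a) | _ \<Rightarrow> 0)"

lemma lin1_single [simp]: "lin1 \<theta> [(p, x)] = \<theta> p x" "lin1 \<theta> [a] = \<theta> (fst a) (snd a)"
  by (auto simp: lin1_def)

lemma lin1_long: "2 \<le> length as \<Longrightarrow> lin1 \<theta> as = 0"
  by (auto simp: lin1_def split: list.split)

lemma smaps_lin1:
  assumes C': "graded_space C'"
    and \<theta>: "\<And>p. lin_on (smul C) (smul C') (grade C p) (\<theta> p)" "\<And>p x. x \<in> grade C p \<Longrightarrow> \<theta> p x \<in> grade C' p"
  shows "smaps 0 C C' (lin1 \<theta>)"
proof -
  have 2: "us \<noteq> [] \<or> vs \<noteq> [] \<Longrightarrow> lin1 \<theta> (us @ (p, x) # vs) = 0" for us vs p x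
    by (rule lin1_long) (cases us; cases vs; auto)
  have "multilin C (smul C') (lin1 \<theta>)"
    unfolding multilin_def
  proof (intro ballI allI)
    fix us vs p
    show "lin_on (smul C) (smul C') (grade C p) (\<lambda>x. lin1 \<theta> (us @ (p, x) # vs))"
    proof (cases "us = [] \<and> vs = []")
      case True
      then show ?thesis using \<theta>(1)[of p] by simp
    next
      case False
      then show ?thesis
        using 2 lin_on_const_simps(2)[OF subspace_simps(1)[OF C'] \<theta>(1)] by simp
    qed
  qed
  moreover have "degmap 0 C C' (lin1 \<theta>)"
    unfolding degmap_def lin1_def using subspace_simps(2)[OF C'] \<theta>(2) by (auto split: list.split)
  moreover have "symm C (lin1 \<theta>)"
    unfolding symm_def using lin1_long[of "us @ a # b # vs" \<theta> for us a b vs] by simp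
  ultimately show ?thesis by (simp add: smaps_def)
qed

lemma is_morph_lin1:
  assumes C: "is_linf C" and C': "is_linf C'"
    and \<theta>: "\<And>p. lin_on (smul C) (smul C') (grade C p) (\<theta> p)" "\<And>p x. x \<in> grade C p \<Longrightarrow> \<theta> p x \<in> grade C' p"
    and brk: "\<And>as. as \<in> lists (letters C) \<Longrightarrow> as \<noteq> [] \<Longrightarrow>
      \<theta> (total_deg as + 1) (brk C as) = brk C' (map (\<lambda>a. (fst a, \<theta> (fst a) (snd a))) as)"
  shows "is_morph C C' (lin1 \<theta>)"
proof (rule is_morph_strictI[OF C C' smaps_lin1[OF is_linfD(1)[OF C'] \<theta>] lin1_long])
  fix as assume as: "as \<in> lists (letters C)" "as \<noteq> []"
  have "linear_part (lin1 \<theta>) = (\<lambda>a. (fst a, \<theta> (fst a) (snd a)))"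
    by (simp add: linear_part_def fun_eq_iff)
  then show "lin1 \<theta> [(total_deg as + 1, brk C as)] = brk C' (map (linear_part (lin1 \<theta>)) as)"
    using brk[OF as] by simp
qed

text \<open>In characteristic 0 the coefficient \<open>c (Suc i)\<close> is recovered from the
  derivative by dividing by \<open>Suc i\<close>, so only the constant term can be nonzero.\<close>

lemma pder_zero:
  assumes C: "graded_space C" and y: "pder C p y (\<lambda>n. 0)"
  shows "y n = y 0"
proof -
  note s = subspace_simps(1)[OF C]
  obtain d c where c: "y = (\<lambda>n. \<Sum>i<d. smul C (of_nat n ^ i) (c i))" and
    0: "(\<lambda>n. 0) = (\<lambda>n. \<Sum>i<d. smul C (of_nat i * of_nat n ^ (i - 1)) (c i))"
    using pder_normal_form[OF C y] by blast
  show ?thesis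
  proof (cases d)
    case 0
    then show ?thesis using c by simp
  next
    case (Suc e)
    have "(\<Sum>i<e. smul C (of_nat n ^ i) (smul C (of_nat (Suc i)) (c (Suc i)))) = 0" for n
      using fun_cong[OF 0, of n] unfolding Suc sum.lessThan_Suc_shift
      by (simp add: vs_simps(2,9)[OF s] mult.commute del: of_nat_Suc)
    from polynomial_coeffs_zero[OF s this] have "c (Suc i) = 0" if "i < e" for i
      using vs_cancel[OF s _ of_nat_neq_0] that by blast
    then have "y n = smul C 1 (c 0)" for n
      unfolding c Suc sum.lessThan_Suc_shift by (simp add: vs_simps(1)[OF s])
    then show ?thesis by simp
  qed
qed

definition peval :: "nat \<Rightarrow> (int \<times> (nat \<Rightarrow> 'v)) list \<Rightarrow> 'v::zero" where
  "peval j = lin1 (\<lambda>p z. q0 z j)"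

definition pincl :: "(int \<times> 'v) list \<Rightarrow> nat \<Rightarrow> 'v::zero" where
  "pincl = lin1 (\<lambda>p x. mk (\<lambda>n. x) (\<lambda>n. 0))"

lemma peval_simps [simp]: "peval j [(p, z)] = q0 z j"
  by (simp add: peval_def)

lemma pincl_simps [simp]: "pincl [(p, x)] = mk (\<lambda>n. x) (\<lambda>n. 0)"
  by (simp add: pincl_def)

lemma peval_long: "2 \<le> length as \<Longrightarrow> peval j as = 0"
  by (simp add: peval_def lin1_long)

lemma path_grade: "z \<in> grade (path C) p \<longleftrightarrow> (\<exists>y'. pder C p (q0 z) y') \<and> (\<exists>w'. pder C (p - 1) (q1 z) w')"
  by (simp add: path_def)

lemma path_brk: "brk (path C) zs = mk (ptw (brk C) (map m0 zs)) (dpart (pD C) zs - ins zs (ptw (brk C)))"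
  by (simp add: path_def brk_dt_ext)

lemma path_brk_single: "brk (path C) [(p, z)] = mk (\<lambda>n. brk C [(p, q0 z n)]) (\<lambda>n. pD C p (q0 z) n - brk C [(p - 1, q1 z n)])"
  by (rule q_eqI) (auto simp: path_brk ptw_def fun_eq_iff)

lemma is_morph_peval:
  assumes C: "is_linf C"
  shows "is_morph (path C) C (peval j)"
  unfolding peval_def
proof (rule is_morph_lin1[OF is_linf_path[OF C] C])
  note g = is_linfD(1)[OF C]
  fix p x
  show "lin_on (smul (path C)) (smul C) (grade (path C) p) (\<lambda>z. q0 z j)"
    unfolding lin_on_def hom_on_def
  proof (intro conjI ballI allI subspace_simps[OF is_linfD(1)[OF is_linf_path[OF C]]])
  qed (simp_all add: path_def)
  show "x \<in> grade (path C) p \<Longrightarrow> q0 x j \<in> grade C p"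
    using pder_grade(1)[OF g] by (auto simp: path_grade)
next
  fix zs
  show "q0 (brk (path C) zs) j = brk C (map (\<lambda>a. (fst a, q0 (snd a) j)) zs)"
    by (simp add: path_brk ptw_def o_def ev_def m0_def)
qed

lemma map_lists: "as \<in> lists A \<Longrightarrow> (\<And>a. a \<in> A \<Longrightarrow> r a \<in> B) \<Longrightarrow> map r as \<in> lists B"
  by (induction as rule: list.induct) auto

text \<open>Constant paths have no dt-part, so each term of \<open>ins\<close> has a zero
  letter.\<close>

lemma ins_pincl:
  assumes "multihom (poly_ext C) f" "graded_space C" "as \<in> lists (letters C)"
  shows "ins (map (\<lambda>a. (fst a, mk (\<lambda>n. snd a) (\<lambda>n. 0))) as) f = 0"
  using assms(3,1)
proof (induction as arbitrary: f rule: list.induct)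
  case (Cons a as)
  let ?i = "\<lambda>a :: int \<times> 'b. (fst a, mk (\<lambda>n. snd a) (\<lambda>n. 0))"
  have L: "m0 (?i a) \<in> letters (poly_ext C)" if "a \<in> letters C" for a
    using that pder.const[of "snd a" C "fst a"] by (cases a) auto
  have as: "as \<in> lists (letters C)" using Cons.prems(1) by auto
  have "map m0 (map ?i as) \<in> lists (letters (poly_ext C))"
    unfolding map_map o_def by (rule map_lists[OF as L])
  from hom_onD(2)[OF multihom_head[OF Cons.prems(2) this]]
  have "f ((fst a - 1, \<lambda>n. 0) # map m0 (map ?i as)) = 0" by (simp add: zero_fun_def)
  moreover have "ins (map ?i as) (\<lambda>w. f (m0 (?i a) # w)) = 0"
    using Cons.prems by (intro Cons.IH multihom_Cons[OF Cons.prems(2)] L) auto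
  ultimately show ?case by simp
qed simp

lemma is_morph_pincl:
  assumes C: "is_linf C"
  shows "is_morph C (path C) pincl"
  unfolding pincl_def
proof (rule is_morph_lin1[OF C is_linf_path[OF C]])
  note g = is_linfD(1)[OF C] and s = is_linfD(4)[OF C]
  fix p and x :: 'b
  show "lin_on (smul C) (smul (path C)) (grade C p) (\<lambda>x. mk (\<lambda>n. x) (\<lambda>n. 0))"
  proof -
    have "mk (\<lambda>n. x + y) (\<lambda>n. 0) = mk (\<lambda>n. x) (\<lambda>n. 0) + mk (\<lambda>n. y) (\<lambda>n. 0)" for x y :: 'b
      by (rule q_eqI) (simp_all add: fun_eq_iff)
    moreover have "mk (\<lambda>n. smul C c x) (\<lambda>n. 0) = smul (path C) c (mk (\<lambda>n. x) (\<lambda>n. 0))" for c x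
      by (rule q_eqI) (simp_all add: path_def fun_eq_iff vs_simps[OF s])
    ultimately show ?thesis
      unfolding lin_on_def hom_on_def using subspace_simps[OF g] by simp
  qed
  show "x \<in> grade C p \<Longrightarrow> mk (\<lambda>n. x) (\<lambda>n. 0) \<in> grade (path C) p"
    using pder.const[of x C p] pder.const[OF subspace_simps(2)[OF g], of "p - 1"] by (auto simp: path_grade)
next
  note g = is_linfD(1)[OF C]
  fix as assume as: "as \<in> lists (letters C)" "as \<noteq> []"
  let ?i = "\<lambda>a :: int \<times> 'b. (fst a, mk (\<lambda>n. snd a) (\<lambda>n. 0))"
  have "map (ev n) (map m0 (map ?i as)) = as" for n
    by (induction as) (simp_all add: ev_def m0_def)
  moreover have "dpart (pD C) (map ?i as) = 0"
  proof (cases "\<exists>a. as = [a]")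
    case True
    then obtain a where a: "as = [a]" by blast
    then have "pD C (fst a) (\<lambda>n. snd a) = (\<lambda>n. 0)"
      using as by (intro pD_eq[OF g] pder.const) (cases a, auto)
    then show ?thesis using a by (simp add: dpart_def zero_fun_def)
  qed (auto simp: dpart_def split: list.split)
  ultimately show "mk (\<lambda>n. brk C as) (\<lambda>n. 0) = brk (path C) (map ?i as)"
    using ins_pincl[OF smapsD(4)[OF smaps_ptw[OF g g is_linfD(2)[OF C]]] g as(1)]
    by (simp add: path_brk ptw_def zero_fun_def)
qed

text \<open>A cocycle y + dt w satisfies d y = 0 and y' = d w. For the antiderivative W of w with
  W(0) = 0, the path y - d W has zero derivative, hence equals the constant y(0), and W bounds the
  difference. That the bounding path starts at 0 is used in the homotopy fibre.\<close>

lemma path_cocycle: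
  assumes C: "is_linf C" and z: "z \<in> cocycles (path C) p"
  shows "\<exists>m\<in>grade (path C) (p - 1). z - pincl [(p, q0 z 0)] = brk (path C) [(p - 1, m)] \<and> q0 m 0 = 0"
    "q0 z n \<in> cocycles C p"
proof -
  note g = is_linfD(1)[OF C] and s = is_linfD(4)[OF C]
  obtain y' w' where y': "pder C p (q0 z) y'" and w': "pder C (p - 1) (q1 z) w'"
    using z by (auto simp: cocycles_def path_grade)
  have "mk (\<lambda>n. brk C [(p, q0 z n)]) (\<lambda>n. pD C p (q0 z) n - brk C [(p - 1, q1 z n)]) = 0"
    using z by (simp add: cocycles_def path_brk_single)
  then have "q0 (mk (\<lambda>n. brk C [(p, q0 z n)]) (\<lambda>n. pD C p (q0 z) n - brk C [(p - 1, q1 z n)])) = q0 0"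
    "q1 (mk (\<lambda>n. brk C [(p, q0 z n)]) (\<lambda>n. pD C p (q0 z) n - brk C [(p - 1, q1 z n)])) = q1 0" by simp_all
  then have 0: "brk C [(p, q0 z n)] = 0" and 1: "y' n = brk C [(p - 1, q1 z n)]" for n
    using pD_eq[OF g y'] by (simp_all add: fun_eq_iff)
  show "q0 z n \<in> cocycles C p" using pder_grade(1)[OF g y'] 0 by (simp add: cocycles_def)
  obtain W where W: "pder C (p - 1) W (q1 z)" "W 0 = 0" using pder_antiderivative[OF g w'] by blast
  have BW: "pder C p (\<lambda>n. brk C [(p - 1, W n)]) (\<lambda>n. brk C [(p - 1, q1 z n)])"
    using pder_multilinear[OF g g is_linfD(2)[OF C], of "[]" "[(p - 1, W)]"] W(1) pD_eq[OF g W(1)] by auto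
  have "pder C p (\<lambda>n. q0 z n + smul C (- 1) (brk C [(p - 1, W n)])) (\<lambda>n. y' n + smul C (- 1) (brk C [(p - 1, q1 z n)]))"
    by (intro pder.add pder_scale g BW y')
  moreover have "(\<lambda>n. y' n + smul C (- 1) (brk C [(p - 1, q1 z n)])) = (\<lambda>n. 0)"
    using 1 by (simp add: vs_simps[OF s])
  ultimately have "pder C p (\<lambda>n. q0 z n + smul C (- 1) (brk C [(p - 1, W n)])) (\<lambda>n. 0)" by simp
  from pder_zero[OF g this] have 2: "q0 z n - brk C [(p - 1, W n)] = q0 z 0 - brk C [(p - 1, 0)]" for n
    using W(2) by (simp add: vs_simps[OF s])
  have B0: "brk C [(q, 0)] = 0" for q using hom_onD(2)[OF d_facts(3)[OF C]] .
  have 3: "q0 z n - q0 z 0 = brk C [(p - 1, W n)]" for n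
    using 2[of n] unfolding B0 by (simp add: diff_eq_eq add.commute)
  let ?m = "mk W (\<lambda>n. 0)"
  have "z - pincl [(p, q0 z 0)] = brk (path C) [(p - 1, ?m)]"
  proof (rule q_eqI)
    show "q0 (z - pincl [(p, q0 z 0)]) = q0 (brk (path C) [(p - 1, ?m)])"
      by (simp add: path_brk_single fun_eq_iff 3)
    show "q1 (z - pincl [(p, q0 z 0)]) = q1 (brk (path C) [(p - 1, ?m)])"
      using B0 pD_eq[OF g W(1)] by (simp add: path_brk_single fun_eq_iff)
  qed
  moreover have "?m \<in> grade (path C) (p - 1)"
    using W(1) pder.const[OF subspace_simps(2)[OF g], of "p - 1 - 1"] by (auto simp: path_grade)
  ultimately show "\<exists>m\<in>grade (path C) (p - 1). z - pincl [(p, q0 z 0)] = brk (path C) [(p - 1, m)] \<and> q0 m 0 = 0"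
    using W(2) by (intro bexI[of _ ?m]) simp_all
qed

text \<open>The affine path from \<open>a\<close> to \<open>b\<close>. It gives joint surjectivity
  of the two evaluations and serves later to correct the end of a path at 1 without touching the one
  at 0.\<close>

definition pline :: "('k::field_char_0, 'v::ab_group_add) linf \<Rightarrow> 'v \<Rightarrow> 'v \<Rightarrow> nat \<Rightarrow> 'v" where
  "pline C a b = mk (\<lambda>n. a + smul C (of_nat n) (b - a)) (\<lambda>n. 0)"

lemma pline:
  assumes C: "graded_space C" and "a \<in> grade C p" "b \<in> grade C p"
  shows "pline C a b \<in> grade (path C) p" "q0 (pline C a b) 0 = a" "q0 (pline C a b) 1 = b"
proof -
  note s = subspace_simps(1)[OF C]
  have "pder C p (\<lambda>n. a + smul C (of_nat n) (b - a)) (\<lambda>n. 0 + ((b - a) + smul C (of_nat n) 0))"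
    by (intro pder.add pder.const pder.mul subspace_simps[OF C] assms)
  then show "pline C a b \<in> grade (path C) p"
    using pder.const[OF subspace_simps(2)[OF C], of "p - 1"] by (auto simp: path_grade pline_def)
  show "q0 (pline C a b) 0 = a" "q0 (pline C a b) 1 = b" by (simp_all add: pline_def vs_simps[OF s])
qed

lemma linf_model_path:
  assumes C: "is_linf C"
  shows "linf_model C (path C) (peval 0) (peval 1) pincl"
proof (rule linf_modelI[OF C is_linf_path[OF C] is_morph_peval[OF C] _ is_morph_peval[OF C] _ is_morph_pincl[OF C]])
  show "\<exists>z\<in>grade (path C) p. peval 0 [(p, z)] = a \<and> peval 1 [(p, z)] = b" if "a \<in> grade C p" "b \<in> grade C p" for p a b
    using pline[OF is_linfD(1)[OF C] that] by auto
  show "\<exists>c\<in>cocycles C p. z - pincl [(p, c)] \<in> coboundaries (path C) p" if "z \<in> cocycles (path C) p" for p z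
    using path_cocycle[OF C that] unfolding coboundaries_iff by blast
qed (simp_all add: peval_long pincl_def lin1_long)

section \<open>Gluing of models\<close>

lemma smaps_cong:
  assumes f: "smaps d C C' f" and eq: "\<And>as. as \<in> lists (letters C) \<Longrightarrow> as \<noteq> [] \<Longrightarrow> f as = g as"
  shows "smaps d C C' g"
  unfolding smaps_def
proof (intro conjI)
  show "degmap d C C' g"
    using smaps_mem[OF f] eq by (simp add: degmap_def)
  show "multilin C (smul C') g"
    unfolding multilin_def
  proof (intro ballI allI)
    fix us vs p assume *: "us \<in> lists (letters C)" "vs \<in> lists (letters C)"
    have "g (us @ (p, x) # vs) = f (us @ (p, x) # vs)" if "x \<in> grade C p" for x
      using * that by (intro eq[symmetric]) auto
    then show "lin_on (smul C) (smul C') (grade C p) (\<lambda>x. g (us @ (p, x) # vs))"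
      using multilinD[OF smapsD(2)[OF f] *, of p] by (simp add: lin_on_def hom_on_def)
  qed
  show "symm C g"
    unfolding symm_def
  proof (intro ballI)
    fix us vs a b assume *: "us \<in> lists (letters C)" "vs \<in> lists (letters C)" "a \<in> letters C" "b \<in> letters C"
    have "f (us @ a # b # vs) = g (us @ a # b # vs)" "f (us @ b # a # vs) = g (us @ b # a # vs)"
      using * by (intro eq; simp)+
    with symmD[OF smapsD(3)[OF f] *] show "g (us @ a # b # vs) = sg (fst a * fst b) (g (us @ b # a # vs))"
      by simp
  qed
qed

lemma is_morph_cong:
  assumes C: "is_linf C" and f: "is_morph C C' f"
    and eq: "\<And>as. as \<in> lists (letters C) \<Longrightarrow> as \<noteq> [] \<Longrightarrow> f as = g as"
  shows "is_morph C C' g"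
  unfolding is_morph_def
proof (intro conjI ballI impI)
  show "smaps 0 C C' g" by (rule smaps_cong[OF is_morphD(1)[OF f] eq])
  fix as assume as: "as \<in> lists (letters C)" "as \<noteq> []"
  have "coder (brk C) as g = coder (brk C) as f"
    by (rule coder_cong[OF is_linfD(5)[OF C] as(1)]) (simp add: eq)
  also have "\<dots> = hat f as (brk C')" by (rule is_morphD(2)[OF f as])
  also have "\<dots> = hat g as (brk C')"
    by (rule hat_cong_map[OF smapsD(1)[OF is_morphD(1)[OF f]] as(1) eq])
  finally show "coder (brk C) as g = hat g as (brk C')" .
qed

lemma smaps_map:
  assumes C': "graded_space C'" and D: "graded_space D"
    and \<theta>: "\<And>p. lin_on (smul C) (smul C') (grade C p) (\<theta> p)" "\<And>p x. x \<in> grade C p \<Longrightarrow> \<theta> p x \<in> grade C' p"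
    and f: "smaps d C' D f"
  shows "smaps d C D (\<lambda>as. f (map (\<lambda>a. (fst a, \<theta> (fst a) (snd a))) as))"
proof (rule smaps_cong[OF smaps_comp[OF D smaps_lin1[OF C' \<theta>] f]])
  fix as assume "as \<in> lists (letters C)"
  from hat_strict[OF smapsD(1)[OF smaps_lin1[OF C' \<theta>]] lin1_long smapsD(4)[OF f] this]
  have "hat (lin1 \<theta>) as f = f (map (linear_part (lin1 \<theta>)) as)" by simp
  moreover have "linear_part (lin1 \<theta>) = (\<lambda>a. (fst a, \<theta> (fst a) (snd a)))"
    by (simp add: linear_part_def fun_eq_iff)
  ultimately show "hat (lin1 \<theta>) as f = f (map (\<lambda>a. (fst a, \<theta> (fst a) (snd a))) as)" by simp
qed

lemma strict_brk:
  assumes C: "is_linf C" and C': "is_linf C'" and f: "is_morph C C' f"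
    and strict: "\<And>as. as \<in> lists (letters C) \<Longrightarrow> 2 \<le> length as \<Longrightarrow> f as = 0"
    and as: "as \<in> lists (letters C)" "as \<noteq> []"
  shows "f [(total_deg as + 1, brk C as)] = brk C' (map (linear_part f) as)"
  using is_morphD(2)[OF f as] coder_into_strict[OF is_linfD(5)[OF C] as strict]
    hat_strict[OF smapsD(1)[OF is_morphD(1)[OF f]] strict smapsD(4)[OF is_linfD(2)[OF C']] as(1)] by simp

definition n1 :: "int \<times> (nat \<Rightarrow> 'w) \<Rightarrow> int \<times> (nat \<Rightarrow> 'w)" where "n1 a = (fst a, q1 (snd a))"

lemma n1_simps [simp]: "fst (n1 a) = fst a" "n1 (p, z) = (p, q1 z)"
  by (auto simp: n1_def)

text \<open>The pullback of \<open>M1\<close> and \<open>M2\<close> over the common target of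
  \<open>e\<close> and \<open>e'\<close>, with componentwise brackets; the pair is interleaved into
  one sequence so that the type of models is kept.\<close>

definition glue ::
  "('k, nat \<Rightarrow> 'w::ab_group_add) linf \<Rightarrow> ('k, nat \<Rightarrow> 'w) linf \<Rightarrow> ((int \<times> (nat \<Rightarrow> 'w)) list \<Rightarrow> 'v)
    \<Rightarrow> ((int \<times> (nat \<Rightarrow> 'w)) list \<Rightarrow> 'v) \<Rightarrow> ('k, nat \<Rightarrow> 'w) linf" where
  "glue M1 M2 e e' = \<lparr>smul = \<lambda>c z. mk (smul M1 c (q0 z)) (smul M2 c (q1 z)),
     grade = \<lambda>p. {z. q0 z \<in> grade M1 p \<and> q1 z \<in> grade M2 p \<and> e [(p, q0 z)] = e' [(p, q1 z)]},
     brk = \<lambda>zs. mk (brk M1 (map m0 zs)) (brk M2 (map n1 zs))\<rparr>"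

lemma glue_simps [simp]:
  "q0 (smul (glue M1 M2 e e') c z) = smul M1 c (q0 z)" "q1 (smul (glue M1 M2 e e') c z) = smul M2 c (q1 z)"
  "z \<in> grade (glue M1 M2 e e') p \<longleftrightarrow> q0 z \<in> grade M1 p \<and> q1 z \<in> grade M2 p \<and> e [(p, q0 z)] = e' [(p, q1 z)]"
  "brk (glue M1 M2 e e') zs = mk (brk M1 (map m0 zs)) (brk M2 (map n1 zs))"
  by (auto simp: glue_def)

locale gluing =
  fixes C :: "('k::field_char_0, 'v::ab_group_add) linf" and M1 M2 :: "('k, nat \<Rightarrow> 'w::ab_group_add) linf"
    and e e' :: "(int \<times> (nat \<Rightarrow> 'w)) list \<Rightarrow> 'v"
  assumes C: "is_linf C" and M1: "is_linf M1" and M2: "is_linf M2"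
    and e: "is_morph M1 C e" and se: "\<And>as. as \<in> lists (letters M1) \<Longrightarrow> 2 \<le> length as \<Longrightarrow> e as = 0"
    and e': "is_morph M2 C e'" and se': "\<And>as. as \<in> lists (letters M2) \<Longrightarrow> 2 \<le> length as \<Longrightarrow> e' as = 0"
begin

abbreviation "G \<equiv> glue M1 M2 e e'"

lemmas g1 = is_linfD(1)[OF M1]
lemmas g2 = is_linfD(1)[OF M2]

lemma graded_glue: "graded_space G"
proof -
  note s = subspace_simps(1)[OF g1] and s' = subspace_simps(1)[OF g2]
  have vs: "vector_space (smul G)"
    by (unfold_locales; rule q_eqI; simp add: vs_simps[OF s] vs_simps[OF s'])
  interpret vector_space "smul G" by fact
  have "subspace (grade G p)" for p
  proof (rule subspaceI)
    note h = hom_onD[OF morph_facts(3)[OF e, of p]] and h' = hom_onD[OF morph_facts(3)[OF e', of p]]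
    show "0 \<in> grade G p"
      using h(1,2) h'(1,2) by simp
    show "x + y \<in> grade G p" if "x \<in> grade G p" "y \<in> grade G p" for x y
      using that h(3,4)[of "q0 x" "q0 y"] h'(3,4)[of "q1 x" "q1 y"] by simp
    show "smul G c x \<in> grade G p" if "x \<in> grade G p" for c x
      using that lin_onD(2,3)[OF morph_facts(2)[OF e, of p], of "q0 x" c] lin_onD(2,3)[OF morph_facts(2)[OF e', of p], of "q1 x" c] by simp
  qed
  then show ?thesis using vs by (simp add: graded_space_def)
qed

lemma lin_on_glue:
  "lin_on (smul G) (smul M1) (grade G p) q0" "lin_on (smul G) (smul M2) (grade G p) q1"
  unfolding lin_on_def hom_on_def
  by (intro conjI ballI allI subspace_simps[OF graded_glue]; simp)+

lemma letters_glue: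
  assumes "a \<in> letters G"
  shows "m0 a \<in> letters M1" "n1 a \<in> letters M2" "linear_part e (m0 a) = linear_part e' (n1 a)"
  using assms by (cases a; simp add: linear_part_def)+

lemma lists_glue:
  assumes "zs \<in> lists (letters G)"
  shows "map m0 zs \<in> lists (letters M1)" "map n1 zs \<in> lists (letters M2)"
    "map (linear_part e) (map m0 zs) = map (linear_part e') (map n1 zs)"
proof -
  show "map m0 zs \<in> lists (letters M1)" by (rule map_lists[OF assms letters_glue(1)])
  show "map n1 zs \<in> lists (letters M2)" by (rule map_lists[OF assms letters_glue(2)])
  show "map (linear_part e) (map m0 zs) = map (linear_part e') (map n1 zs)"
    using assms by (induction zs rule: list.induct) (simp_all add: letters_glue(3))
qed

lemma smaps_glue:
  assumes f: "smaps d B M1 f" and f': "smaps d B M2 f'"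
    and eq: "\<And>as. as \<in> lists (letters B) \<Longrightarrow> as \<noteq> [] \<Longrightarrow> e [(total_deg as + d, f as)] = e' [(total_deg as + d, f' as)]"
  shows "smaps d B G (\<lambda>as. mk (f as) (f' as))"
  unfolding smaps_def
proof (intro conjI)
  show "degmap d B G (\<lambda>as. mk (f as) (f' as))"
    using smaps_mem[OF f] smaps_mem[OF f'] eq by (simp add: degmap_def)
  show "multilin B (smul G) (\<lambda>as. mk (f as) (f' as))"
    unfolding multilin_def
  proof (intro ballI allI)
    fix us vs p assume *: "us \<in> lists (letters B)" "vs \<in> lists (letters B)"
    show "lin_on (smul B) (smul G) (grade B p) (\<lambda>x. mk (f (us @ (p, x) # vs)) (f' (us @ (p, x) # vs)))"
      using multilinD[OF smapsD(2)[OF f] *, of p] multilinD[OF smapsD(2)[OF f'] *, of p]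
      unfolding lin_on_def hom_on_def by (auto intro: q_eqI)
  qed
  show "symm B (\<lambda>as. mk (f as) (f' as))"
    unfolding symm_def
  proof (intro ballI)
    fix us vs a b
    assume *: "us \<in> lists (letters B)" "vs \<in> lists (letters B)" "a \<in> letters B" "b \<in> letters B"
    have "mk (sg n x) (sg n y) = sg n (mk x y)" for n x y
      by (auto simp: sg_def intro: q_eqI)
    then show "mk (f (us @ a # b # vs)) (f' (us @ a # b # vs)) = sg (fst a * fst b) (mk (f (us @ b # a # vs)) (f' (us @ b # a # vs)))"
      unfolding symmD[OF smapsD(3)[OF f] *] symmD[OF smapsD(3)[OF f'] *] .
  qed
qed

text \<open>Strictness of \<open>e\<close> and \<open>e'\<close> keeps the pullback closed under
  brackets: both components of a bracket are sent to the bracket of the common images. The relations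
  then hold in each component.\<close>

lemma is_linf_glue: "is_linf G"
  unfolding is_linf_def
proof (intro conjI ballI)
  show "graded_space G" by (rule graded_glue)
  have m: "(\<lambda>a. (fst a, q0 (snd a))) = (m0 :: int \<times> (nat \<Rightarrow> 'w) \<Rightarrow> _)" "(\<lambda>a. (fst a, q1 (snd a))) = (n1 :: int \<times> (nat \<Rightarrow> 'w) \<Rightarrow> _)"
    by (auto simp: m0_def n1_def)
  have 1: "smaps 1 G M1 (\<lambda>zs. brk M1 (map m0 zs))"
    using smaps_map[OF g1 g1 lin_on_glue(1) _ is_linfD(2)[OF M1]] by (simp add: m)
  have 2: "smaps 1 G M2 (\<lambda>zs. brk M2 (map n1 zs))"
    using smaps_map[OF g2 g2 lin_on_glue(2) _ is_linfD(2)[OF M2]] by (simp add: m)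
  have "smaps 1 G G (\<lambda>zs. mk (brk M1 (map m0 zs)) (brk M2 (map n1 zs)))"
  proof (rule smaps_glue[OF 1 2])
    fix zs assume zs: "zs \<in> lists (letters G)" "zs \<noteq> []"
    have "total_deg (map n1 zs) = total_deg zs" by (rule total_deg_map) simp
    then show "e [(total_deg zs + 1, brk M1 (map m0 zs))] = e' [(total_deg zs + 1, brk M2 (map n1 zs))]"
      using strict_brk[OF M1 C e se lists_glue(1)[OF zs(1)]] strict_brk[OF M2 C e' se' lists_glue(2)[OF zs(1)]] zs(2) lists_glue(3)[OF zs(1)]
      by (simp del: map_map)
  qed
  then show "smaps 1 G G (brk G)" by (rule smaps_cong) simp
  fix zs assume zs: "zs \<in> lists (letters G)"
  show "coder (brk G) zs (brk G) = 0"
  proof (rule q_eqI)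
    have "coder (brk G) zs (\<lambda>W. brk M1 (map m0 W)) = coder (brk M1) (map m0 zs) (brk M1)" by (rule coder_map) auto
    then show "q0 (coder (brk G) zs (brk G)) = q0 0"
      using is_linfD(3)[OF M1 lists_glue(1)[OF zs]] by (simp add: hom_q_coder)
    have "coder (brk G) zs (\<lambda>W. brk M2 (map n1 W)) = coder (brk M2) (map n1 zs) (brk M2)" by (rule coder_map) auto
    then show "q1 (coder (brk G) zs (brk G)) = q1 0"
      using is_linfD(3)[OF M2 lists_glue(2)[OF zs]] by (simp add: hom_q_coder)
  qed
qed

lemma is_morph_glue:
  assumes f: "is_morph B M1 f" and f': "is_morph B M2 f'"
    and eq: "\<And>as. as \<in> lists (letters B) \<Longrightarrow> as \<noteq> [] \<Longrightarrow> e [(total_deg as, f as)] = e' [(total_deg as, f' as)]"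
  shows "is_morph B G (\<lambda>as. mk (f as) (f' as))"
  unfolding is_morph_def
proof (intro conjI ballI impI)
  let ?h = "\<lambda>as. mk (f as) (f' as)"
  show "smaps 0 B G ?h"
    by (rule smaps_glue[OF is_morphD(1)[OF f] is_morphD(1)[OF f']]) (simp add: eq)
  fix as assume as: "as \<in> lists (letters B)" "as \<noteq> []"
  show "coder (brk B) as ?h = hat ?h as (brk G)"
  proof (rule q_eqI)
    have "hat ?h as (\<lambda>W. brk M1 (map m0 W)) = hat f (map (\<lambda>a. a) as) (brk M1)" by (rule hat_map) auto
    then show "q0 (coder (brk B) as ?h) = q0 (hat ?h as (brk G))"
      using is_morphD(2)[OF f as] by (simp add: hom_q_coder hom_q_hat)
    have "hat ?h as (\<lambda>W. brk M2 (map n1 W)) = hat f' (map (\<lambda>a. a) as) (brk M2)" by (rule hat_map) auto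
    then show "q1 (coder (brk B) as ?h) = q1 (hat ?h as (brk G))"
      using is_morphD(2)[OF f' as] by (simp add: hom_q_coder hom_q_hat)
  qed
qed

end

section \<open>Models and the homotopy relation\<close>

lemma hwords_strict:
  "\<forall>as\<in>hwords C. 2 \<le> length as \<longrightarrow> f as = 0 \<Longrightarrow> as \<in> lists (letters C) \<Longrightarrow> 2 \<le> length as \<Longrightarrow> f as = 0"
  by (cases "as = []") (simp_all add: hwords_iff)

lemma linf_modelD:
  assumes C: "is_linf C" and m: "linf_model C M e0 e1 i"
  shows "is_linf M" "is_morph M C e0" "is_morph M C e1" "is_morph C M i"
    "\<And>as. as \<in> lists (letters M) \<Longrightarrow> 2 \<le> length as \<Longrightarrow> e0 as = 0"
    "\<And>as. as \<in> lists (letters M) \<Longrightarrow> 2 \<le> length as \<Longrightarrow> e1 as = 0"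
    "\<And>as. as \<in> lists (letters C) \<Longrightarrow> 2 \<le> length as \<Longrightarrow> i as = 0"
    "\<And>p x. x \<in> grade C p \<Longrightarrow> e0 [(p, i [(p, x)])] = x" "\<And>p x. x \<in> grade C p \<Longrightarrow> e1 [(p, i [(p, x)])] = x"
    "\<And>p a b. a \<in> grade C p \<Longrightarrow> b \<in> grade C p \<Longrightarrow> \<exists>z\<in>grade M p. e0 [(p, z)] = a \<and> e1 [(p, z)] = b"
    "\<And>p z. z \<in> cocycles M p \<Longrightarrow> \<exists>c\<in>cocycles C p. z - i [(p, c)] \<in> coboundaries M p"
proof -
  show M: "is_linf M" using m by (simp add: linf_model_def linf_algebra_iff)
  show "is_morph M C e0" "is_morph M C e1" and i: "is_morph C M i"
    using m by (simp_all add: linf_model_def strict_morphism_def linf_morphism_iff[OF M C] linf_morphism_iff[OF C M])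
  show "\<And>as. as \<in> lists (letters M) \<Longrightarrow> 2 \<le> length as \<Longrightarrow> e0 as = 0"
    "\<And>as. as \<in> lists (letters M) \<Longrightarrow> 2 \<le> length as \<Longrightarrow> e1 as = 0"
    "\<And>as. as \<in> lists (letters C) \<Longrightarrow> 2 \<le> length as \<Longrightarrow> i as = 0"
    using m by (auto simp only: linf_model_def strict_morphism_def intro: hwords_strict)
  show "\<And>p x. x \<in> grade C p \<Longrightarrow> e0 [(p, i [(p, x)])] = x" "\<And>p x. x \<in> grade C p \<Longrightarrow> e1 [(p, i [(p, x)])] = x"
    using m by (auto simp: linf_model_def)
  show "\<exists>z\<in>grade M p. e0 [(p, z)] = a \<and> e1 [(p, z)] = b" if "a \<in> grade C p" "b \<in> grade C p" for p a b
  proof -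
    have "(a, b) \<in> (\<lambda>z. (e0 [(p, z)], e1 [(p, z)])) ` grade M p"
      using m that unfolding linf_model_def by blast
    then show ?thesis by auto
  qed
  show "\<exists>c\<in>cocycles C p. z - i [(p, c)] \<in> coboundaries M p" if "z \<in> cocycles M p" for p z
  proof -
    have "quasi_iso C M i" using m by (simp add: linf_model_def)
    from conjunct2[OF iffD1[OF quasi_iso_iff[OF C M i] this], rule_format, OF that]
    obtain c where c: "c \<in> cocycles C p" "i [(p, c)] - z \<in> coboundaries M p" by blast
    have "- (i [(p, c)] - z) \<in> coboundaries M p" by (rule hom_onD(5)[OF hom_coboundaries[OF M] c(2)])
    then show ?thesis using c(1) by (intro bexI[of _ c]) simp_all
  qed
qed

lemma linf_model_sym:
  assumes C: "is_linf C" and m: "linf_model C M e0 e1 i"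
  shows "linf_model C M e1 e0 i"
proof (rule linf_modelI[OF C linf_modelD(1,3)[OF C m] _ linf_modelD(2)[OF C m] _ linf_modelD(4)[OF C m]])
  show "\<exists>z\<in>grade M p. e1 [(p, z)] = a \<and> e0 [(p, z)] = b" if "a \<in> grade C p" "b \<in> grade C p" for p a b
    using linf_modelD(10)[OF C m that(2,1)] by blast
qed (use linf_modelD[OF C m] in auto)

text \<open>Evaluations are strict, so composing one with \<open>h\<close> is applying its linear
  part to the value of \<open>h\<close>. In this form \<open>linf_comp\<close> has to be dealt with
  only when passing to \<open>homotopic\<close>.\<close>

definition htp ::
  "('k::field_char_0, 'v::ab_group_add) linf \<Rightarrow> ('k, 'w::ab_group_add) linf
    \<Rightarrow> ((int \<times> 'v) list \<Rightarrow> 'w) \<Rightarrow> ((int \<times> 'v) list \<Rightarrow> 'w) \<Rightarrow> bool" where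
  "htp A C f0 f1 \<longleftrightarrow> (\<exists>(M :: ('k, nat \<Rightarrow> 'w) linf) e0 e1 i h. linf_model C M e0 e1 i \<and> is_morph A M h \<and>
     (\<forall>as \<in> lists (letters A). as \<noteq> [] \<longrightarrow> f0 as = e0 [(total_deg as, h as)] \<and> f1 as = e1 [(total_deg as, h as)]))"

lemma htpE:
  fixes A :: "('k::field_char_0, 'v::ab_group_add) linf" and C :: "('k, 'w::ab_group_add) linf"
  assumes "htp A C f0 f1"
  obtains M :: "('k, nat \<Rightarrow> 'w) linf" and e0 e1 i h where "linf_model C M e0 e1 i" "is_morph A M h"
    "\<And>as. as \<in> lists (letters A) \<Longrightarrow> as \<noteq> [] \<Longrightarrow> f0 as = e0 [(total_deg as, h as)] \<and> f1 as = e1 [(total_deg as, h as)]"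
  using assms unfolding htp_def
proof (elim exE conjE)
  fix M :: "('k, nat \<Rightarrow> 'w) linf" and e0 e1 i h
  assume 1: "linf_model C M e0 e1 i" and 2: "is_morph A M h"
    and 3: "\<forall>as\<in>lists (letters A). as \<noteq> [] \<longrightarrow> f0 as = e0 [(total_deg as, h as)] \<and> f1 as = e1 [(total_deg as, h as)]"
  show thesis by (rule that[OF 1 2]) (use 3 in simp)
qed

lemma htp_pathI:
  assumes "is_linf C" "is_morph A (path C) h"
    and "\<And>as. as \<in> lists (letters A) \<Longrightarrow> as \<noteq> [] \<Longrightarrow> f0 as = q0 (h as) 0 \<and> f1 as = q0 (h as) 1"
  shows "htp A C f0 f1"
  unfolding htp_def using linf_model_path[OF assms(1)] assms(2,3)
  by (intro exI[of _ "path C"] exI[of _ "peval 0"] exI[of _ "peval 1"] exI[of _ pincl] exI[of _ h]) simp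

lemma htp_sym:
  fixes A :: "('k::field_char_0, 'v::ab_group_add) linf" and C :: "('k, 'w::ab_group_add) linf"
  assumes C: "is_linf C" and f: "htp A C f0 f1"
  shows "htp A C f1 f0"
proof -
  obtain M :: "('k, nat \<Rightarrow> 'w) linf" and e0 e1 i h where m: "linf_model C M e0 e1 i" and h: "is_morph A M h"
    and hf: "\<And>as. as \<in> lists (letters A) \<Longrightarrow> as \<noteq> [] \<Longrightarrow> f0 as = e0 [(total_deg as, h as)] \<and> f1 as = e1 [(total_deg as, h as)]"
    by (rule htpE[OF f]) (rule that, assumption, assumption, simp)
  show ?thesis
    unfolding htp_def
    by (intro exI[of _ M] exI[of _ e1] exI[of _ e0] exI[of _ i] exI[of _ h] conjI linf_model_sym[OF C m] h) (use hf in simp)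
qed

text \<open>The two models are glued along the end of the first and the start of the second, and the
  two homotopies pair up there. The work lies in the condition on cocycles, where the two halves
  must be bounded compatibly.\<close>

lemma htp_trans:
  fixes A :: "('k::field_char_0, 'v::ab_group_add) linf" and C :: "('k, 'w::ab_group_add) linf"
  assumes C: "is_linf C" and f01: "htp A C f0 f1" and f12: "htp A C f1 f2"
  shows "htp A C f0 f2"
proof -
  obtain M :: "('k, nat \<Rightarrow> 'w) linf" and e0 e1 i h where m: "linf_model C M e0 e1 i" and h: "is_morph A M h"
    and hf: "\<And>as. as \<in> lists (letters A) \<Longrightarrow> as \<noteq> [] \<Longrightarrow> f0 as = e0 [(total_deg as, h as)] \<and> f1 as = e1 [(total_deg as, h as)]"
    by (rule htpE[OF f01]) (rule that, assumption, assumption, simp)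
  obtain M' :: "('k, nat \<Rightarrow> 'w) linf" and e0' e1' i' h' where m': "linf_model C M' e0' e1' i'" and h': "is_morph A M' h'"
    and hf': "\<And>as. as \<in> lists (letters A) \<Longrightarrow> as \<noteq> [] \<Longrightarrow> f1 as = e0' [(total_deg as, h' as)] \<and> f2 as = e1' [(total_deg as, h' as)]"
    by (rule htpE[OF f12]) (rule that, assumption, assumption, simp)
  note D = linf_modelD[OF C m] and D' = linf_modelD[OF C m']
  interpret gluing C M M' e1 e0'
    by unfold_locales (use C D D' in auto)
  let ?e0 = "lin1 (\<lambda>p z. e0 [(p, q0 z)])" and ?e1 = "lin1 (\<lambda>p z. e1' [(p, q1 z)])"
  let ?i = "lin1 (\<lambda>p x. mk (i [(p, x)]) (i' [(p, x)]))"
  have "linf_model C G ?e0 ?e1 ?i"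
  proof (rule linf_modelI[OF C is_linf_glue])
    show "is_morph G C ?e0"
    proof (rule is_morph_lin1[OF is_linf_glue C])
      show "lin_on (smul G) (smul C) (grade G p) (\<lambda>z. e0 [(p, q0 z)])" for p
        by (rule lin_on_comp[OF lin_on_glue(1) morph_facts(2)[OF D(2)]]) simp
      show "e0 [(p, q0 z)] \<in> grade C p" if "z \<in> grade G p" for p z
        using that morph_facts(1)[OF D(2)] by simp
      show "e0 [(total_deg zs + 1, q0 (brk G zs))] = brk C (map (\<lambda>a. (fst a, e0 [(fst a, q0 (snd a))])) zs)"
        if "zs \<in> lists (letters G)" "zs \<noteq> []" for zs
        using strict_brk[OF M1 C D(2,5) lists_glue(1)[OF that(1)]] that(2)
        by (simp add: linear_part_def m0_def o_def)
    qed
    show "is_morph G C ?e1"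
    proof (rule is_morph_lin1[OF is_linf_glue C])
      show "lin_on (smul G) (smul C) (grade G p) (\<lambda>z. e1' [(p, q1 z)])" for p
        by (rule lin_on_comp[OF lin_on_glue(2) morph_facts(2)[OF D'(3)]]) simp
      show "e1' [(p, q1 z)] \<in> grade C p" if "z \<in> grade G p" for p z
        using that morph_facts(1)[OF D'(3)] by simp
      have t: "total_deg (map n1 zs) = total_deg zs" for zs :: "(int \<times> (nat \<Rightarrow> 'w)) list" by (rule total_deg_map) simp
      show "e1' [(total_deg zs + 1, q1 (brk G zs))] = brk C (map (\<lambda>a. (fst a, e1' [(fst a, q1 (snd a))])) zs)"
        if "zs \<in> lists (letters G)" "zs \<noteq> []" for zs
        using strict_brk[OF M2 C D'(3,6) lists_glue(2)[OF that(1)]] that(2) t[of zs]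
        by (simp add: linear_part_def n1_def o_def)
    qed
    show "is_morph C G ?i"
    proof (rule is_morph_lin1[OF C is_linf_glue])
      show "lin_on (smul C) (smul G) (grade C p) (\<lambda>x. mk (i [(p, x)]) (i' [(p, x)]))" for p
        using morph_facts(2)[OF D(4), of p] morph_facts(2)[OF D'(4), of p]
        unfolding lin_on_def hom_on_def by (auto intro: q_eqI)
      show "mk (i [(p, x)]) (i' [(p, x)]) \<in> grade G p" if "x \<in> grade C p" for p x
        using that morph_facts(1)[OF D(4)] morph_facts(1)[OF D'(4)] D(9) D'(8) by simp
      show "mk (i [(total_deg as + 1, brk C as)]) (i' [(total_deg as + 1, brk C as)]) =
          brk G (map (\<lambda>a. (fst a, mk (i [(fst a, snd a)]) (i' [(fst a, snd a)]))) as)"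
        if "as \<in> lists (letters C)" "as \<noteq> []" for as
        using strict_brk[OF C M1 D(4,7) that] strict_brk[OF C M2 D'(4,7) that]
        by (simp add: linear_part_def[abs_def] m0_def n1_def o_def)
    qed
    show "?e0 [(p, ?i [(p, x)])] = x" "?e1 [(p, ?i [(p, x)])] = x" if "x \<in> grade C p" for p x
      using D(8)[OF that] D'(9)[OF that] by simp_all
    show "\<exists>z\<in>grade G p. ?e0 [(p, z)] = a \<and> ?e1 [(p, z)] = b" if "a \<in> grade C p" "b \<in> grade C p" for p a b
    proof -
      note ab = that
      have 0: "0 \<in> grade C p" using subspace_simps(2)[OF is_linfD(1)[OF C]] .
      \<comment> \<open>Prescribing the value 0 in the middle makes the two halves fit.\<close>
      obtain z1 z2 where "z1 \<in> grade M p" "e0 [(p, z1)] = a" "e1 [(p, z1)] = 0" "z2 \<in> grade M' p" "e0' [(p, z2)] = 0" "e1' [(p, z2)] = b"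
        using D(10)[OF ab(1) 0] D'(10)[OF 0 ab(2)] by blast
      then show ?thesis by (intro bexI[of _ "mk z1 z2"]) auto
    qed
    show "\<exists>c\<in>cocycles C p. z - ?i [(p, c)] \<in> coboundaries G p" if z: "z \<in> cocycles G p" for p z
    proof -
      have zz: "q0 z \<in> cocycles M p" "q1 z \<in> cocycles M' p" "e1 [(p, q0 z)] = e0' [(p, q1 z)]"
      proof -
        have "mk (brk M [(p, q0 z)]) (brk M' [(p, q1 z)]) = 0" using z by (simp add: cocycles_def)
        then have "q0 (mk (brk M [(p, q0 z)]) (brk M' [(p, q1 z)])) = q0 0" "q1 (mk (brk M [(p, q0 z)]) (brk M' [(p, q1 z)])) = q1 0" by simp_all
        then show "q0 z \<in> cocycles M p" "q1 z \<in> cocycles M' p" "e1 [(p, q0 z)] = e0' [(p, q1 z)]"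
          using z by (auto simp: cocycles_def)
      qed
      obtain c1 m1 where c1: "c1 \<in> cocycles C p" and m1: "m1 \<in> grade M (p - 1)" "q0 z - i [(p, c1)] = brk M [(p - 1, m1)]"
        using D(11)[OF zz(1)] unfolding coboundaries_iff by blast
      obtain c2 m2 where c2: "c2 \<in> cocycles C p" and m2: "m2 \<in> grade M' (p - 1)" "q1 z - i' [(p, c2)] = brk M' [(p - 1, m2)]"
        using D'(11)[OF zz(2)] unfolding coboundaries_iff by blast
      have c: "c1 \<in> grade C p" "c2 \<in> grade C p" using c1 c2 by (auto simp: cocycles_def)
      \<comment> \<open>The mismatch of the two bounding elements in the middle. Its differential is
        \<open>c2 - c1\<close>, because the cocycle halves agree there.\<close>
      define b where "b = e1 [(p - 1, m1)] - e0' [(p - 1, m2)]"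
      have em: "e1 [(p - 1, m1)] \<in> grade C (p - 1)" "e0' [(p - 1, m2)] \<in> grade C (p - 1)"
        using morph_facts(1)[OF D(3) m1(1)] morph_facts(1)[OF D'(2) m2(1)] .
      then have b: "b \<in> grade C (p - 1)" unfolding b_def by (rule subspace_simps(6)[OF is_linfD(1)[OF C]])
      have "e1 [(p, q0 z)] - c1 = brk C [(p - 1, e1 [(p - 1, m1)])]"
        using hom_onD(10)[OF morph_facts(3)[OF D(3)], of "q0 z" p "i [(p, c1)]"] morph_facts(1)[OF D(4) c(1)] D(9)[OF c(1)]
          morph_facts(4)[OF D(3) m1(1)] m1(2) zz(1) by (simp add: cocycles_def)
      moreover have "e0' [(p, q1 z)] - c2 = brk C [(p - 1, e0' [(p - 1, m2)])]"
        using hom_onD(10)[OF morph_facts(3)[OF D'(2)], of "q1 z" p "i' [(p, c2)]"] morph_facts(1)[OF D'(4) c(2)] D'(8)[OF c(2)]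
          morph_facts(4)[OF D'(2) m2(1)] m2(2) zz(2) by (simp add: cocycles_def)
      moreover have "brk C [(p - 1, b)] = brk C [(p - 1, e1 [(p - 1, m1)])] - brk C [(p - 1, e0' [(p - 1, m2)])]"
        unfolding b_def by (rule hom_onD(10)[OF d_facts(3)[OF C] em])
      ultimately have "brk C [(p - 1, b)] = (e1 [(p, q0 z)] - c1) - (e0' [(p, q1 z)] - c2)" by (simp only:)
      then have db: "brk C [(p - 1, b)] = c2 - c1" unfolding zz(3) by simp
      \<comment> \<open>Adding the included mismatch makes the bounding elements agree in the middle
        and also replaces \<open>c2\<close> by \<open>c1\<close>, so both halves are compared with
        the same cocycle.\<close>
      let ?m2 = "m2 + i' [(p - 1, b)]"
      have ib: "i' [(p - 1, b)] \<in> grade M' (p - 1)" by (rule morph_facts(1)[OF D'(4) b])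
      have "i' [(p, c2 - c1)] = i' [(p, c2)] - i' [(p, c1)]"
        by (rule hom_onD(10)[OF morph_facts(3)[OF D'(4)] c(2,1)])
      then have "brk M' [(p - 1, i' [(p - 1, b)])] = i' [(p, c2)] - i' [(p, c1)]"
        using morph_facts(4)[OF D'(4) b] db by simp
      then have dm2: "brk M' [(p - 1, ?m2)] = q1 z - i' [(p, c1)]"
        using hom_onD(4)[OF d_facts(3)[OF M2] m2(1) ib] m2(2)[symmetric] by simp
      have "e0' [(p - 1, ?m2)] = e1 [(p - 1, m1)]"
        using hom_onD(4)[OF morph_facts(3)[OF D'(2)] m2(1) ib] D'(8)[OF b] by (simp add: b_def)
      then have "mk m1 ?m2 \<in> grade G (p - 1)"
        using m1(1) subspace_simps(3)[OF g2 m2(1) ib] by simp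
      moreover have "z - ?i [(p, c1)] = brk G [(p - 1, mk m1 ?m2)]"
        by (rule q_eqI) (simp_all add: m1(2) dm2)
      ultimately show ?thesis
        using c1 unfolding coboundaries_iff by blast
    qed
  qed (simp_all add: lin1_long)
  moreover have "is_morph A G (\<lambda>as. mk (h as) (h' as))"
    by (rule is_morph_glue[OF h h']) (metis hf hf')
  ultimately show ?thesis
    unfolding htp_def using hf hf'
    by (intro exI[of _ G] exI[of _ ?e0] exI[of _ ?e1] exI[of _ ?i] exI[of _ "\<lambda>as. mk (h as) (h' as)"]) simp
qed

lemma htp_homotopic:
  fixes A :: "('k::field_char_0, 'v::ab_group_add) linf" and C :: "('k, 'w::ab_group_add) linf"
  assumes A: "is_linf A" and C: "is_linf C" and f0: "is_morph A C f0" and f1: "is_morph A C f1" and hh: "htp A C f0 f1"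
  shows "homotopic A C f0 f1"
proof -
  obtain M :: "('k, nat \<Rightarrow> 'w) linf" and e0 e1 i h where m: "linf_model C M e0 e1 i" and h: "is_morph A M h"
    and hf: "\<And>as. as \<in> lists (letters A) \<Longrightarrow> as \<noteq> [] \<Longrightarrow> f0 as = e0 [(total_deg as, h as)] \<and> f1 as = e1 [(total_deg as, h as)]"
    by (rule htpE[OF hh]) (rule that, assumption, assumption, simp)
  note D = linf_modelD[OF C m]
  have "linf_comp C e h as = e [(total_deg as, h as)]"
    if "is_morph M C e" "\<And>as. as \<in> lists (letters M) \<Longrightarrow> 2 \<le> length as \<Longrightarrow> e as = 0" "as \<in> lists (letters A)" "as \<noteq> []" for e as
    using linf_comp_smaps[OF is_linfD(1)[OF C] is_morphD(1)[OF h] is_morphD(1)[OF that(1)] that(3)]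
      hat_into_strict[OF smapsD(1)[OF is_morphD(1)[OF h]] that(2) smapsD(4)[OF is_morphD(1)[OF that(1)]] that(3,4)] by simp
  then have "morph_eq A f0 (linf_comp C e0 h)" "morph_eq A f1 (linf_comp C e1 h)"
    using D hf by (auto simp: morph_eq_def hwords_iff)
  then show ?thesis
    unfolding homotopic_def linf_morphism_iff[OF A C]
    using m h f0 f1
    by (intro conjI exI[of _ M] exI[of _ e0] exI[of _ e1] exI[of _ i] exI[of _ h])
       (simp_all add: linf_morphism_iff[OF A D(1)])
qed

section \<open>Obstruction theory\<close>

text \<open>A basis of \<open>Z\<close> is sent to chosen preimages and extended linearly. The
  vectors on which the extension lands in \<open>K\<close> and splits \<open>d\<close> form a
  subspace, which therefore contains \<open>Z\<close>.\<close>

lemma linear_section: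
  assumes s: "vector_space s" and s': "vector_space s'"
    and Z: "module.subspace s Z" and K: "module.subspace s' K" and d: "lin_on s' s K d"
    and onto: "\<And>x. x \<in> Z \<Longrightarrow> \<exists>y\<in>K. d y = x"
  shows "\<exists>\<sigma>. (\<forall>x y. \<sigma> (x + y) = \<sigma> x + \<sigma> y) \<and> (\<forall>c x. \<sigma> (s c x) = s' c (\<sigma> x)) \<and> (\<forall>x\<in>Z. \<sigma> x \<in> K \<and> d (\<sigma> x) = x)"
proof -
  interpret vector_space_pair s s'
    using s s' by (simp add: vector_space_pair_def)
  obtain B where B: "B \<subseteq> Z" "vs1.independent B" "Z \<subseteq> vs1.span B"
    by (rule vs1.maximal_independent_subset)
  define \<sigma> where "\<sigma> = construct B (\<lambda>b. SOME y. y \<in> K \<and> d y = b)"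
  have "Vector_Spaces.linear s s' \<sigma>"
    unfolding \<sigma>_def by (rule linear_construct[OF B(2)])
  then have lin: "\<sigma> (x + y) = \<sigma> x + \<sigma> y" "\<sigma> (s c x) = s' c (\<sigma> x)" for x y c
    by (auto simp: Vector_Spaces.linear_iff)
  have \<sigma>0: "\<sigma> 0 = 0" using lin(1)[of 0 0] by simp
  note h = hom_onD[OF lin_onD(1)[OF d]]
  have bs: "\<sigma> b \<in> K \<and> d (\<sigma> b) = b" if "b \<in> B" for b
  proof -
    have "\<exists>y. y \<in> K \<and> d y = b" using onto[of b] that B(1) by blast
    then have "(SOME y. y \<in> K \<and> d y = b) \<in> K \<and> d (SOME y. y \<in> K \<and> d y = b) = b" by (rule someI_ex)
    then show ?thesis unfolding \<sigma>_def construct_basis[OF B(2) that] .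
  qed
  have "vs1.subspace {x. \<sigma> x \<in> K \<and> d (\<sigma> x) = x}"
  proof (rule vs1.subspaceI)
    show "0 \<in> {x. \<sigma> x \<in> K \<and> d (\<sigma> x) = x}" using h(1,2) \<sigma>0 by simp
    show "x + y \<in> {x. \<sigma> x \<in> K \<and> d (\<sigma> x) = x}" if "x \<in> {x. \<sigma> x \<in> K \<and> d (\<sigma> x) = x}" "y \<in> {x. \<sigma> x \<in> K \<and> d (\<sigma> x) = x}" for x y
      using that h(3,4) by (simp add: lin)
    show "s c x \<in> {x. \<sigma> x \<in> K \<and> d (\<sigma> x) = x}" if "x \<in> {x. \<sigma> x \<in> K \<and> d (\<sigma> x) = x}" for c x
      using that lin_onD(2,3)[OF d] by (simp add: lin)
  qed
  then have "vs1.span B \<subseteq> {x. \<sigma> x \<in> K \<and> d (\<sigma> x) = x}"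
    by (intro vs1.span_minimal) (use bs in auto)
  then show ?thesis using lin B(3) by blast
qed

text \<open>Over a field primitives of cocycles can be chosen linearly, and such a choice yields a
  contracting homotopy.\<close>

lemma contraction:
  assumes C: "graded_space C"
    and d: "\<And>p. lin_on (smul C) (smul C) (grade C p) (d p)" "\<And>p x. x \<in> grade C p \<Longrightarrow> d p x \<in> grade C (p + 1)"
      "\<And>p x. x \<in> grade C p \<Longrightarrow> d (p + 1) (d p x) = 0"
    and acyclic: "\<And>p x. x \<in> grade C p \<Longrightarrow> d p x = 0 \<Longrightarrow> \<exists>y\<in>grade C (p - 1). d (p - 1) y = x"
  shows "\<exists>\<eta>. (\<forall>p. lin_on (smul C) (smul C) (grade C p) (\<eta> p)) \<and> (\<forall>p. \<forall>x\<in>grade C p. \<eta> p x \<in> grade C (p - 1)) \<and>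
    (\<forall>p. \<forall>x\<in>grade C p. d (p - 1) (\<eta> p x) + \<eta> (p + 1) (d p x) = x)"
proof -
  note s = subspace_simps(1)[OF C]
  interpret vector_space "smul C" by (rule s)
  have sub: "subspace (grade C p)" for p using C by (simp add: graded_space_def)
  note h = hom_onD[OF lin_onD(1)[OF d(1)]]
  have "subspace {x \<in> grade C p. d p x = 0}" for p
    by (rule subspaceI) (use h(1,2,3,4) lin_onD(2,3)[OF d(1)] vs_simps(1)[OF s] in auto)
  then have "\<exists>\<sigma>. (\<forall>x y. \<sigma> (x + y) = \<sigma> x + \<sigma> y) \<and> (\<forall>c x. \<sigma> (smul C c x) = smul C c (\<sigma> x)) \<and>
      (\<forall>x\<in>{x \<in> grade C p. d p x = 0}. \<sigma> x \<in> grade C (p - 1) \<and> d (p - 1) (\<sigma> x) = x)" for p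
    using acyclic by (intro linear_section[OF s s _ sub d(1)]) auto
  from choice[OF allI[OF this]] obtain \<sigma> where \<sigma>': "\<forall>p. (\<forall>x y. \<sigma> p (x + y) = \<sigma> p x + \<sigma> p y) \<and>
      (\<forall>c x. \<sigma> p (smul C c x) = smul C c (\<sigma> p x)) \<and>
      (\<forall>x\<in>{x \<in> grade C p. d p x = 0}. \<sigma> p x \<in> grade C (p - 1) \<and> d (p - 1) (\<sigma> p x) = x)"
    by (rule exE)
  then have \<sigma>: "\<And>p x y. \<sigma> p (x + y) = \<sigma> p x + \<sigma> p y" "\<And>p c x. \<sigma> p (smul C c x) = smul C c (\<sigma> p x)"
    "\<And>p x. x \<in> grade C p \<Longrightarrow> d p x = 0 \<Longrightarrow> \<sigma> p x \<in> grade C (p - 1) \<and> d (p - 1) (\<sigma> p x) = x"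
    by simp_all
  have \<sigma>0: "\<sigma> p 0 = 0" for p using \<sigma>(1)[of p 0 0] by simp
  have \<sigma>m: "\<sigma> p (x - y) = \<sigma> p x - \<sigma> p y" for p x y using \<sigma>(1)[of p "x - y" y] by (simp add: algebra_simps)
  \<comment> \<open>Subtracting \<open>\<sigma> (p + 1) (d p x)\<close> makes \<open>x\<close> a
    cocycle, and \<open>\<sigma>\<close> then chooses its primitive. So d after
    \<open>\<eta>\<close> gives the cocycle part and \<open>\<eta>\<close> after d gives the
    subtracted part.\<close>
  define \<eta> where "\<eta> p x = \<sigma> p (x - \<sigma> (p + 1) (d p x))" for p x
  have dx: "\<sigma> (p + 1) (d p x) \<in> grade C p \<and> d p (\<sigma> (p + 1) (d p x)) = d p x" if "x \<in> grade C p" for p x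
    using \<sigma>(3)[OF d(2)[OF that] d(3)[OF that]] by simp
  have r: "x - \<sigma> (p + 1) (d p x) \<in> grade C p \<and> d p (x - \<sigma> (p + 1) (d p x)) = 0" if "x \<in> grade C p" for p x
    using h(9,10)[of x p "\<sigma> (p + 1) (d p x)"] dx[OF that] that by simp
  have "lin_on (smul C) (smul C) (grade C p) (\<eta> p)" for p
    unfolding lin_on_def hom_on_def \<eta>_def
    by (auto simp: subspace_simps[OF C] h(4) lin_onD(3)[OF d(1)] \<sigma> \<sigma>m vs_simps[OF s])
  moreover have "\<eta> p x \<in> grade C (p - 1)" if "x \<in> grade C p" for p x
    unfolding \<eta>_def using \<sigma>(3) r[OF that] by blast
  moreover have "d (p - 1) (\<eta> p x) + \<eta> (p + 1) (d p x) = x" if "x \<in> grade C p" for p x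
  proof -
    have "d (p - 1) (\<eta> p x) = x - \<sigma> (p + 1) (d p x)"
      unfolding \<eta>_def using \<sigma>(3) r[OF that] by blast
    moreover have "\<eta> (p + 1) (d p x) = \<sigma> (p + 1) (d p x)"
      unfolding \<eta>_def d(3)[OF that] \<sigma>0 by simp
    ultimately show ?thesis by simp
  qed
  ultimately show ?thesis by blast
qed

section \<open>Leading defects and corrections in one word length\<close>

lemma smaps_add:
  assumes C': "graded_space C'" and f: "smaps d C C' f" and g: "smaps d C C' g"
  shows "smaps d C C' (\<lambda>as. f as + g as)"
  unfolding smaps_def multilin_def symm_def degmap_def
proof (intro conjI ballI allI impI)
  note s = subspace_simps(1)[OF C']
  show "f as + g as \<in> grade C' (total_deg as + d)" if "as \<in> lists (letters C)" "as \<noteq> []" for as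
    by (intro subspace_simps[OF C'] smaps_mem[OF f that] smaps_mem[OF g that])
  show "lin_on (smul C) (smul C') (grade C p) (\<lambda>x. f (us @ (p, x) # vs) + g (us @ (p, x) # vs))"
    if "us \<in> lists (letters C)" "vs \<in> lists (letters C)" for us vs p
    by (intro lin_on_add[OF s] multilinD[OF smapsD(2)[OF f] that] multilinD[OF smapsD(2)[OF g] that])
  fix us vs a b
  assume *: "us \<in> lists (letters C)" "vs \<in> lists (letters C)" "a \<in> letters C" "b \<in> letters C"
  show "f (us @ a # b # vs) + g (us @ a # b # vs) = sg (fst a * fst b) (f (us @ b # a # vs) + g (us @ b # a # vs))"
    unfolding symmD[OF smapsD(3)[OF f] *] symmD[OF smapsD(3)[OF g] *] sg_add ..
qed

lemma smaps_post:
  assumes \<theta>: "\<And>p. lin_on (smul C') (smul D) (grade C' p) (\<theta> p)" "\<And>p x. x \<in> grade C' p \<Longrightarrow> \<theta> p x \<in> grade D (p + e)"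
    and f: "smaps d C C' f"
  shows "smaps (d + e) C D (\<lambda>as. \<theta> (total_deg as + d) (f as))"
  unfolding smaps_def multilin_def symm_def degmap_def
proof (intro conjI ballI allI impI)
  show "\<theta> (total_deg as + d) (f as) \<in> grade D (total_deg as + (d + e))" if "as \<in> lists (letters C)" "as \<noteq> []" for as
    using \<theta>(2)[OF smaps_mem[OF f that]] by (simp add: add.assoc)
  show "lin_on (smul C) (smul D) (grade C p) (\<lambda>x. \<theta> (total_deg (us @ (p, x) # vs) + d) (f (us @ (p, x) # vs)))"
    if "us \<in> lists (letters C)" "vs \<in> lists (letters C)" for us vs p
  proof -
    have "lin_on (smul C) (smul D) (grade C p) (\<lambda>x. \<theta> (total_deg us + (p + total_deg vs) + d) (f (us @ (p, x) # vs)))"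
      by (rule lin_on_comp[OF multilinD[OF smapsD(2)[OF f] that] \<theta>(1)])
         (use smaps_mem[OF f, of "us @ (p, x) # vs" for x] that in auto)
    then show ?thesis by simp
  qed
  fix us vs a b
  assume *: "us \<in> lists (letters C)" "vs \<in> lists (letters C)" "a \<in> letters C" "b \<in> letters C"
  have t: "total_deg (us @ a # b # vs) = total_deg (us @ b # a # vs)" by simp
  have "f (us @ b # a # vs) \<in> grade C' (total_deg (us @ b # a # vs) + d)"
    by (rule smaps_mem[OF f]) (use * in simp_all)
  then show "\<theta> (total_deg (us @ a # b # vs) + d) (f (us @ a # b # vs)) = sg (fst a * fst b) (\<theta> (total_deg (us @ b # a # vs) + d) (f (us @ b # a # vs)))"
    unfolding t symmD[OF smapsD(3)[OF f] *] by (rule hom_onD(8)[OF lin_onD(1)[OF \<theta>(1)]])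
qed

lemma smaps_post_0:
  assumes "\<And>p. lin_on (smul C') (smul D) (grade C' p) (\<theta> p)" "\<And>p x. x \<in> grade C' p \<Longrightarrow> \<theta> p x \<in> grade D p"
    and "smaps d C C' f"
  shows "smaps d C D (\<lambda>as. \<theta> (total_deg as + d) (f as))"
  using smaps_post[of C' D \<theta> 0 d C f] assms by simp

text \<open>Isolates the component of one word length: obstructions and corrections of the induction
  live in a single length.\<close>

definition trunc :: "nat \<Rightarrow> ('a list \<Rightarrow> 'b) \<Rightarrow> 'a list \<Rightarrow> 'b::zero" where
  "trunc n f as = (if length as = n then f as else 0)"

lemma trunc_simps [simp]: "length as = n \<Longrightarrow> trunc n f as = f as" "length as \<noteq> n \<Longrightarrow> trunc n f as = 0"
  by (auto simp: trunc_def)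

lemma smaps_trunc:
  assumes C: "graded_space C" and C': "graded_space C'"
    and deg: "\<And>as. as \<in> lists (letters C) \<Longrightarrow> as \<noteq> [] \<Longrightarrow> length as = n \<Longrightarrow> f as \<in> grade C' (total_deg as + d)"
    and f: "multilin C (smul C') f" "symm C f"
  shows "smaps d C C' (trunc n f)"
  unfolding smaps_def multilin_def symm_def degmap_def
proof (intro conjI ballI allI impI)
  note s = subspace_simps(1)[OF C']
  show "trunc n f as \<in> grade C' (total_deg as + d)" if "as \<in> lists (letters C)" "as \<noteq> []" for as
    using deg[OF that] subspace_simps(2)[OF C'] by (simp add: trunc_def)
  show "lin_on (smul C) (smul C') (grade C p) (\<lambda>x. trunc n f (us @ (p, x) # vs))"
    if "us \<in> lists (letters C)" "vs \<in> lists (letters C)" for us vs p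
    using multilinD[OF f(1) that, of p] lin_on_const_simps(2)[OF s multilinD[OF f(1) that, of p]]
    by (cases "Suc (length us + length vs) = n") simp_all
  fix us vs a b
  assume *: "us \<in> lists (letters C)" "vs \<in> lists (letters C)" "a \<in> letters C" "b \<in> letters C"
  show "trunc n f (us @ a # b # vs) = sg (fst a * fst b) (trunc n f (us @ b # a # vs))"
    using symmD[OF f(2) *] by (simp add: trunc_def)
qed

lemma defect_cong:
  assumes l: "degmap 1 C C l" and f: "degmap 0 C C' f" and as: "as \<in> lists (letters C)"
    and eq: "\<And>bs. bs \<in> lists (letters C) \<Longrightarrow> bs \<noteq> [] \<Longrightarrow> length bs \<le> length as \<Longrightarrow> f bs = f' bs"
  shows "defect l l' f as = defect l l' f' as"
proof -
  have "coder l as f = coder l as f'"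
    by (rule coder_cong[OF l as]) (simp add: eq)
  moreover have "hat f as l' = hat f' as l'"
    by (rule hat_cong_map[OF f as eq])
  ultimately show ?thesis by (simp add: defect_def)
qed

lemma smaps_defect:
  assumes C: "is_linf C" and C': "is_linf C'" and f: "smaps 0 C C' f"
  shows "smaps 1 C C' (defect (brk C) (brk C') f)"
proof -
  note g = is_linfD(1)[OF C] and g' = is_linfD(1)[OF C']
  have a: "smaps 1 C C' (\<lambda>as. coder (brk C) as f)"
    using smaps_coder[OF g g' is_linfD(2)[OF C] f] by simp
  have b: "smaps 1 C C' (\<lambda>as. hat f as (brk C'))"
    by (rule smaps_comp[OF g' f is_linfD(2)[OF C']])
  have "smaps 1 C C' (\<lambda>as. coder (brk C) as f - hat f as (brk C'))"
    unfolding smaps_def degmap_def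
    by (intro conjI ballI impI multilin_diff[OF is_linfD(4)[OF C']] symm_diff smapsD(2,3)[OF a] smapsD(2,3)[OF b]
        subspace_simps(6)[OF g'] smaps_mem[OF a] smaps_mem[OF b])
  then show ?thesis by (simp add: defect_def[abs_def])
qed

text \<open>A proper subword is shorter and has zero \<open>E\<close>, so only the term in which
  \<open>E\<close> takes the whole word remains.\<close>

lemma der_leading:
  assumes f: "degmap 0 C C' f" and as: "as \<in> lists (letters C)" "as \<noteq> []" and g: "multihom C' g"
    and E: "\<And>bs. bs \<in> lists (letters C) \<Longrightarrow> bs \<noteq> [] \<Longrightarrow> length bs < length as \<Longrightarrow> E bs = 0"
  shows "der f E as g = g [(total_deg as + 1, E as)]"
proof -
  have "der f E as g = g [(total_deg as + 1, E as)] + spl as (\<lambda>u v. if v = [] then 0 else if u = [] then 0 else hat f v (\<lambda>W. g (apply_deg 1 E u # W)))"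
    unfolding der_def using as(2) by (subst spl_isolate_right) (simp add: apply_deg_def)
  also have "spl as (\<lambda>u v. if v = [] then 0 else if u = [] then 0 else hat f v (\<lambda>W. g (apply_deg 1 E u # W))) = spl as (\<lambda>u v. 0)"
  proof (intro spl_cong_lists[OF as(1)])
    fix u v assume u: "u \<in> lists (letters C)" and v: "v \<in> lists (letters C)" and len: "length u + length v = length as"
    have "hat f v (\<lambda>W. g ((total_deg u + 1, 0) # W)) = hat f v (\<lambda>W. 0)"
      by (intro hat_cong[OF f v] hom_onD(2)[OF multihom_head[OF g]])
    moreover have "E u = 0" if "u \<noteq> []" "v \<noteq> []"
      using E[OF u] that len by (cases v) auto
    ultimately show "(if v = [] then 0 else if u = [] then 0 else hat f v (\<lambda>W. g (apply_deg 1 E u # W))) = 0"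
      by (simp add: apply_deg_def)
  qed
  finally show ?thesis by simp
qed

text \<open>When all shorter defects vanish, the nonlinear right side of \<open>bianchi\<close>
  collapses to the differential of the target. The leading defect is thus a cocycle in the complex
  of multilinear maps.\<close>

lemma bianchi_leading:
  assumes C: "is_linf C" and C': "is_linf C'" and f: "smaps 0 C C' f" and as: "as \<in> lists (letters C)" "as \<noteq> []"
    and E: "\<And>bs. bs \<in> lists (letters C) \<Longrightarrow> bs \<noteq> [] \<Longrightarrow> length bs < length as \<Longrightarrow> defect (brk C) (brk C') f bs = 0"
  shows "coder (brk C) as (defect (brk C) (brk C') f) = - brk C' [(total_deg as + 1, defect (brk C) (brk C') f as)]"
  using bianchi[OF is_linfD(5)[OF C] is_linfD(5)[OF C'] smapsD(1)[OF f] as(1) is_linfD(3)[OF C] is_linfD(3)[OF C']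
      smapsD(4)[OF is_linfD(2)[OF C']] subspace_simps(8)[OF is_linfD(1)[OF C']] smapsD(4,3)[OF f] two_torsion_free[OF is_linfD(4)[OF C']]]
    der_leading[OF smapsD(1)[OF f] as smapsD(4)[OF is_linfD(2)[OF C']] E] by simp

text \<open>For the same reason the leading defect of a composite is the linear part of
  \<open>k\<close> applied to the leading defect of \<open>f\<close>. This compares the defects of a
  path at its ends with those of the end maps.\<close>

lemma defect_comp_leading:
  assumes C: "is_linf C" and C': "is_linf C'" and C'': "is_linf C''" and f: "smaps 0 C C' f" and k: "is_morph C' C'' k"
    and as: "as \<in> lists (letters C)" "as \<noteq> []"
    and E: "\<And>bs. bs \<in> lists (letters C) \<Longrightarrow> bs \<noteq> [] \<Longrightarrow> length bs < length as \<Longrightarrow> defect (brk C) (brk C') f bs = 0"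
  shows "defect (brk C) (brk C'') (\<lambda>as. hat f as k) as = k [(total_deg as + 1, defect (brk C) (brk C') f as)]"
proof -
  note k' = is_morphD(1)[OF k]
  have "hat (\<lambda>u. hat f u k) as (brk C'') = hat f as (\<lambda>W. hat k W (brk C''))"
    by (rule hat_hat[OF smapsD(1)[OF f] smapsD(1)[OF k'] as(1) smapsD(4)[OF is_linfD(2)[OF C'']], symmetric])
  also have "\<dots> = hat f as (\<lambda>W. coder (brk C') W k)"
    by (intro hat_cong[OF smapsD(1)[OF f] as(1)] is_morphD(2)[OF k, symmetric]) (use as in auto)
  finally have "defect (brk C) (brk C'') (\<lambda>as. hat f as k) as = der f (defect (brk C) (brk C') f) as k"
    using defect_comp[OF is_linfD(5)[OF C] is_linfD(5)[OF C'] smapsD(1)[OF f] as(1) smapsD(4)[OF k'] subspace_simps(8)[OF is_linfD(1)[OF C']]]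
    by (simp add: defect_def)
  also have "\<dots> = k [(total_deg as + 1, defect (brk C) (brk C') f as)]"
    by (rule der_leading[OF smapsD(1)[OF f] as smapsD(4)[OF k'] E])
  finally show ?thesis .
qed

text \<open>The change \<open>c\<close> vanishes on words shorter than \<open>as\<close>, so it is
  seen only by the partition whose single block is the whole word.\<close>

lemma hat_perturb:
  assumes C': "graded_space C'" and f: "smaps 0 C C' f" and c: "smaps 0 C C' c" and g: "multihom C' g"
    and as: "as \<in> lists (letters C)" "as \<noteq> []"
    and short: "\<And>bs. length bs < length as \<Longrightarrow> c bs = 0"
  shows "hat (\<lambda>as. f as + c as) as g = hat f as g + g [(total_deg as, c as)]"
proof -
  obtain a bs where eq: "as = a # bs" using as by (cases as) auto
  have a: "a \<in> letters C" and bs: "bs \<in> lists (letters C)" using as eq by auto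
  let ?h = "\<lambda>as. f as + c as"
  have h: "smaps 0 C C' ?h" by (rule smaps_add[OF C' f c])
  have split: "hat k as g = g [(total_deg as, k as)] + spl bs (\<lambda>u v. if v = [] then 0 else hat k v (\<lambda>W. g (apply_deg 0 k (a # u) # W)))" for k
    unfolding eq hat.simps by (subst spl_isolate_right) (simp add: apply_deg_def)
  have "spl bs (\<lambda>u v. if v = [] then 0 else hat ?h v (\<lambda>W. g (apply_deg 0 ?h (a # u) # W)))
      = spl bs (\<lambda>u v. if v = [] then 0 else hat f v (\<lambda>W. g (apply_deg 0 f (a # u) # W)))"
  proof (intro spl_cong_lists[OF bs] if_cong refl)
    fix u v assume uv: "u \<in> lists (letters C)" "v \<in> lists (letters C)" "length u + length v = length bs" "v \<noteq> []"
    have "apply_deg 0 ?h (a # u) = apply_deg 0 f (a # u)"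
      using uv eq short[of "a # u"] by (cases v) (auto simp: apply_deg_def)
    moreover have "hat ?h v G = hat f v G" for G :: "_ \<Rightarrow> 'd"
      by (rule hat_cong_map[OF smapsD(1)[OF h] uv(2)]) (use uv eq short in auto)
    ultimately show "hat ?h v (\<lambda>W. g (apply_deg 0 ?h (a # u) # W)) = hat f v (\<lambda>W. g (apply_deg 0 f (a # u) # W))"
      by simp
  qed
  moreover have "g [(total_deg as, f as + c as)] = g [(total_deg as, f as)] + g [(total_deg as, c as)]"
    using hom_onD(4)[OF multihom_head[OF g, of "[]" "total_deg as"]] smaps_mem[OF f as] smaps_mem[OF c as] by simp
  ultimately show ?thesis
    unfolding split[of ?h] split[of f] by (simp add: add_ac)
qed

lemma hat_perturb_short:
  assumes f: "smaps 0 C C' f" and as: "as \<in> lists (letters C)" and short: "\<And>bs. length bs \<le> length as \<Longrightarrow> c bs = 0"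
  shows "hat (\<lambda>as. f as + c as) as g = hat f as g"
  by (rule hat_cong_map[OF smapsD(1)[OF f] as, symmetric]) (simp add: short)

text \<open>In its leading length the correction enters linearly: the defect changes by the
  differential of \<open>c\<close> in the complex of multilinear maps.\<close>

lemma defect_perturb:
  assumes C: "is_linf C" and C': "is_linf C'" and f: "smaps 0 C C' f" and c: "smaps 0 C C' c"
    and as: "as \<in> lists (letters C)" "as \<noteq> []"
    and short: "\<And>bs. length bs < length as \<Longrightarrow> c bs = 0"
  shows "defect (brk C) (brk C') (\<lambda>as. f as + c as) as = defect (brk C) (brk C') f as + coder (brk C) as c - brk C' [(total_deg as, c as)]"
proof -
  have "hat (\<lambda>as. f as + c as) as (brk C') = hat f as (brk C') + brk C' [(total_deg as, c as)]"
    by (rule hat_perturb[OF is_linfD(1)[OF C'] f c smapsD(4)[OF is_linfD(2)[OF C']] as short])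
  then show ?thesis
    unfolding defect_def coder_add by (simp only:) (simp add: algebra_simps)
qed

lemma smaps_diff:
  assumes C': "graded_space C'" and f: "smaps d C C' f" and g: "smaps d C C' g"
  shows "smaps d C C' (\<lambda>as. f as - g as)"
  unfolding smaps_def degmap_def
  by (intro conjI ballI impI multilin_diff[OF subspace_simps(1)[OF C']] symm_diff smapsD(2,3)[OF f] smapsD(2,3)[OF g]
      subspace_simps(6)[OF C'] smaps_mem[OF f] smaps_mem[OF g])

lemma smaps_zero:
  assumes C: "graded_space C" and C': "graded_space C'"
  shows "smaps d C C' (\<lambda>as. 0)"
  using lin_on_const_simps(2)[OF subspace_simps(1)[OF C'], of "smul C"] subspace_simps[OF C] subspace_simps(2)[OF C']
  by (auto simp: smaps_def degmap_def symm_def multilin_def lin_on_def hom_on_def vs_simps[OF subspace_simps(1)[OF C']])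

text \<open>Linearity and symmetry only compare words of equal length, so the component of each
  length may be taken from a different map. This yields the limit of the inductive
  construction.\<close>

lemma smaps_diagonal:
  assumes C': "graded_space C'" and F: "\<And>n. smaps d C C' (F n)"
  shows "smaps d C C' (\<lambda>as. F (length as) as)"
  unfolding smaps_def multilin_def symm_def degmap_def
proof (intro conjI ballI allI impI)
  show "F (length as) as \<in> grade C' (total_deg as + d)" if "as \<in> lists (letters C)" "as \<noteq> []" for as
    by (rule smaps_mem[OF F that])
  show "lin_on (smul C) (smul C') (grade C p) (\<lambda>x. F (length (us @ (p, x) # vs)) (us @ (p, x) # vs))"
    if "us \<in> lists (letters C)" "vs \<in> lists (letters C)" for us vs p
    using multilinD[OF smapsD(2)[OF F] that] by simp
  show "F (length (us @ a # b # vs)) (us @ a # b # vs) = sg (fst a * fst b) (F (length (us @ b # a # vs)) (us @ b # a # vs))"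
    if "us \<in> lists (letters C)" "vs \<in> lists (letters C)" "a \<in> letters C" "b \<in> letters C" for us vs a b
    using symmD[OF smapsD(3)[OF F, of "length (us @ a # b # vs)"] that] by (simp only: length_append list.size)
qed

section \<open>Simultaneous construction of the inverse and the homotopy\<close>

locale quasi_inverse =
  fixes C1 :: "('k::field_char_0, 'v::ab_group_add) linf" and C2 :: "('k, 'w::ab_group_add) linf"
    and f :: "(int \<times> 'v) list \<Rightarrow> 'w"
  assumes C1: "is_linf C1" and C2: "is_linf C2" and f: "is_morph C1 C2 f" and qf: "quasi_iso C1 C2 f"
begin

abbreviation "P \<equiv> path C2"

lemmas g1 = is_linfD(1)[OF C1]
lemmas g2 = is_linfD(1)[OF C2]
lemmas P = is_linf_path[OF C2]
lemmas gP = is_linfD(1)[OF P]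
lemmas e = is_morph_peval[OF C2]
lemmas f' = is_morphD(1)[OF f]

text \<open>The homotopy fibre of \<open>f\<^sub>1\<close>, in which the obstructions lie.\<close>

definition fib :: "('k, 'v \<times> (nat \<Rightarrow> 'w)) linf" where
  "fib = \<lparr>smul = \<lambda>c xz. (smul C1 c (fst xz), smul P c (snd xz)),
     grade = \<lambda>p. {xz. fst xz \<in> grade C1 p \<and> snd xz \<in> grade P p \<and> f [(p, fst xz)] = q0 (snd xz) 0 \<and> q0 (snd xz) 1 = 0},
     brk = \<lambda>_. 0\<rparr>"

lemma fib_simps [simp]:
  "smul fib c xz = (smul C1 c (fst xz), smul P c (snd xz))"
  "xz \<in> grade fib p \<longleftrightarrow> fst xz \<in> grade C1 p \<and> snd xz \<in> grade P p \<and> f [(p, fst xz)] = q0 (snd xz) 0 \<and> q0 (snd xz) 1 = 0"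
  by (auto simp: fib_def)

lemma q0_smul_path: "q0 (smul P c z) n = smul C2 c (q0 z n)"
  by (simp add: path_def)

lemma graded_fib: "graded_space fib"
proof -
  note s1 = is_linfD(4)[OF C1] and s2 = is_linfD(4)[OF C2] and sP = is_linfD(4)[OF P]
  have vs: "vector_space (smul fib)"
    by unfold_locales (auto simp: vs_simps[OF s1] vs_simps[OF sP] prod_eq_iff)
  interpret vector_space "smul fib" by fact
  have "subspace (grade fib p)" for p
  proof (rule subspaceI)
    note h = hom_onD[OF morph_facts(3)[OF f, of p]]
    show "0 \<in> grade fib p" using h(1,2) subspace_simps(2)[OF gP] by simp
    show "x + y \<in> grade fib p" if "x \<in> grade fib p" "y \<in> grade fib p" for x y
      using that h(3,4)[of "fst x" "fst y"] subspace_simps(3)[OF gP, of "snd x" p "snd y"] by simp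
    show "smul fib c x \<in> grade fib p" if "x \<in> grade fib p" for c x
      using that lin_onD(2,3)[OF morph_facts(2)[OF f, of p], of "fst x" c] subspace_simps(4)[OF gP, of "snd x" p c]
      by (simp add: q0_smul_path vs_simps[OF s2])
  qed
  then show ?thesis using vs by (simp add: graded_space_def)
qed

text \<open>The homotopy fibre is used as a complex of graded vector spaces; this is its
  differential.\<close>

definition dfib :: "int \<Rightarrow> 'v \<times> (nat \<Rightarrow> 'w) \<Rightarrow> 'v \<times> (nat \<Rightarrow> 'w)" where
  "dfib p xz = (brk C1 [(p, fst xz)], brk P [(p, snd xz)])"

lemma q0_dpath: "q0 (brk P [(p, z)]) n = brk C2 [(p, q0 z n)]"
  by (simp add: path_brk_single)

lemma lin_on_fst: "lin_on (smul fib) (smul C1) (grade fib p) fst" "lin_on (smul fib) (smul P) (grade fib p) snd"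
  unfolding lin_on_def hom_on_def
  by (intro conjI ballI allI subspace_simps[OF graded_fib]; simp)+

lemma lin_on_Pair:
  "lin_on sc (smul C1) G a \<Longrightarrow> lin_on sc (smul P) G b \<Longrightarrow> lin_on sc (smul fib) G (\<lambda>x. (a x, b x))"
  by (simp add: lin_on_def hom_on_def)

lemma dfib_facts:
  "lin_on (smul fib) (smul fib) (grade fib p) (dfib p)" "xz \<in> grade fib p \<Longrightarrow> dfib p xz \<in> grade fib (p + 1)"
  "xz \<in> grade fib p \<Longrightarrow> dfib (p + 1) (dfib p xz) = 0"
proof -
  show "lin_on (smul fib) (smul fib) (grade fib p) (dfib p)"
    unfolding dfib_def[abs_def]
    by (intro lin_on_Pair lin_on_comp[OF lin_on_fst(1) d_facts(2)[OF C1]] lin_on_comp[OF lin_on_fst(2) d_facts(2)[OF P]]) simp_all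
  show "dfib p xz \<in> grade fib (p + 1)" if "xz \<in> grade fib p"
    using that d_facts(1)[OF C1] d_facts(1)[OF P] morph_facts(4)[OF f, of "fst xz" p] hom_onD(2)[OF d_facts(3)[OF C2, of p]]
    by (simp add: dfib_def q0_dpath)
  show "dfib (p + 1) (dfib p xz) = 0" if "xz \<in> grade fib p"
    using that d_facts(4)[OF C1] d_facts(4)[OF P] by (simp add: dfib_def zero_prod_def)
qed

text \<open>For a cocycle (x, z), the path z runs from the image of x to 0 and so bounds this image.
  Injectivity of \<open>f\<close> on cohomology gives a primitive of x, and surjectivity corrects it
  so that z has a primitive path with the prescribed ends.\<close>

lemma fib_acyclic:
  assumes xz: "xz \<in> grade fib p" and d0: "dfib p xz = 0"
  shows "\<exists>y\<in>grade fib (p - 1). dfib (p - 1) y = xz"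
proof -
  obtain x z where eq: "xz = (x, z)" by (cases xz)
  have x: "x \<in> cocycles C1 p" and z: "z \<in> cocycles P p" and fx: "f [(p, x)] = q0 z 0" and z1: "q0 z 1 = 0"
    using xz d0 by (auto simp: eq dfib_def zero_prod_def cocycles_def)
  have gx: "x \<in> grade C1 p" using x by (simp add: cocycles_def)
  obtain m where m: "m \<in> grade P (p - 1)" "z - pincl [(p, q0 z 0)] = brk P [(p - 1, m)]" "q0 m 0 = 0"
    using path_cocycle(1)[OF C2 z] by blast
  \<comment> \<open>The end of the bounding path \<open>m\<close>, which starts at 0. Its
    differential is minus the image of \<open>x\<close>, since \<open>z\<close> ends at 0.\<close>
  define V where "V = q0 m 1"
  have qe: "q0 y n \<in> grade C2 r" if "y \<in> grade P r" for y n r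
    using morph_facts(1)[OF e[of n] that] by simp
  have V: "V \<in> grade C2 (p - 1)" unfolding V_def by (rule qe[OF m(1)])
  have "q0 (z - pincl [(p, q0 z 0)]) 1 = q0 (brk P [(p - 1, m)]) 1" by (simp only: m(2))
  then have dV: "brk C2 [(p - 1, V)] = - f [(p, x)]"
    using z1 by (simp add: q0_dpath V_def fx)
  have "f [(p, x)] \<in> coboundaries C2 p"
    unfolding coboundaries_iff using dV hom_onD(5,6)[OF d_facts(3)[OF C2] V] by (intro bexI[of _ "- V"]) simp_all
  then have "x \<in> coboundaries C1 p"
    using conjunct1[OF iffD1[OF quasi_iso_iff[OF C1 C2 f] qf], rule_format, OF x] by simp
  then obtain x0 where x0: "x0 \<in> grade C1 (p - 1)" "x = brk C1 [(p - 1, x0)]"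
    unfolding coboundaries_iff by blast
  have fx0: "f [(p - 1, x0)] \<in> grade C2 (p - 1)" by (rule morph_facts(1)[OF f x0(1)])
  have "brk C2 [(p - 1, f [(p - 1, x0)] + V)] = 0"
    using hom_onD(4)[OF d_facts(3)[OF C2] fx0 V] morph_facts(4)[OF f x0(1)] dV x0(2) by simp
  then have "f [(p - 1, x0)] + V \<in> cocycles C2 (p - 1)"
    using subspace_simps(3)[OF g2 fx0 V] by (simp add: cocycles_def)
  from conjunct2[OF iffD1[OF quasi_iso_iff[OF C1 C2 f] qf], rule_format, OF this]
  obtain c where c: "c \<in> cocycles C1 (p - 1)" "f [(p - 1, c)] - (f [(p - 1, x0)] + V) \<in> coboundaries C2 (p - 1)" by blast
  from hom_onD(5)[OF hom_coboundaries[OF C2] c(2)]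
  obtain b where b: "b \<in> grade C2 (p - 1 - 1)" "(f [(p - 1, x0)] + V) - f [(p - 1, c)] = brk C2 [(p - 1 - 1, b)]"
    unfolding coboundaries_iff by auto
  have gc: "c \<in> grade C1 (p - 1)" "brk C1 [(p - 1, c)] = 0" using c(1) by (auto simp: cocycles_def)
  define x' where "x' = x0 - c"
  have "f [(p - 1, x')] = f [(p - 1, x0)] - f [(p - 1, c)]"
    unfolding x'_def by (rule hom_onD(10)[OF morph_facts(3)[OF f] x0(1) gc(1)])
  then have "f [(p - 1, x')] + V = (f [(p - 1, x0)] + V) - f [(p - 1, c)]" by simp
  then have x'V: "f [(p - 1, x')] + V = brk C2 [(p - 1 - 1, b)]" by (simp only: b(2))
  have x': "x' \<in> grade C1 (p - 1)" "brk C1 [(p - 1, x')] = x"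
    unfolding x'_def using subspace_simps(6)[OF g1 x0(1) gc(1)] hom_onD(10)[OF d_facts(3)[OF C1] x0(1) gc(1)] x0(2) gc(2)
    by simp_all
  have fx': "f [(p - 1, x')] \<in> grade C2 (p - 1)" by (rule morph_facts(1)[OF f x'(1)])
  \<comment> \<open>A path from 0 to \<open>b\<close>: subtracting its differential lowers the end
    at 1 by the differential of \<open>b\<close> and leaves the end at 0 alone.\<close>
  define u where "u = pline C2 0 b"
  have u: "u \<in> grade P (p - 1 - 1)" "q0 u 0 = 0" "q0 u 1 = b"
    unfolding u_def using pline[OF g2 subspace_simps(2)[OF g2] b(1)] by auto
  have du: "brk P [(p - 1 - 1, u)] \<in> grade P (p - 1)" "brk P [(p - 1, brk P [(p - 1 - 1, u)])] = 0"
    using d_facts(1,4)[OF P u(1)] by simp_all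
  have ip: "pincl [(p - 1, f [(p - 1, x')])] \<in> grade P (p - 1)"
    by (rule morph_facts(1)[OF is_morph_pincl[OF C2] fx'])
  \<comment> \<open>The constant path gives the start required by \<open>x'\<close>, and
    \<open>m\<close> bounds \<open>z\<close> up to a constant path. The end at 1 is then the
    boundary of \<open>b\<close>, which the last summand removes.\<close>
  define z' where "z' = pincl [(p - 1, f [(p - 1, x')])] + m - brk P [(p - 1 - 1, u)]"
  have ipm: "pincl [(p - 1, f [(p - 1, x')])] + m \<in> grade P (p - 1)"
    by (rule subspace_simps(3)[OF gP ip m(1)])
  have "z' \<in> grade P (p - 1)"
    unfolding z'_def by (rule subspace_simps(6)[OF gP ipm du(1)])
  moreover have "brk P [(p - 1, z')] = z"
  proof -
    have "brk P [(p - 1, pincl [(p - 1, f [(p - 1, x')])])] = pincl [(p, f [(p, x)])]"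
      using morph_facts(4)[OF is_morph_pincl[OF C2] fx'] morph_facts(4)[OF f x'(1)] x'(2) by simp
    then show ?thesis
      unfolding z'_def using hom_onD(10)[OF d_facts(3)[OF P] ipm du(1)] hom_onD(4)[OF d_facts(3)[OF P] ip m(1)] du(2)
        m(2)[symmetric] by (simp only: fx) simp
  qed
  moreover have "q0 z' 0 = f [(p - 1, x')]"
    using hom_onD(2)[OF d_facts(3)[OF C2]] by (simp add: z'_def q0_dpath m(3) u(2))
  moreover have "q0 z' 1 = 0"
    using x'V by (simp add: z'_def q0_dpath u(3)[unfolded One_nat_def] V_def)
  ultimately show ?thesis
    using x' by (intro bexI[of _ "(x', z')"]) (simp_all add: dfib_def eq)
qed

text \<open>Both maps exist in all word lengths from the beginning; \<open>n\<close> bounds only the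
  words on which the equations are demanded. An extension step thus becomes a change in one
  length.\<close>

definition inverse_upto :: "nat \<Rightarrow> ((int \<times> 'w) list \<Rightarrow> 'v) \<times> ((int \<times> 'w) list \<Rightarrow> nat \<Rightarrow> 'w) \<Rightarrow> bool" where
  "inverse_upto n gH \<longleftrightarrow> smaps 0 C2 C1 (fst gH) \<and> smaps 0 C2 P (snd gH) \<and>
     (\<forall>as\<in>lists (letters C2). as \<noteq> [] \<longrightarrow> length as \<le> n \<longrightarrow>
        q0 (snd gH as) 0 = hat (fst gH) as f \<and> q0 (snd gH as) 1 = linf_id as \<and>
        defect (brk C2) (brk C1) (fst gH) as = 0 \<and> defect (brk C2) (brk P) (snd gH) as = 0)"

lemma inverse_uptoI:
  assumes "smaps 0 C2 C1 g" "smaps 0 C2 P H"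
    and "\<And>as. as \<in> lists (letters C2) \<Longrightarrow> as \<noteq> [] \<Longrightarrow> length as \<le> n \<Longrightarrow>
        q0 (H as) 0 = hat g as f \<and> q0 (H as) 1 = linf_id as \<and>
        defect (brk C2) (brk C1) g as = 0 \<and> defect (brk C2) (brk P) H as = 0"
  shows "inverse_upto n (g, H)"
  using assms unfolding inverse_upto_def fst_conv snd_conv by simp

lemma inverse_uptoD:
  assumes "inverse_upto n (g, H)"
  shows "smaps 0 C2 C1 g" "smaps 0 C2 P H"
    "as \<in> lists (letters C2) \<Longrightarrow> as \<noteq> [] \<Longrightarrow> length as \<le> n \<Longrightarrow> q0 (H as) 0 = hat g as f"
    "as \<in> lists (letters C2) \<Longrightarrow> as \<noteq> [] \<Longrightarrow> length as \<le> n \<Longrightarrow> q0 (H as) 1 = linf_id as"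
    "as \<in> lists (letters C2) \<Longrightarrow> as \<noteq> [] \<Longrightarrow> length as \<le> n \<Longrightarrow> defect (brk C2) (brk C1) g as = 0"
    "as \<in> lists (letters C2) \<Longrightarrow> as \<noteq> [] \<Longrightarrow> length as \<le> n \<Longrightarrow> defect (brk C2) (brk P) H as = 0"
  using assms unfolding inverse_upto_def fst_conv snd_conv by simp_all

text \<open>The ends of the homotopy are put right before the defects: only then do the leading
  defects of \<open>g\<close> and of the homotopy together lie in the homotopy fibre.\<close>

lemma adjust:
  assumes inv: "inverse_upto n (g, H)"
  obtains H' where "smaps 0 C2 P H'" "\<And>as. length as \<noteq> Suc n \<Longrightarrow> H' as = H as"
    "\<And>as. as \<in> lists (letters C2) \<Longrightarrow> as \<noteq> [] \<Longrightarrow> length as \<le> Suc n \<Longrightarrow> q0 (H' as) 0 = hat g as f \<and> q0 (H' as) 1 = linf_id as"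
proof -
  note g = inverse_uptoD(1)[OF inv] and H = inverse_uptoD(2)[OF inv]
  note s2 = is_linfD(4)[OF C2]
  have qH: "smaps 0 C2 C2 (\<lambda>as. q0 (H as) j)" for j
    using smaps_post_0[OF morph_facts(2)[OF e[of j]] morph_facts(1)[OF e[of j]] H] by simp
  \<comment> \<open>The correction is the path A + t B. Its start \<open>A\<close> is the error at
    0, and A + B is the error at 1.\<close>
  define A where "A as = hat g as f - q0 (H as) 0" for as
  define B where "B as = (linf_id as - q0 (H as) 1) - A as" for as
  have A: "smaps 0 C2 C2 A" unfolding A_def[abs_def] by (intro smaps_diff g2 smaps_comp[OF g2 g f'] qH)
  have B: "smaps 0 C2 C2 B" unfolding B_def[abs_def] by (intro smaps_diff g2 smaps_linf_id[OF g2] qH A)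
  let ?t = "\<lambda>b. pline C2 0 b"
  have tl: "lin_on (smul C2) (smul P) (grade C2 p) ?t" for p
  proof -
    have "pline C2 0 (x + y) = pline C2 0 x + pline C2 0 y" for x y
      by (rule q_eqI) (simp_all add: pline_def fun_eq_iff vs_simps[OF s2])
    moreover have "pline C2 0 (smul C2 c x) = smul P c (pline C2 0 x)" for c x
      by (rule q_eqI) (simp_all add: pline_def path_def fun_eq_iff vs_simps[OF s2] mult.commute)
    ultimately show ?thesis
      unfolding lin_on_def hom_on_def using subspace_simps[OF g2] by simp
  qed
  have tm: "?t x \<in> grade P p" if "x \<in> grade C2 p" for x p
    by (rule pline(1)[OF g2 subspace_simps(2)[OF g2] that])
  have a: "smaps 0 C2 P (\<lambda>as. pincl [(total_deg as + 0, A as)])"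
    by (rule smaps_post_0[OF morph_facts(2)[OF is_morph_pincl[OF C2]] morph_facts(1)[OF is_morph_pincl[OF C2]] A])
  have b: "smaps 0 C2 P (\<lambda>as. ?t (B as))"
    by (rule smaps_post_0[OF tl tm B])
  define c where "c as = pincl [(total_deg as + 0, A as)] + ?t (B as)" for as
  have c: "smaps 0 C2 P c" unfolding c_def[abs_def] by (rule smaps_add[OF gP a b])
  have tc: "smaps 0 C2 P (trunc (Suc n) c)"
    by (rule smaps_trunc[OF g2 gP]) (use smaps_mem[OF c] smapsD(2,3)[OF c] in auto)
  have qc: "q0 (c as) 0 = A as" "q0 (c as) 1 = A as + B as" for as
    by (simp_all add: c_def pline_def vs_simps[OF s2])
  show thesis
  proof (rule that[of "\<lambda>as. H as + trunc (Suc n) c as"])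
    show "smaps 0 C2 P (\<lambda>as. H as + trunc (Suc n) c as)" by (rule smaps_add[OF gP H tc])
    show "H as + trunc (Suc n) c as = H as" if "length as \<noteq> Suc n" for as
      using that by simp
    show "q0 (H as + trunc (Suc n) c as) 0 = hat g as f \<and> q0 (H as + trunc (Suc n) c as) 1 = linf_id as"
      if as: "as \<in> lists (letters C2)" "as \<noteq> []" "length as \<le> Suc n" for as
    proof (cases "length as = Suc n")
      case True
      then show ?thesis using qc[of as] by (simp add: A_def B_def)
    next
      case False
      then have "length as \<le> n" using as(3) by simp
      then show ?thesis using inverse_uptoD(3,4)[OF inv as(1,2)] False by simp
    qed
  qed
qed

text \<open>The leading defects of \<open>g\<close> and of the adjusted homotopy form a cocycle with
  values in the fibre. Contracting it gives a correction in length \<open>Suc n\<close> that removes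
  both defects and, having values in the fibre, keeps the ends in place.\<close>

lemma step:
  assumes inv: "inverse_upto n (g, H)"
  shows "\<exists>g' H'. inverse_upto (Suc n) (g', H') \<and> (\<forall>as. length as \<noteq> Suc n \<longrightarrow> g' as = g as \<and> H' as = H as)"
proof -
  note g = inverse_uptoD(1)[OF inv]
  obtain H0 where H0: "smaps 0 C2 P H0" and H0H: "\<And>as. length as \<noteq> Suc n \<Longrightarrow> H0 as = H as"
    and ends: "\<And>as. as \<in> lists (letters C2) \<Longrightarrow> as \<noteq> [] \<Longrightarrow> length as \<le> Suc n \<Longrightarrow> q0 (H0 as) 0 = hat g as f \<and> q0 (H0 as) 1 = linf_id as"
    by (rule adjust[OF inv]) (rule that)
  define Eg where "Eg = defect (brk C2) (brk C1) g"
  define EH where "EH = defect (brk C2) (brk P) H0"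
  have Egs: "smaps 1 C2 C1 Eg" and EHs: "smaps 1 C2 P EH"
    unfolding Eg_def EH_def by (rule smaps_defect[OF C2 C1 g], rule smaps_defect[OF C2 P H0])
  have Eg0: "Eg as = 0" if "as \<in> lists (letters C2)" "as \<noteq> []" "length as \<le> n" for as
    unfolding Eg_def by (rule inverse_uptoD(5)[OF inv that])
  have EH0: "EH as = 0" if "as \<in> lists (letters C2)" "as \<noteq> []" "length as \<le> n" for as
  proof -
    have "EH as = defect (brk C2) (brk P) H as"
      unfolding EH_def by (rule defect_cong[OF is_linfD(5)[OF C2] smapsD(1)[OF H0] that(1)]) (use that(3) H0H in auto)
    then show ?thesis using inverse_uptoD(6)[OF inv that] by simp
  qed
  have E: "Eg as \<in> grade C1 (total_deg as + 1)" "EH as \<in> grade P (total_deg as + 1)"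
    if "as \<in> lists (letters C2)" "as \<noteq> []" for as
    by (rule smaps_mem[OF Egs that], rule smaps_mem[OF EHs that])
  \<comment> \<open>The adjusted homotopy evaluates to the composite of \<open>g\<close> with
    \<open>f\<close> at 0 and to the identity at 1. So its defect starts at the image of the defect
    of \<open>g\<close> and ends at the defect of the identity, which is 0.\<close>
  have Ef: "(Eg as, EH as) \<in> grade fib (total_deg as + 1)"
    if as: "as \<in> lists (letters C2)" "as \<noteq> []" "length as = Suc n" for as
  proof -
    have lowg: "defect (brk C2) (brk C1) g bs = 0" if "bs \<in> lists (letters C2)" "bs \<noteq> []" "length bs < length as" for bs
      using Eg0[OF that(1,2)] that(3) as(3) by (simp add: Eg_def)
    have lowH: "defect (brk C2) (brk P) H0 bs = 0" if "bs \<in> lists (letters C2)" "bs \<noteq> []" "length bs < length as" for bs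
      using EH0[OF that(1,2)] that(3) as(3) by (simp add: EH_def)
    have ev: "q0 (EH as) j = defect (brk C2) (brk C2) (\<lambda>as. hat H0 as (peval j)) as" for j
      using defect_comp_leading[OF C2 P C2 H0 e[of j] as(1,2) lowH] by (simp add: EH_def)
    have hj: "hat H0 bs (peval j) = q0 (H0 bs) j" if "bs \<in> lists (letters C2)" "bs \<noteq> []" for bs j
      using hat_into_strict[OF smapsD(1)[OF H0] peval_long smapsD(4)[OF is_morphD(1)[OF e[of j]]] that] by simp
    have sj: "smaps 0 C2 C2 (\<lambda>as. hat H0 as (peval j))" for j
      by (rule smaps_comp[OF g2 H0 is_morphD(1)[OF e]])
    have "q0 (EH as) 0 = defect (brk C2) (brk C2) (\<lambda>as. hat g as f) as"
      unfolding ev by (rule defect_cong[OF is_linfD(5)[OF C2] smapsD(1)[OF sj] as(1)]) (use hj ends as(3) in simp)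
    also have "\<dots> = f [(total_deg as + 1, Eg as)]"
      unfolding Eg_def by (rule defect_comp_leading[OF C2 C1 C2 g f as(1,2) lowg])
    finally have 0: "f [(total_deg as + 1, Eg as)] = q0 (EH as) 0" by simp
    have "q0 (EH as) 1 = defect (brk C2) (brk C2) linf_id as"
      unfolding ev by (rule defect_cong[OF is_linfD(5)[OF C2] smapsD(1)[OF sj] as(1)]) (use hj ends as(3) in simp)
    also have "\<dots> = 0"
      using is_morphD(2)[OF is_morph_linf_id[OF C2] as(1,2)] by (simp add: defect_def)
    finally show ?thesis using 0 E[OF as(1,2)] by simp
  qed
  have "\<exists>\<eta>. (\<forall>p. lin_on (smul fib) (smul fib) (grade fib p) (\<eta> p)) \<and> (\<forall>p. \<forall>x\<in>grade fib p. \<eta> p x \<in> grade fib (p - 1)) \<and>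
      (\<forall>p. \<forall>x\<in>grade fib p. dfib (p - 1) (\<eta> p x) + \<eta> (p + 1) (dfib p x) = x)"
    by (rule contraction) (assumption | rule graded_fib dfib_facts fib_acyclic)+
  then obtain \<eta> where \<eta>': "\<forall>p. lin_on (smul fib) (smul fib) (grade fib p) (\<eta> p)" "\<forall>p. \<forall>x\<in>grade fib p. \<eta> p x \<in> grade fib (p - 1)"
    "\<forall>p. \<forall>x\<in>grade fib p. dfib (p - 1) (\<eta> p x) + \<eta> (p + 1) (dfib p x) = x"
    by (elim exE conjE)
  note \<eta> = \<eta>'(1)[rule_format] \<eta>'(2,3)[rule_format]
  define F where "F = trunc (Suc n) (\<lambda>as. (Eg as, EH as))"
  have F: "smaps 1 C2 fib F"
    unfolding F_def
  proof (rule smaps_trunc[OF g2 graded_fib Ef])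
    show "multilin C2 (smul fib) (\<lambda>as. (Eg as, EH as))"
      unfolding multilin_def
      by (intro ballI allI lin_on_Pair multilinD[OF smapsD(2)[OF Egs]] multilinD[OF smapsD(2)[OF EHs]])
    show "symm C2 (\<lambda>as. (Eg as, EH as))"
      unfolding symm_def
    proof (intro ballI)
      fix us vs a b
      assume *: "us \<in> lists (letters C2)" "vs \<in> lists (letters C2)" "a \<in> letters C2" "b \<in> letters C2"
      show "(Eg (us @ a # b # vs), EH (us @ a # b # vs)) = sg (fst a * fst b) (Eg (us @ b # a # vs), EH (us @ b # a # vs))"
        unfolding symmD[OF smapsD(3)[OF Egs] *] symmD[OF smapsD(3)[OF EHs] *] by (simp add: sg_def)
    qed
  qed
  \<comment> \<open>\<open>\<eta>\<close> lowers the degree by one: the defects have degree 1, and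
    the correction has degree 0 as a morphism must.\<close>
  define c where "c as = \<eta> (total_deg as + 1) (F as)" for as
  have "smaps (1 + - 1) C2 fib c"
    unfolding c_def[abs_def] by (rule smaps_post[OF \<eta>(1) _ F]) (use \<eta>(2) in simp)
  then have c: "smaps 0 C2 fib c" by simp
  have cg: "smaps 0 C2 C1 (\<lambda>as. fst (c as))" and cH: "smaps 0 C2 P (\<lambda>as. snd (c as))"
    using smaps_post_0[OF lin_on_fst(1) _ c] smaps_post_0[OF lin_on_fst(2) _ c] by simp_all
  have c0: "c as = 0" if "length as \<noteq> Suc n" for as
    using that hom_onD(2)[OF lin_onD(1)[OF \<eta>(1)]] by (simp add: c_def F_def)
  have cend: "f [(total_deg as, fst (c as))] = q0 (snd (c as)) 0" "q0 (snd (c as)) 1 = 0"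
    if "as \<in> lists (letters C2)" "as \<noteq> []" for as
    using smaps_mem[OF c that] by simp_all
  \<comment> \<open>The coderivation only meets words that are no longer than \<open>as\<close>, and
    on shorter ones the defects vanish, so the truncation changes nothing.\<close>
  have cod: "coder (brk C2) as F = - dfib (total_deg as + 1) (F as)"
    if as: "as \<in> lists (letters C2)" "as \<noteq> []" "length as = Suc n" for as
  proof -
    have hp: "hom_on UNIV fst" "hom_on UNIV snd" by (simp_all add: hom_on_def)
    have "fst (coder (brk C2) as F) = coder (brk C2) as (\<lambda>W. fst (F W))" "snd (coder (brk C2) as F) = coder (brk C2) as (\<lambda>W. snd (F W))"
      by (rule coder_hom(2)[OF is_linfD(5)[OF C2] as(1) hp(1) UNIV_I], rule coder_hom(2)[OF is_linfD(5)[OF C2] as(1) hp(2) UNIV_I])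
    moreover have "coder (brk C2) as (\<lambda>W. fst (F W)) = coder (brk C2) as Eg"
      by (rule coder_cong[OF is_linfD(5)[OF C2] as(1)]) (use Eg0 as(3) in \<open>auto simp: F_def trunc_def\<close>)
    moreover have "coder (brk C2) as (\<lambda>W. snd (F W)) = coder (brk C2) as EH"
      by (rule coder_cong[OF is_linfD(5)[OF C2] as(1)]) (use EH0 as(3) in \<open>auto simp: F_def trunc_def\<close>)
    moreover have "coder (brk C2) as Eg = - brk C1 [(total_deg as + 1, Eg as)]"
      unfolding Eg_def by (rule bianchi_leading[OF C2 C1 g as(1,2)]) (use Eg0 as(3) in \<open>simp add: Eg_def\<close>)
    moreover have "coder (brk C2) as EH = - brk P [(total_deg as + 1, EH as)]"
      unfolding EH_def by (rule bianchi_leading[OF C2 P H0 as(1,2)]) (use EH0 as(3) in \<open>simp add: EH_def\<close>)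
    ultimately show ?thesis
      by (simp add: prod_eq_iff dfib_def F_def as(3))
  qed
  \<comment> \<open>Write D for \<open>coder\<close> and d for \<open>dfib\<close>. From
    \<open>c = \<eta> F\<close> and D F = - d F one gets D c = - \<eta> (d F), so the sum is F -
    \<eta> (d F) - d (\<eta> F) = 0. By \<open>defect_perturb\<close> its two components are the new
    defects.\<close>
  have key: "F as + coder (brk C2) as c - dfib (total_deg as) (c as) = 0"
    if as: "as \<in> lists (letters C2)" "as \<noteq> []" "length as = Suc n" for as
  proof -
    let ?p = "total_deg as + 1"
    have Fm: "F as \<in> grade fib ?p" by (rule smaps_mem[OF F as(1,2)])
    have "coder (brk C2) as c = coder (brk C2) as (\<lambda>W. \<eta> (?p + 1) (F W))"
      by (rule coder_cong[OF is_linfD(5)[OF C2] as(1)]) (simp add: c_def)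
    also have "\<dots> = \<eta> (?p + 1) (coder (brk C2) as F)"
    proof (rule coder_hom(2)[OF is_linfD(5)[OF C2] as(1) lin_onD(1)[OF \<eta>(1)], symmetric])
      fix W assume "W \<in> lists (letters C2)" "W \<noteq> []" "total_deg W = total_deg as + 1"
      then show "F W \<in> grade fib (?p + 1)" using smaps_mem[OF F, of W] by simp
    qed
    also have "\<dots> = - \<eta> (?p + 1) (dfib ?p (F as))"
      unfolding cod[OF as] by (rule hom_onD(6)[OF lin_onD(1)[OF \<eta>(1)] dfib_facts(2)[OF Fm]])
    finally have "coder (brk C2) as c = - \<eta> (?p + 1) (dfib ?p (F as))" .
    moreover have "dfib (total_deg as) (c as) + \<eta> (?p + 1) (dfib ?p (F as)) = F as"
      using \<eta>(3)[OF Fm] by (simp add: c_def)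
    ultimately show ?thesis by (simp add: algebra_simps)
  qed
  let ?g = "\<lambda>as. g as + fst (c as)" and ?H = "\<lambda>as. H0 as + snd (c as)"
  have "inverse_upto (Suc n) (?g, ?H)"
  proof (rule inverse_uptoI)
    show "smaps 0 C2 C1 ?g" by (rule smaps_add[OF g1 g cg])
    show "smaps 0 C2 P ?H" by (rule smaps_add[OF gP H0 cH])
    fix as assume as: "as \<in> lists (letters C2)" "as \<noteq> []" "length as \<le> Suc n"
    show "q0 (?H as) 0 = hat ?g as f \<and> q0 (?H as) 1 = linf_id as \<and> defect (brk C2) (brk C1) ?g as = 0 \<and> defect (brk C2) (brk P) ?H as = 0"
    proof (cases "length as = Suc n")
      case True
      have short: "fst (c bs) = 0" "snd (c bs) = 0" if "length bs < length as" for bs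
        using c0[of bs] that True by simp_all
      have "hat ?g as f = hat g as f + f [(total_deg as, fst (c as))]"
        by (rule hat_perturb[OF g1 g cg smapsD(4)[OF f'] as(1,2) short(1)])
      moreover have "defect (brk C2) (brk C1) ?g as = Eg as + coder (brk C2) as (\<lambda>as. fst (c as)) - brk C1 [(total_deg as, fst (c as))]"
        unfolding Eg_def by (rule defect_perturb[OF C2 C1 g cg as(1,2) short(1)])
      moreover have "defect (brk C2) (brk P) ?H as = EH as + coder (brk C2) as (\<lambda>as. snd (c as)) - brk P [(total_deg as, snd (c as))]"
        unfolding EH_def by (rule defect_perturb[OF C2 P H0 cH as(1,2) short(2)])
      moreover have hp: "hom_on UNIV fst" "hom_on UNIV snd" by (simp_all add: hom_on_def)
      have "fst (coder (brk C2) as c) = coder (brk C2) as (\<lambda>W. fst (c W))" "snd (coder (brk C2) as c) = coder (brk C2) as (\<lambda>W. snd (c W))"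
        by (rule coder_hom(2)[OF is_linfD(5)[OF C2] as(1) hp(1) UNIV_I], rule coder_hom(2)[OF is_linfD(5)[OF C2] as(1) hp(2) UNIV_I])
      then have "Eg as + coder (brk C2) as (\<lambda>as. fst (c as)) - brk C1 [(total_deg as, fst (c as))] = 0"
        "EH as + coder (brk C2) as (\<lambda>as. snd (c as)) - brk P [(total_deg as, snd (c as))] = 0"
        using key[OF as(1,2) True] by (simp_all add: prod_eq_iff dfib_def F_def True)
      ultimately show ?thesis
        using ends[OF as] cend[OF as(1,2)] by simp
    next
      case False
      then have n: "length as \<le> n" using as(3) by simp
      have short: "fst (c bs) = 0" "snd (c bs) = 0" if "length bs \<le> length as" for bs
        using c0[of bs] that n by simp_all
      have "hat ?g as f = hat g as f"
        by (rule hat_perturb_short[OF g as(1) short(1)])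
      moreover have "Eg as = defect (brk C2) (brk C1) ?g as"
        unfolding Eg_def by (rule defect_cong[OF is_linfD(5)[OF C2] smapsD(1)[OF g] as(1)]) (simp add: short)
      moreover have "EH as = defect (brk C2) (brk P) ?H as"
        unfolding EH_def by (rule defect_cong[OF is_linfD(5)[OF C2] smapsD(1)[OF H0] as(1)]) (simp add: short)
      ultimately show ?thesis
        using ends[OF as] short[of as] Eg0[OF as(1,2) n] EH0[OF as(1,2) n] by simp
    qed
  qed
  moreover have "?g as = g as \<and> ?H as = H as" if "length as \<noteq> Suc n" for as
    using c0[OF that] H0H[OF that] by simp
  ultimately show ?thesis by (intro exI[of _ ?g] exI[of _ ?H]) simp
qed

text \<open>Dependent choice iterates \<open>step\<close>. The stage from n to n + 1 changes only
  words of length n + 1, so each component is final once its length is reached and the limit is read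
  off on the diagonal.\<close>

lemma exists_inverse:
  obtains g H where "is_morph C2 C1 g" "is_morph C2 P H"
    "\<And>as. as \<in> lists (letters C2) \<Longrightarrow> as \<noteq> [] \<Longrightarrow> q0 (H as) 0 = hat g as f \<and> q0 (H as) 1 = linf_id as"
proof -
  let ?agree = "\<lambda>n x y. \<forall>as. length as \<noteq> Suc n \<longrightarrow> fst y as = fst x as \<and> snd y as = snd x as"
  \<comment> \<open>No nonempty word has length 0, so nothing is demanded of the zero maps.\<close>
  have "inverse_upto 0 (\<lambda>as. 0, \<lambda>as. 0)"
    by (rule inverse_uptoI) (auto intro!: smaps_zero g1 g2 gP)
  then have base: "\<exists>x. inverse_upto 0 x" by blast
  have next_ex: "\<exists>y. inverse_upto (Suc n) y \<and> ?agree n x y" if "inverse_upto n x" for x n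
  proof -
    obtain g H where x: "x = (g, H)" by (cases x)
    from step[OF that[unfolded x]] obtain g' H' where
      "inverse_upto (Suc n) (g', H')" "\<forall>as. length as \<noteq> Suc n \<longrightarrow> g' as = g as \<and> H' as = H as" by blast
    then show ?thesis by (intro exI[of _ "(g', H')"]) (simp add: x)
  qed
  have "\<exists>G. \<forall>n. inverse_upto n (G n) \<and> ?agree n (G n) (G (Suc n))"
    by (rule dependent_nat_choice[of inverse_upto ?agree]) (rule base next_ex, assumption?)+
  then obtain G where G': "\<forall>n. inverse_upto n (G n) \<and> ?agree n (G n) (G (Suc n))" by (elim exE)
  have G: "inverse_upto n (G n)" "?agree n (G n) (G (Suc n))" for n by (rule conjunct1[OF spec[OF G']], rule conjunct2[OF spec[OF G']])
  have stable: "fst (G (length as + m)) as = fst (G (length as)) as \<and> snd (G (length as + m)) as = snd (G (length as)) as" for as m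
  proof (induction m)
    case (Suc m)
    then show ?case using G(2)[of "length as + m"] by simp
  qed simp
  have st: "fst (G n) as = fst (G (length as)) as" "snd (G n) as = snd (G (length as)) as" if "length as \<le> n" for n as
    using stable[of as "n - length as"] that by simp_all
  define g where "g as = fst (G (length as)) as" for as
  define H where "H as = snd (G (length as)) as" for as
  note I = inverse_uptoD[of n "fst (G n)" "snd (G n)" for n, unfolded prod.collapse, OF G(1)]
  have g: "smaps 0 C2 C1 g" unfolding g_def[abs_def] by (rule smaps_diagonal[OF g1 I(1)])
  have H: "smaps 0 C2 P H" unfolding H_def[abs_def] by (rule smaps_diagonal[OF gP I(2)])
  have gst: "g as = fst (G n) as" and Hst: "H as = snd (G n) as" if "length as \<le> n" for n as
    using st[OF that] by (simp_all add: g_def H_def)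
  have eqg: "hat g as k = hat (fst (G (length as))) as k" if "as \<in> lists (letters C2)" for as and k :: "_ \<Rightarrow> 'w"
    by (rule hat_cong_map[OF smapsD(1)[OF g] that]) (use gst in blast)
  have errg: "defect (brk C2) (brk C1) g as = 0" if "as \<in> lists (letters C2)" "as \<noteq> []" for as
    using I(5)[OF that order_refl] defect_cong[OF is_linfD(5)[OF C2] smapsD(1)[OF g] that(1), of "fst (G (length as))" "brk C1"] gst
    by simp
  have errH: "defect (brk C2) (brk P) H as = 0" if "as \<in> lists (letters C2)" "as \<noteq> []" for as
    using I(6)[OF that order_refl] defect_cong[OF is_linfD(5)[OF C2] smapsD(1)[OF H] that(1), of "snd (G (length as))" "brk P"] Hst
    by simp
  show thesis
  proof (rule that)
    show "is_morph C2 C1 g" using g errg by (simp add: is_morph_def defect_def)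
    show "is_morph C2 P H" using H errH by (simp add: is_morph_def defect_def)
    show "q0 (H as) 0 = hat g as f \<and> q0 (H as) 1 = linf_id as" if "as \<in> lists (letters C2)" "as \<noteq> []" for as
      using I(3,4)[OF that order_refl] eqg[OF that(1)] by (simp add: H_def)
  qed
qed

end

section \<open>Composing homotopies with morphisms, and the conclusion\<close>

lemma is_morph_path_comp:
  assumes A: "is_linf A" and C: "is_linf C" and C': "is_linf C'" and h: "is_morph A (path C) h" and k: "is_morph C C' k"
  shows "is_morph A (path C') (\<lambda>as. hat h as (path_map k))"
  by (rule is_morph_comp[OF A is_linf_path[OF C] is_linf_path[OF C'] h is_morph_path_map[OF C C' k]])

text \<open>Evaluating \<open>path_map k\<close> at \<open>j\<close> is applying \<open>k\<close>
  after the evaluation. Since the evaluation is strict, this is a composite of coalgebra morphisms,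
  and functoriality moves the evaluation to \<open>h\<close>.\<close>

lemma q0_path_comp:
  assumes A: "is_linf A" and C: "is_linf C" and h: "is_morph A (path C) h" and k: "multihom C k"
    and as: "as \<in> lists (letters A)" "as \<noteq> []"
    and h0: "\<And>as. as \<in> lists (letters A) \<Longrightarrow> as \<noteq> [] \<Longrightarrow> q0 (h as) j = h0 as"
  shows "q0 (hat h as (path_map k)) j = hat h0 as k"
proof -
  note h' = smapsD(1)[OF is_morphD(1)[OF h]] and ej = is_morphD(1)[OF is_morph_peval[OF C, of j]]
  have e: "linear_part (peval j) = (\<lambda>a. ev j (m0 a))"
    by (simp add: linear_part_def peval_def ev_def m0_def fun_eq_iff)
  have "q0 (hat h as (path_map k)) j = hat h as (\<lambda>W. k (map (ev j) (map m0 W)))"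
    by (simp add: hom_q_hat hat_pointwise path_map_def ptw_def)
  also have "\<dots> = hat h as (\<lambda>W. hat (peval j) W k)"
  proof (rule hat_cong[OF h' as(1)])
    fix W assume W: "W \<in> lists (letters (path C))"
    from hat_strict[OF smapsD(1)[OF ej] peval_long k W]
    show "k (map (ev j) (map m0 W)) = hat (peval j) W k" by (simp add: e o_def)
  qed
  also have "\<dots> = hat (\<lambda>u. hat h u (peval j)) as k"
    by (rule hat_hat[OF h' smapsD(1)[OF ej] as(1) k])
  also have "\<dots> = hat h0 as k"
  proof (rule hat_cong_map[OF _ as(1)])
    show "degmap 0 A C (\<lambda>u. hat h u (peval j))"
      by (rule smapsD(1)[OF smaps_comp[OF is_linfD(1)[OF C] is_morphD(1)[OF h] ej]])
    fix bs assume bs: "bs \<in> lists (letters A)" "bs \<noteq> []"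
    show "hat h bs (peval j) = h0 bs"
      using hat_into_strict[OF h' peval_long smapsD(4)[OF ej] bs] h0[OF bs] by simp
  qed
  finally show ?thesis .
qed

text \<open>A cocycle of paths differs from the constant path at its start by a boundary; evaluating
  at 1 shows that its ends are cohomologous.\<close>

lemma path_morph_cohomologous:
  assumes A: "is_linf A" and C: "is_linf C" and h: "is_morph A (path C) h" and x: "x \<in> cocycles A p"
  shows "q0 (h [(p, x)]) 1 - q0 (h [(p, x)]) 0 \<in> coboundaries C p"
proof -
  have z: "h [(p, x)] \<in> cocycles (path C) p" by (rule morph_cocycles(1)[OF A is_linf_path[OF C] h x])
  obtain m where m: "m \<in> grade (path C) (p - 1)" "h [(p, x)] - pincl [(p, q0 (h [(p, x)]) 0)] = brk (path C) [(p - 1, m)]"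
    using path_cocycle(1)[OF C z] by blast
  have "q0 (h [(p, x)] - pincl [(p, q0 (h [(p, x)]) 0)]) 1 = q0 (brk (path C) [(p - 1, m)]) 1"
    by (simp only: m(2))
  then have "q0 (h [(p, x)]) 1 - q0 (h [(p, x)]) 0 = brk C [(p - 1, q0 m 1)]"
    by (simp add: path_brk_single)
  moreover have "q0 m 1 \<in> grade C (p - 1)"
    using morph_facts(1)[OF is_morph_peval[OF C, of 1] m(1)] by simp
  ultimately show ?thesis unfolding coboundaries_iff by blast
qed

text \<open>By the homotopy, \<open>f\<close> after \<open>g\<close> is the identity on cohomology.
  As \<open>f\<close> is bijective there, \<open>g\<close> induces its inverse.\<close>

lemma quasi_iso_inverse:
  assumes C1: "is_linf C1" and C2: "is_linf C2" and f: "is_morph C1 C2 f" and qf: "quasi_iso C1 C2 f" and g: "is_morph C2 C1 g"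
    and H: "is_morph C2 (path C2) H" "\<And>as. as \<in> lists (letters C2) \<Longrightarrow> as \<noteq> [] \<Longrightarrow> q0 (H as) 0 = hat g as f \<and> q0 (H as) 1 = linf_id as"
  shows "quasi_iso C2 C1 g"
proof -
  note inj = conjunct1[OF iffD1[OF quasi_iso_iff[OF C1 C2 f] qf], rule_format]
  note fc = morph_cocycles[OF C1 C2 f] and gc = morph_cocycles[OF C2 C1 g]
  have fg: "y - f [(p, g [(p, y)])] \<in> coboundaries C2 p" if y: "y \<in> cocycles C2 p" for p y
    using path_morph_cohomologous[OF C2 C2 H(1) y] H(2)[of "[(p, y)]"] y by (simp add: cocycles_def apply_deg_def)
  show ?thesis
    unfolding quasi_iso_iff[OF C2 C1 g]
  proof (intro conjI allI ballI impI)
    fix p y assume y: "y \<in> cocycles C2 p" "g [(p, y)] \<in> coboundaries C1 p"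
    from hom_onD(3)[OF hom_coboundaries[OF C2] fg[OF y(1)] fc(2)[OF y(2)]]
    show "y \<in> coboundaries C2 p" by simp
  next
    fix p x assume x: "x \<in> cocycles C1 p"
    let ?y = "f [(p, x)]"
    have gy: "g [(p, ?y)] \<in> cocycles C1 p" by (rule gc(1)[OF fc(1)[OF x]])
    have "f [(p, x - g [(p, ?y)])] = ?y - f [(p, g [(p, ?y)])]"
      using hom_onD(10)[OF morph_facts(3)[OF f]] x gy by (simp add: cocycles_def)
    then have "f [(p, x - g [(p, ?y)])] \<in> coboundaries C2 p" using fg[OF fc(1)[OF x]] by simp
    from inj[OF hom_onD(9)[OF hom_cocycles[OF C1] x gy] this] hom_onD(5)[OF hom_coboundaries[OF C1]]
    have "- (x - g [(p, ?y)]) \<in> coboundaries C1 p" by blast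
    then show "\<exists>y\<in>cocycles C2 p. g [(p, y)] - x \<in> coboundaries C1 p"
      using fc(1)[OF x] by (intro bexI[of _ ?y]) simp_all
  qed
qed

theorem theorem1p7:
  fixes C1 :: "('k::field_char_0, 'v::ab_group_add) linf"
    and C2 :: "('k, 'w::ab_group_add) linf"
    and f :: "(int \<times> 'v) list \<Rightarrow> 'w"
  assumes "linf_algebra C1"
    and "linf_algebra C2"
    and "linf_morphism C1 C2 f"
    and "quasi_iso C1 C2 f"
  shows "homotopy_equivalence C1 C2 f"
proof -
  have C1: "is_linf C1" and C2: "is_linf C2" using assms by (simp_all add: linf_algebra_iff)
  have f: "is_morph C1 C2 f" using assms(3) by (simp add: linf_morphism_iff[OF C1 C2])
  note g1 = is_linfD(1)[OF C1] and g2 = is_linfD(1)[OF C2]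
  interpret F: quasi_inverse C1 C2 f by unfold_locales (fact C1 C2 f assms(4))+
  obtain g H where g: "is_morph C2 C1 g" and H: "is_morph C2 (path C2) H"
    and Hends: "\<And>as. as \<in> lists (letters C2) \<Longrightarrow> as \<noteq> [] \<Longrightarrow> q0 (H as) 0 = hat g as f \<and> q0 (H as) 1 = linf_id as"
    by (rule F.exists_inverse) (rule that)
  have qg: "quasi_iso C2 C1 g" by (rule quasi_iso_inverse[OF C1 C2 f assms(4) g H Hends])
  \<comment> \<open>The construction yields only right inverses up to homotopy; applied to
    \<open>g\<close> it produces \<open>f'\<close>.\<close>
  interpret G: quasi_inverse C2 C1 g by unfold_locales (fact C1 C2 g qg)+
  obtain f' H' where f': "is_morph C1 C2 f'" and H': "is_morph C1 (path C1) H'"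
    and H'ends: "\<And>as. as \<in> lists (letters C1) \<Longrightarrow> as \<noteq> [] \<Longrightarrow> q0 (H' as) 0 = hat f' as g \<and> q0 (H' as) 1 = linf_id as"
    by (rule G.exists_inverse) (rule that)
  note mf = smapsD[OF is_morphD(1)[OF f]] and mg = smapsD[OF is_morphD(1)[OF g]] and mf' = smapsD[OF is_morphD(1)[OF f']]
  define gf where "gf = (\<lambda>as. hat f as g)"
  have gf: "is_morph C1 C1 gf" unfolding gf_def by (rule is_morph_comp[OF C1 C2 C1 f g])
  have fg: "is_morph C2 C2 (\<lambda>as. hat g as f)" by (rule is_morph_comp[OF C2 C1 C2 g f])
  note mgf = smapsD[OF is_morphD(1)[OF gf]]

  text \<open>\<open>g f \<simeq> g f g f' \<simeq> g f' \<simeq> id\<close>\<close>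

  let ?gf' = "\<lambda>as. hat f' as g" and ?gfgf' = "\<lambda>as. hat (\<lambda>u. hat f' u g) as gf"
  \<comment> \<open>\<open>H'\<close> runs from the composite of \<open>f'\<close> and
    \<open>g\<close> to the identity; postcomposing it with \<open>gf\<close> gives this
    homotopy.\<close>
  have 1: "htp C1 C1 ?gfgf' gf"
  proof (rule htp_pathI[OF C1 is_morph_path_comp[OF C1 C1 C1 H' gf]])
    fix as assume as: "as \<in> lists (letters C1)" "as \<noteq> []"
    show "?gfgf' as = q0 (hat H' as (path_map gf)) 0 \<and> gf as = q0 (hat H' as (path_map gf)) 1"
      using q0_path_comp[OF C1 C1 H' mgf(4) as, of 0 ?gf'] q0_path_comp[OF C1 C1 H' mgf(4) as, of 1 linf_id]
        H'ends hat_linf_id[OF g1 mgf(4) as(1)] by simp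
  qed
  \<comment> \<open>\<open>H\<close> preceded by \<open>f'\<close> is a path from f g f' to f';
    postcomposing it with \<open>g\<close> gives the second link of the chain.\<close>
  define K where "K = (\<lambda>as. hat f' as H)"
  have K: "is_morph C1 (path C2) K" unfolding K_def by (rule is_morph_comp[OF C1 C2 is_linf_path[OF C2] f' H])
  have Kj: "q0 (K as) j = hat f' as (\<lambda>W. q0 (H W) j)" for as j
    by (simp add: K_def hom_q_hat hat_pointwise)
  have 2: "htp C1 C1 ?gfgf' ?gf'"
  proof (rule htp_pathI[OF C1 is_morph_path_comp[OF C1 C2 C1 K g]])
    have K0: "q0 (K as) 0 = hat f' as (\<lambda>W. hat g W f)" and K1: "q0 (K as) 1 = f' as"
      if as: "as \<in> lists (letters C1)" "as \<noteq> []" for as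
    proof -
      show "q0 (K as) 0 = hat f' as (\<lambda>W. hat g W f)"
        unfolding Kj by (rule hat_cong[OF mf'(1) as(1)]) (use Hends as in auto)
      have "q0 (K as) 1 = hat f' as linf_id"
        unfolding Kj by (rule hat_cong[OF mf'(1) as(1)]) (use Hends as in auto)
      then show "q0 (K as) 1 = f' as" using hat_into_linf_id[OF mf'(1) g2 as] by simp
    qed
    fix as assume as: "as \<in> lists (letters C1)" "as \<noteq> []"
    have "q0 (hat K as (path_map g)) 0 = hat (\<lambda>u. hat f' u (\<lambda>W. hat g W f)) as g"
      by (rule q0_path_comp[OF C1 C2 K mg(4) as K0])
    also have "\<dots> = hat f' as (\<lambda>W. hat (\<lambda>u. hat g u f) W g)"
      by (rule hat_hat[OF mf'(1) smapsD(1)[OF is_morphD(1)[OF fg]] as(1) mg(4), symmetric])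
    also have "\<dots> = hat f' as (\<lambda>W. hat g W gf)"
      unfolding gf_def by (rule hat_cong[OF mf'(1) as(1)]) (rule hat_hat[OF mg(1) mf(1) _ mg(4), symmetric])
    also have "\<dots> = ?gfgf' as"
      by (rule hat_hat[OF mf'(1) mg(1) as(1) mgf(4)])
    finally show "?gfgf' as = q0 (hat K as (path_map g)) 0 \<and> ?gf' as = q0 (hat K as (path_map g)) 1"
      using q0_path_comp[OF C1 C2 K mg(4) as K1] by simp
  qed
  have 3: "htp C1 C1 ?gf' linf_id"
    by (rule htp_pathI[OF C1 H']) (use H'ends in simp)
  have "htp C1 C1 gf linf_id"
    by (rule htp_trans[OF C1 htp_sym[OF C1 1] htp_trans[OF C1 2 3]])
  moreover have "htp C2 C2 (\<lambda>as. hat g as f) linf_id"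
    by (rule htp_pathI[OF C2 H]) (use Hends in simp)
  moreover have c1: "linf_comp C1 g f as = gf as" if "as \<in> lists (letters C1)" for as
    unfolding gf_def by (rule linf_comp_smaps[OF g1 is_morphD(1)[OF f] is_morphD(1)[OF g] that])
  moreover have c2: "linf_comp C2 f g as = hat g as f" if "as \<in> lists (letters C2)" for as
    by (rule linf_comp_smaps[OF g2 is_morphD(1)[OF g] is_morphD(1)[OF f] that])
  ultimately have "htp C1 C1 (linf_comp C1 g f) linf_id" "htp C2 C2 (linf_comp C2 f g) linf_id"
    unfolding htp_def by simp_all
  moreover have "is_morph C1 C1 (linf_comp C1 g f)" "is_morph C2 C2 (linf_comp C2 f g)"
    using is_morph_cong[OF C1 gf] is_morph_cong[OF C2 fg] c1 c2 by simp_all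
  ultimately have "homotopic C1 C1 (linf_comp C1 g f) linf_id" "homotopic C2 C2 (linf_comp C2 f g) linf_id"
    using htp_homotopic[OF C1 C1] htp_homotopic[OF C2 C2] is_morph_linf_id[OF C1] is_morph_linf_id[OF C2] by simp_all
  then show ?thesis
    unfolding homotopy_equivalence_def using assms(3) g linf_morphism_iff[OF C2 C1] by blast
qed

end
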